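(* Let $1<p<\infty$, and suppose that $\mu,\nu\in\mathcal P(\mathbb R^d)$ are compactly supported, such that $\mu$ is absolutely continuous and $\mathrm{spt}(\mu)$ is convex. For every $\theta\in\mathbb S^{d-1}$, let $\varphi^\theta$ be an OT potential from $\mathfrak p^\theta_\sharp\mu$ to $\mathfrak p^\theta_\sharp\nu$ for $\mathsf W_p$, which is unique up to additive constants on $\mathrm{int}(\mathrm{spt}(\mathfrak p^\theta_\sharp\mu))$. Also, set $\psi^\theta=[\varphi^\theta]^c$, the $c$-transform of $\varphi^\theta$ for $c(s,t)=|s-t|^p$. The following hold. (i) We have $$\sqrt n\big(\underline{\mathsf W}_p^p(\hat\mu_n,\nu)-\underline{\mathsf W}_p^p(\mu,\nu)\big)\stackrel{d}{\to}N(0,v_p^2),$$ where $v_p^2=\iint\mathrm{Cov}_\mu(\varphi^\theta\circ\mathfrak p^\theta,\varphi^\vartheta\circ\mathfrak p^\vartheta)\,d\sigma(\theta)\,d\sigma(\vartheta)$, which is well-defined under the current assumption. The asymptotic variance $v_p^2$ coincides with the semiparametric efficiency bound for estimating $\underline{\mathsf W}_p^p(\cdot,\nu)$ at $\mu$. Also, provided that $v_p^2>0$, $$\sup_{t\in\mathbb R}\Big|\mathbb P^B\Big(\sqrt n\big(\underline{\mathsf W}_p^p(\hat\mu_n^B,\nu)-\underline{\mathsf W}_p^p(\hat\mu_n,\nu)\big)\le t\Big)-\mathbb P\big(N(0,v_p^2)\le t\big)\Big|\stackrel{\mathbb P}{\to}0.$$ (ii) If in addition $\nu$ is absolutely continuous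 with convex support, then $$\sqrt n\big(\underline{\mathsf W}_p^p(\hat\mu_n,\hat\nu_n)-\underline{\mathsf W}_p^p(\mu,\nu)\big)\stackrel{d}{\to}N(0,v_p^2+w_p^2),$$ where $v_p^2$ is given in (i) and $w_p^2=\iint\mathrm{Cov}_\nu(\psi^\theta\circ\mathfrak p^\theta,\psi^\vartheta\circ\mathfrak p^\vartheta)\,d\sigma(\theta)\,d\sigma(\vartheta)$. The asymptotic variance $v_p^2+w_p^2$ coincides with the semiparametric efficiency bound for estimating $\underline{\mathsf W}_p^p(\cdot,\cdot)$ at $(\mu,\nu)$. Also, provided that $v_p^2+w_p^2>0$, $$\sup_{t\in\mathbb R}\Big|\mathbb P^B\Big(\sqrt n\big(\underline{\mathsf W}_p^p(\hat\mu_n^B,\hat\nu_n^B)-\underline{\mathsf W}_p^p(\hat\mu_n,\hat\nu_n)\big)\le t\Big)-\mathbb P\big(N(0,v_p^2+w_p^2)\le t\big)\Big|\stackrel{\mathbb P}{\to}0.$$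
   Context: $\mathcal P(\mathbb R^d)$: Borel probability measures on $\mathbb R^d$; $\mathrm{spt}$ is topological support; $\sharp$ denotes pushforward. $\mathsf W_p(\mu,\nu)=\inf_{\pi\in\Pi(\mu,\nu)}[\int\|x-y\|^pd\pi]^{1/p}$, with $\Pi(\mu,\nu)$ the couplings. $\mathfrak p^\theta(x)=\theta^\intercal x$, $\sigma$ is the uniform distribution on the unit sphere $\mathbb S^{d-1}$, and the average-sliced distance is $\underline{\mathsf W}_p(\mu,\nu)=[\int_{\mathbb S^{d-1}}\mathsf W_p^p(\mathfrak p^\theta_\sharp\mu,\mathfrak p^\theta_\sharp\nu)\,d\sigma(\theta)]^{1/p}$. The $c$-transform of $\varphi$ is $\varphi^c(y)=\inf_x[c(x,y)-\varphi(x)]$ with $c(x,y)=\|x-y\|^p$. A function $f$ with values in $[-\infty,\infty)$ is $c$-concave if $f=g^c$ for some $g$ with values in $[-\infty,\infty)$. An OT potential from $\mu$ to $\nu$ for $\mathsf W_p$ is a $c$-concave $\varphi\in L^1(\mu)$ attaining the supremum in $\mathsf W_p^p(\mu,\nu)=\sup_{\varphi\in L^1(\mu)}[\int\varphi\,d\mu+\int\varphi^c\,d\nu]$. $X_1,X_2,\dots\sim\mu$ and $Y_1,Y_2,\dots\sim\nu$ are independent i.i.d. sequences; $\hat\mu_n=n^{-1}\sum_{i=1}^n\delta_{X_i}$, $\hat\nu_n=n^{-1}\sum_{i=1}^n\delta_{Y_i}$. Bootstrap: given the data, $X_1^B,\dots,X_n^B$ are i.i.d. from $\hat\mu_n$ and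 $\hat\mu_n^B=n^{-1}\sum\delta_{X_i^B}$; $\hat\nu_n^B$ is defined analogously (independently, given the data); $\mathbb P^B$ is conditional probability given the data. Semiparametric efficiency bound. Let $T_\mu$ be the set of bounded measurable $h:\mathbb R^d\to\mathbb R$ with $\mu(h)=0$. For a functional $\kappa$ of $\mu$, if there is a continuous linear functional $\dot\kappa_\mu$ on $L^2(\mu)$ with $t^{-1}\{\kappa((1+th)\mu)-\kappa(\mu)\}\to\dot\kappa_\mu h$ as $t\downarrow0$ for every $h\in T_\mu$, the bound at $\mu$ is $\sup_{h\in T_\mu,h\ne0}(\dot\kappa_\mu h)^2/\|h\|^2_{L^2(\mu)}$. In the two-sample case it is relative to the tangent space $\{h_1\oplus h_2:h_1\in T_\mu,h_2\in T_\nu\}$, $(h_1\oplus h_2)(x,y)=h_1(x)+h_2(y)$: with $\dot\kappa$ a continuous linear functional on $L^2(\mu\otimes\nu)$ such that $t^{-1}\{\kappa((1+th_1)\mu,(1+th_2)\nu)-\kappa(\mu,\nu)\}\to\dot\kappa(h_1\oplus h_2)$, the bound is $\sup(\dot\kappa(h_1\oplus h_2))^2/\|h_1\oplus h_2\|^2_{L^2(\mu\otimes\nu)}$ over nonzero $h_1\oplus h_2$. *)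

theory Defs
  imports "HOL-Probability.Probability"
begin

definition spt :: "'a::topological_space measure \<Rightarrow> 'a set" where
  "spt \<mu> = {x. \<forall>U. open U \<longrightarrow> x \<in> U \<longrightarrow> emeasure \<mu> U > 0}"

definition proj_law :: "'a::euclidean_space \<Rightarrow> 'a measure \<Rightarrow> real measure" where
  "proj_law \<theta> \<mu> = distr \<mu> borel (\<lambda>x. \<theta> \<bullet> x)"

text \<open>The uniform distribution on the unit sphere is the image of the uniform distribution on the
  unit ball under radial projection \<open>x \<mapsto> x / \<parallel>x\<parallel>\<close> (which is \<^const>\<open>sgn\<close>; the origin is a null set).
  It is a measure whose space is the sphere, so that measurability of an integrand
  only concerns its values on the sphere.\<close>

definition sphere_unif :: "'a::euclidean_space measure" where
  "sphere_unif = restrict_space (distr (uniform_measure lborel (ball 0 1)) borel sgn) (sphere 0 1)"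

definition empirical :: "nat \<Rightarrow> (nat \<Rightarrow> 'a::euclidean_space) \<Rightarrow> 'a measure" where
  "empirical n x = distr (uniform_count_measure {..<n}) borel x"

text \<open>The normal distribution with variance \<open>v \<ge> 0\<close>; for \<open>v = 0\<close> it is the Dirac measure at \<open>m\<close>.\<close>

definition normal_law :: "real \<Rightarrow> real \<Rightarrow> real measure" where
  "normal_law m v = distr std_normal_distribution borel (\<lambda>z. m + sqrt v * z)"

definition cov :: "'a measure \<Rightarrow> ('a \<Rightarrow> real) \<Rightarrow> ('a \<Rightarrow> real) \<Rightarrow> real" where
  "cov \<mu> f g = (\<integral>x. (f x - (\<integral>u. f u \<partial>\<mu>)) * (g x - (\<integral>u. g u \<partial>\<mu>)) \<partial>\<mu>)"

definition square_integrable :: "'a measure \<Rightarrow> ('a \<Rightarrow> real) \<Rightarrow> bool" where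
  "square_integrable M f \<longleftrightarrow> f \<in> borel_measurable M \<and> integrable M (\<lambda>x. (f x)\<^sup>2)"

definition tendsto_zero_in_prob :: "'w measure \<Rightarrow> (nat \<Rightarrow> 'w \<Rightarrow> real) \<Rightarrow> bool" where
  "tendsto_zero_in_prob M Z \<longleftrightarrow>
     (\<forall>n. Z n \<in> borel_measurable M) \<and>
     (\<forall>\<epsilon>>0. (\<lambda>n. measure M {\<omega> \<in> space M. \<bar>Z n \<omega>\<bar> > \<epsilon>}) \<longlonglongrightarrow> 0)"

definition couplings :: "'a::euclidean_space measure \<Rightarrow> 'a measure \<Rightarrow> ('a \<times> 'a) measure set" where
  "couplings \<mu> \<nu> = {\<pi>. sets \<pi> = sets (borel \<Otimes>\<^sub>M borel) \<and> distr \<pi> borel fst = \<mu> \<and> distr \<pi> borel snd = \<nu>}"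

definition ennreal_powr :: "ennreal \<Rightarrow> real \<Rightarrow> ennreal" where
  "ennreal_powr x a = (if x = \<top> then \<top> else ennreal (enn2real x powr a))"

definition wasserstein :: "real \<Rightarrow> 'a::euclidean_space measure \<Rightarrow> 'a measure \<Rightarrow> ennreal" where
  "wasserstein p \<mu> \<nu> =
     (INF \<pi>\<in>couplings \<mu> \<nu>. ennreal_powr (\<integral>\<^sup>+(x, y). ennreal (norm (x - y) powr p) \<partial>\<pi>) (1 / p))"

definition sliced_wasserstein :: "real \<Rightarrow> 'a::euclidean_space measure \<Rightarrow> 'a measure \<Rightarrow> ennreal" where
  "sliced_wasserstein p \<mu> \<nu> =
     ennreal_powr
       (\<integral>\<^sup>+\<theta>. ennreal_powr (wasserstein p (proj_law \<theta> \<mu>) (proj_law \<theta> \<nu>)) p \<partial>sphere_unif) (1 / p)"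

definition sliced_wasserstein_pow :: "real \<Rightarrow> 'a::euclidean_space measure \<Rightarrow> 'a measure \<Rightarrow> real" where
  "sliced_wasserstein_pow p \<mu> \<nu> = enn2real (ennreal_powr (sliced_wasserstein p \<mu> \<nu>) p)"

definition c_transform :: "real \<Rightarrow> ('a::euclidean_space \<Rightarrow> ereal) \<Rightarrow> 'a \<Rightarrow> ereal" where
  "c_transform p \<phi> y = (INF x. ereal (norm (x - y) powr p) - \<phi> x)"

definition c_concave :: "real \<Rightarrow> ('a::euclidean_space \<Rightarrow> ereal) \<Rightarrow> bool" where
  "c_concave p f \<longleftrightarrow> (\<forall>x. f x \<noteq> \<infinity>) \<and> (\<exists>g. (\<forall>y. g y \<noteq> \<infinity>) \<and> f = c_transform p g)"

definition ereal_L1 :: "'a measure \<Rightarrow> ('a \<Rightarrow> ereal) \<Rightarrow> bool" where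
  "ereal_L1 M f \<longleftrightarrow> f \<in> borel_measurable M \<and> (\<integral>\<^sup>+x. e2ennreal \<bar>f x\<bar> \<partial>M) < \<infinity>"

text \<open>The integral of an extended-real function as positive minus negative part
  (\<^const>\<open>e2ennreal\<close> sends negative arguments to \<open>0\<close>). When \<open>\<phi>\<close> is in \<open>L\<^sup>1(\<mu>)\<close> and \<open>\<nu>\<close> has compact
  support, the positive part of the \<open>c\<close>-transform of \<open>\<phi>\<close> has finite \<open>\<nu>\<close>-integral, so that the
  dual objective lies in \<open>[-\<infinity>, \<infinity>)\<close>.\<close>

definition ereal_integral :: "'a measure \<Rightarrow> ('a \<Rightarrow> ereal) \<Rightarrow> ereal" where
  "ereal_integral M f =
     enn2ereal (\<integral>\<^sup>+x. e2ennreal (f x) \<partial>M) - enn2ereal (\<integral>\<^sup>+x. e2ennreal (- f x) \<partial>M)"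

definition dual_objective ::
    "real \<Rightarrow> 'a::euclidean_space measure \<Rightarrow> 'a measure \<Rightarrow> ('a \<Rightarrow> ereal) \<Rightarrow> ereal" where
  "dual_objective p \<mu> \<nu> \<phi> = ereal_integral \<mu> \<phi> + ereal_integral \<nu> (c_transform p \<phi>)"

definition ot_potential ::
    "real \<Rightarrow> 'a::euclidean_space measure \<Rightarrow> 'a measure \<Rightarrow> ('a \<Rightarrow> ereal) \<Rightarrow> bool" where
  "ot_potential p \<mu> \<nu> \<phi> \<longleftrightarrow>
     c_concave p \<phi> \<and> ereal_L1 \<mu> \<phi> \<and>
     dual_objective p \<mu> \<nu> \<phi> =
       (SUP f\<in>{f. ereal_L1 \<mu> f \<and> (\<forall>x. f x \<noteq> \<infinity>)}. dual_objective p \<mu> \<nu> f)"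

text \<open>Potentials are finite almost everywhere, so the conversion to real values below only
  alters them on a null set.\<close>

definition sliced_potential :: "('a::euclidean_space \<Rightarrow> real \<Rightarrow> ereal) \<Rightarrow> 'a \<Rightarrow> 'a \<Rightarrow> real" where
  "sliced_potential \<phi> \<theta> x = real_of_ereal (\<phi> \<theta> (\<theta> \<bullet> x))"

definition sliced_variance ::
    "'a::euclidean_space measure \<Rightarrow> ('a \<Rightarrow> real \<Rightarrow> ereal) \<Rightarrow> real" where
  "sliced_variance \<mu> \<phi> =
     (\<integral>\<eta>. (\<integral>\<theta>. cov \<mu> (sliced_potential \<phi> \<theta>) (sliced_potential \<phi> \<eta>) \<partial>sphere_unif) \<partial>sphere_unif)"

definition sliced_variance_exists ::
    "'a::euclidean_space measure \<Rightarrow> ('a \<Rightarrow> real \<Rightarrow> ereal) \<Rightarrow> bool" where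
  "sliced_variance_exists \<mu> \<phi> \<longleftrightarrow>
     (\<forall>\<theta>\<in>sphere 0 1. (AE x in \<mu>. \<bar>\<phi> \<theta> (\<theta> \<bullet> x)\<bar> \<noteq> \<infinity>) \<and> square_integrable \<mu> (sliced_potential \<phi> \<theta>)) \<and>
     integrable (sphere_unif \<Otimes>\<^sub>M sphere_unif)
       (\<lambda>(\<theta>, \<eta>). cov \<mu> (sliced_potential \<phi> \<theta>) (sliced_potential \<phi> \<eta>))"

definition tangents :: "'a::euclidean_space measure \<Rightarrow> ('a \<Rightarrow> real) set" where
  "tangents \<mu> = {h. h \<in> borel_measurable borel \<and> bounded (range h) \<and> (\<integral>x. h x \<partial>\<mu>) = 0}"

definition perturb :: "'a measure \<Rightarrow> real \<Rightarrow> ('a \<Rightarrow> real) \<Rightarrow> 'a measure" where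
  "perturb \<mu> t h = density \<mu> (\<lambda>x. ennreal (1 + t * h x))"

text \<open>Continuous linear functionals on \<open>L\<^sup>2(M)\<close>, as functions on representatives; the norm bound
  makes the value depend on the almost-everywhere class only.\<close>

definition L2_functional :: "'a measure \<Rightarrow> (('a \<Rightarrow> real) \<Rightarrow> real) \<Rightarrow> bool" where
  "L2_functional M L \<longleftrightarrow>
     (\<forall>f g. square_integrable M f \<longrightarrow> square_integrable M g \<longrightarrow> L (\<lambda>x. f x + g x) = L f + L g) \<and>
     (\<forall>a f. square_integrable M f \<longrightarrow> L (\<lambda>x. a * f x) = a * L f) \<and>
     (\<exists>C. \<forall>f. square_integrable M f \<longrightarrow> \<bar>L f\<bar> \<le> C * sqrt (\<integral>x. (f x)\<^sup>2 \<partial>M))"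

definition efficiency_sup :: "'a measure \<Rightarrow> ('a \<Rightarrow> real) set \<Rightarrow> (('a \<Rightarrow> real) \<Rightarrow> real) \<Rightarrow> ereal" where
  "efficiency_sup M H L =
     (SUP h\<in>{h\<in>H. \<not> (AE x in M. h x = 0)}. ereal ((L h)\<^sup>2 / (\<integral>x. (h x)\<^sup>2 \<partial>M)))"

text \<open>The bound is only defined for functionals differentiable along the tangent space, so it is
  rendered as a relation. The supremum is taken in \<^typ>\<open>ereal\<close>, where it always exists. The
  derivative is determined on the tangent space by the limits, hence \<open>b\<close> is unique.\<close>

definition efficiency_bound ::
    "'a::euclidean_space measure \<Rightarrow> ('a measure \<Rightarrow> real) \<Rightarrow> real \<Rightarrow> bool" where
  "efficiency_bound \<mu> \<kappa> b \<longleftrightarrow>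
     (\<exists>L. L2_functional \<mu> L \<and>
       (\<forall>h\<in>tangents \<mu>. ((\<lambda>t. (\<kappa> (perturb \<mu> t h) - \<kappa> \<mu>) / t) \<longlongrightarrow> L h) (at_right 0)) \<and>
       ereal b = efficiency_sup \<mu> (tangents \<mu>) L)"

definition direct_sum :: "('a \<Rightarrow> real) \<Rightarrow> ('b \<Rightarrow> real) \<Rightarrow> 'a \<times> 'b \<Rightarrow> real" where
  "direct_sum h\<^sub>1 h\<^sub>2 = (\<lambda>(x, y). h\<^sub>1 x + h\<^sub>2 y)"

definition efficiency_bound2 ::
    "'a::euclidean_space measure \<Rightarrow> 'a measure \<Rightarrow> ('a measure \<Rightarrow> 'a measure \<Rightarrow> real) \<Rightarrow> real \<Rightarrow> bool" where
  "efficiency_bound2 \<mu> \<nu> \<kappa> b \<longleftrightarrow>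
     (\<exists>L. L2_functional (\<mu> \<Otimes>\<^sub>M \<nu>) L \<and>
       (\<forall>h\<^sub>1\<in>tangents \<mu>. \<forall>h\<^sub>2\<in>tangents \<nu>.
          ((\<lambda>t. (\<kappa> (perturb \<mu> t h\<^sub>1) (perturb \<nu> t h\<^sub>2) - \<kappa> \<mu> \<nu>) / t)
             \<longlongrightarrow> L (direct_sum h\<^sub>1 h\<^sub>2)) (at_right 0)) \<and>
       ereal b =
         efficiency_sup (\<mu> \<Otimes>\<^sub>M \<nu>) {direct_sum h\<^sub>1 h\<^sub>2 |h\<^sub>1 h\<^sub>2. h\<^sub>1 \<in> tangents \<mu> \<and> h\<^sub>2 \<in> tangents \<nu>} L)"

text \<open>Given the data \<open>x\<^sub>0, \<dots>, x\<^bsub>n-1\<^esub>\<close>, the conditional law of a bootstrap sample is the \<open>n\<close>-fold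
  product of the empirical measure. The two definitions below are the conditional distribution
  functions, given the data, of the one- and two-sample bootstrap statistics.\<close>

definition bootstrap_law :: "nat \<Rightarrow> (nat \<Rightarrow> 'a::euclidean_space) \<Rightarrow> (nat \<Rightarrow> 'a) measure" where
  "bootstrap_law n x = (\<Pi>\<^sub>M i\<in>{..<n}. empirical n x)"

definition bootstrap_cdf ::
    "real \<Rightarrow> 'a::euclidean_space measure \<Rightarrow> nat \<Rightarrow> (nat \<Rightarrow> 'a) \<Rightarrow> real \<Rightarrow> real" where
  "bootstrap_cdf p \<nu> n x t =
     measure (bootstrap_law n x)
       {x' \<in> space (bootstrap_law n x).
          sqrt (real n) * (sliced_wasserstein_pow p (empirical n x') \<nu>
            - sliced_wasserstein_pow p (empirical n x) \<nu>) \<le> t}"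

definition bootstrap_cdf2 ::
    "real \<Rightarrow> nat \<Rightarrow> (nat \<Rightarrow> 'a::euclidean_space) \<Rightarrow> (nat \<Rightarrow> 'a) \<Rightarrow> real \<Rightarrow> real" where
  "bootstrap_cdf2 p n x y t =
     measure (bootstrap_law n x \<Otimes>\<^sub>M bootstrap_law n y)
       {(x', y') \<in> space (bootstrap_law n x \<Otimes>\<^sub>M bootstrap_law n y).
          sqrt (real n) * (sliced_wasserstein_pow p (empirical n x') (empirical n y')
            - sliced_wasserstein_pow p (empirical n x) (empirical n y)) \<le> t}"

lemma space_sphere_unif: "space (sphere_unif :: 'a::euclidean_space measure) = sphere 0 1"
  by (simp add: sphere_unif_def space_restrict_space)

lemma prob_space_sphere_unif: "prob_space (sphere_unif :: 'a::euclidean_space measure)"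
proof -
  let ?U = "uniform_measure lborel (ball 0 1) :: 'a measure"
  have "emeasure lborel (ball (0::'a) 1) \<noteq> 0"
    using content_ball_pos[of 1 "0::'a"] by (auto simp: measure_def)
  moreover have fin: "emeasure lborel (ball (0::'a) 1) \<noteq> \<infinity>"
    using emeasure_lborel_ball_finite[of "0::'a" 1] by simp
  ultimately interpret U: prob_space ?U
    by (rule prob_space_uniform_measure)
  interpret S: prob_space "distr ?U borel (sgn :: 'a \<Rightarrow> 'a)"
    by (rule U.prob_space_distr) simp
  have "AE x in lborel. x \<noteq> (0::'a)"
    by (rule AE_lborel_singleton)
  then have "AE x in ?U. sgn x \<in> sphere (0::'a) 1"
    by (intro AE_uniform_measureI) (auto simp: norm_sgn)
  then have "emeasure (distr ?U borel sgn) (sphere (0::'a) 1) = 1"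
    by (intro S.emeasure_eq_1_AE) (auto simp: AE_distr_iff)
  then show ?thesis
    unfolding sphere_unif_def
    by (intro prob_spaceI) (simp add: space_restrict_space emeasure_restrict_space)
qed

lemma emeasure_empirical:
  fixes x :: "nat \<Rightarrow> 'a::euclidean_space"
  assumes "A \<in> sets borel"
  shows "emeasure (empirical n x) A = ennreal (real (card {i. i < n \<and> x i \<in> A}) / real n)"
proof -
  have "emeasure (empirical n x) A = emeasure (uniform_count_measure {..<n}) {i. i < n \<and> x i \<in> A}"
    using assms unfolding empirical_def
    by (subst emeasure_distr)
       (auto simp: space_uniform_count_measure intro!: arg_cong2[where f = emeasure]
             cong: measurable_cong_sets)
  also have "\<dots> = ennreal (real (card {i. i < n \<and> x i \<in> A}) / real n)"
    by (subst emeasure_uniform_count_measure) auto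
  finally show ?thesis .
qed

lemma normal_law_density:
  assumes "v > 0"
  shows "normal_law m v = density lborel (normal_density m (sqrt v))"
proof -
  interpret prob_space std_normal_distribution
    using prob_space_normal_density[of 1 0] by simp
  have "distributed std_normal_distribution lborel (\<lambda>z. z) std_normal_density"
    unfolding distributed_def by (auto simp: distr_id2)
  from normal_density_affine[OF this, of "sqrt v" m] assms
  have "distributed std_normal_distribution lborel (\<lambda>z. m + z * sqrt v) (normal_density m (sqrt v))"
    by (simp add: mult.commute)
  then have "distr std_normal_distribution lborel (\<lambda>z. m + z * sqrt v)
      = density lborel (normal_density m (sqrt v))"
    by (simp add: distributed_def)
  moreover have "distr std_normal_distribution lborel (\<lambda>z. m + z * sqrt v) = normal_law m v"
    unfolding normal_law_def by (intro distr_cong) (auto simp: mult.commute)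
  ultimately show ?thesis
    by simp
qed

lemma normal_law_zero: "normal_law m 0 = return borel m"
proof -
  interpret prob_space std_normal_distribution
    using prob_space_normal_density[of 1 0] by simp
  show ?thesis
    unfolding normal_law_def by (auto intro!: measure_eqI simp: emeasure_distr emeasure_space_1 split: split_indicator)
qed

end

theory Submission
  imports Defs
begin

text \<open>
The cost \<bar>x - y\<bar>^p on the line is a mixture of threshold events: it is the integral of the density
p (p - 1) \<bar>s - t\<bar>^(p - 2) over the pairs of thresholds (s, t) with y \<le> t < s < x or x \<le> s < t < y
(nn_integral_cost_density_step). Now average over a coupling of two laws with distribution functions F and G. By
Jensen's inequality, which is sharp for the quantile coupling, the p-th power of the one-dimensional transport
distance is the integral of the positive part of sgn (s - t) (G t - F s) against that density
(wasserstein_real_line). Averaging over directions, the sliced functional is S = \<integral> max 0 D dN, where N is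
a finite measure on directions and thresholds and the gap D is affine in the two laws
(sliced_wasserstein_pow_eq_integral). Everything of first order about S follows from this formula.

A positive part is differentiable away from 0, so S has at (\<mu>, \<nu>) the linearization \<integral> 1{D > 0} \<Delta> dN in the
increment \<Delta> of the gap, provided the ties D = 0 do no harm. Convexity of the support of \<mu> takes care of them:
a projection of \<mu> charges every interval between two of its support points, so its distribution function is
injective at levels strictly between 0 and 1 (cdf_proj_law_injective). Hence almost every tie happens where both
distribution functions are 0 or 1, and there neither a perturbation of the laws nor an empirical estimate moves
the gap (score_cdf_eq_0, sliced_linearization).

By Fubini the linearization is \<integral> \<Psi> d\<mu>' + \<integral> \<psi> d\<nu>', where the influence functions \<Psi> and \<psi> are averages over
directions of explicit functions pot1 and pot2 on the line. These are optimal dual potentials. Conversely the dual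
value of an arbitrary potential is affine along perturbations of the two laws, lies below the transport value
and touches it at the unperturbed laws. So its slopes equal the derivative of the value, and the potential agrees
with pot1 up to a constant almost everywhere (ot_potential_AE_eq). Continuity of c-transforms improves this to the
interior of the support (ot_potential_unique), and it follows that the variances in the theorem are those of
\<Psi> and \<psi> (sliced_variance_potentials).

The central limit theorem then needs two facts. The error of the linearization is o(1/sqrt n) in mean for all
estimates of the laws whose distribution functions have mean squared error of order F (1 - F) / n; dominated
convergence shows this (linearization_error_vanishes). The linear part is a sum of independent bounded variables, and
its characteristic function is compared with the normal one with an explicit error that depends only on a bound
for the variables and on their variance (char_sum_normal_bound). Both facts hold for resampled data as well: the
first on the product of the space of the data with the space of resampled indices, the second conditionally on
the data, where the variance is the sample variance. A uniform version of the continuity theorem of Levy turns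
closeness of characteristic functions into closeness of distribution functions (cdf_close_if_char_close), which gives
consistency of the bootstrap (boot_distance_tendsto).

Finally, the derivative of S along bounded perturbations is the inner product with the centred influence function.
That function is itself a tangent, so the supremum in the efficiency bound is attained there and equals its squared
norm, the limit variance (efficiency_sup_inner_product).
\<close>

section \<open>Integrals of bounded functions\<close>

lemma abs_integral_le:
  fixes f :: "'b \<Rightarrow> real"
  assumes N: "finite_measure N" and B: "\<And>x. \<bar>f x\<bar> \<le> B"
  shows "\<bar>\<integral>x. f x \<partial>N\<bar> \<le> B * measure N (space N)"
proof (cases "integrable N f")
  case True
  interpret finite_measure N by fact
  have "\<bar>\<integral>x. f x \<partial>N\<bar> \<le> (\<integral>x. \<bar>f x\<bar> \<partial>N)" using integral_norm_bound[of N f] by simp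
  also have "\<dots> \<le> (\<integral>x. B \<partial>N)" using True B by (intro integral_mono) auto
  finally show ?thesis by (simp add: mult.commute)
next
  case False
  have "0 \<le> B" using B[of undefined] by linarith
  then show ?thesis using False by (simp add: not_integrable_integral_eq)
qed

lemma abs_expectation_le:
  fixes f :: "'b \<Rightarrow> real"
  assumes N: "prob_space N" and B: "\<And>x. \<bar>f x\<bar> \<le> B"
  shows "\<bar>\<integral>x. f x \<partial>N\<bar> \<le> B"
  using abs_integral_le[OF prob_space.finite_measure[OF N] B] by (simp add: prob_space.prob_space[OF N])

lemma integrable_mult_bounded:
  fixes f h :: "'b \<Rightarrow> real"
  assumes f: "integrable N f" and [measurable]: "h \<in> borel_measurable N" and C: "\<And>x. \<bar>h x\<bar> \<le> C"
  shows "integrable N (\<lambda>x. f x * h x)"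
proof (rule Bochner_Integration.integrable_bound[OF integrable_mult_right[OF f, of C]])
  have "\<bar>f x * h x\<bar> \<le> \<bar>C * f x\<bar>" for x
    using mult_left_mono[OF order_trans[OF C[of x] abs_ge_self], of "\<bar>f x\<bar>"] by (simp add: abs_mult mult.commute)
  then show "AE x in N. norm (f x * h x) \<le> norm (C * f x)" by simp
qed (use f in measurable)

section \<open>The cost as an integral over pairs of thresholds\<close>

text \<open>
The second derivative of \<bar>u\<bar>^p at u = s - t. Integrated over a triangle of thresholds it gives back a power.
\<close>
definition cost_density :: "real \<Rightarrow> real \<times> real \<Rightarrow> real" where
  "cost_density p z = p * (p - 1) * \<bar>fst z - snd z\<bar> powr (p - 2)"

definition step :: "real \<Rightarrow> real \<Rightarrow> real" where
  "step x s = (if x \<le> s then 1 else 0)"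

text \<open>
The sign treats both orders of the two thresholds alike. For F = step x and G = step y the gap is positive
exactly if y \<le> t < s < x or x \<le> s < t < y.
\<close>
definition gap :: "(real \<Rightarrow> real) \<Rightarrow> (real \<Rightarrow> real) \<Rightarrow> real \<times> real \<Rightarrow> real" where
  "gap F G z = sgn (fst z - snd z) * (G (snd z) - F (fst z))"

lemma cost_density_nonneg: "1 < p \<Longrightarrow> 0 \<le> cost_density p z"
  by (simp add: cost_density_def)

lemma measurable_cost_density [measurable]: "cost_density p \<in> borel_measurable (borel \<Otimes>\<^sub>M borel)"
  unfolding cost_density_def by measurable

lemma measurable_step [measurable (raw)]:
  assumes [measurable]: "f \<in> borel_measurable M" "g \<in> borel_measurable M"
  shows "(\<lambda>x. step (f x) (g x)) \<in> borel_measurable M"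
  unfolding step_def by measurable

lemma measurable_gap [measurable (raw)]:
  assumes [measurable]: "f \<in> M \<rightarrow>\<^sub>M borel \<Otimes>\<^sub>M borel"
    "(\<lambda>x. F x (fst (f x))) \<in> borel_measurable M" "(\<lambda>x. G x (snd (f x))) \<in> borel_measurable M"
  shows "(\<lambda>x. gap (F x) (G x) (f x)) \<in> borel_measurable M"
  unfolding gap_def by measurable

lemma abs_gap_diff_le: "\<bar>gap F G z - gap F' G' z\<bar> \<le> \<bar>G (snd z) - G' (snd z)\<bar> + \<bar>F (fst z) - F' (fst z)\<bar>"
proof -
  have "\<bar>gap F G z - gap F' G' z\<bar> = \<bar>sgn (fst z - snd z)\<bar> * \<bar>(G (snd z) - G' (snd z)) - (F (fst z) - F' (fst z))\<bar>"
    unfolding gap_def abs_mult[symmetric] by (simp add: algebra_simps)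
  also have "\<dots> \<le> 1 * (\<bar>G (snd z) - G' (snd z)\<bar> + \<bar>F (fst z) - F' (fst z)\<bar>)"
    by (intro mult_mono) (auto simp: sgn_if)
  finally show ?thesis by simp
qed

lemma nn_integral_powr_from_0:
  assumes "-1 < a" "0 \<le> c"
  shows "(\<integral>\<^sup>+u. ennreal (u powr a) * indicator {0..c} u \<partial>lborel) = ennreal (c powr (a + 1) / (a + 1))"
  by (rule nn_integral_has_integral_lebesgue'[OF _ has_integral_powr_from_0[OF assms]]) auto

lemma nn_integral_cost_density_triangle:
  assumes p: "1 < p" and "y \<le> x"
  shows "(\<integral>\<^sup>+z. ennreal (cost_density p z * (if y \<le> snd z \<and> snd z < fst z \<and> fst z < x then 1 else 0)) \<partial>(lborel \<Otimes>\<^sub>M lborel))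
    = ennreal ((x - y) powr p)"
proof -
  have inner: "(\<integral>\<^sup>+s. ennreal (cost_density p (s, t) * (if y \<le> t \<and> t < s \<and> s < x then 1 else 0)) \<partial>lborel)
      = ennreal (p * (x - t) powr (p - 1)) * indicator {y..x} t" (is "?L = _") for t
  proof (cases "y \<le> t \<and> t \<le> x")
    case True
    have "?L = (\<integral>\<^sup>+u. ennreal (cost_density p (t + 1 * u, t) * (if y \<le> t \<and> t < t + 1 * u \<and> t + 1 * u < x then 1 else 0)) \<partial>lborel)"
      by (subst nn_integral_real_affine[where c = 1 and t = t]) auto
    also have "\<dots> = (\<integral>\<^sup>+u. ennreal (p * (p - 1)) * (ennreal (u powr (p - 2)) * indicator {0..x - t} u) \<partial>lborel)"
    proof (rule nn_integral_cong_AE)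
      have pp: "0 \<le> p * (p - 1)" using p by simp
      \<comment> \<open>the strict inequalities of the triangle and the closed interval differ only at u = 0 and u = x - t\<close>
      show "AE u in lborel. ennreal (cost_density p (t + 1 * u, t) * (if y \<le> t \<and> t < t + 1 * u \<and> t + 1 * u < x then 1 else 0))
          = ennreal (p * (p - 1)) * (ennreal (u powr (p - 2)) * indicator {0..x - t} u)"
        using AE_lborel_singleton[of 0] AE_lborel_singleton[of "x - t"]
      proof eventually_elim
        case (elim u)
        then show ?case
          using True ennreal_mult[OF pp, of "u powr (p - 2)"]
          by (cases "0 < u \<and> u < x - t") (auto simp: cost_density_def indicator_def)
      qed
    qed
    also have "\<dots> = ennreal (p * (p - 1)) * ennreal ((x - t) powr (p - 2 + 1) / (p - 2 + 1))"
      using p True by (subst nn_integral_cmult) (auto simp: nn_integral_powr_from_0)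
    also have "\<dots> = ennreal (p * (x - t) powr (p - 1))"
      using p by (simp flip: ennreal_mult)
    finally show ?thesis using True by simp
  next
    case False
    then show ?thesis by (auto intro!: nn_integral_zero' simp: indicator_def)
  qed
  have "(\<integral>\<^sup>+z. ennreal (cost_density p z * (if y \<le> snd z \<and> snd z < fst z \<and> fst z < x then 1 else 0)) \<partial>(lborel \<Otimes>\<^sub>M lborel))
    = (\<integral>\<^sup>+t. ennreal (p * (x - t) powr (p - 1)) * indicator {y..x} t \<partial>lborel)"
    by (subst lborel_pair.nn_integral_snd[symmetric]) (auto simp: inner)
  also have "\<dots> = (\<integral>\<^sup>+u. ennreal (p * (x - (x + -1 * u)) powr (p - 1)) * indicator {y..x} (x + -1 * u) \<partial>lborel)"
    by (subst nn_integral_real_affine[where c = "-1" and t = x]) auto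
  also have "\<dots> = (\<integral>\<^sup>+u. ennreal p * (ennreal (u powr (p - 1)) * indicator {0..x - y} u) \<partial>lborel)"
    using p by (intro nn_integral_cong) (auto simp: indicator_def ennreal_mult')
  also have "\<dots> = ennreal p * ennreal ((x - y) powr (p - 1 + 1) / (p - 1 + 1))"
    using p assms(2) by (subst nn_integral_cmult) (auto simp: nn_integral_powr_from_0)
  also have "\<dots> = ennreal ((x - y) powr p)"
    using p by (simp flip: ennreal_mult)
  finally show ?thesis .
qed

lemma nn_integral_lborel_swap:
  fixes f :: "real \<times> real \<Rightarrow> ennreal"
  assumes [measurable]: "f \<in> borel_measurable (borel \<Otimes>\<^sub>M borel)"
  shows "(\<integral>\<^sup>+z. f z \<partial>(lborel \<Otimes>\<^sub>M lborel)) = (\<integral>\<^sup>+z. f (snd z, fst z) \<partial>(lborel \<Otimes>\<^sub>M lborel))"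
  by (subst (1) lborel_pair.distr_pair_swap, subst nn_integral_distr) (auto simp: case_prod_beta)

text \<open>
For y \<le> x the positive part of the gap is the indicator of the triangle y \<le> t < s < x, and the density
integrates to (x - y)^p over it. The other case is its mirror image.
\<close>
lemma nn_integral_cost_density_step:
  assumes p: "1 < p"
  shows "(\<integral>\<^sup>+z. ennreal (cost_density p z * max 0 (gap (step x) (step y) z)) \<partial>(lborel \<Otimes>\<^sub>M lborel))
    = ennreal (\<bar>x - y\<bar> powr p)"
proof (cases "y \<le> x")
  case True
  have "(\<integral>\<^sup>+z. ennreal (cost_density p z * max 0 (gap (step x) (step y) z)) \<partial>(lborel \<Otimes>\<^sub>M lborel)) =
      (\<integral>\<^sup>+z. ennreal (cost_density p z * (if y \<le> snd z \<and> snd z < fst z \<and> fst z < x then 1 else 0)) \<partial>(lborel \<Otimes>\<^sub>M lborel))"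
    using True by (intro nn_integral_cong) (auto simp: gap_def step_def sgn_if)
  then show ?thesis
    using nn_integral_cost_density_triangle[OF p True] True by simp
next
  case False
  have "(\<integral>\<^sup>+z. ennreal (cost_density p z * max 0 (gap (step x) (step y) z)) \<partial>(lborel \<Otimes>\<^sub>M lborel)) =
      (\<integral>\<^sup>+z. ennreal (cost_density p z * (if x \<le> snd z \<and> snd z < fst z \<and> fst z < y then 1 else 0)) \<partial>(lborel \<Otimes>\<^sub>M lborel))"
    using False by (subst nn_integral_lborel_swap) (auto intro!: nn_integral_cong simp: gap_def step_def sgn_if cost_density_def abs_minus_commute)
  then show ?thesis
    using nn_integral_cost_density_triangle[OF p, of x y] False by (simp add: abs_minus_commute)
qed

section \<open>One-dimensional optimal transport\<close>

lemma cdf_eq_expectation_step: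
  assumes "real_distribution \<mu>"
  shows "cdf \<mu> s = (\<integral>x. step x s \<partial>\<mu>)"
proof -
  interpret real_distribution \<mu> by fact
  have "(\<integral>x. step x s \<partial>\<mu>) = (\<integral>x. indicator {..s} x \<partial>\<mu>)"
    by (intro Bochner_Integration.integral_cong) (auto simp: step_def)
  then show ?thesis by (simp add: cdf_def)
qed

lemma borel_measurable_cdf [measurable]:
  assumes "real_distribution \<mu>"
  shows "cdf \<mu> \<in> borel_measurable borel"
proof -
  interpret real_distribution \<mu> by fact
  show ?thesis by (intro borel_measurable_mono monoI cdf_nondecreasing)
qed

text \<open>
The cost of the quantile coupling, as a functional of the distribution functions alone.
\<close>
definition transport_value :: "real \<Rightarrow> (real \<Rightarrow> real) \<Rightarrow> (real \<Rightarrow> real) \<Rightarrow> ennreal" where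
  "transport_value p F G = (\<integral>\<^sup>+z. ennreal (cost_density p z * max 0 (gap F G z)) \<partial>(lborel \<Otimes>\<^sub>M lborel))"

text \<open>
After this exchange of integrals couplings can be compared threshold by threshold: without the positive part
the inner integral would be the same for all of them.
\<close>
lemma coupling_cost_eq:
  assumes p: "1 < p" and pi: "prob_space \<pi>" "sets \<pi> = sets (borel \<Otimes>\<^sub>M borel)"
  shows "(\<integral>\<^sup>+(x, y). ennreal (\<bar>x - y\<bar> powr p) \<partial>\<pi>) =
    (\<integral>\<^sup>+z. ennreal (cost_density p z) * (\<integral>\<^sup>+w. ennreal (max 0 (gap (step (fst w)) (step (snd w)) z)) \<partial>\<pi>) \<partial>(lborel \<Otimes>\<^sub>M lborel))"
proof -
  interpret prob_space \<pi> by fact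
  have [measurable_cong]: "sets \<pi> = sets (borel \<Otimes>\<^sub>M borel)" by fact
  interpret P: pair_sigma_finite \<pi> "lborel \<Otimes>\<^sub>M lborel :: (real \<times> real) measure"
    by standard
  have "(\<integral>\<^sup>+(x, y). ennreal (\<bar>x - y\<bar> powr p) \<partial>\<pi>) =
    (\<integral>\<^sup>+w. \<integral>\<^sup>+z. ennreal (cost_density p z * max 0 (gap (step (fst w)) (step (snd w)) z)) \<partial>(lborel \<Otimes>\<^sub>M lborel) \<partial>\<pi>)"
    unfolding nn_integral_cost_density_step[OF p] by (simp add: case_prod_beta')
  also have "\<dots> = (\<integral>\<^sup>+z. \<integral>\<^sup>+w. ennreal (cost_density p z * max 0 (gap (step (fst w)) (step (snd w)) z)) \<partial>\<pi> \<partial>(lborel \<Otimes>\<^sub>M lborel))"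
    by (rule P.Fubini'[symmetric]) measurable
  also have "\<dots> = (\<integral>\<^sup>+z. ennreal (cost_density p z) * (\<integral>\<^sup>+w. ennreal (max 0 (gap (step (fst w)) (step (snd w)) z)) \<partial>\<pi>) \<partial>(lborel \<Otimes>\<^sub>M lborel))"
    using cost_density_nonneg[OF p]
    by (intro nn_integral_cong) (auto simp: ennreal_mult nn_integral_cmult)
  finally show ?thesis .
qed

text \<open>
The gap is affine in each of the two step functions, so its mean under a coupling sees only the marginals.
\<close>
lemma gap_cdf_eq_expectation:
  assumes pi: "\<pi> \<in> couplings \<mu> \<nu>" and mu: "real_distribution \<mu>" and nu: "real_distribution \<nu>"
  shows "prob_space \<pi>"
    and "integrable \<pi> (\<lambda>w. gap (step (fst w)) (step (snd w)) z)"
    and "(\<integral>w. gap (step (fst w)) (step (snd w)) z \<partial>\<pi>) = gap (cdf \<mu>) (cdf \<nu>) z"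
proof -
  interpret mu: real_distribution \<mu> by fact
  interpret nu: real_distribution \<nu> by fact
  have sets [measurable_cong]: "sets \<pi> = sets (borel \<Otimes>\<^sub>M borel)"
    and d: "distr \<pi> borel fst = \<mu>" "distr \<pi> borel snd = \<nu>"
    using pi by (auto simp: couplings_def)
  show P: "prob_space \<pi>"
    by (rule prob_space_distrD[where f = fst and N = borel]) (auto simp: d mu.prob_space_axioms)
  then interpret P: prob_space \<pi> .
  have i: "integrable \<pi> (\<lambda>w. step (fst w) s)" "integrable \<pi> (\<lambda>w. step (snd w) s)" for s
    by (auto intro!: P.integrable_const_bound[where B = 1] simp: step_def)
  show "integrable \<pi> (\<lambda>w. gap (step (fst w)) (step (snd w)) z)"
    unfolding gap_def by (intro integrable_mult_right Bochner_Integration.integrable_diff i)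
  have "cdf \<mu> s = (\<integral>w. step (fst w) s \<partial>\<pi>)" "cdf \<nu> s = (\<integral>w. step (snd w) s \<partial>\<pi>)" for s
    using cdf_eq_expectation_step[OF mu, of s] cdf_eq_expectation_step[OF nu, of s]
    by (auto simp: d[symmetric] integral_distr)
  then show "(\<integral>w. gap (step (fst w)) (step (snd w)) z \<partial>\<pi>) = gap (cdf \<mu>) (cdf \<nu>) z"
    unfolding gap_def using i by simp
qed

text \<open>
Jensen's inequality for the positive part, applied for every pair of thresholds.
\<close>
lemma transport_value_le_coupling_cost:
  assumes p: "1 < p" and pi: "\<pi> \<in> couplings \<mu> \<nu>" and mu: "real_distribution \<mu>" and nu: "real_distribution \<nu>"
  shows "transport_value p (cdf \<mu>) (cdf \<nu>) \<le> (\<integral>\<^sup>+(x, y). ennreal (\<bar>x - y\<bar> powr p) \<partial>\<pi>)"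
proof -
  note E = gap_cdf_eq_expectation[OF pi mu nu]
  interpret prob_space \<pi> by (rule E)
  have sets: "sets \<pi> = sets (borel \<Otimes>\<^sub>M borel)" using pi by (simp add: couplings_def)
  have "ennreal (max 0 (gap (cdf \<mu>) (cdf \<nu>) z)) \<le> (\<integral>\<^sup>+w. ennreal (max 0 (gap (step (fst w)) (step (snd w)) z)) \<partial>\<pi>)" for z
  proof -
    have i: "integrable \<pi> (\<lambda>w. max 0 (gap (step (fst w)) (step (snd w)) z))"
      using E(2)[of z] by (intro integrable_max) auto
    have "max 0 (gap (cdf \<mu>) (cdf \<nu>) z) \<le> (\<integral>w. max 0 (gap (step (fst w)) (step (snd w)) z) \<partial>\<pi>)"
      unfolding E(3)[symmetric] using i E(2)[of z] by (auto intro!: integral_mono integral_nonneg_AE)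
    also have "ennreal \<dots> = (\<integral>\<^sup>+w. ennreal (max 0 (gap (step (fst w)) (step (snd w)) z)) \<partial>\<pi>)"
      by (rule nn_integral_eq_integral[symmetric, OF i]) auto
    finally show ?thesis by (simp add: ennreal_leI)
  qed
  then show ?thesis
    unfolding coupling_cost_eq[OF p prob_space_axioms sets] transport_value_def
    using cost_density_nonneg[OF p] by (intro nn_integral_mono) (auto simp: ennreal_mult intro: mult_left_mono)
qed

text \<open>
Under the quantile coupling the step functions of both coordinates are indicators of u \<le> F s and u \<le> G t. For fixed
thresholds their difference has the same sign for all u, and then Jensen's inequality is an equality.
\<close>
lemma optimal_coupling_exists:
  assumes p: "1 < p" and mu: "real_distribution \<mu>" and nu: "real_distribution \<nu>"
  obtains \<pi> where "\<pi> \<in> couplings \<mu> \<nu>"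
    "(\<integral>\<^sup>+(x, y). ennreal (\<bar>x - y\<bar> powr p) \<partial>\<pi>) = transport_value p (cdf \<mu>) (cdf \<nu>)"
proof -
  interpret mu: cdf_distribution \<mu> unfolding cdf_distribution_def by fact
  interpret nu: cdf_distribution \<nu> unfolding cdf_distribution_def by fact
  let ?U = "restrict_space lborel {0<..<1} :: real measure"
  have sU [measurable_cong]: "sets ?U = sets (restrict_space borel {0<..<1})"
    by (simp add: sets_restrict_space)
  define \<pi> where "\<pi> = distr ?U (borel \<Otimes>\<^sub>M borel) (\<lambda>u. (mu.I u, nu.I u))"
  have I: "mu.I \<in> borel_measurable ?U" "nu.I \<in> borel_measurable ?U"
    using mu.measurable_CI nu.measurable_CI by (simp_all cong: measurable_cong_sets)
  then have m: "(\<lambda>u. (mu.I u, nu.I u)) \<in> ?U \<rightarrow>\<^sub>M borel \<Otimes>\<^sub>M borel"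
    by (intro measurable_Pair)
  have pi: "\<pi> \<in> couplings \<mu> \<nu>"
    unfolding couplings_def \<pi>_def using m
    by (auto simp: distr_distr comp_def mu.distr_I_eq_M nu.distr_I_eq_M)
  note E = gap_cdf_eq_expectation[OF pi mu nu]
  interpret prob_space \<pi> by (rule E)
  have sets [measurable_cong]: "sets \<pi> = sets (borel \<Otimes>\<^sub>M borel)" using pi by (simp add: couplings_def)
  have inner: "(\<integral>\<^sup>+w. ennreal (max 0 (gap (step (fst w)) (step (snd w)) z)) \<partial>\<pi>)
      = ennreal (max 0 (gap (cdf \<mu>) (cdf \<nu>) z))" for z
  proof -
    let ?g = "\<lambda>w. gap (step (fst w)) (step (snd w)) z"
    \<comment> \<open>the two indicators are nested, which is what makes the sign independent of u\<close>
    have st: "step (mu.I u) s = (if u \<le> cdf \<mu> s then 1 else 0)"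
         "step (nu.I u) s = (if u \<le> cdf \<nu> s then 1 else 0)" if "u \<in> {0<..<1}" for u s
      using that mu.pseudoinverse[of u s] nu.pseudoinverse[of u s] by (auto simp: step_def)
    show ?thesis
    proof (cases "0 \<le> gap (cdf \<mu>) (cdf \<nu>) z")
      case True
      have ae: "AE w in \<pi>. 0 \<le> ?g w"
        unfolding \<pi>_def using True
        by (subst AE_distr_iff[OF m])
           (auto intro!: AE_I2 simp: st gap_def sgn_if split: if_splits)
      have "(\<integral>\<^sup>+w. ennreal (max 0 (?g w)) \<partial>\<pi>) = (\<integral>\<^sup>+w. ennreal (?g w) \<partial>\<pi>)"
        using ae by (intro nn_integral_cong_AE) (auto simp: max_def elim!: eventually_mono)
      also have "\<dots> = ennreal (gap (cdf \<mu>) (cdf \<nu>) z)"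
        using nn_integral_eq_integral[OF E(2) ae] E(3) by simp
      finally show ?thesis using True by simp
    next
      case False
      have ae: "AE w in \<pi>. ?g w \<le> 0"
        unfolding \<pi>_def using False
        by (subst AE_distr_iff[OF m])
           (auto intro!: AE_I2 simp: st gap_def sgn_if split: if_splits)
      have "(\<integral>\<^sup>+w. ennreal (max 0 (?g w)) \<partial>\<pi>) = (\<integral>\<^sup>+w. 0 \<partial>\<pi>)"
        using ae by (intro nn_integral_cong_AE) (auto simp: max_def elim!: eventually_mono)
      then show ?thesis using False by (simp add: max_def)
    qed
  qed
  have "(\<integral>\<^sup>+(x, y). ennreal (\<bar>x - y\<bar> powr p) \<partial>\<pi>) = transport_value p (cdf \<mu>) (cdf \<nu>)"
    unfolding coupling_cost_eq[OF p prob_space_axioms sets] transport_value_def inner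
    using cost_density_nonneg[OF p] by (simp add: ennreal_mult)
  with pi show ?thesis by (rule that)
qed

lemma ennreal_powr_mono: "0 \<le> a \<Longrightarrow> x \<le> y \<Longrightarrow> ennreal_powr x a \<le> ennreal_powr y a"
  by (auto simp: ennreal_powr_def top_unique less_top[symmetric] intro!: ennreal_leI powr_mono2 enn2real_mono)

lemma ennreal_powr_inverse: "0 < a \<Longrightarrow> ennreal_powr (ennreal_powr x (1 / a)) a = x"
  by (auto simp: ennreal_powr_def powr_powr less_top[symmetric])

lemma wasserstein_real_line:
  assumes p: "1 < p" and mu: "real_distribution \<mu>" and nu: "real_distribution \<nu>"
  shows "ennreal_powr (wasserstein p \<mu> \<nu>) p = transport_value p (cdf \<mu>) (cdf \<nu>)"
proof -
  obtain \<pi> where pi: "\<pi> \<in> couplings \<mu> \<nu>"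
    "(\<integral>\<^sup>+(x, y). ennreal (\<bar>x - y\<bar> powr p) \<partial>\<pi>) = transport_value p (cdf \<mu>) (cdf \<nu>)"
    using optimal_coupling_exists[OF p mu nu] by blast
  have "wasserstein p \<mu> \<nu> = ennreal_powr (transport_value p (cdf \<mu>) (cdf \<nu>)) (1 / p)"
    unfolding wasserstein_def
  proof (rule antisym)
    show "(INF \<pi>\<in>couplings \<mu> \<nu>. ennreal_powr (\<integral>\<^sup>+(x, y). ennreal (norm (x - y) powr p) \<partial>\<pi>) (1 / p))
      \<le> ennreal_powr (transport_value p (cdf \<mu>) (cdf \<nu>)) (1 / p)"
      using pi by (intro INF_lower2[OF pi(1)]) simp
    show "ennreal_powr (transport_value p (cdf \<mu>) (cdf \<nu>)) (1 / p) \<le>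
      (INF \<pi>\<in>couplings \<mu> \<nu>. ennreal_powr (\<integral>\<^sup>+(x, y). ennreal (norm (x - y) powr p) \<partial>\<pi>) (1 / p))"
      using p transport_value_le_coupling_cost[OF p _ mu nu]
      by (intro INF_greatest ennreal_powr_mono) auto
  qed
  then show ?thesis using p by (simp add: ennreal_powr_inverse)
qed

section \<open>Thresholds in a bounded box\<close>

text \<open>
With thresholds confined to a box that contains the supports, the cost density becomes a finite measure. This makes
dominated convergence and Fubini available for bounded integrands.
\<close>
definition box_measure :: "real \<Rightarrow> real \<Rightarrow> (real \<times> real) measure" where
  "box_measure p R = density (lborel \<Otimes>\<^sub>M lborel)
     (\<lambda>z. ennreal (cost_density p z) * indicator ({-R..R} \<times> {-R..R}) z)"

lemma sets_box_measure [measurable_cong, simp]: "sets (box_measure p R) = sets (borel \<Otimes>\<^sub>M borel)"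
  by (simp add: box_measure_def)

lemma space_box_measure [simp]: "space (box_measure p R) = UNIV"
  by (simp add: box_measure_def space_pair_measure)

text \<open>
For p < 2 the density is unbounded near the diagonal. It is integrable because, off the diagonal, the box is
covered by the triangles that represent the cost of moving between -R and R + 1, in both directions.
\<close>
lemma finite_measure_box_measure:
  assumes p: "1 < p"
  shows "finite_measure (box_measure p R)"
proof
  let ?g = "\<lambda>x y z. ennreal (cost_density p z * max 0 (gap (step x) (step y) z))"
  have U: "(UNIV :: (real \<times> real) set) \<in> sets (borel \<Otimes>\<^sub>M borel)"
    using sets.top[of "borel \<Otimes>\<^sub>M borel :: (real \<times> real) measure"] by (simp add: space_pair_measure)
  have "emeasure (box_measure p R) (space (box_measure p R)) =
      (\<integral>\<^sup>+z. ennreal (cost_density p z) * indicator ({-R..R} \<times> {-R..R}) z \<partial>(lborel \<Otimes>\<^sub>M lborel))"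
    unfolding space_box_measure unfolding box_measure_def using U by (subst emeasure_density) auto
  \<comment> \<open>R + 1 instead of R, since the triangles are open at their upper end\<close>
  also have "\<dots> \<le> (\<integral>\<^sup>+z. ?g (R + 1) (- R) z + ?g (- R) (R + 1) z \<partial>(lborel \<Otimes>\<^sub>M lborel))"
  proof (rule nn_integral_mono)
    fix z :: "real \<times> real"
    obtain s t where z: "z = (s, t)" by (cases z)
    consider "s < t" | "t < s" | "s = t" by linarith
    then show "ennreal (cost_density p z) * indicator ({-R..R} \<times> {-R..R}) z \<le> ?g (R + 1) (- R) z + ?g (- R) (R + 1) z"
      by cases (auto simp: z gap_def step_def indicator_def cost_density_def)
  qed
  also have "\<dots> = ennreal (\<bar>(R + 1) - (- R)\<bar> powr p) + ennreal (\<bar>(- R) - (R + 1)\<bar> powr p)"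
    by (subst nn_integral_add) (measurable, simp add: nn_integral_cost_density_step[OF p])
  finally show "emeasure (box_measure p R) (space (box_measure p R)) \<noteq> \<infinity>"
    by (auto simp: top_unique)
qed

lemma AE_box_measureI:
  assumes "AE z in lborel \<Otimes>\<^sub>M lborel. P z"
  shows "AE z in box_measure p R. P z"
  unfolding box_measure_def using assms by (subst AE_density) (auto elim: eventually_mono)

definition cdf_within :: "real \<Rightarrow> (real \<Rightarrow> real) \<Rightarrow> bool" where
  "cdf_within R F \<longleftrightarrow> F \<in> borel_measurable borel \<and> (\<forall>s. 0 \<le> F s \<and> F s \<le> 1) \<and> (\<forall>s. s < - R \<longrightarrow> F s = 0) \<and> (\<forall>s\<ge>R. F s = 1)"

lemma cdf_within_cdf:
  assumes mu: "real_distribution \<mu>" and R: "AE x in \<mu>. \<bar>x\<bar> \<le> R"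
  shows "cdf_within R (cdf \<mu>)"
proof -
  interpret real_distribution \<mu> by fact
  have "cdf \<mu> s = 0" if "s < - R" for s
  proof -
    have "prob {..s} = prob {}" using R that by (intro finite_measure_eq_AE) (auto elim!: eventually_mono)
    then show ?thesis by (simp add: cdf_def)
  qed
  moreover have "cdf \<mu> s = 1" if "R \<le> s" for s
    unfolding cdf_def using R that by (intro prob_eq_1[THEN iffD2]) (auto elim!: eventually_mono)
  ultimately show ?thesis
    using cdf_nonneg cdf_bounded_prob borel_measurable_cdf[OF mu] by (auto simp: cdf_within_def)
qed

lemma gap_bounded:
  assumes "cdf_within R F" "cdf_within R G"
  shows "\<bar>gap F G z\<bar> \<le> 1"
proof -
  have "\<bar>G t - F s\<bar> \<le> 1" for s t
    using assms unfolding cdf_within_def by (smt (verit))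
  then show ?thesis by (auto simp: gap_def abs_mult sgn_if)
qed

lemma abs_pos_part_le: "\<bar>u :: real\<bar> \<le> B \<Longrightarrow> \<bar>max 0 u\<bar> \<le> B"
  by (auto simp: max_def)

text \<open>
Thresholds outside the box contribute nothing: if, say, s < t and s < - R, then F s = 0 \<le> G t and the gap is not
positive.
\<close>
lemma transport_value_within:
  assumes p: "1 < p" and F: "cdf_within R F" and G: "cdf_within R G"
  shows "transport_value p F G = ennreal (\<integral>z. max 0 (gap F G z) \<partial>box_measure p R)"
proof -
  interpret finite_measure "box_measure p R" by (rule finite_measure_box_measure[OF p])
  have [measurable]: "F \<in> borel_measurable borel" "G \<in> borel_measurable borel"
    using F G by (auto simp: cdf_within_def)
  have i: "integrable (box_measure p R) (\<lambda>z. max 0 (gap F G z))"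
    using abs_pos_part_le[OF gap_bounded[OF F G]] by (intro integrable_const_bound[where B = 1] AE_I2) auto
  have pt: "ennreal (cost_density p z * max 0 (gap F G z)) =
      (ennreal (cost_density p z) * indicator ({-R..R} \<times> {-R..R}) z) * ennreal (max 0 (gap F G z))" for z
  proof (cases "z \<in> {-R..R} \<times> {-R..R}")
    case True
    then show ?thesis using cost_density_nonneg[OF p] by (simp add: ennreal_mult)
  next
    case False
    obtain s t where z: "z = (s, t)" by (cases z)
    have *: "0 \<le> F s" "F s \<le> 1" "0 \<le> G t" "G t \<le> 1" "s < - R \<Longrightarrow> F s = 0" "t < - R \<Longrightarrow> G t = 0"
      "R \<le> s \<Longrightarrow> F s = 1" "R \<le> t \<Longrightarrow> G t = 1"
      using F G by (auto simp: cdf_within_def)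
    have "s < t \<Longrightarrow> F s \<le> G t"
      using * False unfolding z by (cases "s < - R"; cases "R \<le> t") auto
    moreover have "t < s \<Longrightarrow> G t \<le> F s"
      using * False unfolding z by (cases "t < - R"; cases "R \<le> s") auto
    ultimately have "gap F G (s, t) \<le> 0"
      by (cases s t rule: linorder_cases) (auto simp: gap_def)
    then show ?thesis using False by (simp add: z max_def)
  qed
  have "transport_value p F G = (\<integral>\<^sup>+z. ennreal (max 0 (gap F G z)) \<partial>box_measure p R)"
    unfolding transport_value_def pt box_measure_def by (subst nn_integral_density) auto
  also have "\<dots> = ennreal (\<integral>z. max 0 (gap F G z) \<partial>box_measure p R)"
    using i by (intro nn_integral_eq_integral) auto
  finally show ?thesis .
qed

section \<open>Integrals of positive parts\<close>

text \<open>
The slope is taken at a third point d, since d1 and d2 will be estimates of d. An error occurs only if d1 or d2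
lies on the other side of 0 than d, and then \<bar>d\<bar> \<le> \<bar>d1 - d\<bar> + \<bar>d2 - d\<bar>; this is the gain in the second bound.
\<close>
lemma pos_part_linearization_error:
  fixes d d1 d2 :: real
  shows "\<bar>max 0 d2 - max 0 d1 - of_bool (0 < d) * (d2 - d1)\<bar> \<le> \<bar>d2 - d1\<bar>"
    and "\<bar>d\<bar> * \<bar>max 0 d2 - max 0 d1 - of_bool (0 < d) * (d2 - d1)\<bar> \<le> \<bar>d2 - d1\<bar> * (\<bar>d1 - d\<bar> + \<bar>d2 - d\<bar>)"
proof -
  show 1: "\<bar>max 0 d2 - max 0 d1 - of_bool (0 < d) * (d2 - d1)\<bar> \<le> \<bar>d2 - d1\<bar>"
    by (auto simp: max_def)
  show "\<bar>d\<bar> * \<bar>max 0 d2 - max 0 d1 - of_bool (0 < d) * (d2 - d1)\<bar> \<le> \<bar>d2 - d1\<bar> * (\<bar>d1 - d\<bar> + \<bar>d2 - d\<bar>)"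
  proof (cases "\<bar>d\<bar> \<le> \<bar>d1 - d\<bar> + \<bar>d2 - d\<bar>")
    case True
    then have "\<bar>d\<bar> * \<bar>max 0 d2 - max 0 d1 - of_bool (0 < d) * (d2 - d1)\<bar> \<le> (\<bar>d1 - d\<bar> + \<bar>d2 - d\<bar>) * \<bar>d2 - d1\<bar>"
      using 1 by (intro mult_mono) auto
    then show ?thesis by (simp add: mult.commute)
  next
    case False
    then have "max 0 d2 - max 0 d1 - of_bool (0 < d) * (d2 - d1) = 0"
      by (auto simp: max_def)
    then show ?thesis by simp
  qed
qed

text \<open>
The positive part is differentiable away from 0, and at almost all zeros of D the direction vanishes as well.
Dominated convergence does the rest.
\<close>
lemma pos_part_integral_right_derivative:
  fixes D \<Delta> :: "'b \<Rightarrow> real"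
  assumes N: "finite_measure N" and [measurable]: "D \<in> borel_measurable N" "\<Delta> \<in> borel_measurable N"
    and D: "\<And>z. \<bar>D z\<bar> \<le> A" and \<Delta>: "\<And>z. \<bar>\<Delta> z\<bar> \<le> B"
    and nd: "AE z in N. D z \<noteq> 0 \<or> \<Delta> z = 0"
  shows "((\<lambda>\<tau>. ((\<integral>z. max 0 (D z + \<tau> * \<Delta> z) \<partial>N) - (\<integral>z. max 0 (D z) \<partial>N)) / \<tau>)
     \<longlongrightarrow> (\<integral>z. of_bool (0 < D z) * \<Delta> z \<partial>N)) (at_right 0)"
proof (rule tendsto_at_right_sequentially[where b = 1])
  interpret finite_measure N by fact
  fix S :: "nat \<Rightarrow> real" assume S: "\<And>n. 0 < S n" "\<And>n. S n < 1" "S \<longlonglongrightarrow> 0"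
  have i: "integrable N (\<lambda>z. max 0 (D z + \<tau> * \<Delta> z))" for \<tau>
  proof (rule integrable_const_bound[where B = "A + \<bar>\<tau>\<bar> * B"])
    have "\<bar>max 0 (D z + \<tau> * \<Delta> z)\<bar> \<le> A + \<bar>\<tau>\<bar> * B" for z
    proof -
      have "\<bar>max 0 (D z + \<tau> * \<Delta> z)\<bar> \<le> \<bar>D z\<bar> + \<bar>\<tau> * \<Delta> z\<bar>" by (auto simp: max_def)
      also have "\<dots> \<le> A + \<bar>\<tau>\<bar> * B" unfolding abs_mult using D \<Delta> by (intro add_mono mult_left_mono) auto
      finally show ?thesis .
    qed
    then show "AE z in N. norm (max 0 (D z + \<tau> * \<Delta> z)) \<le> A + \<bar>\<tau>\<bar> * B" by simp
  qed auto
  have i0: "integrable N (\<lambda>z. max 0 (D z))" using i[of 0] by simp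
  have "(\<lambda>n. \<integral>z. (max 0 (D z + S n * \<Delta> z) - max 0 (D z)) / S n \<partial>N) \<longlonglongrightarrow> (\<integral>z. of_bool (0 < D z) * \<Delta> z \<partial>N)"
  proof (rule integral_dominated_convergence[where w = "\<lambda>_. B"])
    show "AE z in N. (\<lambda>n. (max 0 (D z + S n * \<Delta> z) - max 0 (D z)) / S n) \<longlonglongrightarrow> of_bool (0 < D z) * \<Delta> z"
      using nd
    proof eventually_elim
      case (elim z)
      show ?case
      proof (cases "D z = 0")
        case True
        with elim show ?thesis by simp
      next
        case False
        have "(\<lambda>n. S n * \<Delta> z) \<longlonglongrightarrow> 0 * \<Delta> z" by (intro tendsto_intros S)
        then have "\<forall>\<^sub>F n in sequentially. \<bar>S n * \<Delta> z\<bar> < \<bar>D z\<bar>"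
          using False by (intro order_tendstoD(2)[OF tendsto_rabs]) auto
        then have "\<forall>\<^sub>F n in sequentially. (max 0 (D z + S n * \<Delta> z) - max 0 (D z)) / S n = of_bool (0 < D z) * \<Delta> z"
        proof eventually_elim
          case (elim n)
          then show ?case using S(1)[of n] by (auto simp: max_def)
        qed
        then show ?thesis by (rule tendsto_eventually)
      qed
    qed
    have "\<bar>(max 0 (D z + S n * \<Delta> z) - max 0 (D z)) / S n\<bar> \<le> B" for z n
    proof -
      have "\<bar>max 0 (D z + S n * \<Delta> z) - max 0 (D z)\<bar> \<le> \<bar>S n * \<Delta> z\<bar>" by (auto simp: max_def)
      also have "\<dots> \<le> S n * B" unfolding abs_mult using S(1)[of n] \<Delta>[of z] by (auto intro: mult_left_mono)
      finally show ?thesis using S(1)[of n] by (simp add: abs_divide field_simps)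
    qed
    then show "AE z in N. norm ((max 0 (D z + S n * \<Delta> z) - max 0 (D z)) / S n) \<le> B" for n
      by simp
  qed auto
  then show "(\<lambda>n. ((\<integral>z. max 0 (D z + S n * \<Delta> z) \<partial>N) - (\<integral>z. max 0 (D z) \<partial>N)) / S n) \<longlonglongrightarrow> (\<integral>z. of_bool (0 < D z) * \<Delta> z \<partial>N)"
    using i i0 by simp
qed simp

text \<open>
For paths on which the integral of the gap over D > 0 is known to be affine in t, the slope of that affine function is
the derivative of the integral of the positive part.
\<close>
lemma pos_part_path_derivative:
  fixes D E :: "'b \<Rightarrow> real" and G :: "real \<Rightarrow> 'b \<Rightarrow> real"
  assumes N: "finite_measure N" and [measurable]: "D \<in> borel_measurable N" "E \<in> borel_measurable N"
    and D: "\<And>z. \<bar>D z\<bar> \<le> A" and E: "\<And>z. \<bar>E z\<bar> \<le> B" and nd: "AE z in N. D z \<noteq> 0 \<or> E z = 0"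
    and T: "0 < T" and G: "\<And>t z. 0 \<le> t \<Longrightarrow> t \<le> T \<Longrightarrow> G t z = D z + t * E z"
    and lin: "\<And>t. 0 \<le> t \<Longrightarrow> t \<le> T \<Longrightarrow> (\<integral>z. of_bool (0 < D z) * G t z \<partial>N) = c + t * d"
  shows "((\<lambda>t. ((\<integral>z. max 0 (G t z) \<partial>N) - (\<integral>z. max 0 (D z) \<partial>N)) / t) \<longlongrightarrow> d) (at_right 0)"
proof -
  interpret finite_measure N by fact
  have iD: "integrable N (\<lambda>z. of_bool (0 < D z) * D z)"
  proof (intro integrable_const_bound[where B = A] AE_I2)
    show "norm (of_bool (0 < D z) * D z) \<le> A" for z using D[of z] by auto
  qed auto
  have iE: "integrable N (\<lambda>z. of_bool (0 < D z) * E z)"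
  proof (intro integrable_const_bound[where B = B] AE_I2)
    show "norm (of_bool (0 < D z) * E z) \<le> B" for z using E[of z] by auto
  qed auto
  have split: "(\<integral>z. of_bool (0 < D z) * G t z \<partial>N) = (\<integral>z. of_bool (0 < D z) * D z \<partial>N) + t * (\<integral>z. of_bool (0 < D z) * E z \<partial>N)"
    if "0 \<le> t" "t \<le> T" for t
    using iD iE by (simp add: G[OF that] distrib_left mult.left_commute[of _ t])
  have "(\<integral>z. of_bool (0 < D z) * D z \<partial>N) = c" using split[of 0] lin[of 0] T by simp
  then have d: "(\<integral>z. of_bool (0 < D z) * E z \<partial>N) = d" using split[of T] lin[of T] T by simp
  have "((\<lambda>t. ((\<integral>z. max 0 (D z + t * E z) \<partial>N) - (\<integral>z. max 0 (D z) \<partial>N)) / t) \<longlongrightarrow> d) (at_right 0)"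
    unfolding d[symmetric] by (rule pos_part_integral_right_derivative[OF N _ _ D E nd]) measurable
  moreover have "\<forall>\<^sub>F t in at_right 0. t \<in> {0<..<T}"
    using T by (intro eventually_at_right_real)
  then have "\<forall>\<^sub>F t in at_right 0. ((\<integral>z. max 0 (G t z) \<partial>N) - (\<integral>z. max 0 (D z) \<partial>N)) / t
      = ((\<integral>z. max 0 (D z + t * E z) \<partial>N) - (\<integral>z. max 0 (D z) \<partial>N)) / t"
    by (rule eventually_mono) (simp add: G)
  ultimately show ?thesis by (subst tendsto_cong)
qed

section \<open>Dual potentials on the line\<close>

text \<open>
Integrated over the set where the gap of F and G is positive, the gap of two laws \<alpha> and \<beta> becomes a sum of a
linear functional of \<alpha> and one of \<beta>. The densities of these functionals are pot1 and pot2. If F and G are themselves the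
distribution functions of the laws, they form an optimal pair of dual potentials.
\<close>
definition pot1 :: "real \<Rightarrow> real \<Rightarrow> (real \<Rightarrow> real) \<Rightarrow> (real \<Rightarrow> real) \<Rightarrow> real \<Rightarrow> real" where
  "pot1 p R F G x = (\<integral>z. of_bool (0 < gap F G z) * (- sgn (fst z - snd z) * step x (fst z)) \<partial>box_measure p R)"

definition pot2 :: "real \<Rightarrow> real \<Rightarrow> (real \<Rightarrow> real) \<Rightarrow> (real \<Rightarrow> real) \<Rightarrow> real \<Rightarrow> real" where
  "pot2 p R F G y = (\<integral>z. of_bool (0 < gap F G z) * (sgn (fst z - snd z) * step y (snd z)) \<partial>box_measure p R)"

lemma abs_of_bool_sgn_step_le: "\<bar>of_bool b * (sgn u * step x s)\<bar> \<le> 1" "\<bar>of_bool b * (- sgn u * step x s)\<bar> \<le> 1"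
  by (auto simp: step_def sgn_if)

lemma measurable_of_bool_less [measurable (raw)]:
  fixes f g :: "'b \<Rightarrow> real"
  assumes [measurable]: "f \<in> borel_measurable M" "g \<in> borel_measurable M"
  shows "(\<lambda>x. of_bool (f x < g x) :: real) \<in> borel_measurable M"
proof -
  have "(\<lambda>x. of_bool (f x < g x) :: real) = (\<lambda>x. if f x < g x then 1 else 0)" by auto
  then show ?thesis by simp
qed

lemma measurable_pot:
  assumes p: "1 < p"
    and [measurable]: "(\<lambda>(w, s). F w s) \<in> borel_measurable (N \<Otimes>\<^sub>M borel)"
      "(\<lambda>(w, s). G w s) \<in> borel_measurable (N \<Otimes>\<^sub>M borel)" "f \<in> borel_measurable N"
  shows "(\<lambda>w. pot1 p R (F w) (G w) (f w)) \<in> borel_measurable N"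
    and "(\<lambda>w. pot2 p R (F w) (G w) (f w)) \<in> borel_measurable N"
proof -
  interpret finite_measure "box_measure p R" by (rule finite_measure_box_measure[OF p])
  have [measurable]: "(\<lambda>x. F (fst x) (fst (snd x))) \<in> borel_measurable (N \<Otimes>\<^sub>M (borel \<Otimes>\<^sub>M borel))"
      "(\<lambda>x. G (fst x) (snd (snd x))) \<in> borel_measurable (N \<Otimes>\<^sub>M (borel \<Otimes>\<^sub>M borel))"
    using measurable_compose[of "\<lambda>x. (fst x, fst (snd x))" "N \<Otimes>\<^sub>M (borel \<Otimes>\<^sub>M borel)" "N \<Otimes>\<^sub>M borel" "\<lambda>(w, s). F w s" borel]
      measurable_compose[of "\<lambda>x. (fst x, snd (snd x))" "N \<Otimes>\<^sub>M (borel \<Otimes>\<^sub>M borel)" "N \<Otimes>\<^sub>M borel" "\<lambda>(w, s). G w s" borel]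
    by auto
  show "(\<lambda>w. pot1 p R (F w) (G w) (f w)) \<in> borel_measurable N"
    unfolding pot1_def by (rule borel_measurable_lebesgue_integral) (simp add: case_prod_beta')
  show "(\<lambda>w. pot2 p R (F w) (G w) (f w)) \<in> borel_measurable N"
    unfolding pot2_def by (rule borel_measurable_lebesgue_integral) (simp add: case_prod_beta')
qed

lemma pot_bounded:
  assumes p: "1 < p"
  shows "\<bar>pot1 p R F G x\<bar> \<le> measure (box_measure p R) UNIV"
    and "\<bar>pot2 p R F G x\<bar> \<le> measure (box_measure p R) UNIV"
proof -
  have *: "\<bar>\<integral>z. f z \<partial>box_measure p R\<bar> \<le> measure (box_measure p R) UNIV"
    if "\<And>z. \<bar>f z\<bar> \<le> 1" for f :: "real \<times> real \<Rightarrow> real"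
    using abs_integral_le[OF finite_measure_box_measure[OF p] that] by simp
  show "\<bar>pot1 p R F G x\<bar> \<le> measure (box_measure p R) UNIV"
    "\<bar>pot2 p R F G x\<bar> \<le> measure (box_measure p R) UNIV"
    unfolding pot1_def pot2_def by (intro * abs_of_bool_sgn_step_le)+
qed

lemma gap_eq_sum: "gap F G z = - sgn (fst z - snd z) * F (fst z) + sgn (fst z - snd z) * G (snd z)"
  by (simp add: gap_def algebra_simps)

text \<open>
A distribution function is the mean of a step function; exchanging the two integrals produces the potentials.
\<close>
lemma integral_positive_gap_eq_potentials:
  assumes p: "1 < p" and a: "real_distribution \<alpha>" and b: "real_distribution \<beta>"
    and [measurable]: "F \<in> borel_measurable borel" "G \<in> borel_measurable borel"
  shows "(\<integral>z. of_bool (0 < gap F G z) * gap (cdf \<alpha>) (cdf \<beta>) z \<partial>box_measure p R)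
    = (\<integral>x. pot1 p R F G x \<partial>\<alpha>) + (\<integral>y. pot2 p R F G y \<partial>\<beta>)"
proof -
  let ?B = "box_measure p R"
  interpret finite_measure ?B by (rule finite_measure_box_measure[OF p])
  interpret a: real_distribution \<alpha> by fact
  interpret b: real_distribution \<beta> by fact
  interpret A: pair_sigma_finite \<alpha> ?B by standard
  interpret B: pair_sigma_finite \<beta> ?B by standard
  interpret A: finite_measure "\<alpha> \<Otimes>\<^sub>M ?B" by (intro finite_measure_pair_measure a.finite_measure_axioms finite_measure_axioms)
  interpret B: finite_measure "\<beta> \<Otimes>\<^sub>M ?B" by (intro finite_measure_pair_measure b.finite_measure_axioms finite_measure_axioms)
  have [measurable]: "cdf \<alpha> \<in> borel_measurable borel" "cdf \<beta> \<in> borel_measurable borel"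
    using a b by auto
  have iA: "integrable (\<alpha> \<Otimes>\<^sub>M ?B) (\<lambda>(x, z). of_bool (0 < gap F G z) * (- sgn (fst z - snd z) * step x (fst z)))"
    by (intro A.integrable_const_bound[where B = 1]) (auto simp: case_prod_beta sgn_if step_def)
  have iB: "integrable (\<beta> \<Otimes>\<^sub>M ?B) (\<lambda>(x, z). of_bool (0 < gap F G z) * (sgn (fst z - snd z) * step x (snd z)))"
    by (intro B.integrable_const_bound[where B = 1]) (auto simp: case_prod_beta sgn_if step_def)
  have c: "0 \<le> cdf \<alpha> s" "cdf \<alpha> s \<le> 1" "0 \<le> cdf \<beta> s" "cdf \<beta> s \<le> 1" for s
    using a.cdf_nonneg a.cdf_bounded_prob b.cdf_nonneg b.cdf_bounded_prob by auto
  have i1: "integrable ?B (\<lambda>z. of_bool (0 < gap F G z) * (- sgn (fst z - snd z) * cdf \<alpha> (fst z)))"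
    using c by (intro integrable_const_bound[where B = 1]) (auto simp: sgn_if intro: AE_I2)
  have i2: "integrable ?B (\<lambda>z. of_bool (0 < gap F G z) * (sgn (fst z - snd z) * cdf \<beta> (snd z)))"
    using c by (intro integrable_const_bound[where B = 1]) (auto simp: sgn_if intro: AE_I2)
  have "(\<integral>x. pot1 p R F G x \<partial>\<alpha>) = (\<integral>z. (\<integral>x. of_bool (0 < gap F G z) * (- sgn (fst z - snd z) * step x (fst z)) \<partial>\<alpha>) \<partial>?B)"
    unfolding pot1_def using A.Fubini_integral[OF iA] by simp
  also have "\<dots> = (\<integral>z. of_bool (0 < gap F G z) * (- sgn (fst z - snd z) * cdf \<alpha> (fst z)) \<partial>?B)"
    by (simp add: cdf_eq_expectation_step[OF a])
  finally have 1: "(\<integral>x. pot1 p R F G x \<partial>\<alpha>) = \<dots>" .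
  have "(\<integral>x. pot2 p R F G x \<partial>\<beta>) = (\<integral>z. (\<integral>x. of_bool (0 < gap F G z) * (sgn (fst z - snd z) * step x (snd z)) \<partial>\<beta>) \<partial>?B)"
    unfolding pot2_def using B.Fubini_integral[OF iB] by simp
  also have "\<dots> = (\<integral>z. of_bool (0 < gap F G z) * (sgn (fst z - snd z) * cdf \<beta> (snd z)) \<partial>?B)"
    by (simp add: cdf_eq_expectation_step[OF b])
  finally have 2: "(\<integral>x. pot2 p R F G x \<partial>\<beta>) = \<dots>" .
  show ?thesis
    unfolding 1 2 Bochner_Integration.integral_add[OF i1 i2, symmetric]
    by (intro Bochner_Integration.integral_cong) (auto simp: gap_eq_sum[of "cdf \<alpha>"] algebra_simps)
qed

text \<open>
Dual feasibility: the integral of the gap of two step functions over any set of thresholds is at most the integral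
of its positive part, and that is the cost.
\<close>
lemma pot_sum_le_cost:
  assumes p: "1 < p" and F: "cdf_within R F" and G: "cdf_within R G"
  shows "pot1 p R F G x + pot2 p R F G y \<le> \<bar>x - y\<bar> powr p"
proof -
  let ?B = "box_measure p R"
  interpret finite_measure ?B by (rule finite_measure_box_measure[OF p])
  have [measurable]: "F \<in> borel_measurable borel" "G \<in> borel_measurable borel"
    using F G by (auto simp: cdf_within_def)
  have i1: "integrable ?B (\<lambda>z. of_bool (0 < gap F G z) * (- sgn (fst z - snd z) * step x (fst z)))"
    by (intro integrable_const_bound[where B = 1]) (auto simp: sgn_if step_def)
  have i2: "integrable ?B (\<lambda>z. of_bool (0 < gap F G z) * (sgn (fst z - snd z) * step y (snd z)))"
    by (intro integrable_const_bound[where B = 1]) (auto simp: sgn_if step_def)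
  have b: "\<bar>gap (step x) (step y) z\<bar> \<le> 1" for z
    by (auto simp: gap_def step_def sgn_if)
  have i3: "integrable ?B (\<lambda>z. max 0 (gap (step x) (step y) z))"
    using abs_pos_part_le[OF b] by (intro integrable_const_bound[where B = 1] AE_I2) auto
  have "pot1 p R F G x + pot2 p R F G y = (\<integral>z. of_bool (0 < gap F G z) * gap (step x) (step y) z \<partial>?B)"
    unfolding pot1_def pot2_def Bochner_Integration.integral_add[OF i1 i2, symmetric]
    by (intro Bochner_Integration.integral_cong) (auto simp: gap_eq_sum[of "step x"] algebra_simps)
  also have "\<dots> \<le> (\<integral>z. max 0 (gap (step x) (step y) z) \<partial>?B)"
  proof (rule integral_mono[OF _ i3])
    have "\<bar>of_bool (0 < gap F G z) * gap (step x) (step y) z\<bar> \<le> 1" for z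
      using b[of z] by auto
    then show "integrable ?B (\<lambda>z. of_bool (0 < gap F G z) * gap (step x) (step y) z)"
      by (intro integrable_const_bound[where B = 1] AE_I2) auto
  qed auto
  finally have "ennreal (pot1 p R F G x + pot2 p R F G y) \<le> ennreal (\<integral>z. max 0 (gap (step x) (step y) z) \<partial>?B)"
    by (rule ennreal_leI)
  also have "\<dots> = (\<integral>\<^sup>+z. ennreal (max 0 (gap (step x) (step y) z)) \<partial>?B)"
    using i3 by (intro nn_integral_eq_integral[symmetric]) auto
  also have "\<dots> = (\<integral>\<^sup>+z. (ennreal (cost_density p z) * indicator ({-R..R} \<times> {-R..R}) z) * ennreal (max 0 (gap (step x) (step y) z)) \<partial>(lborel \<Otimes>\<^sub>M lborel))"
    unfolding box_measure_def by (subst nn_integral_density) auto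
  also have "\<dots> \<le> (\<integral>\<^sup>+z. ennreal (cost_density p z * max 0 (gap (step x) (step y) z)) \<partial>(lborel \<Otimes>\<^sub>M lborel))"
    using cost_density_nonneg[OF p] by (intro nn_integral_mono) (auto simp: indicator_def ennreal_mult)
  also have "\<dots> = ennreal (\<bar>x - y\<bar> powr p)" by (rule nn_integral_cost_density_step[OF p])
  finally show ?thesis by (subst (asm) ennreal_le_iff) auto
qed

text \<open>
Dual optimality: over the set where a function is positive, it equals its positive part.
\<close>
lemma integral_potentials_eq_value:
  assumes p: "1 < p" and a: "real_distribution \<alpha>" and b: "real_distribution \<beta>"
  shows "(\<integral>x. pot1 p R (cdf \<alpha>) (cdf \<beta>) x \<partial>\<alpha>) + (\<integral>y. pot2 p R (cdf \<alpha>) (cdf \<beta>) y \<partial>\<beta>)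
    = (\<integral>z. max 0 (gap (cdf \<alpha>) (cdf \<beta>) z) \<partial>box_measure p R)"
  using a b by (subst integral_positive_gap_eq_potentials[symmetric, OF p])
    (auto intro!: Bochner_Integration.integral_cong simp: max_def)

section \<open>Bounded perturbations of a law\<close>

text \<open>
The bound t C \<le> 1 keeps the density 1 + t h nonnegative. Since integrals are affine in t, all functionals that are
affine in the law are affine along the perturbation.
\<close>
lemma perturb_prob:
  fixes \<mu> :: "'a::euclidean_space measure"
  assumes mu: "prob_space \<mu>" "sets \<mu> = sets borel" and h: "h \<in> tangents \<mu>" and C: "\<And>x. \<bar>h x\<bar> \<le> C"
    and t: "0 \<le> t" "t * C \<le> 1"
  shows "prob_space (perturb \<mu> t h)" and "sets (perturb \<mu> t h) = sets borel"
    and "integrable \<mu> f \<Longrightarrow> integrable (perturb \<mu> t h) f"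
    and "integrable \<mu> f \<Longrightarrow> (\<integral>x. f x \<partial>perturb \<mu> t h) = (\<integral>x. f x \<partial>\<mu>) + t * (\<integral>x. f x * h x \<partial>\<mu>)"
    and "AE x in \<mu>. P x \<Longrightarrow> AE x in perturb \<mu> t h. P x"
proof -
  interpret prob_space \<mu> by fact
  have [measurable_cong]: "sets \<mu> = sets borel" by fact
  have [measurable]: "h \<in> borel_measurable borel" using h by (simp add: tangents_def)
  have pos: "0 \<le> 1 + t * h x" for x
  proof -
    have "\<bar>t * h x\<bar> \<le> t * C" unfolding abs_mult using t C by (auto intro: mult_left_mono)
    then show ?thesis using t by linarith
  qed
  have ih: "integrable \<mu> h" using C by (intro integrable_const_bound[where B = C]) auto
  have ifh: "integrable \<mu> (\<lambda>x. f x * h x)" if "integrable \<mu> f" for f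
    by (rule integrable_mult_bounded[OF that _ C]) measurable
  show "sets (perturb \<mu> t h) = sets borel" using mu by (simp add: perturb_def)
  have E: "integrable (perturb \<mu> t h) f" "(\<integral>x. f x \<partial>perturb \<mu> t h) = (\<integral>x. f x \<partial>\<mu>) + t * (\<integral>x. f x * h x \<partial>\<mu>)"
    if f: "integrable \<mu> f" for f
  proof -
    have [measurable]: "f \<in> borel_measurable \<mu>" using f by auto
    have eq: "(1 + t * h x) *\<^sub>R f x = f x + t * (f x * h x)" for x by (simp add: algebra_simps)
    have i: "integrable \<mu> (\<lambda>x. f x + t * (f x * h x))"
      by (intro Bochner_Integration.integrable_add integrable_mult_right f ifh)
    show "integrable (perturb \<mu> t h) f"
      unfolding perturb_def by (subst integrable_density) (simp_all only: eq i, measurable, simp add: pos)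
    have "(\<integral>x. f x \<partial>perturb \<mu> t h) = (\<integral>x. f x + t * (f x * h x) \<partial>\<mu>)"
      unfolding perturb_def by (subst integral_density) (simp_all only: eq, measurable, simp add: pos)
    also have "\<dots> = (\<integral>x. f x \<partial>\<mu>) + t * (\<integral>x. f x * h x \<partial>\<mu>)"
      using f ifh[OF f] by simp
    finally show "(\<integral>x. f x \<partial>perturb \<mu> t h) = (\<integral>x. f x \<partial>\<mu>) + t * (\<integral>x. f x * h x \<partial>\<mu>)" .
  qed
  show "integrable \<mu> f \<Longrightarrow> integrable (perturb \<mu> t h) f"
    "integrable \<mu> f \<Longrightarrow> (\<integral>x. f x \<partial>perturb \<mu> t h) = (\<integral>x. f x \<partial>\<mu>) + t * (\<integral>x. f x * h x \<partial>\<mu>)"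
    using E by auto
  show "prob_space (perturb \<mu> t h)"
  proof
    have i1: "integrable \<mu> (\<lambda>x. 1 + t * h x)" using ih by auto
    have "emeasure (perturb \<mu> t h) (space (perturb \<mu> t h)) = (\<integral>\<^sup>+x. ennreal (1 + t * h x) \<partial>\<mu>)"
      unfolding perturb_def space_density by (subst emeasure_density) (auto intro!: nn_integral_cong)
    also have "\<dots> = ennreal (\<integral>x. 1 + t * h x \<partial>\<mu>)" by (rule nn_integral_eq_integral[OF i1]) (auto intro: pos)
    also have "(\<integral>x. 1 + t * h x \<partial>\<mu>) = 1" using ih h by (simp add: tangents_def prob_space)
    finally show "emeasure (perturb \<mu> t h) (space (perturb \<mu> t h)) = 1" by simp
  qed
  show "AE x in perturb \<mu> t h. P x" if "AE x in \<mu>. P x"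
    unfolding perturb_def using that by (subst AE_density) (auto elim: eventually_mono)
qed

lemma tangentsD:
  assumes "h \<in> tangents \<mu>"
  obtains C where "0 < C" "\<And>x. \<bar>h x\<bar> \<le> C"
proof -
  from assms obtain C where C: "\<And>x. \<bar>h x\<bar> \<le> C" by (auto simp: tangents_def bounded_iff)
  then have "\<bar>h x\<bar> \<le> max 1 C" for x by (simp add: le_max_iff_disj)
  then show ?thesis by (intro that[of "max 1 C"]) auto
qed

text \<open>
The pairing of q with the centred sign of q - E q is the mean of \<bar>q - E q\<bar>.
\<close>
lemma AE_eq_const_if_orthogonal_tangents:
  fixes \<mu> :: "'a::euclidean_space measure"
  assumes mu: "prob_space \<mu>" "sets \<mu> = sets borel" and q: "integrable \<mu> q"
    and orth: "\<And>h. h \<in> tangents \<mu> \<Longrightarrow> (\<integral>x. q x * h x \<partial>\<mu>) \<le> 0"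
  shows "AE x in \<mu>. q x = (\<integral>x. q x \<partial>\<mu>)"
proof -
  interpret prob_space \<mu> by fact
  have mc [measurable_cong]: "sets \<mu> = sets borel" by fact
  define m where "m = (\<integral>x. q x \<partial>\<mu>)"
  have [measurable]: "q \<in> borel_measurable borel" using q by (auto cong: measurable_cong_sets[OF mc])
  define g where "g x = sgn (q x - m)" for x
  have [measurable]: "g \<in> borel_measurable borel" by (simp add: g_def[abs_def])
  have ig: "integrable \<mu> g" by (intro integrable_const_bound[where B = 1]) (auto simp: g_def sgn_if)
  define c where "c = (\<integral>x. g x \<partial>\<mu>)"
  have "bounded (range (\<lambda>x. g x - c))"
    unfolding bounded_iff by (rule exI[of _ "1 + \<bar>c\<bar>"]) (auto simp: g_def sgn_if)
  then have "(\<lambda>x. g x - c) \<in> tangents \<mu>"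
    using ig by (auto simp: tangents_def c_def prob_space)
  then have le: "(\<integral>x. q x * (g x - c) \<partial>\<mu>) \<le> 0" by (rule orth)
  have iqg: "integrable \<mu> (\<lambda>x. q x * g x)"
    by (rule Bochner_Integration.integrable_bound[OF q]) (auto simp: g_def abs_mult sgn_if)
  have "(\<integral>x. \<bar>q x - m\<bar> \<partial>\<mu>) = (\<integral>x. q x * g x - m * g x \<partial>\<mu>)"
    by (intro Bochner_Integration.integral_cong) (auto simp: g_def sgn_if)
  also have "\<dots> = (\<integral>x. q x * g x \<partial>\<mu>) - m * c" using iqg ig by (simp add: c_def)
  also have "\<dots> = (\<integral>x. q x * (g x - c) \<partial>\<mu>)" using iqg q by (simp add: algebra_simps m_def)
  finally have "(\<integral>x. \<bar>q x - m\<bar> \<partial>\<mu>) \<le> 0" using le by simp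
  moreover have "0 \<le> (\<integral>x. \<bar>q x - m\<bar> \<partial>\<mu>)" by (intro integral_nonneg_AE) auto
  ultimately have "(\<integral>x. \<bar>q x - m\<bar> \<partial>\<mu>) = 0" by linarith
  moreover have "integrable \<mu> (\<lambda>x. \<bar>q x - m\<bar>)" using q by auto
  ultimately have "AE x in \<mu>. \<bar>q x - m\<bar> = 0" by (subst (asm) integral_nonneg_eq_0_iff_AE) auto
  then show ?thesis by (auto simp: m_def elim: eventually_mono)
qed

section \<open>Kantorovich duality on the line\<close>

text \<open>
A c-transform is an infimum of functions that are continuous or constant, so its strict sublevel sets are open.
\<close>
lemma borel_measurable_c_transform:
  assumes p: "1 < p"
  shows "c_transform p f \<in> borel_measurable borel"
proof (rule borel_measurableI_less)
  fix a :: ereal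
  have "open {y. ereal (norm (x - y) powr p) - f x < a}" for x :: 'a
  proof (cases "f x")
    case (real r)
    have "continuous_on UNIV (\<lambda>y. norm (x - y) powr p)"
      using p by (intro continuous_on_powr' continuous_intros) auto
    then have "open {y. norm (x - y) powr p < b}" for b
      by (intro open_Collect_less continuous_on_const)
    moreover have "{y. ereal (norm (x - y) powr p) - f x < ereal b} = {y. norm (x - y) powr p < b + r}" for b
      using real by (auto simp: algebra_simps)
    moreover have "{y. ereal (norm (x - y) powr p) - f x < \<infinity>} = UNIV"
      using real by auto
    ultimately show ?thesis by (cases a) simp_all
  next
    case PInf
    then show ?thesis by (cases "a = -\<infinity>") auto
  next
    case MInf
    then show ?thesis by auto
  qed
  then have "open (\<Union>x. {y. ereal (norm (x - y) powr p) - f x < a})" by blast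
  also have "(\<Union>x. {y. ereal (norm (x - y) powr p) - f x < a}) = {y \<in> space borel. c_transform p f y < a}"
    by (auto simp: c_transform_def INF_less_iff)
  finally show "{y \<in> space borel. c_transform p f y < a} \<in> sets borel" by (rule borel_open)
qed

lemma ereal_integral_real:
  assumes f: "ereal_L1 M f"
  shows "AE x in M. \<bar>f x\<bar> \<noteq> \<infinity>" and "integrable M (\<lambda>x. real_of_ereal (f x))"
    and "ereal_integral M f = ereal (\<integral>x. real_of_ereal (f x) \<partial>M)"
proof -
  have [measurable]: "f \<in> borel_measurable M" and fin: "(\<integral>\<^sup>+x. e2ennreal \<bar>f x\<bar> \<partial>M) < \<infinity>"
    using f by (auto simp: ereal_L1_def)
  have "AE x in M. e2ennreal \<bar>f x\<bar> \<noteq> \<infinity>"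
    using fin by (intro nn_integral_PInf_AE) auto
  then show ae: "AE x in M. \<bar>f x\<bar> \<noteq> \<infinity>"
    by (rule eventually_mono) auto
  have "(\<integral>\<^sup>+x. ennreal (norm (real_of_ereal (f x))) \<partial>M) = (\<integral>\<^sup>+x. e2ennreal \<bar>f x\<bar> \<partial>M)"
    using ae by (intro nn_integral_cong_AE) (auto elim!: eventually_mono)
  then show i: "integrable M (\<lambda>x. real_of_ereal (f x))"
    using fin by (intro integrableI_bounded) auto
  have "(\<integral>\<^sup>+x. e2ennreal (f x) \<partial>M) = (\<integral>\<^sup>+x. ennreal (real_of_ereal (f x)) \<partial>M)"
       "(\<integral>\<^sup>+x. e2ennreal (- f x) \<partial>M) = (\<integral>\<^sup>+x. ennreal (- real_of_ereal (f x)) \<partial>M)"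
    using ae by (auto intro!: nn_integral_cong_AE elim!: eventually_mono)
  moreover have "(\<integral>\<^sup>+x. ennreal (real_of_ereal (f x)) \<partial>M) < \<infinity>" "(\<integral>\<^sup>+x. ennreal (- real_of_ereal (f x)) \<partial>M) < \<infinity>"
    using i by (auto simp: real_integrable_def less_top)
  moreover have "enn2ereal a - enn2ereal b = ereal (enn2real a - enn2real b)" if "a < \<infinity>" "b < \<infinity>" for a b
    using that by (cases a; cases b) (auto simp: enn2ereal_ennreal)
  ultimately show "ereal_integral M f = ereal (\<integral>x. real_of_ereal (f x) \<partial>M)"
    unfolding ereal_integral_def real_lebesgue_integral_def[OF i]
    by (auto simp: less_top[symmetric] elim!: ennreal_cases)
qed

lemma ereal_integral_mono:
  assumes "\<And>x. f x \<le> g x"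
  shows "ereal_integral M f \<le> ereal_integral M g"
  unfolding ereal_integral_def
  by (intro ereal_minus_mono) (auto simp: assms less_eq_ennreal.rep_eq[symmetric] intro!: nn_integral_mono e2ennreal_mono)

lemma ereal_L1_bounded:
  assumes M: "finite_measure M" and [measurable]: "f \<in> borel_measurable M" and "\<And>x. \<bar>f x\<bar> \<le> B"
  shows "ereal_L1 M (\<lambda>x. ereal (f x))" 
proof -
  interpret finite_measure M by fact
  have "integrable M f" using assms(3) by (intro integrable_const_bound[where B = B]) auto
  then show ?thesis by (auto simp: ereal_L1_def integrable_iff_bounded)
qed

lemma c_transform_le: "c_transform p f y \<le> ereal (norm (x - y) powr p) - f x"
  unfolding c_transform_def by (rule INF_lower) simp

text \<open>
Weak duality: integrate the inequality between a function, its c-transform and the cost against an optimal coupling.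
\<close>
lemma dual_le_transport_value:
  assumes p: "1 < p" and mu: "real_distribution \<mu>" "AE x in \<mu>. \<bar>x\<bar> \<le> R"
    and nu: "real_distribution \<nu>" "AE x in \<nu>. \<bar>x\<bar> \<le> R"
    and f: "AE x in \<mu>. \<bar>f x\<bar> \<noteq> \<infinity>" "integrable \<mu> (\<lambda>x. real_of_ereal (f x))"
    and g: "AE y in \<nu>. \<bar>c_transform p f y\<bar> \<noteq> \<infinity>" "integrable \<nu> (\<lambda>y. real_of_ereal (c_transform p f y))"
  shows "(\<integral>x. real_of_ereal (f x) \<partial>\<mu>) + (\<integral>y. real_of_ereal (c_transform p f y) \<partial>\<nu>)
    \<le> (\<integral>z. max 0 (gap (cdf \<mu>) (cdf \<nu>) z) \<partial>box_measure p R)"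
proof -
  note [measurable] = borel_measurable_c_transform[OF p]
  let ?V = "\<integral>z. max 0 (gap (cdf \<mu>) (cdf \<nu>) z) \<partial>box_measure p R"
  obtain \<pi> where pi: "\<pi> \<in> couplings \<mu> \<nu>"
    and cost: "(\<integral>\<^sup>+(x, y). ennreal (\<bar>x - y\<bar> powr p) \<partial>\<pi>) = transport_value p (cdf \<mu>) (cdf \<nu>)"
    using optimal_coupling_exists[OF p mu(1) nu(1)] by blast
  have [measurable_cong]: "sets \<pi> = sets (borel \<Otimes>\<^sub>M borel)" and d: "distr \<pi> borel fst = \<mu>" "distr \<pi> borel snd = \<nu>"
    using pi by (auto simp: couplings_def)
  interpret mu: real_distribution \<mu> by fact
  interpret nu: real_distribution \<nu> by fact
  have [measurable]: "(\<lambda>x. real_of_ereal (f x)) \<in> borel_measurable borel"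
    using f(2) by (auto cong: measurable_cong_sets)
  let ?c = "\<lambda>w :: real \<times> real. \<bar>fst w - snd w\<bar> powr p"
  have cost': "(\<integral>\<^sup>+w. ennreal (?c w) \<partial>\<pi>) = ennreal ?V"
    using cost transport_value_within[OF p cdf_within_cdf[OF mu] cdf_within_cdf[OF nu]]
    by (simp add: case_prod_beta')
  have V: "0 \<le> ?V" by (intro integral_nonneg_AE) auto
  have ic: "integrable \<pi> ?c" using cost' by (intro integrableI_nonneg) auto
  have Vc: "(\<integral>w. ?c w \<partial>\<pi>) = ?V" using V cost' by (intro integral_eq_nn_integral[THEN trans]) auto
  have i1: "integrable \<pi> (\<lambda>w. real_of_ereal (f (fst w)))"
    using f(2) integrable_distr[of fst \<pi> borel "\<lambda>x. real_of_ereal (f x)"] by (simp add: d)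
  have i2: "integrable \<pi> (\<lambda>w. real_of_ereal (c_transform p f (snd w)))"
    using g(2) integrable_distr[of snd \<pi> borel "\<lambda>x. real_of_ereal (c_transform p f x)"] by (simp add: d)
  have e: "(\<integral>x. real_of_ereal (f x) \<partial>\<mu>) = (\<integral>w. real_of_ereal (f (fst w)) \<partial>\<pi>)"
     "(\<integral>y. real_of_ereal (c_transform p f y) \<partial>\<nu>) = (\<integral>w. real_of_ereal (c_transform p f (snd w)) \<partial>\<pi>)"
    by (simp_all add: d[symmetric] integral_distr)
  have a1: "AE w in \<pi>. \<bar>f (fst w)\<bar> \<noteq> \<infinity>"
    by (rule AE_distrD[of fst \<pi> borel, unfolded d, OF _ f(1)]) measurable
  have a2: "AE w in \<pi>. \<bar>c_transform p f (snd w)\<bar> \<noteq> \<infinity>"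
    by (rule AE_distrD[of snd \<pi> borel, unfolded d, OF _ g(1)]) measurable
  have "AE w in \<pi>. real_of_ereal (f (fst w)) + real_of_ereal (c_transform p f (snd w)) \<le> ?c w"
    using a1 a2
  proof eventually_elim
    case (elim w)
    then show ?case using c_transform_le[of p f "snd w" "fst w"]
      by (cases "f (fst w)"; cases "c_transform p f (snd w)") auto
  qed
  then have "(\<integral>w. real_of_ereal (f (fst w)) + real_of_ereal (c_transform p f (snd w)) \<partial>\<pi>) \<le> (\<integral>w. ?c w \<partial>\<pi>)"
    using i1 i2 ic by (intro integral_mono_AE) auto
  then show ?thesis using i1 i2 by (simp add: e Vc)
qed

text \<open>
The dual value of a potential is at least that of pot1, whose c-transform dominates pot2 by feasibility, and hence at
least the transport value. Weak duality gives the converse, once the c-transform is known to be integrable. Its positive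
part is bounded by the cost of moving to a point at which the potential is finite. Its negative part is
integrable because otherwise the dual value would be minus infinity.
\<close>
lemma ot_potential_dual_equality:
  assumes p: "1 < p" and mu: "real_distribution \<mu>" "AE x in \<mu>. \<bar>x\<bar> \<le> R"
    and nu: "real_distribution \<nu>" "AE x in \<nu>. \<bar>x\<bar> \<le> R"
    and pot: "ot_potential p \<mu> \<nu> f"
  shows "ereal_L1 \<mu> f" and "ereal_L1 \<nu> (c_transform p f)"
    and "(\<integral>x. real_of_ereal (f x) \<partial>\<mu>) + (\<integral>y. real_of_ereal (c_transform p f y) \<partial>\<nu>)
      = (\<integral>z. max 0 (gap (cdf \<mu>) (cdf \<nu>) z) \<partial>box_measure p R)"
proof -
  note [measurable] = borel_measurable_c_transform[OF p]
  let ?V = "\<integral>z. max 0 (gap (cdf \<mu>) (cdf \<nu>) z) \<partial>box_measure p R"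
  interpret mu: real_distribution \<mu> by fact
  interpret nu: real_distribution \<nu> by fact
  show L1: "ereal_L1 \<mu> f" using pot by (simp add: ot_potential_def)
  note F = ereal_integral_real[OF L1]
  let ?F = "cdf \<mu>" and ?G = "cdf \<nu>"
  have [measurable]: "?F \<in> borel_measurable borel" "?G \<in> borel_measurable borel"
    by (rule borel_measurable_cdf mu nu)+
  have FG: "(\<lambda>(w :: real, s). ?F s) \<in> borel_measurable (borel \<Otimes>\<^sub>M borel)"
    "(\<lambda>(w :: real, s). ?G s) \<in> borel_measurable (borel \<Otimes>\<^sub>M borel)"
    unfolding case_prod_beta' by measurable
  have meas: "pot1 p R ?F ?G \<in> borel_measurable borel" "pot2 p R ?F ?G \<in> borel_measurable borel"
    by (rule measurable_pot[OF p FG, where f = "\<lambda>x. x"], measurable)+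
  have P1: "ereal_L1 \<mu> (\<lambda>x. ereal (pot1 p R ?F ?G x))" and P2: "ereal_L1 \<nu> (\<lambda>x. ereal (pot2 p R ?F ?G x))"
    by (rule ereal_L1_bounded[OF mu.finite_measure_axioms _ pot_bounded(1)[OF p]], use meas in simp)
       (rule ereal_L1_bounded[OF nu.finite_measure_axioms _ pot_bounded(2)[OF p]], use meas in simp)
  have "ereal ?V = ereal_integral \<mu> (\<lambda>x. ereal (pot1 p R ?F ?G x)) + ereal_integral \<nu> (\<lambda>x. ereal (pot2 p R ?F ?G x))"
    unfolding ereal_integral_real(3)[OF P1] ereal_integral_real(3)[OF P2]
    using integral_potentials_eq_value[OF p mu(1) nu(1), of R] by simp
  also have "\<dots> \<le> dual_objective p \<mu> \<nu> (\<lambda>x. ereal (pot1 p R ?F ?G x))"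
    unfolding dual_objective_def
  proof (intro add_left_mono ereal_integral_mono)
    fix y
    show "ereal (pot2 p R ?F ?G y) \<le> c_transform p (\<lambda>x. ereal (pot1 p R ?F ?G x)) y"
      unfolding c_transform_def
      using pot_sum_le_cost[OF p cdf_within_cdf[OF mu] cdf_within_cdf[OF nu], of _ y]
      by (intro INF_greatest) (simp add: le_diff_eq add.commute)
  qed
  also have "\<dots> \<le> dual_objective p \<mu> \<nu> f"
    using pot P1 unfolding ot_potential_def by (auto intro!: SUP_upper)
  also have "\<dots> = ereal (\<integral>x. real_of_ereal (f x) \<partial>\<mu>) + ereal_integral \<nu> (c_transform p f)"
    by (simp add: dual_objective_def F)
  finally have ge: "ereal ?V \<le> ereal (\<integral>x. real_of_ereal (f x) \<partial>\<mu>) + ereal_integral \<nu> (c_transform p f)" .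
  have "\<exists>x r. f x = ereal r"
  proof (rule ccontr)
    assume no: "\<nexists>x r. f x = ereal r"
    have "\<bar>f x\<bar> = \<infinity>" for x using no by (cases "f x") auto
    then have "AE x in \<mu>. False" using F(1) by auto
    then show False by simp
  qed
  then obtain x0 r where x0: "f x0 = ereal r" by blast
  define B where "B = (\<bar>x0\<bar> + R) powr p + \<bar>r\<bar>"
  have "AE y in \<nu>. e2ennreal (c_transform p f y) \<le> ennreal B"
    using nu(2)
  proof eventually_elim
    case (elim y)
    have "c_transform p f y \<le> ereal (norm (x0 - y) powr p) - f x0" by (rule c_transform_le)
    also have "\<dots> \<le> ereal B"
    proof -
      have "norm (x0 - y) powr p \<le> (\<bar>x0\<bar> + R) powr p" using elim p by (intro powr_mono2) auto
      then show ?thesis by (simp add: x0 B_def)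
    qed
    finally show ?case using e2ennreal_mono by fastforce
  qed
  then have "(\<integral>\<^sup>+y. e2ennreal (c_transform p f y) \<partial>\<nu>) \<le> (\<integral>\<^sup>+y. ennreal B \<partial>\<nu>)"
    by (rule nn_integral_mono_AE)
  also have "\<dots> < \<infinity>" by (simp add: nu.emeasure_space_1[simplified] ennreal_mult_less_top)
  finally have posfin: "(\<integral>\<^sup>+y. e2ennreal (c_transform p f y) \<partial>\<nu>) < \<infinity>" .
  have negfin: "(\<integral>\<^sup>+y. e2ennreal (- c_transform p f y) \<partial>\<nu>) < \<infinity>"
  proof (rule ccontr)
    assume "\<not> ?thesis"
    then have inf: "(\<integral>\<^sup>+y. e2ennreal (- c_transform p f y) \<partial>\<nu>) = \<top>" by (simp add: less_top[symmetric])
    from posfin obtain u where "(\<integral>\<^sup>+y. e2ennreal (c_transform p f y) \<partial>\<nu>) = ennreal u" "0 \<le> u"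
      by (cases "\<integral>\<^sup>+y. e2ennreal (c_transform p f y) \<partial>\<nu>") auto
    then have "ereal_integral \<nu> (c_transform p f) = - \<infinity>"
      unfolding ereal_integral_def inf by (simp add: enn2ereal_top)
    then show False using ge by simp
  qed
  have "(\<integral>\<^sup>+y. e2ennreal \<bar>c_transform p f y\<bar> \<partial>\<nu>) = (\<integral>\<^sup>+y. e2ennreal (c_transform p f y) + e2ennreal (- c_transform p f y) \<partial>\<nu>)"
  proof (intro nn_integral_cong)
    fix y show "e2ennreal \<bar>c_transform p f y\<bar> = e2ennreal (c_transform p f y) + e2ennreal (- c_transform p f y)"
      by (cases "c_transform p f y") (auto simp: abs_if e2ennreal_neg ennreal_neg)
  qed
  also have "\<dots> < \<infinity>" using posfin negfin by (subst nn_integral_add) auto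
  finally show L2: "ereal_L1 \<nu> (c_transform p f)" by (simp add: ereal_L1_def)
  note G = ereal_integral_real[OF L2]
  have "?V \<le> (\<integral>x. real_of_ereal (f x) \<partial>\<mu>) + (\<integral>y. real_of_ereal (c_transform p f y) \<partial>\<nu>)"
    using ge by (simp add: G)
  then show "(\<integral>x. real_of_ereal (f x) \<partial>\<mu>) + (\<integral>y. real_of_ereal (c_transform p f y) \<partial>\<nu>) = ?V"
    using dual_le_transport_value[OF p mu nu F(1,2) G(1,2)] by simp
qed

section \<open>First variation and identification of potentials\<close>

text \<open>
Ties of F and G at a common level strictly between 0 and 1 are the places where the transport value may fail to be
differentiable.
\<close>
definition tie_free :: "(real \<Rightarrow> real) \<Rightarrow> (real \<Rightarrow> real) \<Rightarrow> bool" where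
  "tie_free F G \<longleftrightarrow> (AE z in lborel \<Otimes>\<^sub>M lborel. F (fst z) = G (snd z) \<longrightarrow> F (fst z) = 0 \<or> F (fst z) = 1)"

text \<open>
The derivative at s of the distribution function of g under the perturbation of \<mu> in the direction h.
\<close>
definition score_cdf :: "'a measure \<Rightarrow> ('a \<Rightarrow> real) \<Rightarrow> ('a \<Rightarrow> real) \<Rightarrow> real \<Rightarrow> real" where
  "score_cdf \<mu> h g s = (\<integral>x. step (g x) s * h x \<partial>\<mu>)"

lemma integral_step_eq_measure:
  assumes "prob_space \<mu>" and [measurable]: "g \<in> borel_measurable \<mu>"
  shows "(\<integral>x. step (g x) s \<partial>\<mu>) = measure \<mu> {x \<in> space \<mu>. g x \<le> s}"
proof -
  interpret prob_space \<mu> by fact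
  have "(\<integral>x. step (g x) s \<partial>\<mu>) = (\<integral>x. indicator {x \<in> space \<mu>. g x \<le> s} x \<partial>\<mu>)"
    by (intro Bochner_Integration.integral_cong) (auto simp: step_def)
  then show ?thesis by simp
qed

text \<open>
A centred direction integrates to 0 over events of probability 0 or 1. Therefore ties at the levels 0 and 1 are
harmless.
\<close>
lemma score_cdf_eq_0:
  assumes mu: "prob_space \<mu>" "sets \<mu> = sets borel" and h: "h \<in> tangents \<mu>"
    and [measurable]: "g \<in> borel_measurable borel"
    and F: "(\<integral>x. step (g x) s \<partial>\<mu>) = 0 \<or> (\<integral>x. step (g x) s \<partial>\<mu>) = 1"
  shows "score_cdf \<mu> h g s = 0"
proof -
  interpret prob_space \<mu> by fact
  have [measurable_cong]: "sets \<mu> = sets borel" by fact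
  have [measurable]: "h \<in> borel_measurable borel" using h by (simp add: tangents_def)
  have i: "integrable \<mu> (\<lambda>x. step (g x) s)"
    by (intro integrable_const_bound[where B = 1]) (auto simp: step_def)
  from F show ?thesis
  proof
    assume "(\<integral>x. step (g x) s \<partial>\<mu>) = 0"
    then have "AE x in \<mu>. step (g x) s = 0"
      using i by (subst (asm) integral_nonneg_eq_0_iff_AE) (auto simp: step_def)
    then have "score_cdf \<mu> h g s = (\<integral>x. 0 \<partial>\<mu>)"
      unfolding score_cdf_def by (intro integral_cong_AE) (auto elim: eventually_mono)
    then show ?thesis by simp
  next
    assume 1: "(\<integral>x. step (g x) s \<partial>\<mu>) = 1"
    have "AE x in \<mu>. g x \<le> s"
      using 1 unfolding integral_step_eq_measure[OF mu(1) measurable_cong_sets[OF mu(2) refl, THEN equalityD2, THEN subsetD, OF \<open>g \<in> borel_measurable borel\<close>]]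
      by (simp add: prob_Collect_eq_1)
    then have "score_cdf \<mu> h g s = (\<integral>x. h x \<partial>\<mu>)"
      unfolding score_cdf_def by (intro integral_cong_AE) (auto elim!: eventually_mono simp: step_def)
    then show ?thesis using h by (simp add: tangents_def)
  qed
qed

lemma score_cdf_bounded:
  assumes mu: "prob_space \<mu>" and C: "\<And>x. \<bar>h x\<bar> \<le> C"
  shows "\<bar>score_cdf \<mu> h g s\<bar> \<le> C"
  unfolding score_cdf_def
proof (rule abs_expectation_le[OF mu])
  show "\<bar>step (g x) s * h x\<bar> \<le> C" for x using C[of x] by (auto simp: step_def)
qed

lemma cdf_perturb:
  assumes mu: "real_distribution \<mu>" and h: "h \<in> tangents \<mu>" and C: "\<And>x. \<bar>h x\<bar> \<le> C"
    and t: "0 \<le> t" "t * C \<le> 1"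
  shows "real_distribution (perturb \<mu> t h)"
    and "cdf (perturb \<mu> t h) s = cdf \<mu> s + t * score_cdf \<mu> h (\<lambda>x. x) s"
proof -
  interpret real_distribution \<mu> by fact
  note P = perturb_prob[OF prob_space_axioms _ h C t]
  show rd: "real_distribution (perturb \<mu> t h)"
    using P(1,2) by (auto simp: real_distribution_def real_distribution_axioms_def)
  have i: "integrable \<mu> (\<lambda>x. step x s)"
    by (intro integrable_const_bound[where B = 1]) (auto simp: step_def)
  show "cdf (perturb \<mu> t h) s = cdf \<mu> s + t * score_cdf \<mu> h (\<lambda>x. x) s"
    unfolding cdf_eq_expectation_step[OF rd] cdf_eq_expectation_step[OF real_distribution_axioms] score_cdf_def
    using i by (intro P) auto
qed

lemma borel_measurable_score_cdf:
  assumes "prob_space \<mu>" "sets \<mu> = sets borel" "h \<in> borel_measurable borel"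
    and [measurable]: "(\<lambda>(w, x). g w x) \<in> borel_measurable (N \<Otimes>\<^sub>M borel)" "f \<in> borel_measurable N"
  shows "(\<lambda>w. score_cdf \<mu> h (g w) (f w)) \<in> borel_measurable N"
proof -
  interpret prob_space \<mu> by fact
  have [measurable_cong]: "sets \<mu> = sets borel" by fact
  note [measurable] = assms(3)
  have [measurable]: "(\<lambda>x. g (fst x) (snd x)) \<in> borel_measurable (N \<Otimes>\<^sub>M borel)"
    using assms(4) by (simp add: case_prod_beta')
  show ?thesis
    unfolding score_cdf_def by (rule borel_measurable_lebesgue_integral) (simp add: case_prod_beta')
qed

text \<open>
Distribution functions are affine along perturbations, hence so is the gap. Its slope E vanishes at almost all
ties: at the levels 0 and 1 by score_cdf_eq_0, and there are no others. The slope of the linear part is read off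
from the potentials.
\<close>
lemma value_right_derivative:
  assumes p: "1 < p" and mu: "real_distribution \<mu>" "AE x in \<mu>. \<bar>x\<bar> \<le> R"
    and nu: "real_distribution \<nu>" "AE x in \<nu>. \<bar>x\<bar> \<le> R"
    and tf: "tie_free (cdf \<mu>) (cdf \<nu>)"
    and h: "h1 \<in> tangents \<mu>" "h2 \<in> tangents \<nu>"
  shows "((\<lambda>t. ((\<integral>z. max 0 (gap (cdf (perturb \<mu> t h1)) (cdf (perturb \<nu> t h2)) z) \<partial>box_measure p R)
        - (\<integral>z. max 0 (gap (cdf \<mu>) (cdf \<nu>) z) \<partial>box_measure p R)) / t)
     \<longlongrightarrow> (\<integral>x. pot1 p R (cdf \<mu>) (cdf \<nu>) x * h1 x \<partial>\<mu>) + (\<integral>y. pot2 p R (cdf \<mu>) (cdf \<nu>) y * h2 y \<partial>\<nu>)) (at_right 0)"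
proof -
  let ?B = "box_measure p R"
  let ?F = "cdf \<mu>" and ?G = "cdf \<nu>"
  let ?p1 = "pot1 p R ?F ?G" and ?p2 = "pot2 p R ?F ?G"
  interpret mu: real_distribution \<mu> by fact
  interpret nu: real_distribution \<nu> by fact
  interpret B: finite_measure ?B by (rule finite_measure_box_measure[OF p])
  have [measurable]: "?F \<in> borel_measurable borel" "?G \<in> borel_measurable borel"
    by (rule borel_measurable_cdf mu nu)+
  obtain C1 where C1: "0 < C1" "\<And>x. \<bar>h1 x\<bar> \<le> C1" using tangentsD[OF h(1)] by blast
  obtain C2 where C2: "0 < C2" "\<And>x. \<bar>h2 x\<bar> \<le> C2" using tangentsD[OF h(2)] by blast
  define H1 where "H1 = score_cdf \<mu> h1 (\<lambda>x. x)"
  define H2 where "H2 = score_cdf \<nu> h2 (\<lambda>x. x)"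
  have hm: "h1 \<in> borel_measurable borel" "h2 \<in> borel_measurable borel" using h by (auto simp: tangents_def)
  have id: "(\<lambda>(w :: real, x :: real). x) \<in> borel_measurable (borel \<Otimes>\<^sub>M borel)" by measurable
  have [measurable]: "H1 \<in> borel_measurable borel" "H2 \<in> borel_measurable borel"
    unfolding H1_def H2_def
    by (rule borel_measurable_score_cdf[OF mu.prob_space_axioms _ hm(1) id, of "\<lambda>x. x"], simp_all)
       (rule borel_measurable_score_cdf[OF nu.prob_space_axioms _ hm(2) id, of "\<lambda>x. x"], simp_all)
  define D where "D = gap ?F ?G"
  define E where "E = gap H1 H2"
  have [measurable]: "D \<in> borel_measurable ?B" "E \<in> borel_measurable ?B" unfolding D_def E_def by measurable
  have Db: "\<bar>D z\<bar> \<le> 1" for z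
    unfolding D_def by (rule gap_bounded[OF cdf_within_cdf[OF mu] cdf_within_cdf[OF nu]])
  have Eb: "\<bar>E z\<bar> \<le> C1 + C2" for z
    using abs_gap_diff_le[of H1 H2 z "\<lambda>_. 0" "\<lambda>_. 0"]
      score_cdf_bounded[where h = h1, OF mu.prob_space_axioms C1(2), where g = "\<lambda>x. x" and s = "fst z"]
      score_cdf_bounded[where h = h2, OF nu.prob_space_axioms C2(2), where g = "\<lambda>x. x" and s = "snd z"]
    by (simp add: E_def H1_def H2_def) (simp add: gap_def)
  have nd: "AE z in ?B. D z \<noteq> 0 \<or> E z = 0"
  proof (rule AE_box_measureI)
    show "AE z in lborel \<Otimes>\<^sub>M lborel. D z \<noteq> 0 \<or> E z = 0"
      using tf unfolding tie_free_def
    proof eventually_elim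
      case (elim z)
      show ?case
      proof (cases "D z = 0 \<and> fst z \<noteq> snd z")
        case True
        then have eq: "?F (fst z) = ?G (snd z)" by (auto simp: D_def gap_def sgn_if split: if_splits)
        with elim have "?F (fst z) = 0 \<or> ?F (fst z) = 1" "?G (snd z) = 0 \<or> ?G (snd z) = 1" by auto
        then have "H1 (fst z) = 0" "H2 (snd z) = 0"
          unfolding H1_def H2_def cdf_eq_expectation_step[OF mu(1)] cdf_eq_expectation_step[OF nu(1)]
          by (auto intro!: score_cdf_eq_0 mu.prob_space_axioms nu.prob_space_axioms h)
        then show ?thesis by (simp add: E_def gap_def)
      qed (auto simp: E_def gap_def)
    qed
  qed
  \<comment> \<open>for t \<le> T both perturbed measures are nonnegative\<close>
  define T where "T = 1 / (C1 + C2)"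
  have T: "0 < T" using C1 C2 by (simp add: T_def)
  have tC: "t * C1 \<le> 1" "t * C2 \<le> 1" if "0 \<le> t" "t \<le> T" for t
  proof -
    have "t * C1 \<le> t * (C1 + C2)" "t * C2 \<le> t * (C1 + C2)" using that C1 C2 by (auto intro: mult_left_mono)
    moreover have "t * (C1 + C2) \<le> 1" using that C1 C2 by (simp add: T_def field_simps)
    ultimately show "t * C1 \<le> 1" "t * C2 \<le> 1" by linarith+
  qed
  have gapt: "gap (cdf (perturb \<mu> t h1)) (cdf (perturb \<nu> t h2)) z = D z + t * E z" if "0 \<le> t" "t \<le> T" for t z
    unfolding D_def E_def H1_def H2_def gap_def
    using cdf_perturb(2)[OF mu(1) h(1) C1(2) that(1) tC(1)[OF that]] cdf_perturb(2)[OF nu(1) h(2) C2(2) that(1) tC(2)[OF that]]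
    by (simp add: algebra_simps)
  have FG: "(\<lambda>(w :: real, s). ?F s) \<in> borel_measurable (borel \<Otimes>\<^sub>M borel)"
    "(\<lambda>(w :: real, s). ?G s) \<in> borel_measurable (borel \<Otimes>\<^sub>M borel)"
    unfolding case_prod_beta' by measurable
  have meas [measurable]: "?p1 \<in> borel_measurable borel" "?p2 \<in> borel_measurable borel"
    by (rule measurable_pot[OF p FG, where f = "\<lambda>x. x"], measurable)+
  have ip: "integrable \<mu> ?p1" "integrable \<nu> ?p2"
    using pot_bounded[OF p, of R ?F ?G]
    by (auto intro!: mu.integrable_const_bound[where B = "measure ?B UNIV"] nu.integrable_const_bound[where B = "measure ?B UNIV"])
  have lin: "(\<integral>z. of_bool (0 < D z) * gap (cdf (perturb \<mu> t h1)) (cdf (perturb \<nu> t h2)) z \<partial>?B)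
      = ((\<integral>x. ?p1 x \<partial>\<mu>) + (\<integral>y. ?p2 y \<partial>\<nu>)) + t * ((\<integral>x. ?p1 x * h1 x \<partial>\<mu>) + (\<integral>y. ?p2 y * h2 y \<partial>\<nu>))"
    if t: "0 \<le> t" "t \<le> T" for t
  proof -
    have "(\<integral>z. of_bool (0 < D z) * gap (cdf (perturb \<mu> t h1)) (cdf (perturb \<nu> t h2)) z \<partial>?B)
        = (\<integral>x. ?p1 x \<partial>perturb \<mu> t h1) + (\<integral>y. ?p2 y \<partial>perturb \<nu> t h2)"
      unfolding D_def
      by (intro integral_positive_gap_eq_potentials[OF p cdf_perturb(1)[OF mu(1) h(1) C1(2) t(1) tC(1)[OF t]]
            cdf_perturb(1)[OF nu(1) h(2) C2(2) t(1) tC(2)[OF t]]]) measurable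
    then show ?thesis
      using perturb_prob(4)[OF mu.prob_space_axioms _ h(1) C1(2) t(1) tC(1)[OF t] ip(1)]
        perturb_prob(4)[OF nu.prob_space_axioms _ h(2) C2(2) t(1) tC(2)[OF t] ip(2)]
      by (simp add: algebra_simps)
  qed
  show ?thesis
    unfolding D_def[symmetric]
    by (rule pos_part_path_derivative[OF B.finite_measure_axioms _ _ Db Eb nd T gapt lin]) measurable
qed

lemma tangents_zero: "(\<lambda>_. 0) \<in> tangents \<mu>"
  by (auto simp: tangents_def)

text \<open>
Along a perturbation of the two laws the dual value of f is affine, remains below the transport value by weak
duality and equals it at the start. So in every direction its slope is at most the derivative of the transport
value. That derivative is the pairing of the direction with pot1 and pot2, so the difference of f and pot1
pairs nonpositively with all directions. The same argument applies to the c-transform.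
\<close>
lemma ot_potential_AE_eq:
  assumes p: "1 < p" and mu: "real_distribution \<mu>" "AE x in \<mu>. \<bar>x\<bar> \<le> R"
    and nu: "real_distribution \<nu>" "AE x in \<nu>. \<bar>x\<bar> \<le> R"
    and tf: "tie_free (cdf \<mu>) (cdf \<nu>)" and pot: "ot_potential p \<mu> \<nu> f"
  shows "\<exists>a. AE x in \<mu>. f x = ereal (pot1 p R (cdf \<mu>) (cdf \<nu>) x + a)"
    and "\<exists>b. AE y in \<nu>. c_transform p f y = ereal (pot2 p R (cdf \<mu>) (cdf \<nu>) y + b)"
proof -
  let ?B = "box_measure p R"
  let ?F = "cdf \<mu>" and ?G = "cdf \<nu>"
  let ?p1 = "pot1 p R ?F ?G" and ?p2 = "pot2 p R ?F ?G"
  let ?f = "\<lambda>x. real_of_ereal (f x)" and ?g = "\<lambda>y. real_of_ereal (c_transform p f y)"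
  interpret mu: real_distribution \<mu> by fact
  interpret nu: real_distribution \<nu> by fact
  note L1 = ot_potential_dual_equality(1,2)[OF p mu nu pot]
  note eq = ot_potential_dual_equality(3)[OF p mu nu pot]
  note f = ereal_integral_real(1,2)[OF L1(1)] and g = ereal_integral_real(1,2)[OF L1(2)]
  have [measurable]: "?F \<in> borel_measurable borel" "?G \<in> borel_measurable borel"
    by (rule borel_measurable_cdf mu nu)+
  have FG: "(\<lambda>(w :: real, s). ?F s) \<in> borel_measurable (borel \<Otimes>\<^sub>M borel)"
    "(\<lambda>(w :: real, s). ?G s) \<in> borel_measurable (borel \<Otimes>\<^sub>M borel)"
    unfolding case_prod_beta' by measurable
  have meas [measurable]: "?p1 \<in> borel_measurable borel" "?p2 \<in> borel_measurable borel"
    by (rule measurable_pot[OF p FG, where f = "\<lambda>x. x"], measurable)+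
  have ip: "integrable \<mu> ?p1" "integrable \<nu> ?p2"
    using pot_bounded[OF p, of R ?F ?G]
    by (auto intro!: mu.integrable_const_bound[where B = "measure ?B UNIV"] nu.integrable_const_bound[where B = "measure ?B UNIV"])
  have key: "(\<integral>x. ?f x * h1 x \<partial>\<mu>) + (\<integral>y. ?g y * h2 y \<partial>\<nu>) \<le> (\<integral>x. ?p1 x * h1 x \<partial>\<mu>) + (\<integral>y. ?p2 y * h2 y \<partial>\<nu>)"
    if h: "h1 \<in> tangents \<mu>" "h2 \<in> tangents \<nu>" for h1 h2
  proof (rule tendsto_lowerbound[OF value_right_derivative[OF p mu nu tf h]])
    obtain C1 where C1: "0 < C1" "\<And>x. \<bar>h1 x\<bar> \<le> C1" using tangentsD[OF h(1)] by blast
    obtain C2 where C2: "0 < C2" "\<And>x. \<bar>h2 x\<bar> \<le> C2" using tangentsD[OF h(2)] by blast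
    have "\<forall>\<^sub>F t in at_right 0. t \<in> {0<..<min (1 / C1) (1 / C2)}"
      using C1 C2 by (intro eventually_at_right_real) auto
    then show "\<forall>\<^sub>F t in at_right 0. (\<integral>x. ?f x * h1 x \<partial>\<mu>) + (\<integral>y. ?g y * h2 y \<partial>\<nu>)
       \<le> ((\<integral>z. max 0 (gap (cdf (perturb \<mu> t h1)) (cdf (perturb \<nu> t h2)) z) \<partial>?B) - (\<integral>z. max 0 (gap ?F ?G z) \<partial>?B)) / t"
    proof eventually_elim
      case (elim t)
      then have t: "0 \<le> t" "0 < t" "t * C1 \<le> 1" "t * C2 \<le> 1" using C1 C2 by (auto simp: field_simps)
      note P1 = perturb_prob[OF mu.prob_space_axioms _ h(1) C1(2) t(1,3)]
      note P2 = perturb_prob[OF nu.prob_space_axioms _ h(2) C2(2) t(1,4)]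
      have "(\<integral>x. ?f x \<partial>perturb \<mu> t h1) + (\<integral>y. ?g y \<partial>perturb \<nu> t h2)
        \<le> (\<integral>z. max 0 (gap (cdf (perturb \<mu> t h1)) (cdf (perturb \<nu> t h2)) z) \<partial>?B)"
        using mu nu f g
        by (intro dual_le_transport_value[OF p] cdf_perturb(1)[OF mu(1) h(1) C1(2) t(1,3)]
            cdf_perturb(1)[OF nu(1) h(2) C2(2) t(1,4)] P1 P2) auto
      also have "(\<integral>x. ?f x \<partial>perturb \<mu> t h1) = (\<integral>x. ?f x \<partial>\<mu>) + t * (\<integral>x. ?f x * h1 x \<partial>\<mu>)"
        using f by (intro P1) auto
      also have "(\<integral>x. ?g x \<partial>perturb \<nu> t h2) = (\<integral>x. ?g x \<partial>\<nu>) + t * (\<integral>x. ?g x * h2 x \<partial>\<nu>)"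
        using g by (intro P2) auto
      finally show ?case using eq t by (simp add: field_simps)
    qed
  qed simp
  have d1: "(\<integral>x. (?f x - ?p1 x) * h x \<partial>\<mu>) \<le> 0" if h: "h \<in> tangents \<mu>" for h
  proof -
    obtain C1 where C1: "0 < C1" "\<And>x. \<bar>h x\<bar> \<le> C1" using tangentsD[OF h(1)] by blast
    have [measurable]: "h \<in> borel_measurable borel" using h by (simp add: tangents_def)
    have "integrable \<mu> (\<lambda>x. q x * h x)" if "integrable \<mu> q" for q
      by (rule integrable_mult_bounded[OF that _ C1(2)]) measurable
    then show ?thesis using key[OF h tangents_zero] f(2) ip(1) by (simp add: left_diff_distrib)
  qed
  have d2: "(\<integral>x. (?g x - ?p2 x) * h x \<partial>\<nu>) \<le> 0" if h: "h \<in> tangents \<nu>" for h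
  proof -
    obtain C1 where C1: "0 < C1" "\<And>x. \<bar>h x\<bar> \<le> C1" using tangentsD[OF h(1)] by blast
    have [measurable]: "h \<in> borel_measurable borel" using h by (simp add: tangents_def)
    have "integrable \<nu> (\<lambda>x. q x * h x)" if "integrable \<nu> q" for q
      by (rule integrable_mult_bounded[OF that _ C1(2)]) measurable
    then show ?thesis using key[OF tangents_zero h] g(2) ip(2) by (simp add: left_diff_distrib)
  qed
  have "AE x in \<mu>. ?f x - ?p1 x = (\<integral>x. ?f x - ?p1 x \<partial>\<mu>)"
    using f(2) ip(1) by (intro AE_eq_const_if_orthogonal_tangents mu.prob_space_axioms d1) auto
  then have "AE x in \<mu>. f x = ereal (?p1 x + (\<integral>x. ?f x - ?p1 x \<partial>\<mu>))"
    using f(1)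
  proof eventually_elim
    case (elim x)
    then show ?case by (cases "f x") auto
  qed
  then show "\<exists>a. AE x in \<mu>. f x = ereal (?p1 x + a)" by blast
  have "AE x in \<nu>. ?g x - ?p2 x = (\<integral>x. ?g x - ?p2 x \<partial>\<nu>)"
    using g(2) ip(2) by (intro AE_eq_const_if_orthogonal_tangents nu.prob_space_axioms d2) auto
  then have "AE x in \<nu>. c_transform p f x = ereal (?p2 x + (\<integral>x. ?g x - ?p2 x \<partial>\<nu>))"
    using g(1)
  proof eventually_elim
    case (elim x)
    then show ?case by (cases "c_transform p f x") auto
  qed
  then show "\<exists>b. AE y in \<nu>. c_transform p f y = ereal (?p2 y + b)" by blast
qed

section \<open>Uniqueness of potentials\<close>

text \<open>
At distance u the cost grows at a rate of at least u^(q - 1), which tends to infinity with u as q > 1.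
\<close>
lemma powr_add_ge:
  fixes u v q :: real
  assumes q: "1 < q" and u: "0 \<le> u" and v: "0 \<le> v"
  shows "u powr q + v * u powr (q - 1) \<le> (u + v) powr q"
proof -
  have e: "w powr q = w * w powr (q - 1)" if "0 \<le> w" for w :: real
    using that powr_mult_base[of w "q - 1"] by simp
  have "u powr q + v * u powr (q - 1) = (u + v) * u powr (q - 1)"
    using u by (simp add: e[OF u] distrib_right)
  also have "\<dots> \<le> (u + v) * (u + v) powr (q - 1)"
    using q u v by (intro mult_left_mono powr_mono2) auto
  also have "\<dots> = (u + v) powr q" using u v by (simp add: e)
  finally show ?thesis .
qed

text \<open>
The infimum at x is nearly attained only at points y of a fixed bounded interval. Indeed, if y is far to the left of
a, then the cost from x > a to y exceeds the cost from a to y by an arbitrarily large amount, while the finite value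
at a bounds the latter minus g y from below; points far to the right are excluded by the value at b. On the bounded
interval the cost is uniformly continuous, and this passes to the infimum.
\<close>
lemma c_transform_continuous_between:
  fixes g :: "real \<Rightarrow> ereal"
  assumes p: "1 < p" and g: "\<And>y. g y \<noteq> \<infinity>"
    and fin: "\<bar>c_transform p g a\<bar> \<noteq> \<infinity>" "\<bar>c_transform p g b\<bar> \<noteq> \<infinity>" and x0: "a < x0" "x0 < b"
  shows "\<bar>c_transform p g x0\<bar> \<noteq> \<infinity>" and "isCont (\<lambda>x. real_of_ereal (c_transform p g x)) x0"
proof -
  let ?f = "c_transform p g"
  define Y where "Y x y = \<bar>y - x\<bar> powr p" for x y :: real
  obtain \<alpha> where \<alpha>: "?f a = ereal \<alpha>" using fin(1) by (cases "?f a") auto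
  obtain \<beta> where \<beta>: "?f b = ereal \<beta>" using fin(2) by (cases "?f b") auto
  have le: "?f x \<le> ereal (Y x y - r)" if "g y = ereal r" for x y r
    using c_transform_le[of p g x y] that by (simp add: Y_def)
  have ge: "ereal c \<le> ?f x" if "\<And>y r. g y = ereal r \<Longrightarrow> c \<le> Y x y - r" for c x
    unfolding c_transform_def
  proof (rule INF_greatest)
    fix y show "ereal c \<le> ereal (norm (y - x) powr p) - g y"
      using that[of y] g[of y] by (cases "g y") (auto simp: Y_def)
  qed
  have "\<exists>y r. g y = ereal r"
  proof (rule ccontr)
    assume no: "\<nexists>y r. g y = ereal r"
    have "ereal (\<alpha> + 1) \<le> ?f a" by (rule ge) (use no in auto)
    then show False by (simp add: \<alpha>)
  qed
  then obtain y0 r0 where r0: "g y0 = ereal r0" by blast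
  \<comment> \<open>an upper bound for the infimum on all of [a, b], from a single point where g is finite\<close>
  define M where "M = (\<bar>y0\<bar> + \<bar>a\<bar> + \<bar>b\<bar>) powr p - r0"
  have M: "?f x \<le> ereal M" if "a \<le> x" "x \<le> b" for x
  proof -
    have "Y x y0 \<le> (\<bar>y0\<bar> + \<bar>a\<bar> + \<bar>b\<bar>) powr p"
      unfolding Y_def using that p by (intro powr_mono2) auto
    then have "ereal (Y x y0 - r0) \<le> ereal M" by (simp add: M_def)
    with le[OF r0] show ?thesis by (rule order_trans)
  qed
  define e where "e = min (x0 - a) (b - x0) / 2"
  have "0 < e" "2 * e \<le> x0 - a" "2 * e \<le> b - x0" using x0 by (auto simp: e_def)
  then have e: "0 < e" "\<And>x. \<bar>x - x0\<bar> \<le> e \<Longrightarrow> a + e \<le> x \<and> x \<le> b - e"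
    unfolding abs_le_iff by (simp, linarith)
  define N where "N = \<bar>M\<bar> + 1 + \<bar>\<alpha>\<bar> + \<bar>\<beta>\<bar>"
  \<comment> \<open>at distance at least K from a or b the additional cost e u^(p - 1) exceeds N\<close>
  define K where "K = (N / e) powr (1 / (p - 1))"
  have K: "N \<le> e * u powr (p - 1)" if "K \<le> u" for u
  proof -
    have "N / e = K powr (p - 1)" using p e by (simp add: K_def powr_powr N_def)
    also have "\<dots> \<le> u powr (p - 1)" using that p by (intro powr_mono2) (auto simp: K_def)
    finally show ?thesis using e by (simp add: field_simps)
  qed
  have K0: "0 \<le> K" by (simp add: K_def)
  have lo: "\<alpha> \<le> Y a y - r" "\<beta> \<le> Y b y - r" if "g y = ereal r" for y r
    using le[OF that, of a] le[OF that, of b] by (auto simp: \<alpha> \<beta>)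
  have far: "a - K < y \<and> y < b + K" if r: "g y = ereal r" and x: "\<bar>x - x0\<bar> \<le> e" and small: "Y x y - r < M + 1" for x y r
  proof (rule ccontr)
    assume "\<not> ?thesis"
    then consider "y \<le> a - K" | "b + K \<le> y" by linarith
    then show False
    proof cases
      case 1
      have "Y a y + (x - a) * (a - y) powr (p - 1) \<le> Y x y"
        using powr_add_ge[OF p, of "a - y" "x - a"] 1 K0 e(2)[OF x] e(1) by (simp add: Y_def abs_minus_commute)
      moreover have "e * (a - y) powr (p - 1) \<le> (x - a) * (a - y) powr (p - 1)"
        using e(2)[OF x] by (intro mult_right_mono) auto
      moreover have "N \<le> e * (a - y) powr (p - 1)" using 1 by (intro K) auto
      ultimately show False using lo(1)[OF r] small unfolding N_def by linarith
    next
      case 2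
      have "Y b y + (b - x) * (y - b) powr (p - 1) \<le> Y x y"
        using powr_add_ge[OF p, of "y - b" "b - x"] 2 K0 e(2)[OF x] e(1) by (simp add: Y_def)
      moreover have "e * (y - b) powr (p - 1) \<le> (b - x) * (y - b) powr (p - 1)"
        using e(2)[OF x] by (intro mult_right_mono) auto
      moreover have "N \<le> e * (y - b) powr (p - 1)" using 2 by (intro K) auto
      ultimately show False using lo(2)[OF r] small unfolding N_def by linarith
    qed
  qed
  have real: "\<exists>r. ?f x = ereal r \<and> r \<le> M" if x: "\<bar>x - x0\<bar> \<le> e" for x
  proof -
    define L where "L = min (M + 1) (\<alpha> - (\<bar>a\<bar> + \<bar>a - K\<bar> + \<bar>b + K\<bar>) powr p)"
    have "ereal L \<le> ?f x"
    proof (rule ge, unfold L_def)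
      fix y r assume r: "g y = ereal r"
      show "min (M + 1) (\<alpha> - (\<bar>a\<bar> + \<bar>a - K\<bar> + \<bar>b + K\<bar>) powr p) \<le> Y x y - r"
      proof (cases "Y x y - r < M + 1")
        case True
        with far[OF r x] have "a - K < y" "y < b + K" by auto
        then have "Y a y \<le> (\<bar>a\<bar> + \<bar>a - K\<bar> + \<bar>b + K\<bar>) powr p"
          unfolding Y_def using p by (intro powr_mono2) auto
        moreover have "0 \<le> Y x y" by (simp add: Y_def)
        ultimately show ?thesis using lo(1)[OF r] by linarith
      qed auto
    qed
    moreover have "?f x \<le> ereal M" using e(2)[OF x] e(1) by (intro M) auto
    ultimately show ?thesis by (cases "?f x") auto
  qed
  from real[of x0] e show "\<bar>?f x0\<bar> \<noteq> \<infinity>" by auto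
  \<comment> \<open>a point that is nearly optimal for x is a competitor for every nearby point\<close>
  have step: "real_of_ereal (?f x') \<le> real_of_ereal (?f x) + 2 * \<epsilon>"
    if x: "\<bar>x - x0\<bar> \<le> e" and x': "\<bar>x' - x0\<bar> \<le> e" and \<epsilon>: "0 < \<epsilon>" "\<epsilon> < 1"
      and uc: "\<And>y. y \<in> {a - K..b + K} \<Longrightarrow> \<bar>Y x' y - Y x y\<bar> < \<epsilon>" for x x' \<epsilon>
  proof -
    obtain r where r: "?f x = ereal r" "r \<le> M" using real[OF x] by blast
    obtain r' where r': "?f x' = ereal r'" using real[OF x'] by blast
    have "?f x < ereal (r + \<epsilon>)" using \<epsilon> by (simp add: r)
    then obtain y where "ereal (norm (y - x) powr p) - g y < ereal (r + \<epsilon>)"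
      unfolding c_transform_def INF_less_iff by blast
    then obtain s where s: "g y = ereal s" "Y x y - s < r + \<epsilon>"
      using g[of y] by (cases "g y") (auto simp: Y_def)
    then have "y \<in> {a - K..b + K}" using far[OF s(1) x] r(2) \<epsilon> by auto
    then have "\<bar>Y x' y - Y x y\<bar> < \<epsilon>" by (rule uc)
    moreover have "r' \<le> Y x' y - s" using le[OF s(1), of x'] by (simp add: r')
    ultimately show ?thesis using s(2) by (simp add: r r')
  qed
  have "continuous_on ({x0 - e..x0 + e} \<times> {a - K..b + K}) (\<lambda>(x, y). Y x y)"
    unfolding Y_def case_prod_beta' using p by (intro continuous_on_powr' continuous_intros) auto
  then have uc: "uniformly_continuous_on ({x0 - e..x0 + e} \<times> {a - K..b + K}) (\<lambda>(x, y). Y x y)"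
    by (intro compact_uniformly_continuous compact_Times) auto
  show "isCont (\<lambda>x. real_of_ereal (?f x)) x0"
    unfolding continuous_at_eps_delta
  proof (intro allI impI)
    fix \<epsilon>0 :: real assume \<epsilon>0: "0 < \<epsilon>0"
    define \<epsilon> where "\<epsilon> = min \<epsilon>0 1 / 3"
    have \<epsilon>: "0 < \<epsilon>" "\<epsilon> < 1" "2 * \<epsilon> < \<epsilon>0" using \<epsilon>0 by (auto simp: \<epsilon>_def)
    obtain \<delta> where \<delta>: "0 < \<delta>" "\<And>z z'. z \<in> {x0 - e..x0 + e} \<times> {a - K..b + K} \<Longrightarrow> z' \<in> {x0 - e..x0 + e} \<times> {a - K..b + K} \<Longrightarrow>
        dist z' z < \<delta> \<Longrightarrow> dist (case z' of (x, y) \<Rightarrow> Y x y) (case z of (x, y) \<Rightarrow> Y x y) < \<epsilon>"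
      using uc \<epsilon>(1) unfolding uniformly_continuous_on_def by blast
    show "\<exists>d>0. \<forall>x. dist x x0 < d \<longrightarrow> dist (real_of_ereal (?f x)) (real_of_ereal (?f x0)) < \<epsilon>0"
    proof (intro exI[of _ "min \<delta> e"] conjI allI impI)
      fix x assume "dist x x0 < min \<delta> e"
      then have x: "\<bar>x - x0\<bar> \<le> e" "\<bar>x - x0\<bar> < \<delta>" by (auto simp: dist_real_def)
      have x0': "\<bar>x0 - x0\<bar> \<le> e" using e by simp
      have d: "\<bar>Y x y - Y x0 y\<bar> < \<epsilon>" if "y \<in> {a - K..b + K}" for y
        using \<delta>(2)[of "(x0, y)" "(x, y)"] x x0' that by (auto simp: dist_Pair_Pair dist_real_def abs_le_iff)
      have "real_of_ereal (?f x) \<le> real_of_ereal (?f x0) + 2 * \<epsilon>"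
        by (rule step[OF x0' x(1) \<epsilon>(1,2) d])
      moreover have "real_of_ereal (?f x0) \<le> real_of_ereal (?f x) + 2 * \<epsilon>"
        by (rule step[OF x(1) x0' \<epsilon>(1,2)]) (use d in \<open>simp add: abs_minus_commute\<close>)
      ultimately show "dist (real_of_ereal (?f x)) (real_of_ereal (?f x0)) < \<epsilon>0"
        using \<epsilon> by (simp add: dist_real_def abs_less_iff)
    qed (use \<delta> e in auto)
  qed
qed

lemma AE_point_in_open:
  assumes "open U" "x \<in> U" "x \<in> spt \<mu>" "sets \<mu> = sets borel" "AE x in \<mu>. P x"
  obtains y where "y \<in> U" "P y"
proof -
  have "0 < emeasure \<mu> U" using assms by (auto simp: spt_def)
  moreover have "emeasure \<mu> U = 0" if "\<And>y. y \<in> U \<Longrightarrow> \<not> P y"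
  proof -
    have "AE x in \<mu>. x \<notin> U" using assms(5) by (rule eventually_mono) (use that in blast)
    then show ?thesis using assms(1,4) by (subst (asm) AE_iff_measurable[of U]) (auto dest: sets_eq_imp_space_eq)
  qed
  ultimately show ?thesis using that by (metis less_irrefl)
qed

text \<open>
Almost everywhere the two potentials differ by a constant. Every neighbourhood of an interior point of the support
contains such points on both sides, so there both potentials are finite and continuous, and the difference is
constant by continuity.
\<close>
lemma ot_potential_unique:
  assumes p: "1 < p" and mu: "real_distribution \<mu>" "AE x in \<mu>. \<bar>x\<bar> \<le> R"
    and nu: "real_distribution \<nu>" "AE x in \<nu>. \<bar>x\<bar> \<le> R"
    and tf: "tie_free (cdf \<mu>) (cdf \<nu>)" and pot: "ot_potential p \<mu> \<nu> f" "ot_potential p \<mu> \<nu> g"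
  shows "\<exists>a::real. \<forall>s\<in>interior (spt \<mu>). f s = g s + ereal a"
proof -
  interpret mu: real_distribution \<mu> by fact
  let ?p1 = "pot1 p R (cdf \<mu>) (cdf \<nu>)"
  obtain a where a: "AE x in \<mu>. f x = ereal (?p1 x + a)"
    using ot_potential_AE_eq(1)[OF p mu nu tf pot(1)] by blast
  obtain b where b: "AE x in \<mu>. g x = ereal (?p1 x + b)"
    using ot_potential_AE_eq(1)[OF p mu nu tf pot(2)] by blast
  define good where "good x \<longleftrightarrow> \<bar>f x\<bar> \<noteq> \<infinity> \<and> \<bar>g x\<bar> \<noteq> \<infinity> \<and> real_of_ereal (f x) = real_of_ereal (g x) + (a - b)" for x
  have good: "AE x in \<mu>. good x"
    using a b by eventually_elim (auto simp: good_def)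
  obtain f' where f': "\<And>y. f' y \<noteq> \<infinity>" "f = c_transform p f'"
    using pot(1) by (auto simp: ot_potential_def c_concave_def)
  obtain g' where g': "\<And>y. g' y \<noteq> \<infinity>" "g = c_transform p g'"
    using pot(2) by (auto simp: ot_potential_def c_concave_def)
  have "f s = g s + ereal (a - b)" if "s \<in> interior (spt \<mu>)" for s
  proof -
    from that have "\<exists>e>0. ball s e \<subseteq> spt \<mu>" by (rule mem_interior[THEN iffD1])
    then obtain e where e: "0 < e" "ball s e \<subseteq> spt \<mu>" by (elim exE conjE)
    have pt: "\<exists>y. u < y \<and> y < v \<and> good y" if "s - e < u" "u < v" "v < s + e" for u v
    proof -
      have "u < (u + v) / 2" "(u + v) / 2 < v" using that(2) by simp_all
      with that(1,3) have "s - (u + v) / 2 < e" "(u + v) / 2 - s < e" by linarith+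
      then have "\<bar>s - (u + v) / 2\<bar> < e" by (simp only: abs_less_iff minus_diff_eq)
      then have "(u + v) / 2 \<in> ball s e" by (simp only: mem_ball dist_real_def)
      with e have "(u + v) / 2 \<in> spt \<mu>" by blast
      moreover have "open {u<..<v}" "(u + v) / 2 \<in> {u<..<v}" using that by auto
      ultimately obtain y where "y \<in> {u<..<v}" "good y"
        using AE_point_in_open[OF _ _ _ mu.events_eq_borel good] by blast
      then show ?thesis by auto
    qed
    obtain u where u: "u < s" "good u" using pt[of "s - e / 2" s] e by auto
    obtain v where v: "s < v" "good v" using pt[of s "s + e / 2"] e by auto
    have F: "\<bar>f s\<bar> \<noteq> \<infinity>" "isCont (\<lambda>x. real_of_ereal (f x)) s"
      using c_transform_continuous_between[where g = f', OF p f'(1), of u v s] u v by (auto simp: f'(2)[symmetric] good_def)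
    have G: "\<bar>g s\<bar> \<noteq> \<infinity>" "isCont (\<lambda>x. real_of_ereal (g x)) s"
      using c_transform_continuous_between[where g = g', OF p g'(1), of u v s] u v by (auto simp: g'(2)[symmetric] good_def)
    define d where "d x = real_of_ereal (f x) - real_of_ereal (g x) - (a - b)" for x
    have d: "isCont d s" unfolding d_def by (intro continuous_intros F G)
    have "d s = 0"
    proof (rule ccontr)
      assume "d s \<noteq> 0"
      then obtain \<delta> where \<delta>: "0 < \<delta>" "\<And>x. dist x s < \<delta> \<Longrightarrow> dist (d x) (d s) < \<bar>d s\<bar>"
        using d unfolding continuous_at_eps_delta by (metis zero_less_abs_iff)
      define m where "m = min \<delta> e / 2"
      have m: "0 < m" "m < e" "m < \<delta>" using e \<delta>(1) by (auto simp: m_def)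
      obtain y where "s < y" "y < s + m" "good y"
        using pt[of s "s + m"] e m by auto
      then have "d y = 0" "dist y s < \<delta>" using m by (auto simp: good_def d_def dist_real_def)
      then show False using \<delta>(2)[of y] by (simp add: dist_real_def)
    qed
    then show ?thesis using F(1) G(1) by (cases "f s"; cases "g s") (auto simp: d_def)
  qed
  then show ?thesis by blast
qed

section \<open>Supports and one-dimensional projections\<close>

text \<open>
The complement of the support is a union of countably many null sets of a countable basis.
\<close>
lemma AE_in_spt:
  fixes \<mu> :: "'a::euclidean_space measure"
  assumes s: "sets \<mu> = sets borel"
  shows "AE x in \<mu>. x \<in> spt \<mu>"
proof -
  obtain B :: "'a set set" where B: "countable B" "topological_basis B" using ex_countable_basis by blast
  define N where "N = \<Union>{U \<in> B. emeasure \<mu> U = 0}"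
  have "N \<in> null_sets \<mu>"
    unfolding N_def using B s topological_basis_open[OF B(2)]
    by (intro null_sets_UN'[of _ "\<lambda>x. x", simplified] countable_subset[OF _ B(1)]) (auto simp: null_sets_def)
  moreover have "{x \<in> space \<mu>. x \<notin> spt \<mu>} \<subseteq> N"
  proof
    fix x assume "x \<in> {x \<in> space \<mu>. x \<notin> spt \<mu>}"
    then obtain U where U: "open U" "x \<in> U" "emeasure \<mu> U = 0" by (auto simp: spt_def zero_less_iff_neq_zero)
    obtain V where V: "V \<in> B" "x \<in> V" "V \<subseteq> U" using topological_basisE[OF B(2) U(1,2)] by blast
    have "emeasure \<mu> V \<le> emeasure \<mu> U" using V U(1) s by (intro emeasure_mono) auto
    then show "x \<in> N" using V U by (auto simp: N_def)
  qed
  ultimately show ?thesis by (rule AE_I')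
qed

lemma real_distribution_proj_law:
  assumes "prob_space \<mu>" "sets \<mu> = sets borel"
  shows "real_distribution (proj_law \<theta> \<mu>)"
proof -
  interpret prob_space \<mu> by fact
  have [measurable_cong]: "sets \<mu> = sets borel" by fact
  show ?thesis
    unfolding proj_law_def real_distribution_def real_distribution_axioms_def
    by (auto intro!: prob_space_distr)
qed

lemma AE_proj_law_bounded:
  fixes \<mu> :: "'a::euclidean_space measure"
  assumes "sets \<mu> = sets borel" and R: "AE x in \<mu>. norm x \<le> R" and \<theta>: "\<theta> \<in> sphere 0 1"
  shows "AE s in proj_law \<theta> \<mu>. \<bar>s\<bar> \<le> R"
proof -
  have [measurable_cong]: "sets \<mu> = sets borel" by fact
  have "\<bar>\<theta> \<bullet> x\<bar> \<le> norm x" for x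
    using Cauchy_Schwarz_ineq2[of \<theta> x] \<theta> by simp
  then have "AE x in \<mu>. \<bar>\<theta> \<bullet> x\<bar> \<le> R" using R by (auto elim!: eventually_mono intro: order_trans)
  then show ?thesis unfolding proj_law_def by (subst AE_distr_iff) auto
qed

lemma cdf_proj_law:
  assumes "prob_space \<mu>" "sets \<mu> = sets borel"
  shows "cdf (proj_law \<theta> \<mu>) s = (\<integral>x. step (\<theta> \<bullet> x) s \<partial>\<mu>)"
    and "cdf (proj_law \<theta> \<mu>) s = measure \<mu> {x. \<theta> \<bullet> x \<le> s}"
proof -
  have [measurable_cong]: "sets \<mu> = sets borel" by fact
  have sp: "space \<mu> = UNIV" using sets_eq_imp_space_eq[OF assms(2)] by simp
  show 1: "cdf (proj_law \<theta> \<mu>) s = (\<integral>x. step (\<theta> \<bullet> x) s \<partial>\<mu>)"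
    unfolding cdf_eq_expectation_step[OF real_distribution_proj_law[OF assms]] unfolding proj_law_def
    by (subst integral_distr) auto
  show "cdf (proj_law \<theta> \<mu>) s = measure \<mu> {x. \<theta> \<bullet> x \<le> s}"
    unfolding 1 by (subst integral_step_eq_measure[OF assms(1)]) (auto simp: sp)
qed

text \<open>
If the distribution function took the same value in (0, 1) at s < s', the open slab s < \<theta> \<bullet> x < s' would be null,
with support points on both of its sides. By convexity there would be a support point inside the slab.
\<close>
lemma cdf_proj_law_injective:
  fixes \<mu> :: "'a::euclidean_space measure"
  assumes mu: "prob_space \<mu>" "sets \<mu> = sets borel" and conv: "convex (spt \<mu>)"
    and st: "s < s'" and eq: "cdf (proj_law \<theta> \<mu>) s = cdf (proj_law \<theta> \<mu>) s'"
  shows "cdf (proj_law \<theta> \<mu>) s = 0 \<or> cdf (proj_law \<theta> \<mu>) s = 1"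
proof (rule ccontr)
  assume neg: "\<not> ?thesis"
  interpret prob_space \<mu> by fact
  have [measurable_cong, simp]: "sets \<mu> = sets borel" by fact
  have sp: "space \<mu> = UNIV" using sets_eq_imp_space_eq[OF mu(2)] by simp
  let ?A = "\<lambda>s. {x. \<theta> \<bullet> x \<le> s}"
  have meas: "?A s \<in> sets \<mu>" for s by simp
  have e: "prob (?A s) = prob (?A s')" "prob (?A s) \<noteq> 0" "prob (?A s) \<noteq> 1"
    using neg eq by (auto simp: cdf_proj_law(2)[OF mu])
  have slab: "prob {x. s < \<theta> \<bullet> x \<and> \<theta> \<bullet> x < s'} = 0"
  proof -
    have "prob {x. s < \<theta> \<bullet> x \<and> \<theta> \<bullet> x < s'} \<le> prob (?A s' - ?A s)"
      by (intro finite_measure_mono) auto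
    also have "\<dots> = 0" using st e by (subst finite_measure_Diff) auto
    finally show ?thesis using measure_nonneg[of \<mu>] by (metis order_antisym)
  qed
  have spt_pt: "\<exists>x\<in>spt \<mu>. P x" if "\<not> (AE x in \<mu>. \<not> P x)" for P
  proof (rule ccontr)
    assume "\<not> (\<exists>x\<in>spt \<mu>. P x)"
    then have "AE x in \<mu>. \<not> P x" using AE_in_spt[OF mu(2)] by (auto elim!: eventually_mono)
    with that show False by simp
  qed
  obtain x0 where x0: "x0 \<in> spt \<mu>" "\<theta> \<bullet> x0 \<le> s"
    using spt_pt[of "\<lambda>x. \<theta> \<bullet> x \<le> s"] e(2) prob_eq_0[OF meas[of s]] by auto
  obtain x1 where x1: "x1 \<in> spt \<mu>" "s' < \<theta> \<bullet> x1"
    using spt_pt[of "\<lambda>x. s' < \<theta> \<bullet> x"] e(1,3) prob_eq_1[OF meas[of s']] by (auto simp: not_less)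
  define u where "u = ((s + s') / 2 - \<theta> \<bullet> x0) / (\<theta> \<bullet> x1 - \<theta> \<bullet> x0)"
  have u: "0 \<le> u" "u \<le> 1" using x0 x1 st by (auto simp: u_def field_simps)
  define z where "z = (1 - u) *\<^sub>R x0 + u *\<^sub>R x1"
  have "z \<in> spt \<mu>" unfolding z_def using conv x0 x1 u by (auto simp: convex_alt)
  moreover have "\<theta> \<bullet> z = \<theta> \<bullet> x0 + u * (\<theta> \<bullet> x1 - \<theta> \<bullet> x0)"
    by (simp add: z_def inner_add_right algebra_simps)
  then have "\<theta> \<bullet> z = (s + s') / 2" using x0 x1 st by (simp add: u_def)
  then have "z \<in> {x. s < \<theta> \<bullet> x \<and> \<theta> \<bullet> x < s'}" using st by (simp add: field_simps)
  moreover have "open {x. s < \<theta> \<bullet> x \<and> \<theta> \<bullet> x < s'}"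
    by (intro open_Collect_conj open_Collect_less continuous_intros)
  ultimately have "0 < emeasure \<mu> {x. s < \<theta> \<bullet> x \<and> \<theta> \<bullet> x < s'}" by (auto simp: spt_def)
  then show False using slab by (simp add: emeasure_eq_measure)
qed

text \<open>
For fixed t at most one s has F s = G t at a level strictly between 0 and 1. Single points are null, and Fubini
finishes the argument.
\<close>
lemma tie_freeI:
  assumes [measurable]: "F \<in> borel_measurable borel" "G \<in> borel_measurable borel"
    and inj: "\<And>s s'. s < s' \<Longrightarrow> F s = F s' \<Longrightarrow> F s = 0 \<or> F s = 1"
  shows "tie_free F G"
proof -
  have "AE s in lborel. F s = G t \<longrightarrow> F s = 0 \<or> F s = 1" for t
  proof (cases "\<exists>s. F s = G t \<and> F s \<noteq> 0 \<and> F s \<noteq> 1")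
    case True
    then obtain s where s: "F s = G t" "F s \<noteq> 0" "F s \<noteq> 1" by blast
    show ?thesis
    proof (rule eventually_mono[OF AE_lborel_singleton[of s]], rule impI)
      fix s' assume "s' \<noteq> s" "F s' = G t"
      then show "F s' = 0 \<or> F s' = 1" using inj[of s s'] inj[of s' s] s by (cases "s < s'") auto
    qed
  qed auto
  then have "AE t in lborel. AE s in lborel. F s = G t \<longrightarrow> F s = 0 \<or> F s = 1" by simp
  moreover have meas: "{z \<in> space (lborel \<Otimes>\<^sub>M lborel). F (fst z) = G (snd z) \<longrightarrow> F (fst z) = 0 \<or> F (fst z) = 1}
      \<in> sets (lborel \<Otimes>\<^sub>M lborel)"
    by measurable
  ultimately have "AE s in lborel. AE t in lborel. F s = G t \<longrightarrow> F s = 0 \<or> F s = 1"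
    using lborel_pair.AE_commute[OF meas] by blast
  then show ?thesis
    unfolding tie_free_def using meas by (intro lborel_pair.AE_pair_measure) simp_all
qed

lemma tie_free_proj_law:
  fixes \<mu> \<nu> :: "'a::euclidean_space measure"
  assumes mu: "prob_space \<mu>" "sets \<mu> = sets borel" "convex (spt \<mu>)" and nu: "prob_space \<nu>" "sets \<nu> = sets borel"
  shows "tie_free (cdf (proj_law \<theta> \<mu>)) (cdf (proj_law \<theta> \<nu>))"
  using cdf_proj_law_injective[OF mu, of _ _ \<theta>]
  by (intro tie_freeI borel_measurable_cdf real_distribution_proj_law mu nu) auto

lemma compact_spt_bounded:
  fixes \<mu> :: "'a::euclidean_space measure"
  assumes "sets \<mu> = sets borel" "compact (spt \<mu>)"
  obtains R where "0 < R" "AE x in \<mu>. norm x \<le> R"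
proof -
  obtain R where "0 < R" "\<And>x. x \<in> spt \<mu> \<Longrightarrow> norm x \<le> R"
    using compact_imp_bounded[OF assms(2)] unfolding bounded_pos by blast
  then show ?thesis using AE_in_spt[OF assms(1)] by (intro that[of R]) (auto elim: eventually_mono)
qed

section \<open>The sliced functional\<close>

interpretation sphere: prob_space "sphere_unif :: 'a::euclidean_space measure"
  by (rule prob_space_sphere_unif)

lemma measurable_sphere_unif: "(\<lambda>\<theta>. \<theta>) \<in> borel_measurable (sphere_unif :: 'a::euclidean_space measure)"
  unfolding sphere_unif_def by (rule measurable_restrict_space1) simp

definition slice_measure :: "real \<Rightarrow> real \<Rightarrow> ('a::euclidean_space \<times> real \<times> real) measure" where
  "slice_measure p R = sphere_unif \<Otimes>\<^sub>M box_measure p R"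

text \<open>
For fixed direction and thresholds this is affine in \<mu> and in \<nu>.
\<close>
definition slice_gap :: "'a::euclidean_space measure \<Rightarrow> 'a measure \<Rightarrow> 'a \<times> real \<times> real \<Rightarrow> real" where
  "slice_gap \<mu> \<nu> w = gap (cdf (proj_law (fst w) \<mu>)) (cdf (proj_law (fst w) \<nu>)) (snd w)"

lemma sets_slice_measure [measurable_cong]: "sets (slice_measure p R) = sets (sphere_unif \<Otimes>\<^sub>M (borel \<Otimes>\<^sub>M borel))"
  unfolding slice_measure_def by (intro sets_pair_measure_cong) auto

lemma finite_measure_slice_measure: "1 < p \<Longrightarrow> finite_measure (slice_measure p R)"
  unfolding slice_measure_def
  by (intro finite_measure_pair_measure finite_measure_box_measure sphere.finite_measure_axioms)

lemma measurable_slice_direction [measurable]: "fst \<in> borel_measurable (slice_measure p R)"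
proof -
  have "(\<lambda>w. fst w) \<in> slice_measure p R \<rightarrow>\<^sub>M sphere_unif" unfolding slice_measure_def by measurable
  from measurable_compose[OF this measurable_sphere_unif] show ?thesis by simp
qed

lemma measurable_cdf_proj_law:
  assumes mu: "prob_space \<mu>" "sets \<mu> = sets borel"
    and [measurable]: "f \<in> borel_measurable N" "g \<in> borel_measurable N"
  shows "(\<lambda>w. cdf (proj_law (f w) \<mu>) (g w)) \<in> borel_measurable N"
proof -
  interpret prob_space \<mu> by fact
  have [measurable_cong]: "sets \<mu> = sets borel" by fact
  show ?thesis
    unfolding cdf_proj_law(1)[OF mu] by (rule borel_measurable_lebesgue_integral) (simp add: case_prod_beta')
qed

lemma measurable_slice_gap:
  assumes "prob_space \<mu>" "sets \<mu> = sets borel" "prob_space \<nu>" "sets \<nu> = sets borel"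
  shows "slice_gap \<mu> \<nu> \<in> borel_measurable (slice_measure p R)"
proof -
  have [measurable]: "(\<lambda>w. cdf (proj_law (fst w) \<mu>) (fst (snd w))) \<in> borel_measurable (slice_measure p R)"
    "(\<lambda>w. cdf (proj_law (fst w) \<nu>) (snd (snd w))) \<in> borel_measurable (slice_measure p R)"
    by (intro measurable_cdf_proj_law assms measurable_slice_direction; measurable)+
  show ?thesis unfolding slice_gap_def[abs_def] by measurable
qed

lemma sliced_wasserstein_pow_eq_transport_value:
  assumes p: "1 < p" and "prob_space \<mu>" "sets \<mu> = sets borel" "prob_space \<nu>" "sets \<nu> = sets borel"
  shows "sliced_wasserstein_pow p \<mu> \<nu> =
    enn2real (\<integral>\<^sup>+\<theta>. transport_value p (cdf (proj_law \<theta> \<mu>)) (cdf (proj_law \<theta> \<nu>)) \<partial>sphere_unif)"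
proof -
  have p0: "0 < p" using p by simp
  show ?thesis
    unfolding sliced_wasserstein_pow_def sliced_wasserstein_def ennreal_powr_inverse[OF p0]
    by (simp add: wasserstein_real_line[OF p] real_distribution_proj_law assms)
qed

lemma cdf_proj_law_bounds:
  assumes "prob_space \<mu>" "sets \<mu> = sets borel"
  shows "0 \<le> cdf (proj_law \<theta> \<mu>) s" "cdf (proj_law \<theta> \<mu>) s \<le> 1"
proof -
  interpret prob_space \<mu> by fact
  show "0 \<le> cdf (proj_law \<theta> \<mu>) s" "cdf (proj_law \<theta> \<mu>) s \<le> 1" by (simp_all add: cdf_proj_law(2)[OF assms])
qed

lemma slice_gap_bounded:
  assumes "prob_space \<mu>" "sets \<mu> = sets borel" "prob_space \<nu>" "sets \<nu> = sets borel"
  shows "\<bar>slice_gap \<mu> \<nu> w\<bar> \<le> 1"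
proof -
  have "\<bar>cdf (proj_law (fst w) \<nu>) t - cdf (proj_law (fst w) \<mu>) s\<bar> \<le> 1" for s t
    using cdf_proj_law_bounds[OF assms(1,2), of "fst w" s] cdf_proj_law_bounds[OF assms(3,4), of "fst w" t]
    by (simp add: abs_le_iff)
  then show ?thesis by (auto simp: slice_gap_def gap_def abs_mult sgn_if)
qed

lemma integrable_slice_pos_part:
  assumes "1 < p" "prob_space \<mu>" "sets \<mu> = sets borel" "prob_space \<nu>" "sets \<nu> = sets borel"
  shows "integrable (slice_measure p R) (\<lambda>w. max 0 (slice_gap \<mu> \<nu> w))"
proof -
  interpret finite_measure "slice_measure p R" by (rule finite_measure_slice_measure) fact
  note [measurable] = measurable_slice_gap[OF assms(2-)]
  show ?thesis
    using abs_pos_part_le[OF slice_gap_bounded[OF assms(2-)]]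
    by (intro integrable_const_bound[where B = 1] AE_I2) auto
qed

text \<open>
The one-dimensional formula averaged over directions. It exhibits the sliced functional as a convex function of a
quantity that is affine in the two laws.
\<close>
lemma sliced_wasserstein_pow_eq_integral:
  fixes \<mu> \<nu> :: "'a::euclidean_space measure"
  assumes p: "1 < p" and mu: "prob_space \<mu>" "sets \<mu> = sets borel" "AE x in \<mu>. norm x \<le> R"
    and nu: "prob_space \<nu>" "sets \<nu> = sets borel" "AE x in \<nu>. norm x \<le> R"
  shows "sliced_wasserstein_pow p \<mu> \<nu> = (\<integral>w. max 0 (slice_gap \<mu> \<nu> w) \<partial>slice_measure p R)"
proof -
  interpret B: finite_measure "box_measure p R" by (rule finite_measure_box_measure[OF p])
  note [measurable] = measurable_slice_gap[OF mu(1,2) nu(1,2)]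
  note i = integrable_slice_pos_part[OF p mu(1,2) nu(1,2), of R]
  have "(\<integral>\<^sup>+\<theta>. transport_value p (cdf (proj_law \<theta> \<mu>)) (cdf (proj_law \<theta> \<nu>)) \<partial>sphere_unif)
      = (\<integral>\<^sup>+\<theta>. (\<integral>\<^sup>+z. ennreal (max 0 (slice_gap \<mu> \<nu> (\<theta>, z))) \<partial>box_measure p R) \<partial>sphere_unif)"
  proof (rule nn_integral_cong)
    fix \<theta> :: 'a assume "\<theta> \<in> space sphere_unif"
    then have th: "\<theta> \<in> sphere 0 1" by (simp add: space_sphere_unif)
    have F: "cdf_within R (cdf (proj_law \<theta> \<mu>))" "cdf_within R (cdf (proj_law \<theta> \<nu>))"
      using mu nu th by (auto intro!: cdf_within_cdf real_distribution_proj_law AE_proj_law_bounded)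
    then have [measurable]: "cdf (proj_law \<theta> \<mu>) \<in> borel_measurable borel" "cdf (proj_law \<theta> \<nu>) \<in> borel_measurable borel"
      by (auto simp: cdf_within_def)
    have "integrable (box_measure p R) (\<lambda>z. max 0 (gap (cdf (proj_law \<theta> \<mu>)) (cdf (proj_law \<theta> \<nu>)) z))"
      using abs_pos_part_le[OF gap_bounded[OF F]] by (intro B.integrable_const_bound[where B = 1] AE_I2) auto
    then show "transport_value p (cdf (proj_law \<theta> \<mu>)) (cdf (proj_law \<theta> \<nu>))
        = (\<integral>\<^sup>+z. ennreal (max 0 (slice_gap \<mu> \<nu> (\<theta>, z))) \<partial>box_measure p R)"
      unfolding transport_value_within[OF p F] slice_gap_def fst_conv snd_conv
      by (intro nn_integral_eq_integral[symmetric]) auto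
  qed
  also have "\<dots> = (\<integral>\<^sup>+w. ennreal (max 0 (slice_gap \<mu> \<nu> w)) \<partial>slice_measure p R)"
  proof -
    have "(\<lambda>w. ennreal (max 0 (slice_gap \<mu> \<nu> w))) \<in> borel_measurable (slice_measure p R)" by measurable
    then show ?thesis unfolding slice_measure_def by (rule B.nn_integral_fst)
  qed
  also have "\<dots> = ennreal (\<integral>w. max 0 (slice_gap \<mu> \<nu> w) \<partial>slice_measure p R)"
    using i by (intro nn_integral_eq_integral) auto
  finally show ?thesis
    unfolding sliced_wasserstein_pow_eq_transport_value[OF p mu(1,2) nu(1,2)]
    by (simp add: integral_nonneg_AE)
qed

text \<open>
A measure that depends measurably on w, to the extent to which the sliced functional can see it: only the distribution
functions of its projections are required to be jointly measurable.
\<close>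
definition random_law :: "'w measure \<Rightarrow> ('w \<Rightarrow> 'a::euclidean_space measure) \<Rightarrow> bool" where
  "random_law N \<alpha> \<longleftrightarrow> (\<forall>w. prob_space (\<alpha> w) \<and> sets (\<alpha> w) = sets borel) \<and>
     (\<lambda>(w, \<theta>, s). cdf (proj_law \<theta> (\<alpha> w)) s) \<in> borel_measurable (N \<Otimes>\<^sub>M (borel \<Otimes>\<^sub>M borel))"

lemma random_lawD:
  assumes "random_law N \<alpha>"
  shows "prob_space (\<alpha> w)" "sets (\<alpha> w) = sets borel"
    and "h \<in> L \<rightarrow>\<^sub>M N \<Longrightarrow> f \<in> borel_measurable L \<Longrightarrow> g \<in> borel_measurable L \<Longrightarrow>
      (\<lambda>x. cdf (proj_law (f x) (\<alpha> (h x))) (g x)) \<in> borel_measurable L"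
proof -
  show "prob_space (\<alpha> w)" "sets (\<alpha> w) = sets borel" using assms by (auto simp: random_law_def)
  assume [measurable]: "h \<in> L \<rightarrow>\<^sub>M N" "f \<in> borel_measurable L" "g \<in> borel_measurable L"
  have "(\<lambda>x. (h x, f x, g x)) \<in> L \<rightarrow>\<^sub>M N \<Otimes>\<^sub>M (borel \<Otimes>\<^sub>M borel)" by measurable
  from measurable_compose[OF this, of "\<lambda>(w, \<theta>, s). cdf (proj_law \<theta> (\<alpha> w)) s" borel] assms
  show "(\<lambda>x. cdf (proj_law (f x) (\<alpha> (h x))) (g x)) \<in> borel_measurable L"
    by (simp add: random_law_def)
qed

lemma random_law_const: "prob_space \<nu> \<Longrightarrow> sets \<nu> = sets borel \<Longrightarrow> random_law N (\<lambda>_. \<nu>)"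
  unfolding random_law_def case_prod_beta' by (auto intro!: measurable_cdf_proj_law)

lemma random_law_compose:
  assumes "random_law N \<alpha>" and [measurable]: "h \<in> L \<rightarrow>\<^sub>M N"
  shows "random_law L (\<lambda>x. \<alpha> (h x))"
  unfolding random_law_def case_prod_beta'
  using random_lawD(1,2)[OF assms(1)] by (auto intro!: random_lawD(3)[OF assms(1)])

lemma measurable_sliced_wasserstein_pow:
  fixes \<alpha> \<beta> :: "'w \<Rightarrow> 'a::euclidean_space measure"
  assumes p: "1 < p" and a: "random_law N \<alpha>" and b: "random_law N \<beta>"
  shows "(\<lambda>w. sliced_wasserstein_pow p (\<alpha> w) (\<beta> w)) \<in> borel_measurable N"
proof -
  \<comment> \<open>the direction lives on the sphere and has to be read as a point of the space\<close>
  have *: "(\<lambda>x. snd (fst x)) \<in> borel_measurable ((N \<Otimes>\<^sub>M (sphere_unif :: 'a measure)) \<Otimes>\<^sub>M (lborel \<Otimes>\<^sub>M lborel :: (real \<times> real) measure))"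
    by (rule measurable_compose[OF _ measurable_sphere_unif]) measurable
  have "(\<lambda>x. fst (snd x)) \<in> ((N \<Otimes>\<^sub>M (sphere_unif :: 'a measure)) \<Otimes>\<^sub>M (lborel \<Otimes>\<^sub>M lborel :: (real \<times> real) measure)) \<rightarrow>\<^sub>M lborel"
    "(\<lambda>x. snd (snd x)) \<in> ((N \<Otimes>\<^sub>M (sphere_unif :: 'a measure)) \<Otimes>\<^sub>M (lborel \<Otimes>\<^sub>M lborel :: (real \<times> real) measure)) \<rightarrow>\<^sub>M lborel"
    by (rule measurable_compose[OF measurable_snd measurable_fst] measurable_compose[OF measurable_snd measurable_snd])+
  then have **: "(\<lambda>x. fst (snd x)) \<in> borel_measurable ((N \<Otimes>\<^sub>M (sphere_unif :: 'a measure)) \<Otimes>\<^sub>M (lborel \<Otimes>\<^sub>M lborel :: (real \<times> real) measure))"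
    "(\<lambda>x. snd (snd x)) \<in> borel_measurable ((N \<Otimes>\<^sub>M (sphere_unif :: 'a measure)) \<Otimes>\<^sub>M (lborel \<Otimes>\<^sub>M lborel :: (real \<times> real) measure))"
    by (simp_all only: measurable_lborel1)
  note ff = measurable_compose[OF measurable_fst measurable_fst]
  have [measurable]: "(\<lambda>x. cdf (proj_law (snd (fst x)) (\<alpha> (fst (fst x)))) (fst (snd x)))
      \<in> borel_measurable ((N \<Otimes>\<^sub>M (sphere_unif :: 'a measure)) \<Otimes>\<^sub>M (lborel \<Otimes>\<^sub>M lborel :: (real \<times> real) measure))"
    by (rule random_lawD(3)[OF a, where h = "\<lambda>x. fst (fst x)" and f = "\<lambda>x. snd (fst x)" and g = "\<lambda>x. fst (snd x)", OF ff * **(1)])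
  have [measurable]: "(\<lambda>x. cdf (proj_law (snd (fst x)) (\<beta> (fst (fst x)))) (snd (snd x)))
      \<in> borel_measurable ((N \<Otimes>\<^sub>M (sphere_unif :: 'a measure)) \<Otimes>\<^sub>M (lborel \<Otimes>\<^sub>M lborel :: (real \<times> real) measure))"
    by (rule random_lawD(3)[OF b, where h = "\<lambda>x. fst (fst x)" and f = "\<lambda>x. snd (fst x)" and g = "\<lambda>x. snd (snd x)", OF ff * **(2)])
  have "(\<lambda>x. transport_value p (cdf (proj_law (snd x) (\<alpha> (fst x)))) (cdf (proj_law (snd x) (\<beta> (fst x)))))
      \<in> borel_measurable (N \<Otimes>\<^sub>M (sphere_unif :: 'a measure))"
    unfolding transport_value_def
    by (rule lborel_pair.borel_measurable_nn_integral) (simp add: case_prod_beta')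
  then have [measurable]: "(\<lambda>x. \<integral>\<^sup>+\<theta>. transport_value p (cdf (proj_law \<theta> (\<alpha> x))) (cdf (proj_law \<theta> (\<beta> x))) \<partial>sphere_unif) \<in> borel_measurable N"
    by (intro sphere.borel_measurable_nn_integral) (simp add: case_prod_beta')
  show ?thesis
    unfolding sliced_wasserstein_pow_eq_transport_value[OF p random_lawD(1,2)[OF a] random_lawD(1,2)[OF b]]
    by measurable
qed

section \<open>The influence functions\<close>

definition slice_pot1 :: "real \<Rightarrow> real \<Rightarrow> 'a::euclidean_space measure \<Rightarrow> 'a measure \<Rightarrow> 'a \<Rightarrow> 'a \<Rightarrow> real" where
  "slice_pot1 p R \<mu> \<nu> \<theta> x = pot1 p R (cdf (proj_law \<theta> \<mu>)) (cdf (proj_law \<theta> \<nu>)) (\<theta> \<bullet> x)"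

definition slice_pot2 :: "real \<Rightarrow> real \<Rightarrow> 'a::euclidean_space measure \<Rightarrow> 'a measure \<Rightarrow> 'a \<Rightarrow> 'a \<Rightarrow> real" where
  "slice_pot2 p R \<mu> \<nu> \<theta> y = pot2 p R (cdf (proj_law \<theta> \<mu>)) (cdf (proj_law \<theta> \<nu>)) (\<theta> \<bullet> y)"

text \<open>
The averages of the dual potentials over all directions. They are the influence functions of the sliced functional in its
two arguments.
\<close>
definition influence1 :: "real \<Rightarrow> real \<Rightarrow> 'a::euclidean_space measure \<Rightarrow> 'a measure \<Rightarrow> 'a \<Rightarrow> real" where
  "influence1 p R \<mu> \<nu> x = (\<integral>\<theta>. slice_pot1 p R \<mu> \<nu> \<theta> x \<partial>sphere_unif)"

definition influence2 :: "real \<Rightarrow> real \<Rightarrow> 'a::euclidean_space measure \<Rightarrow> 'a measure \<Rightarrow> 'a \<Rightarrow> real" where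
  "influence2 p R \<mu> \<nu> y = (\<integral>\<theta>. slice_pot2 p R \<mu> \<nu> \<theta> y \<partial>sphere_unif)"

definition box_mass :: "real \<Rightarrow> real \<Rightarrow> real" where
  "box_mass p R = measure (box_measure p R) UNIV"

lemma slice_pot_bounded:
  assumes "1 < p"
  shows "\<bar>slice_pot1 p R \<mu> \<nu> \<theta> x\<bar> \<le> box_mass p R" "\<bar>slice_pot2 p R \<mu> \<nu> \<theta> x\<bar> \<le> box_mass p R"
  unfolding slice_pot1_def slice_pot2_def box_mass_def by (intro pot_bounded assms)+

lemma measurable_slice_pot:
  assumes p: "1 < p" and mu: "prob_space \<mu>" "sets \<mu> = sets borel" and nu: "prob_space \<nu>" "sets \<nu> = sets borel"
    and [measurable]: "f \<in> borel_measurable N" "g \<in> borel_measurable N"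
  shows "(\<lambda>w. slice_pot1 p R \<mu> \<nu> (f w) (g w)) \<in> borel_measurable N"
    "(\<lambda>w. slice_pot2 p R \<mu> \<nu> (f w) (g w)) \<in> borel_measurable N"
proof -
  have "(\<lambda>(w, s). cdf (proj_law (f w) \<mu>) s) \<in> borel_measurable (N \<Otimes>\<^sub>M borel)"
    "(\<lambda>(w, s). cdf (proj_law (f w) \<nu>) s) \<in> borel_measurable (N \<Otimes>\<^sub>M borel)"
    unfolding case_prod_beta' by (intro measurable_cdf_proj_law mu nu; measurable)+
  then show "(\<lambda>w. slice_pot1 p R \<mu> \<nu> (f w) (g w)) \<in> borel_measurable N"
    "(\<lambda>w. slice_pot2 p R \<mu> \<nu> (f w) (g w)) \<in> borel_measurable N"
    unfolding slice_pot1_def slice_pot2_def by (intro measurable_pot[OF p]; measurable)+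
qed

lemma measurable_influence:
  fixes \<mu> \<nu> :: "'a::euclidean_space measure"
  assumes p: "1 < p" and mu: "prob_space \<mu>" "sets \<mu> = sets borel" and nu: "prob_space \<nu>" "sets \<nu> = sets borel"
  shows "influence1 p R \<mu> \<nu> \<in> borel_measurable borel" "influence2 p R \<mu> \<nu> \<in> borel_measurable borel"
proof -
  have *: "snd \<in> borel_measurable (borel \<Otimes>\<^sub>M (sphere_unif :: 'a measure))"
    by (rule measurable_compose[OF measurable_snd measurable_sphere_unif])
  have **: "(\<lambda>(x, \<theta>). slice_pot1 p R \<mu> \<nu> \<theta> x) \<in> borel_measurable (borel \<Otimes>\<^sub>M sphere_unif)"
     "(\<lambda>(x, \<theta>). slice_pot2 p R \<mu> \<nu> \<theta> x) \<in> borel_measurable (borel \<Otimes>\<^sub>M sphere_unif)"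
    unfolding case_prod_beta' by (intro measurable_slice_pot[OF p mu nu *]; measurable)+
  show "influence1 p R \<mu> \<nu> \<in> borel_measurable borel" "influence2 p R \<mu> \<nu> \<in> borel_measurable borel"
    unfolding influence1_def[abs_def] influence2_def[abs_def]
    by (intro sphere.borel_measurable_lebesgue_integral **)+
qed

lemma influence_bounded:
  assumes p: "1 < p"
  shows "\<bar>influence1 p R \<mu> \<nu> x\<bar> \<le> box_mass p R" "\<bar>influence2 p R \<mu> \<nu> x\<bar> \<le> box_mass p R"
  unfolding influence1_def influence2_def
  by (intro abs_expectation_le prob_space_sphere_unif slice_pot_bounded p)+

text \<open>
Fubini for the average over directions. The weight h is constant where the linear part of the functional is represented, and
a centred function where variances are computed.
\<close>
lemma integral_slice_pot:
  fixes \<mu> \<nu> \<alpha> :: "'a::euclidean_space measure"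
  assumes p: "1 < p" and mu: "prob_space \<mu>" "sets \<mu> = sets borel" and nu: "prob_space \<nu>" "sets \<nu> = sets borel"
    and a: "prob_space \<alpha>" "sets \<alpha> = sets borel"
    and [measurable]: "h \<in> borel_measurable borel" and h: "\<And>x. \<bar>h x\<bar> \<le> C"
  shows "(\<integral>\<theta>. (\<integral>x. slice_pot1 p R \<mu> \<nu> \<theta> x * h x \<partial>\<alpha>) \<partial>sphere_unif) = (\<integral>x. influence1 p R \<mu> \<nu> x * h x \<partial>\<alpha>)"
    and "(\<integral>\<theta>. (\<integral>x. slice_pot2 p R \<mu> \<nu> \<theta> x * h x \<partial>\<alpha>) \<partial>sphere_unif) = (\<integral>x. influence2 p R \<mu> \<nu> x * h x \<partial>\<alpha>)"
    and "integrable sphere_unif (\<lambda>\<theta>. \<integral>x. slice_pot1 p R \<mu> \<nu> \<theta> x * h x \<partial>\<alpha>)"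
    and "integrable sphere_unif (\<lambda>\<theta>. \<integral>x. slice_pot2 p R \<mu> \<nu> \<theta> x * h x \<partial>\<alpha>)"
proof -
  interpret a: prob_space \<alpha> by fact
  have [measurable_cong]: "sets \<alpha> = sets borel" by fact
  interpret P: pair_sigma_finite "sphere_unif :: 'a measure" \<alpha> by standard
  interpret P: finite_measure "(sphere_unif :: 'a measure) \<Otimes>\<^sub>M \<alpha>"
    by (intro finite_measure_pair_measure a.finite_measure_axioms sphere.finite_measure_axioms)
  have *: "fst \<in> borel_measurable ((sphere_unif :: 'a measure) \<Otimes>\<^sub>M \<alpha>)"
    by (rule measurable_compose[OF measurable_fst measurable_sphere_unif])
  have [measurable]: "(\<lambda>w. slice_pot1 p R \<mu> \<nu> (fst w) (snd w)) \<in> borel_measurable (sphere_unif \<Otimes>\<^sub>M \<alpha>)"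
    "(\<lambda>w. slice_pot2 p R \<mu> \<nu> (fst w) (snd w)) \<in> borel_measurable (sphere_unif \<Otimes>\<^sub>M \<alpha>)"
    by (intro measurable_slice_pot[OF p mu nu *]; measurable)+
  have b: "\<bar>u * h x\<bar> \<le> box_mass p R * C" if "\<bar>u\<bar> \<le> box_mass p R" for u x
    unfolding abs_mult using that h[of x] by (intro mult_mono) auto
  have i: "integrable (sphere_unif \<Otimes>\<^sub>M \<alpha>) (\<lambda>(\<theta>, x). slice_pot1 p R \<mu> \<nu> \<theta> x * h x)"
    "integrable (sphere_unif \<Otimes>\<^sub>M \<alpha>) (\<lambda>(\<theta>, x). slice_pot2 p R \<mu> \<nu> \<theta> x * h x)"
    unfolding case_prod_beta'
    by (intro P.integrable_const_bound[where B = "box_mass p R * C"] AE_I2; simp add: b slice_pot_bounded[OF p])+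
  show "(\<integral>\<theta>. (\<integral>x. slice_pot1 p R \<mu> \<nu> \<theta> x * h x \<partial>\<alpha>) \<partial>sphere_unif) = (\<integral>x. influence1 p R \<mu> \<nu> x * h x \<partial>\<alpha>)"
    unfolding influence1_def using P.Fubini_integral[OF i(1)] by simp
  show "(\<integral>\<theta>. (\<integral>x. slice_pot2 p R \<mu> \<nu> \<theta> x * h x \<partial>\<alpha>) \<partial>sphere_unif) = (\<integral>x. influence2 p R \<mu> \<nu> x * h x \<partial>\<alpha>)"
    unfolding influence2_def using P.Fubini_integral[OF i(2)] by simp
  show "integrable sphere_unif (\<lambda>\<theta>. \<integral>x. slice_pot1 p R \<mu> \<nu> \<theta> x * h x \<partial>\<alpha>)"
    "integrable sphere_unif (\<lambda>\<theta>. \<integral>x. slice_pot2 p R \<mu> \<nu> \<theta> x * h x \<partial>\<alpha>)"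
    using P.integrable_fst'[OF i(1)] P.integrable_fst'[OF i(2)] by simp_all
qed

lemma integral_positive_slice_gap_eq_influence:
  fixes \<mu> \<nu> \<alpha> \<beta> :: "'a::euclidean_space measure"
  assumes p: "1 < p" and mu: "prob_space \<mu>" "sets \<mu> = sets borel" and nu: "prob_space \<nu>" "sets \<nu> = sets borel"
    and a: "prob_space \<alpha>" "sets \<alpha> = sets borel" and b: "prob_space \<beta>" "sets \<beta> = sets borel"
  shows "integrable (slice_measure p R) (\<lambda>w. of_bool (0 < slice_gap \<mu> \<nu> w) * slice_gap \<alpha> \<beta> w)"
    and "(\<integral>w. of_bool (0 < slice_gap \<mu> \<nu> w) * slice_gap \<alpha> \<beta> w \<partial>slice_measure p R)
    = (\<integral>x. influence1 p R \<mu> \<nu> x \<partial>\<alpha>) + (\<integral>y. influence2 p R \<mu> \<nu> y \<partial>\<beta>)"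
proof -
  have [measurable_cong]: "sets \<alpha> = sets borel" "sets \<beta> = sets borel" by fact+
  interpret B: finite_measure "box_measure p R" by (rule finite_measure_box_measure[OF p])
  interpret S: finite_measure "slice_measure p R :: ('a \<times> real \<times> real) measure" by (rule finite_measure_slice_measure[OF p])
  interpret P: pair_sigma_finite "sphere_unif :: 'a measure" "box_measure p R" by standard
  note [measurable] = measurable_slice_gap[OF mu nu] measurable_slice_gap[OF a b]
  show i: "integrable (slice_measure p R) (\<lambda>w. of_bool (0 < slice_gap \<mu> \<nu> w) * slice_gap \<alpha> \<beta> w)"
  proof (intro S.integrable_const_bound[where B = 1] AE_I2)
    show "norm (of_bool (0 < slice_gap \<mu> \<nu> w) * slice_gap \<alpha> \<beta> w) \<le> 1" for w
      using slice_gap_bounded[OF a b, of w] by auto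
  qed auto
  have inner: "(\<integral>z. of_bool (0 < slice_gap \<mu> \<nu> (\<theta>, z)) * slice_gap \<alpha> \<beta> (\<theta>, z) \<partial>box_measure p R)
      = (\<integral>x. slice_pot1 p R \<mu> \<nu> \<theta> x * 1 \<partial>\<alpha>) + (\<integral>y. slice_pot2 p R \<mu> \<nu> \<theta> y * 1 \<partial>\<beta>)" for \<theta>
  proof -
    have [measurable]: "cdf (proj_law \<theta> \<mu>) \<in> borel_measurable borel" "cdf (proj_law \<theta> \<nu>) \<in> borel_measurable borel"
      by (intro borel_measurable_cdf real_distribution_proj_law mu nu)+
    have FG: "(\<lambda>(w :: real, s). cdf (proj_law \<theta> \<mu>) s) \<in> borel_measurable (borel \<Otimes>\<^sub>M borel)"
      "(\<lambda>(w :: real, s). cdf (proj_law \<theta> \<nu>) s) \<in> borel_measurable (borel \<Otimes>\<^sub>M borel)"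
      unfolding case_prod_beta' by measurable
    have [measurable]: "pot1 p R (cdf (proj_law \<theta> \<mu>)) (cdf (proj_law \<theta> \<nu>)) \<in> borel_measurable borel"
      "pot2 p R (cdf (proj_law \<theta> \<mu>)) (cdf (proj_law \<theta> \<nu>)) \<in> borel_measurable borel"
      by (rule measurable_pot[OF p FG, where f = "\<lambda>x. x"], measurable)+
    have "(\<integral>z. of_bool (0 < slice_gap \<mu> \<nu> (\<theta>, z)) * slice_gap \<alpha> \<beta> (\<theta>, z) \<partial>box_measure p R)
      = (\<integral>x. pot1 p R (cdf (proj_law \<theta> \<mu>)) (cdf (proj_law \<theta> \<nu>)) x \<partial>proj_law \<theta> \<alpha>)
        + (\<integral>y. pot2 p R (cdf (proj_law \<theta> \<mu>)) (cdf (proj_law \<theta> \<nu>)) y \<partial>proj_law \<theta> \<beta>)"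
      unfolding slice_gap_def fst_conv snd_conv
      by (intro integral_positive_gap_eq_potentials p real_distribution_proj_law a b) measurable
    then show ?thesis
      unfolding slice_pot1_def slice_pot2_def unfolding proj_law_def[of \<theta> \<alpha>] proj_law_def[of \<theta> \<beta>]
      by (simp add: integral_distr)
  qed
  have "(\<integral>w. of_bool (0 < slice_gap \<mu> \<nu> w) * slice_gap \<alpha> \<beta> w \<partial>slice_measure p R)
     = (\<integral>\<theta>. (\<integral>z. of_bool (0 < slice_gap \<mu> \<nu> (\<theta>, z)) * slice_gap \<alpha> \<beta> (\<theta>, z) \<partial>box_measure p R) \<partial>sphere_unif)"
    using P.integral_fst'[of "\<lambda>w. of_bool (0 < slice_gap \<mu> \<nu> w) * slice_gap \<alpha> \<beta> w"] i
    by (simp add: slice_measure_def)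
  also have "\<dots> = (\<integral>x. influence1 p R \<mu> \<nu> x * 1 \<partial>\<alpha>) + (\<integral>y. influence2 p R \<mu> \<nu> y * 1 \<partial>\<beta>)"
    unfolding inner
    using integral_slice_pot[OF p mu nu a, of "\<lambda>_. 1" 1 R] integral_slice_pot[OF p mu nu b, of "\<lambda>_. 1" 1 R]
    by simp
  finally show "(\<integral>w. of_bool (0 < slice_gap \<mu> \<nu> w) * slice_gap \<alpha> \<beta> w \<partial>slice_measure p R)
    = (\<integral>x. influence1 p R \<mu> \<nu> x \<partial>\<alpha>) + (\<integral>y. influence2 p R \<mu> \<nu> y \<partial>\<beta>)" by simp
qed

text \<open>
In every direction a vanishing gap is a tie of the two distribution functions, up to the diagonal of the thresholds, where
the gap vanishes by its definition but which is null.
\<close>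
lemma AE_slice_gap_tie:
  fixes \<mu> \<nu> :: "'a::euclidean_space measure"
  assumes p: "1 < p" and mu: "prob_space \<mu>" "sets \<mu> = sets borel" "convex (spt \<mu>)" and nu: "prob_space \<nu>" "sets \<nu> = sets borel"
  shows "AE w in slice_measure p R. slice_gap \<mu> \<nu> w = 0 \<longrightarrow>
     cdf (proj_law (fst w) \<mu>) (fst (snd w)) \<in> {0, 1} \<and> cdf (proj_law (fst w) \<nu>) (snd (snd w)) \<in> {0, 1}"
proof -
  interpret B: finite_measure "box_measure p R" by (rule finite_measure_box_measure[OF p])
  interpret P: pair_sigma_finite "sphere_unif :: 'a measure" "box_measure p R" by standard
  note [measurable] = measurable_slice_gap[OF mu(1,2) nu]
  have [measurable]: "(\<lambda>w. cdf (proj_law (fst w) \<mu>) (fst (snd w))) \<in> borel_measurable (slice_measure p R)"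
    "(\<lambda>w. cdf (proj_law (fst w) \<nu>) (snd (snd w))) \<in> borel_measurable (slice_measure p R)"
    by (intro measurable_cdf_proj_law mu nu measurable_slice_direction; measurable)+
  have "{z \<in> space (lborel \<Otimes>\<^sub>M lborel). fst z \<noteq> (snd z :: real)} \<in> sets (lborel \<Otimes>\<^sub>M lborel)" by measurable
  then have diag: "AE z in lborel \<Otimes>\<^sub>M lborel. fst z \<noteq> (snd z :: real)"
    using AE_lborel_singleton by (intro lborel_pair.AE_pair_measure) (auto simp: eq_commute)
  show ?thesis
    unfolding slice_measure_def
  proof (rule P.AE_pair_measure, goal_cases)
    case 2
    show ?case
    proof (rule AE_I2)
    fix \<theta> :: 'a
    show "AE z in box_measure p R. slice_gap \<mu> \<nu> (\<theta>, z) = 0 \<longrightarrow>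
       cdf (proj_law (fst (\<theta>, z)) \<mu>) (fst (snd (\<theta>, z))) \<in> {0, 1} \<and> cdf (proj_law (fst (\<theta>, z)) \<nu>) (snd (snd (\<theta>, z))) \<in> {0, 1}"
    proof (rule AE_box_measureI)
      show "AE z in lborel \<Otimes>\<^sub>M lborel. slice_gap \<mu> \<nu> (\<theta>, z) = 0 \<longrightarrow>
         cdf (proj_law (fst (\<theta>, z)) \<mu>) (fst (snd (\<theta>, z))) \<in> {0, 1} \<and> cdf (proj_law (fst (\<theta>, z)) \<nu>) (snd (snd (\<theta>, z))) \<in> {0, 1}"
        using diag tie_free_proj_law[OF mu nu, of \<theta>] unfolding tie_free_def
      proof eventually_elim
        case (elim z)
        then show ?case by (auto simp: slice_gap_def gap_def sgn_if split: if_splits)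
      qed
    qed
    qed
  next
    case 1
    have "{w \<in> space (slice_measure p R). slice_gap \<mu> \<nu> w = 0 \<longrightarrow>
       cdf (proj_law (fst w) \<mu>) (fst (snd w)) \<in> {0, 1} \<and> cdf (proj_law (fst w) \<nu>) (snd (snd w)) \<in> {0, 1}} \<in> sets (slice_measure p R)"
      by measurable
    then show ?case unfolding slice_measure_def .
  qed
qed

section \<open>Sums of independent bounded variables\<close>

lemma (in prob_space) second_moment_sum:
  fixes Z :: "'i \<Rightarrow> 'a \<Rightarrow> real"
  assumes J: "finite J" and "indep_vars (\<lambda>_. borel) Z J"
    and B: "\<And>j w. \<bar>Z j w\<bar> \<le> B" and "\<And>j. j \<in> J \<Longrightarrow> expectation (Z j) = 0"
  shows "expectation (\<lambda>w. (\<Sum>j\<in>J. Z j w)\<^sup>2) = (\<Sum>j\<in>J. expectation (\<lambda>w. (Z j w)\<^sup>2))"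
  using assms(1,2,4)
proof (induction J)
  case empty
  then show ?case by simp
next
  case (insert i I)
  have rv: "random_variable borel (Z j)" if "j \<in> insert i I" for j
    using insert.prems(1) that by (auto simp: indep_vars_def)
  define S where "S w = (\<Sum>j\<in>I. Z j w)" for w
  have [measurable]: "random_variable borel (Z i)" "random_variable borel S"
    using rv unfolding S_def by (auto intro!: borel_measurable_sum)
  have Sb: "\<bar>S w\<bar> \<le> real (card I) * B" for w
    unfolding S_def using B by (intro order_trans[OF sum_abs] sum_bounded_above) auto
  have B0: "0 \<le> B" using B[of undefined undefined] by linarith
  have sq: "u\<^sup>2 \<le> C\<^sup>2" if "\<bar>u\<bar> \<le> C" for u C :: real
    using that by (simp add: abs_le_square_iff[symmetric])
  have iZ: "integrable M (Z i)" and iS: "integrable M S"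
    by (rule integrable_const_bound[where B = B], use B in simp, simp)
       (rule integrable_const_bound[where B = "real (card I) * B"], use Sb in simp, simp)
  have iZ2: "integrable M (\<lambda>w. (Z i w)\<^sup>2)" and iS2: "integrable M (\<lambda>w. (S w)\<^sup>2)"
    by (rule integrable_const_bound[where B = "B\<^sup>2"], use sq[OF B] in simp, simp)
       (rule integrable_const_bound[where B = "(real (card I) * B)\<^sup>2"], use sq[OF Sb] in simp, simp)
  have ind: "indep_var borel (Z i) borel S"
    unfolding S_def using insert by (intro indep_vars_sum) auto
  have e: "expectation (\<lambda>w. Z i w * S w) = expectation (Z i) * expectation S"
    by (rule indep_var_lebesgue_integral[OF ind iZ iS])
  have i: "integrable M (\<lambda>w. Z i w * S w)" by (rule indep_var_integrable[OF ind iZ iS])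
  have "expectation (\<lambda>w. (\<Sum>j\<in>insert i I. Z j w)\<^sup>2) = expectation (\<lambda>w. (Z i w)\<^sup>2 + (S w)\<^sup>2 + 2 * (Z i w * S w))"
    using insert.hyps by (intro Bochner_Integration.integral_cong) (auto simp: S_def power2_sum)
  also have "\<dots> = expectation (\<lambda>w. (Z i w)\<^sup>2) + expectation (\<lambda>w. (S w)\<^sup>2)"
    using iZ2 iS2 i e insert.prems(2)[of i] by simp
  also have "expectation (\<lambda>w. (S w)\<^sup>2) = (\<Sum>j\<in>I. expectation (\<lambda>w. (Z j w)\<^sup>2))"
    unfolding S_def using insert.prems indep_vars_subset[OF insert.prems(1)] by (intro insert.IH) auto
  finally show ?case using insert.hyps by simp
qed

lemma exp_minus_quadratic:
  fixes u :: real
  assumes "0 \<le> u"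
  shows "\<bar>exp (- u) - (1 - u)\<bar> \<le> u\<^sup>2 / 2"
proof -
  define f where "f x = 1 - x + x\<^sup>2 / 2 - exp (- x)" for x :: real
  have "f 0 \<le> f u"
  proof (rule DERIV_nonneg_imp_nondecreasing[OF assms])
    fix x :: real assume "0 \<le> x"
    have "(f has_real_derivative (x - 1 + exp (- x))) (at x)"
      unfolding f_def by (auto intro!: derivative_eq_intros)
    moreover have "0 \<le> x - 1 + exp (- x)" using exp_ge_add_one_self[of "- x"] by linarith
    ultimately show "\<exists>y. (f has_real_derivative y) (at x) \<and> 0 \<le> y" by blast
  qed
  then have "exp (- u) \<le> 1 - u + u\<^sup>2 / 2" by (simp add: f_def)
  moreover have "1 - u \<le> exp (- u)" using exp_ge_add_one_self[of "- u"] by linarith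
  ultimately show ?thesis by (simp add: abs_le_iff)
qed

text \<open>
Factor by factor, a third order expansion compares the characteristic function of a summand with that of a normal
law of the same variance; the third absolute moment is at most B times the variance. The error is explicit in B and
in the variances because the estimate will be applied conditionally on data, to laws that change with n.
\<close>
lemma (in prob_space) char_sum_normal_bound:
  fixes Z :: "'i \<Rightarrow> 'a \<Rightarrow> real"
  assumes J: "finite J" and ind: "indep_vars (\<lambda>_. borel) Z J"
    and B: "\<And>j w. \<bar>Z j w\<bar> \<le> B" and mean: "\<And>j. j \<in> J \<Longrightarrow> expectation (Z j) = 0"
  shows "cmod (char (distr M borel (\<lambda>w. \<Sum>j\<in>J. Z j w)) t
      - of_real (exp (- (t\<^sup>2 * (\<Sum>j\<in>J. expectation (\<lambda>w. (Z j w)\<^sup>2)) / 2))))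
    \<le> (\<bar>t\<bar>^3 * B + t^4 * B\<^sup>2) * (\<Sum>j\<in>J. expectation (\<lambda>w. (Z j w)\<^sup>2))"
proof -
  have rv [measurable]: "random_variable borel (Z j)" if "j \<in> J" for j
    using ind that by (auto simp: indep_vars_def)
  have B0: "0 \<le> B" using B[of undefined undefined] by linarith
  define \<sigma> where "\<sigma> j = expectation (\<lambda>w. (Z j w)\<^sup>2)" for j
  have sq: "(Z j w)\<^sup>2 \<le> B\<^sup>2" for j w using B[of j w] B0 by (simp add: abs_le_square_iff[symmetric])
  have \<sigma>: "0 \<le> \<sigma> j" for j by (simp add: \<sigma>_def)
  have each: "cmod (char (distr M borel (Z j)) t - of_real (exp (- (t\<^sup>2 * \<sigma> j / 2)))) \<le> (\<bar>t\<bar>^3 * B + t^4 * B\<^sup>2) * \<sigma> j"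
    if j: "j \<in> J" for j
  proof -
    note [measurable] = rv[OF j]
    have i1: "integrable M (Z j)" using B by (intro integrable_const_bound[where B = B]) auto
    have i2: "integrable M (\<lambda>w. (Z j w)\<^sup>2)" using sq by (intro integrable_const_bound[where B = "B\<^sup>2"]) auto
    have \<sigma>le: "\<sigma> j \<le> B\<^sup>2"
    proof -
      have "\<sigma> j \<le> expectation (\<lambda>_. B\<^sup>2)" unfolding \<sigma>_def using i2 sq by (intro integral_mono) auto
      then show ?thesis by (simp add: prob_space)
    qed
    have var: "variance (Z j) = \<sigma> j" using mean[OF j] by (simp add: \<sigma>_def)
    have "cmod (char (distr M borel (Z j)) t - (1 - t\<^sup>2 * \<sigma> j / 2))
       \<le> (t\<^sup>2 / 6) * expectation (\<lambda>w. min (6 * (Z j w)\<^sup>2) (\<bar>t\<bar> * \<bar>Z j w\<bar> ^ 3))"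
      by (rule char_approx3'[OF _ i1 i2 mean[OF j] var refl]) simp
    also have "\<dots> \<le> (t\<^sup>2 / 6) * expectation (\<lambda>w. \<bar>t\<bar> * B * (Z j w)\<^sup>2)"
    proof (intro mult_left_mono integral_mono)
      show "integrable M (\<lambda>w. \<bar>t\<bar> * B * (Z j w)\<^sup>2)" using i2 by simp
      show "integrable M (\<lambda>w. min (6 * (Z j w)\<^sup>2) (\<bar>t\<bar> * \<bar>Z j w\<bar> ^ 3))"
        by (rule Bochner_Integration.integrable_bound[OF integrable_mult_right[OF i2, of 6]]) auto
      fix w
      have "\<bar>Z j w\<bar> ^ 3 = \<bar>Z j w\<bar> * (Z j w)\<^sup>2" by (simp add: power3_eq_cube power2_eq_square)
      also have "\<dots> \<le> B * (Z j w)\<^sup>2" using B by (intro mult_right_mono) auto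
      finally have "\<bar>t\<bar> * \<bar>Z j w\<bar> ^ 3 \<le> \<bar>t\<bar> * (B * (Z j w)\<^sup>2)" by (intro mult_left_mono) auto
      then show "min (6 * (Z j w)\<^sup>2) (\<bar>t\<bar> * \<bar>Z j w\<bar> ^ 3) \<le> \<bar>t\<bar> * B * (Z j w)\<^sup>2" by (simp add: mult.assoc)
    qed auto
    also have "\<dots> = (\<bar>t\<bar>^3 * B * \<sigma> j) / 6"
      by (simp add: \<sigma>_def power3_eq_cube power2_eq_square)
    also have "\<dots> \<le> \<bar>t\<bar>^3 * B * \<sigma> j" using B0 \<sigma>[of j] by simp
    finally have a: "cmod (char (distr M borel (Z j)) t - (1 - t\<^sup>2 * \<sigma> j / 2)) \<le> \<bar>t\<bar>^3 * B * \<sigma> j" .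
    have "cmod (of_real (1 - t\<^sup>2 * \<sigma> j / 2) - of_real (exp (- (t\<^sup>2 * \<sigma> j / 2)))) \<le> (t\<^sup>2 * \<sigma> j / 2)\<^sup>2 / 2"
      unfolding of_real_diff[symmetric] norm_of_real using exp_minus_quadratic[of "t\<^sup>2 * \<sigma> j / 2"] \<sigma>[of j]
      by (simp add: abs_minus_commute)
    also have "\<dots> = t^4 * \<sigma> j * \<sigma> j / 8" by (simp add: power2_eq_square power4_eq_xxxx)
    also have "\<dots> \<le> t^4 * B\<^sup>2 * \<sigma> j"
    proof -
      have "t^4 * \<sigma> j * \<sigma> j \<le> t^4 * B\<^sup>2 * \<sigma> j" using \<sigma>le \<sigma>[of j] by (intro mult_right_mono mult_left_mono) auto
      moreover have "0 \<le> t^4 * \<sigma> j * \<sigma> j" using \<sigma>[of j] by simp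
      ultimately show ?thesis by linarith
    qed
    finally have b: "cmod (of_real (1 - t\<^sup>2 * \<sigma> j / 2) - of_real (exp (- (t\<^sup>2 * \<sigma> j / 2)))) \<le> t^4 * B\<^sup>2 * \<sigma> j" .
    show ?thesis
      using norm_triangle_ineq[of "char (distr M borel (Z j)) t - (1 - t\<^sup>2 * \<sigma> j / 2)"
          "of_real (1 - t\<^sup>2 * \<sigma> j / 2) - of_real (exp (- (t\<^sup>2 * \<sigma> j / 2)))"] a b
      by (simp add: algebra_simps)
  qed
  have e: "of_real (exp (- (t\<^sup>2 * (\<Sum>j\<in>J. \<sigma> j) / 2))) = (\<Prod>j\<in>J. of_real (exp (- (t\<^sup>2 * \<sigma> j / 2))) :: complex)"
  proof -
    have "- (t\<^sup>2 * (\<Sum>j\<in>J. \<sigma> j) / 2) = (\<Sum>j\<in>J. - (t\<^sup>2 * \<sigma> j / 2))"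
      by (simp add: sum_distrib_left sum_divide_distrib sum_negf)
    then have "exp (- (t\<^sup>2 * (\<Sum>j\<in>J. \<sigma> j) / 2)) = (\<Prod>j\<in>J. exp (- (t\<^sup>2 * \<sigma> j / 2)))"
      using exp_sum[OF J] by metis
    then show ?thesis by (simp only: of_real_prod)
  qed
  have "cmod (char (distr M borel (\<lambda>w. \<Sum>j\<in>J. Z j w)) t - of_real (exp (- (t\<^sup>2 * (\<Sum>j\<in>J. \<sigma> j) / 2))))
     \<le> (\<Sum>j\<in>J. cmod (char (distr M borel (Z j)) t - of_real (exp (- (t\<^sup>2 * \<sigma> j / 2)))))"
    unfolding char_distr_sum[OF ind] e
  proof (rule norm_prod_diff)
    fix j assume j: "j \<in> J"
    show "cmod (char (distr M borel (Z j)) t) \<le> 1"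
      by (rule real_distribution.cmod_char_le_1[OF real_distribution_distr[OF rv[OF j]]])
    show "cmod (of_real (exp (- (t\<^sup>2 * \<sigma> j / 2)))) \<le> 1" using \<sigma>[of j] by (simp del: of_real_exp)
  qed
  also have "\<dots> \<le> (\<Sum>j\<in>J. (\<bar>t\<bar>^3 * B + t^4 * B\<^sup>2) * \<sigma> j)"
    by (rule sum_mono[OF each])
  finally show ?thesis by (simp add: \<sigma>_def sum_distrib_left)
qed

lemma char_normal_law:
  assumes "0 \<le> v"
  shows "char (normal_law 0 v) t = of_real (exp (- (t\<^sup>2 * v / 2)))"
proof -
  have "char (normal_law 0 v) t = (CLINT z|std_normal_distribution. iexp (t * sqrt v * z))"
    unfolding normal_law_def char_def by (subst integral_distr) (auto simp: mult.assoc)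
  also have "\<dots> = char std_normal_distribution (t * sqrt v)" by (simp add: char_def)
  also have "\<dots> = of_real (exp (- (t\<^sup>2 * v / 2)))"
    using assms by (simp only: char_std_normal_distribution power_mult_distrib real_sqrt_pow2 minus_divide_left)
  finally show ?thesis .
qed

lemma real_distribution_normal_law: "real_distribution (normal_law m v)"
proof -
  interpret prob_space std_normal_distribution using prob_space_normal_density[of 1 0] by simp
  show ?thesis unfolding normal_law_def by (rule real_distribution_distr) simp
qed

lemma cmod_iexp_minus_one: "cmod (iexp x - 1) \<le> \<bar>x\<bar>"
  using iexp_approx1[of x 0] by simp

text \<open>
The function exp (i x) is Lipschitz with constant 1.
\<close>
lemma (in prob_space) char_perturbation:
  assumes [measurable]: "random_variable borel A" "random_variable borel S" and R: "integrable M (\<lambda>w. S w - A w)"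
  shows "cmod (char (distr M borel S) t - char (distr M borel A) t) \<le> \<bar>t\<bar> * expectation (\<lambda>w. \<bar>S w - A w\<bar>)"
proof -
  have "char (distr M borel S) t - char (distr M borel A) t = (CLINT w|M. iexp (t * S w) - iexp (t * A w))"
    by (simp add: char_def integral_distr integrable_iexp)
  also have "cmod \<dots> \<le> expectation (\<lambda>w. cmod (iexp (t * S w) - iexp (t * A w)))"
    by (rule integral_norm_bound)
  also have "\<dots> \<le> expectation (\<lambda>w. \<bar>t\<bar> * \<bar>S w - A w\<bar>)"
  proof (rule integral_mono)
    show "integrable M (\<lambda>w. cmod (iexp (t * S w) - iexp (t * A w)))"
      by (intro integrable_norm Bochner_Integration.integrable_diff integrable_iexp) auto
    show "integrable M (\<lambda>w. \<bar>t\<bar> * \<bar>S w - A w\<bar>)" using R by auto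
    fix w
    have "iexp (t * S w) - iexp (t * A w) = iexp (t * A w) * (iexp (t * (S w - A w)) - 1)"
      by (simp add: algebra_simps exp_add[symmetric] flip: of_real_mult)
    then have "cmod (iexp (t * S w) - iexp (t * A w)) = cmod (iexp (t * (S w - A w)) - 1)"
      by (simp only: norm_mult norm_exp_i_times mult_1_left)
    also have "\<dots> \<le> \<bar>t * (S w - A w)\<bar>" by (rule cmod_iexp_minus_one)
    finally show "cmod (iexp (t * S w) - iexp (t * A w)) \<le> \<bar>t\<bar> * \<bar>S w - A w\<bar>" by (simp add: abs_mult)
  qed
  finally show ?thesis by simp
qed

lemma char_pair_sum:
  assumes P: "prob_space P" "prob_space Q" and [measurable]: "f \<in> borel_measurable P" "g \<in> borel_measurable Q"
  shows "char (distr (P \<Otimes>\<^sub>M Q) borel (\<lambda>(x, y). f x + g y)) t = char (distr P borel f) t * char (distr Q borel g) t"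
proof -
  interpret P: prob_space P by fact
  interpret Q: prob_space Q by fact
  interpret pair_sigma_finite P Q by standard
  interpret PQ: prob_space "P \<Otimes>\<^sub>M Q" by (rule prob_space_pair) fact+
  have "char (distr (P \<Otimes>\<^sub>M Q) borel (\<lambda>(x, y). f x + g y)) t = (CLINT z|P \<Otimes>\<^sub>M Q. iexp (t * (f (fst z) + g (snd z))))"
    unfolding char_def by (subst integral_distr) (auto simp: case_prod_beta')
  also have "\<dots> = (CLINT x|P. CLINT y|Q. iexp (t * (f x + g y)))"
    by (subst integral_fst'[symmetric]) (auto intro!: PQ.integrable_iexp)
  also have "\<dots> = (CLINT x|P. CLINT y|Q. iexp (t * f x) * iexp (t * g y))"
    by (simp add: distrib_left exp_add)
  also have "\<dots> = char (distr P borel f) t * char (distr Q borel g) t"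
    by (simp add: char_def integral_distr Q.integrable_iexp)
  finally show ?thesis .
qed

section \<open>From characteristic functions to uniform convergence of distribution functions\<close>

lemma isCont_cdf_normal_law:
  assumes "0 < v"
  shows "isCont (cdf (normal_law 0 v)) x"
proof -
  interpret real_distribution "normal_law 0 v" by (rule real_distribution_normal_law)
  have "emeasure (normal_law 0 v) {x} = 0"
    unfolding normal_law_density[OF assms] by (subst emeasure_density) (auto intro!: nn_integral_zero' AE_lborel_singleton[THEN eventually_mono] simp: indicator_def)
  then show ?thesis unfolding isCont_cdf by (simp add: measure_def)
qed

text \<open>
The theorem of Polya. A continuous limit F attains the levels i / N at points y i. Convergence at these finitely many
points controls all others by monotonicity.
\<close>
lemma cdf_convergence_uniform:
  fixes Q :: "nat \<Rightarrow> real measure"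
  assumes Q: "\<And>k. real_distribution (Q k)" and L: "real_distribution L" and cont: "\<And>x. isCont (cdf L) x"
    and conv: "weak_conv_m Q L" and \<epsilon>: "0 < \<epsilon>"
  shows "\<forall>\<^sub>F k in sequentially. \<forall>x. \<bar>cdf (Q k) x - cdf L x\<bar> \<le> \<epsilon>"
proof -
  interpret L: real_distribution L by fact
  interpret Q: real_distribution "Q k" for k by fact
  let ?F = "cdf L"
  obtain N :: nat where N: "3 / \<epsilon> < real N" using reals_Archimedean2 by blast
  have N0: "0 < real N" using N \<epsilon> by (smt (verit) divide_pos_pos)
  have N3: "3 / real N \<le> \<epsilon>" using N \<epsilon> N0 by (simp add: field_simps)
  have ex: "\<exists>y. ?F y = real i / real N" if i: "0 < i" "i < N" for i
  proof -
    have r: "0 < real i / real N" "real i / real N < 1" using i by auto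
    obtain a where a: "?F a < real i / real N"
      using order_tendstoD(2)[OF L.cdf_lim_at_bot r(1)] eventually_happens'[OF trivial_limit_at_bot_linorder] by blast
    obtain b where b: "real i / real N < ?F b"
      using order_tendstoD(1)[OF L.cdf_lim_at_top_prob r(2)] eventually_happens'[OF trivial_limit_at_top_linorder] by blast
    have "a \<le> b" using a b L.cdf_nondecreasing[of b a] by (meson less_trans linorder_le_cases not_less)
    then show ?thesis using IVT[of ?F a "real i / real N" b] a b cont by auto
  qed
  then have "\<forall>i. \<exists>y. 0 < i \<and> i < N \<longrightarrow> ?F y = real i / real N" by blast
  then obtain y where y: "\<And>i. 0 < i \<Longrightarrow> i < N \<Longrightarrow> ?F (y i) = real i / real N" by metis
  have "\<forall>\<^sub>F k in sequentially. \<forall>i\<in>{0<..<N}. \<bar>cdf (Q k) (y i) - ?F (y i)\<bar> < 1 / real N"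
  proof (intro eventually_ball_finite ballI)
    fix i
    have "(\<lambda>k. cdf (Q k) (y i)) \<longlonglongrightarrow> ?F (y i)" using conv cont by (auto simp: weak_conv_m_def weak_conv_def)
    then show "\<forall>\<^sub>F k in sequentially. \<bar>cdf (Q k) (y i) - ?F (y i)\<bar> < 1 / real N"
      using N0 by (auto dest!: tendstoD[where e = "1 / real N"] simp: dist_real_def)
  qed simp
  then show ?thesis
  proof eventually_elim
    case (elim k)
    show ?case
    proof
      fix x
      have Fx: "0 \<le> ?F x" "?F x \<le> 1" "0 \<le> cdf (Q k) x" "cdf (Q k) x \<le> 1"
        using L.cdf_nonneg L.cdf_bounded_prob Q.cdf_nonneg Q.cdf_bounded_prob by auto
      define m where "m = nat \<lfloor>?F x * real N\<rfloor>"
      have m: "real m \<le> ?F x * real N" "?F x * real N < real m + 1"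
        using Fx N0 by (auto simp: m_def of_nat_nat le_nat_floor)
      have mF: "real m / real N \<le> ?F x" "?F x < (real m + 1) / real N"
        using m N0 by (simp_all add: field_simps)
      \<comment> \<open>with m / N \<le> F x < (m + 1) / N, the point x lies to the left of y (m + 1)\<close>
      have up: "cdf (Q k) x \<le> ?F x + 3 / real N"
      proof (cases "m + 1 < N")
        case True
        have Fy: "?F (y (m + 1)) = (real m + 1) / real N" using y[of "m + 1"] True by simp
        have "?F x < ?F (y (m + 1))" unfolding Fy by (rule mF(2))
        then have "x \<le> y (m + 1)" using L.cdf_nondecreasing[of "y (m + 1)" x] by (meson linorder_le_cases not_less)
        then have "cdf (Q k) x \<le> cdf (Q k) (y (m + 1))" by (rule Q.cdf_nondecreasing)
        also have "\<dots> \<le> (real m + 1) / real N + 1 / real N" using elim[rule_format, of "m + 1"] True Fy by auto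
        also have "\<dots> \<le> ?F x + 3 / real N" using mF(1) positive_imp_inverse_positive[OF N0]
            unfolding divide_inverse distrib_right left_diff_distrib by linarith
        finally show ?thesis .
      next
        case False
        then have "real N \<le> real m + 1" by linarith
        with m(1) have "real N \<le> ?F x * real N + 1" by linarith
        then have "1 \<le> ?F x + 1 / real N" using N0 by (simp add: field_simps)
        moreover have "1 / real N \<le> 3 / real N" using N0 by (simp add: divide_right_mono)
        ultimately show ?thesis using Fx by linarith
      qed
      \<comment> \<open>since F x = m / N is possible, only y (m - 1) is certain to lie to the left of x\<close>
      have low: "?F x - 3 / real N \<le> cdf (Q k) x"
      proof (cases "1 < m")
        case True
        have "real m \<le> real N" using m(1) Fx(2) N0 by (smt (verit) mult_left_le_one_le mult_le_cancel_right1)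
        then have mN: "m - 1 < N" "0 < m - 1" using True by linarith+
        have Fy: "?F (y (m - 1)) = (real m - 1) / real N" using y[OF mN(2,1)] True by simp
        have "(real m - 1) / real N < real m / real N" using N0 by (simp add: divide_strict_right_mono)
        then have "?F (y (m - 1)) < ?F x" unfolding Fy using mF(1) by linarith
        then have "y (m - 1) \<le> x" using L.cdf_nondecreasing[of x "y (m - 1)"] by (meson linorder_le_cases not_less)
        then have "cdf (Q k) (y (m - 1)) \<le> cdf (Q k) x" by (rule Q.cdf_nondecreasing)
        moreover have "(real m - 1) / real N - 1 / real N \<le> cdf (Q k) (y (m - 1))"
          using elim[rule_format, of "m - 1"] mN Fy by (auto simp: abs_less_iff)
        moreover have "?F x - 3 / real N \<le> (real m - 1) / real N - 1 / real N"
          using mF(2) positive_imp_inverse_positive[OF N0]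
            unfolding divide_inverse distrib_right left_diff_distrib by linarith
        ultimately show ?thesis by linarith
      next
        case False
        then have "?F x * real N < 3" using m by linarith
        then have "?F x \<le> 3 / real N" using N0 by (simp add: field_simps)
        then show ?thesis using Fx by linarith
      qed
      show "\<bar>cdf (Q k) x - ?F x\<bar> \<le> \<epsilon>" using up low N3 by linarith
    qed
  qed
qed

text \<open>
Otherwise there would be laws that are not uniformly close to the normal law although their characteristic functions
converge to the normal one; this contradicts the theorems of Levy and Polya. The point is that \<delta> and T serve all laws Q at
once, since the conditional law of a bootstrap statistic varies with the data.
\<close>
lemma cdf_close_if_char_close:
  assumes v: "0 < v" and \<epsilon>: "0 < \<epsilon>"
  obtains \<delta> T where "0 < \<delta>" "0 < T"
    "\<And>Q. real_distribution Q \<Longrightarrow> (\<And>t. \<bar>t\<bar> \<le> T \<Longrightarrow> cmod (char Q t - of_real (exp (- (t\<^sup>2 * v / 2)))) \<le> \<delta>) \<Longrightarrow>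
      (\<And>x. \<bar>cdf Q x - cdf (normal_law 0 v) x\<bar> \<le> \<epsilon>)"
proof (rule ccontr)
  assume no: "\<not> thesis"
  have "\<exists>Q. real_distribution Q \<and> (\<forall>t. \<bar>t\<bar> \<le> real k + 1 \<longrightarrow> cmod (char Q t - of_real (exp (- (t\<^sup>2 * v / 2)))) \<le> 1 / (real k + 1))
      \<and> (\<exists>x. \<epsilon> < \<bar>cdf Q x - cdf (normal_law 0 v) x\<bar>)" for k :: nat
  proof (rule ccontr)
    assume neg: "\<not> ?thesis"
    have thesis
    proof (rule that[of "1 / (real k + 1)" "real k + 1"])
      fix Q x
      assume "real_distribution Q" "\<And>t. \<bar>t\<bar> \<le> real k + 1 \<Longrightarrow> cmod (char Q t - of_real (exp (- (t\<^sup>2 * v / 2)))) \<le> 1 / (real k + 1)"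
      with neg show "\<bar>cdf Q x - cdf (normal_law 0 v) x\<bar> \<le> \<epsilon>" by (meson not_le)
    qed simp_all
    with no show False ..
  qed
  then obtain Q where Q: "\<And>k. real_distribution (Q k)"
    "\<And>k t. \<bar>t\<bar> \<le> real k + 1 \<Longrightarrow> cmod (char (Q k) t - of_real (exp (- (t\<^sup>2 * v / 2)))) \<le> 1 / (real k + 1)"
    "\<And>k. \<exists>x. \<epsilon> < \<bar>cdf (Q k) x - cdf (normal_law 0 v) x\<bar>"
    by metis
  have "(\<lambda>k. char (Q k) t) \<longlonglongrightarrow> char (normal_law 0 v) t" for t
  proof (rule Lim_transform_eventually[OF _ eventually_sequentiallyI])
    show "(\<lambda>k. char (normal_law 0 v) t + (char (Q k) t - of_real (exp (- (t\<^sup>2 * v / 2))))) \<longlonglongrightarrow> char (normal_law 0 v) t"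
    proof -
      obtain m :: nat where m: "\<bar>t\<bar> < real m" using reals_Archimedean2 by blast
      have "(\<lambda>k. char (Q k) t - of_real (exp (- (t\<^sup>2 * v / 2)))) \<longlonglongrightarrow> 0"
      proof (rule Lim_null_comparison)
        show "(\<lambda>k. 1 / (real k + 1)) \<longlonglongrightarrow> 0" using LIMSEQ_inverse_real_of_nat by (simp add: inverse_eq_divide add.commute)
        show "\<forall>\<^sub>F k in sequentially. cmod (char (Q k) t - of_real (exp (- (t\<^sup>2 * v / 2)))) \<le> 1 / (real k + 1)"
          using m by (intro eventually_sequentiallyI[of m] Q(2)) auto
      qed
      from tendsto_add[OF tendsto_const this, of "char (normal_law 0 v) t"] show ?thesis by simp
    qed
    show "char (normal_law 0 v) t + (char (Q k) t - of_real (exp (- (t\<^sup>2 * v / 2)))) = char (Q k) t" if "0 \<le> k" for k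
      using v by (simp add: char_normal_law)
  qed
  then have "weak_conv_m Q (normal_law 0 v)"
    by (intro levy_continuity Q(1) real_distribution_normal_law)
  from cdf_convergence_uniform[OF Q(1) real_distribution_normal_law isCont_cdf_normal_law[OF v] this \<epsilon>]
  obtain k where "\<forall>x. \<bar>cdf (Q k) x - cdf (normal_law 0 v) x\<bar> \<le> \<epsilon>" by (auto simp: eventually_sequentially)
  with Q(3)[of k] show False by (auto simp: not_le[symmetric])
qed

section \<open>Empirical measures and resampling\<close>

lemma empirical_law:
  fixes x :: "nat \<Rightarrow> 'a::euclidean_space"
  assumes "0 < n"
  shows "prob_space (empirical n x)" "sets (empirical n x) = sets borel"
proof -
  have m: "x \<in> uniform_count_measure {..<n} \<rightarrow>\<^sub>M borel"
    by (simp cong: measurable_cong_sets add: sets_uniform_count_measure_count_space)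
  show "prob_space (empirical n x)"
    unfolding empirical_def using assms
    by (intro prob_space.prob_space_distr prob_space_uniform_count_measure m) auto
qed (simp add: empirical_def)

lemma integral_empirical:
  fixes x :: "nat \<Rightarrow> 'a::euclidean_space" and f :: "'a \<Rightarrow> real"
  assumes [measurable]: "f \<in> borel_measurable borel"
  shows "(\<integral>z. f z \<partial>empirical n x) = (\<Sum>i<n. f (x i)) / real n"
proof -
  have m: "x \<in> uniform_count_measure {..<n} \<rightarrow>\<^sub>M borel"
    by (simp cong: measurable_cong_sets add: sets_uniform_count_measure_count_space)
  show ?thesis unfolding empirical_def by (subst integral_distr[OF m]) (auto simp: integral_uniform_count_measure)
qed

lemma empirical_cong: "(\<And>i. i < n \<Longrightarrow> x i = y i) \<Longrightarrow> empirical n x = empirical n y"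
  unfolding empirical_def by (intro distr_cong) (auto simp: space_uniform_count_measure)

lemma AE_empirical: "(\<And>i. i < n \<Longrightarrow> P (x i)) \<Longrightarrow> Measurable.pred borel P \<Longrightarrow> AE z in empirical n x. P z"
proof -
  assume "\<And>i. i < n \<Longrightarrow> P (x i)" and [measurable]: "Measurable.pred borel P"
  moreover have m: "x \<in> uniform_count_measure {..<n} \<rightarrow>\<^sub>M borel"
    by (simp cong: measurable_cong_sets add: sets_uniform_count_measure_count_space)
  ultimately show ?thesis
    unfolding empirical_def by (subst AE_distr_iff[OF m]) (auto simp: space_uniform_count_measure intro!: AE_I2)
qed

lemma random_law_empirical:
  fixes X :: "nat \<Rightarrow> 'w \<Rightarrow> 'a::euclidean_space"
  assumes n: "0 < n" and X: "\<And>i. i < n \<Longrightarrow> X i \<in> borel_measurable N"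
  shows "random_law N (\<lambda>w. empirical n (\<lambda>i. X i w))"
proof -
  have e: "cdf (proj_law \<theta> (empirical n x)) s = (\<Sum>i<n. step (\<theta> \<bullet> x i) s) / real n" for \<theta> s and x :: "nat \<Rightarrow> 'a"
    unfolding cdf_proj_law(1)[OF empirical_law[OF n]] by (rule integral_empirical) measurable
  have "(\<lambda>w. step (fst (snd w) \<bullet> X i (fst w)) (snd (snd w))) \<in> borel_measurable (N \<Otimes>\<^sub>M (borel \<Otimes>\<^sub>M borel))" if "i < n" for i
  proof -
    note [measurable] = X[OF that]
    show ?thesis by measurable
  qed
  then have "(\<lambda>w. (\<Sum>i<n. step (fst (snd w) \<bullet> X i (fst w)) (snd (snd w))) / real n) \<in> borel_measurable (N \<Otimes>\<^sub>M (borel \<Otimes>\<^sub>M borel))"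
    by (intro borel_measurable_divide borel_measurable_sum) auto
  then show ?thesis
    unfolding random_law_def case_prod_beta' e using empirical_law[OF n] by auto
qed

lemma sample_mean_second_moment:
  fixes X :: "nat \<Rightarrow> 'w \<Rightarrow> 'a::euclidean_space"
  assumes M: "prob_space M" and n: "0 < n" and ind: "prob_space.indep_vars M (\<lambda>_. borel) X {..<n}"
    and X: "\<And>i. i < n \<Longrightarrow> distr M borel (X i) = \<rho>"
    and [measurable]: "g \<in> borel_measurable borel" and B: "\<And>x. \<bar>g x\<bar> \<le> B"
  shows "(\<integral>w. ((\<integral>z. g z \<partial>empirical n (\<lambda>i. X i w)) - (\<integral>z. g z \<partial>\<rho>))\<^sup>2 \<partial>M) = (\<integral>z. (g z - (\<integral>u. g u \<partial>\<rho>))\<^sup>2 \<partial>\<rho>) / real n"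
proof -
  interpret prob_space M by fact
  define m where "m = (\<integral>z. g z \<partial>\<rho>)"
  define V where "V = (\<integral>z. (g z - m)\<^sup>2 \<partial>\<rho>)"
  define Z where "Z i w = g (X i w) - m" for i w
  have rv: "X i \<in> borel_measurable M" if "i < n" for i using ind that by (auto simp: indep_vars_def)
  interpret \<rho>: prob_space \<rho> using prob_space_distr[OF rv[OF n]] X[OF n] by simp
  have s\<rho> [measurable_cong]: "sets \<rho> = sets borel" using X[OF n, symmetric] by simp
  have ig: "integrable \<rho> g" using B by (intro \<rho>.integrable_const_bound[where B = B]) auto
  have Zb: "\<bar>Z i w\<bar> \<le> B + \<bar>m\<bar>" for i w using B[of "X i w"] by (simp add: Z_def)
  have ind': "indep_vars (\<lambda>_. borel) Z {..<n}"
    unfolding Z_def by (rule indep_vars_compose2[OF ind]) measurable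
  have E: "expectation (\<lambda>w. h (X i w)) = (\<integral>z. h z \<partial>\<rho>)" if "i < n" "h \<in> borel_measurable borel" for h :: "'a \<Rightarrow> real" and i
    using rv[OF that(1)] that(2) by (simp add: X[OF that(1), symmetric] integral_distr)
  have mean: "expectation (Z i) = 0" if "i \<in> {..<n}" for i
    unfolding Z_def using E[of i "\<lambda>x. g x - m"] that ig by (simp add: m_def \<rho>.prob_space)
  have "expectation (\<lambda>w. (\<Sum>i<n. Z i w)\<^sup>2) = (\<Sum>i<n. expectation (\<lambda>w. (Z i w)\<^sup>2))"
    by (rule second_moment_sum[OF _ ind' Zb mean]) auto
  also have "\<dots> = (\<Sum>i<n. V)"
    unfolding V_def Z_def by (intro sum.cong refl E) auto
  finally have S: "expectation (\<lambda>w. (\<Sum>i<n. Z i w)\<^sup>2) = real n * V" by simp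
  have "((\<integral>z. g z \<partial>empirical n (\<lambda>i. X i w)) - m)\<^sup>2 = (\<Sum>i<n. Z i w)\<^sup>2 / (real n)\<^sup>2" for w
  proof -
    have "(\<integral>z. g z \<partial>empirical n (\<lambda>i. X i w)) - m = (\<Sum>i<n. Z i w) / real n"
      using n by (simp add: integral_empirical Z_def sum_subtractf diff_divide_distrib)
    then show ?thesis by (simp add: power_divide)
  qed
  then have "(\<integral>w. ((\<integral>z. g z \<partial>empirical n (\<lambda>i. X i w)) - m)\<^sup>2 \<partial>M) = real n * V / (real n)\<^sup>2"
    using S by simp
  then show ?thesis using n by (simp add: m_def V_def power2_eq_square)
qed

lemma abs_step_le: "\<bar>step x s\<bar> \<le> 1"
  by (simp add: step_def)

lemma variance_step:
  assumes "prob_space \<rho>" "sets \<rho> = sets borel"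
  shows "(\<integral>z. (step (\<theta> \<bullet> z) s - (\<integral>u. step (\<theta> \<bullet> u) s \<partial>\<rho>))\<^sup>2 \<partial>\<rho>)
    = cdf (proj_law \<theta> \<rho>) s * (1 - cdf (proj_law \<theta> \<rho>) s)"
proof -
  interpret prob_space \<rho> by fact
  have [measurable_cong]: "sets \<rho> = sets borel" by fact
  let ?F = "cdf (proj_law \<theta> \<rho>) s"
  have i: "integrable \<rho> (\<lambda>z. step (\<theta> \<bullet> z) s)"
    by (intro integrable_const_bound[where B = 1]) (auto simp: step_def)
  have "(\<integral>z. (step (\<theta> \<bullet> z) s - ?F)\<^sup>2 \<partial>\<rho>) = (\<integral>z. step (\<theta> \<bullet> z) s * (1 - 2 * ?F) + ?F\<^sup>2 \<partial>\<rho>)"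
    by (intro Bochner_Integration.integral_cong) (auto simp: step_def power2_eq_square algebra_simps)
  also have "\<dots> = ?F * (1 - 2 * ?F) + ?F\<^sup>2" using i by (simp add: prob_space cdf_proj_law(1)[OF assms])
  finally show ?thesis by (simp add: cdf_proj_law(1)[OF assms] power2_eq_square algebra_simps)
qed

text \<open>
The mean squared error of the estimated distribution functions is of order 1 / n with a constant proportional to F (1 - F).
This factor is essential: it vanishes at the levels 0 and 1, where ties of the gap occur. The constant 4 leaves room for the
bootstrap, whose error has two sources.
\<close>
definition root_n_estimator :: "'w measure \<Rightarrow> nat \<Rightarrow> real \<Rightarrow> 'a::euclidean_space measure \<Rightarrow> ('w \<Rightarrow> 'a measure) \<Rightarrow> bool" where
  "root_n_estimator N n R \<mu> \<alpha> \<longleftrightarrow> random_law N \<alpha> \<and> (AE w in N. AE x in \<alpha> w. norm x \<le> R) \<and>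
     (\<forall>\<theta> s. (\<integral>w. (cdf (proj_law \<theta> (\<alpha> w)) s - cdf (proj_law \<theta> \<mu>) s)\<^sup>2 \<partial>N)
        \<le> 4 * (cdf (proj_law \<theta> \<mu>) s * (1 - cdf (proj_law \<theta> \<mu>) s)) / real n)"

lemma root_n_estimator_const:
  assumes mu: "prob_space \<mu>" "sets \<mu> = sets borel" "AE x in \<mu>. norm x \<le> R"
  shows "root_n_estimator N n R \<mu> (\<lambda>_. \<mu>)"
  using cdf_proj_law_bounds[OF mu(1,2)] mu unfolding root_n_estimator_def
  by (auto intro!: random_law_const mult_nonneg_nonneg divide_nonneg_nonneg)

lemma root_n_estimator_compose:
  assumes a: "root_n_estimator N n R \<mu> \<alpha>" and h: "h \<in> L \<rightarrow>\<^sub>M N" and d: "distr L N h = N"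
  shows "root_n_estimator L n R \<mu> (\<lambda>w. \<alpha> (h w))"
  unfolding root_n_estimator_def
proof (intro conjI allI)
  have rl: "random_law N \<alpha>" using a by (simp add: root_n_estimator_def)
  show "random_law L (\<lambda>w. \<alpha> (h w))" by (rule random_law_compose[OF rl h])
  show "AE w in L. AE x in \<alpha> (h w). norm x \<le> R"
    by (rule AE_distrD[OF h], subst d) (use a in \<open>simp add: root_n_estimator_def\<close>)
  fix \<theta> s
  have [measurable]: "(\<lambda>w. cdf (proj_law \<theta> (\<alpha> w)) s) \<in> borel_measurable N"
    by (rule random_lawD(3)[OF rl, where h = "\<lambda>w. w" and f = "\<lambda>_. \<theta>" and g = "\<lambda>_. s"]) auto
  have "(\<integral>w. (cdf (proj_law \<theta> (\<alpha> (h w))) s - cdf (proj_law \<theta> \<mu>) s)\<^sup>2 \<partial>L)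
      = (\<integral>w. (cdf (proj_law \<theta> (\<alpha> w)) s - cdf (proj_law \<theta> \<mu>) s)\<^sup>2 \<partial>N)"
    using integral_distr[OF h, of "\<lambda>w. (cdf (proj_law \<theta> (\<alpha> w)) s - cdf (proj_law \<theta> \<mu>) s)\<^sup>2"] by (simp add: d)
  then show "(\<integral>w. (cdf (proj_law \<theta> (\<alpha> (h w))) s - cdf (proj_law \<theta> \<mu>) s)\<^sup>2 \<partial>L)
      \<le> 4 * (cdf (proj_law \<theta> \<mu>) s * (1 - cdf (proj_law \<theta> \<mu>) s)) / real n"
    using a by (simp add: root_n_estimator_def)
qed

text \<open>
Resampling draws indices, not points. The indices then live on a space that does not depend on the data, and data and
resampling together live on a product space.
\<close>
definition resample_space :: "nat \<Rightarrow> (nat \<Rightarrow> nat) measure" where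
  "resample_space n = (\<Pi>\<^sub>M i\<in>{..<n}. uniform_count_measure {..<n})"

lemma prob_space_resample_space: "0 < n \<Longrightarrow> prob_space (resample_space n)"
  unfolding resample_space_def by (intro prob_space_PiM prob_space_uniform_count_measure) auto

lemma resample_index_less: "k \<in> space (resample_space n) \<Longrightarrow> i < n \<Longrightarrow> k i < n"
  by (auto simp: resample_space_def space_PiM space_uniform_count_measure)

lemma measurable_resample_index: "i < n \<Longrightarrow> (\<lambda>k. k i) \<in> resample_space n \<rightarrow>\<^sub>M count_space {..<n}"
proof -
  assume "i < n"
  then have "(\<lambda>k. k i) \<in> resample_space n \<rightarrow>\<^sub>M uniform_count_measure {..<n}"
    unfolding resample_space_def by simp
  then show ?thesis
    unfolding measurable_cong_sets[OF refl sets_uniform_count_measure_count_space] .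
qed

lemma indep_resample:
  fixes x :: "nat \<Rightarrow> 'a::euclidean_space"
  assumes n: "0 < n"
  shows "prob_space.indep_vars (resample_space n) (\<lambda>_. borel) (\<lambda>i k. x (k i)) {..<n}"
    and "i < n \<Longrightarrow> distr (resample_space n) borel (\<lambda>k. x (k i)) = empirical n x"
proof -
  interpret prob_space "resample_space n" by (rule prob_space_resample_space[OF n])
  let ?U = "uniform_count_measure {..<n}"
  have comp: "(\<lambda>k. k i) \<in> resample_space n \<rightarrow>\<^sub>M ?U" if "i < n" for i
    using that unfolding resample_space_def by simp
  have d: "distr (resample_space n) ?U (\<lambda>k. k i) = ?U" if "i < n" for i
    unfolding resample_space_def using that n
    by (intro distr_PiM_component prob_space_uniform_count_measure) auto
  have x: "x \<in> ?U \<rightarrow>\<^sub>M borel"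
    by (simp cong: measurable_cong_sets add: sets_uniform_count_measure_count_space)
  have "indep_vars (\<lambda>_. ?U) (\<lambda>i k. k i) {..<n}"
  proof (subst indep_vars_iff_distr_eq_PiM')
    show "{..<n} \<noteq> {}" using n by auto
    have "distr (resample_space n) (\<Pi>\<^sub>M i\<in>{..<n}. ?U) (\<lambda>k. \<lambda>i\<in>{..<n}. k i) = distr (resample_space n) (\<Pi>\<^sub>M i\<in>{..<n}. ?U) (\<lambda>k. k)"
      by (intro distr_cong) (auto simp: resample_space_def space_PiM PiE_def extensional_restrict)
    also have "\<dots> = (\<Pi>\<^sub>M i\<in>{..<n}. ?U)" by (simp add: resample_space_def distr_id2)
    also have "\<dots> = (\<Pi>\<^sub>M i\<in>{..<n}. distr (resample_space n) ?U (\<lambda>k. k i))"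
      by (intro PiM_cong) (auto simp: d)
    finally show "distr (resample_space n) (\<Pi>\<^sub>M i\<in>{..<n}. ?U) (\<lambda>k. \<lambda>i\<in>{..<n}. k i) = (\<Pi>\<^sub>M i\<in>{..<n}. distr (resample_space n) ?U (\<lambda>k. k i))" .
  qed (use comp in auto)
  then show "indep_vars (\<lambda>_. borel) (\<lambda>i k. x (k i)) {..<n}"
    by (rule indep_vars_compose2) (rule x)
  show "distr (resample_space n) borel (\<lambda>k. x (k i)) = empirical n x" if "i < n"
  proof -
    have "distr (resample_space n) borel (\<lambda>k. x (k i)) = distr (distr (resample_space n) ?U (\<lambda>k. k i)) borel x"
      using comp[OF that] x by (subst distr_distr) (auto simp: comp_def)
    then show ?thesis by (simp add: d[OF that] empirical_def)
  qed
qed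

lemma bootstrap_law_eq_distr:
  fixes x :: "nat \<Rightarrow> 'a::euclidean_space"
  assumes n: "0 < n"
  shows "bootstrap_law n x = distr (resample_space n) (\<Pi>\<^sub>M i\<in>{..<n}. borel) (\<lambda>k. \<lambda>i\<in>{..<n}. x (k i))"
proof -
  interpret prob_space "resample_space n" by (rule prob_space_resample_space[OF n])
  have "distr (resample_space n) (\<Pi>\<^sub>M i\<in>{..<n}. borel) (\<lambda>k. \<lambda>i\<in>{..<n}. x (k i))
      = (\<Pi>\<^sub>M i\<in>{..<n}. distr (resample_space n) borel (\<lambda>k. x (k i)))"
    using indep_resample(1)[OF n, of x] n
    by (subst indep_vars_iff_distr_eq_PiM'[symmetric]) (auto simp: indep_vars_def)
  also have "\<dots> = bootstrap_law n x"
    unfolding bootstrap_law_def using indep_resample(2)[OF n, of _ x] by (intro PiM_cong) auto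
  finally show ?thesis ..
qed

lemma root_n_estimator_empirical:
  fixes X :: "nat \<Rightarrow> 'w \<Rightarrow> 'a::euclidean_space"
  assumes M: "prob_space M" and n: "0 < n" and ind: "prob_space.indep_vars M (\<lambda>_. borel) X {..<n}"
    and X: "\<And>i. i < n \<Longrightarrow> distr M borel (X i) = \<mu>"
    and mu: "prob_space \<mu>" "sets \<mu> = sets borel" "AE x in \<mu>. norm x \<le> R"
  shows "root_n_estimator M n R \<mu> (\<lambda>w. empirical n (\<lambda>i. X i w))"
    and "AE w in M. \<forall>i<n. norm (X i w) \<le> R"
    and "(\<integral>w. (cdf (proj_law \<theta> (empirical n (\<lambda>i. X i w))) s - cdf (proj_law \<theta> \<mu>) s)\<^sup>2 \<partial>M)
        = cdf (proj_law \<theta> \<mu>) s * (1 - cdf (proj_law \<theta> \<mu>) s) / real n"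
proof -
  interpret prob_space M by fact
  have rv: "X i \<in> borel_measurable M" if "i < n" for i using ind that by (auto simp: indep_vars_def)
  have "AE w in M. \<forall>i\<in>{..<n}. norm (X i w) \<le> R"
  proof (intro AE_finite_allI)
    fix i assume i: "i \<in> {..<n}"
    have "AE x in distr M borel (X i). norm x \<le> R" by (subst X) (use i mu(3) in auto)
    from AE_distrD[OF rv this] i show "AE w in M. norm (X i w) \<le> R" by simp
  qed simp
  then show ae: "AE w in M. \<forall>i<n. norm (X i w) \<le> R" by (auto elim!: eventually_mono)
  show eq: "(\<integral>w. (cdf (proj_law \<theta> (empirical n (\<lambda>i. X i w))) s - cdf (proj_law \<theta> \<mu>) s)\<^sup>2 \<partial>M)
        = cdf (proj_law \<theta> \<mu>) s * (1 - cdf (proj_law \<theta> \<mu>) s) / real n" for \<theta> s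
    using sample_mean_second_moment[OF M n ind X, of "\<lambda>x. step (\<theta> \<bullet> x) s" 1]
    by (simp add: variance_step[OF mu(1,2)] cdf_proj_law(1)[OF empirical_law[OF n]] cdf_proj_law(1)[OF mu(1,2)] abs_step_le)
  show "root_n_estimator M n R \<mu> (\<lambda>w. empirical n (\<lambda>i. X i w))"
    unfolding root_n_estimator_def
  proof (intro conjI allI)
    show "random_law M (\<lambda>w. empirical n (\<lambda>i. X i w))" by (rule random_law_empirical[OF n rv])
    show "AE w in M. AE x in empirical n (\<lambda>i. X i w). norm x \<le> R"
      using ae by (rule eventually_mono) (auto intro!: AE_empirical)
    show "(\<integral>w. (cdf (proj_law \<theta> (empirical n (\<lambda>i. X i w))) s - cdf (proj_law \<theta> \<mu>) s)\<^sup>2 \<partial>M)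
        \<le> 4 * (cdf (proj_law \<theta> \<mu>) s * (1 - cdf (proj_law \<theta> \<mu>) s)) / real n" for \<theta> s
      unfolding eq using cdf_proj_law_bounds[OF mu(1,2), of \<theta> s] by (intro divide_right_mono) auto
  qed
qed

text \<open>
The error is that of the sample plus that of resampling from it. Given the data, the mean squared error of the latter is
F' (1 - F') / n with the empirical distribution function F', whose mean is at most F (1 - F) / n by concavity. The
inequality (u + v)^2 \<le> 2 u^2 + 2 v^2 then leads to the constant 4.
\<close>
lemma root_n_estimator_bootstrap:
  fixes X :: "nat \<Rightarrow> 'w \<Rightarrow> 'a::euclidean_space"
  assumes M: "prob_space M" and n: "0 < n" and ind: "prob_space.indep_vars M (\<lambda>_. borel) X {..<n}"
    and X: "\<And>i. i < n \<Longrightarrow> distr M borel (X i) = \<mu>"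
    and mu: "prob_space \<mu>" "sets \<mu> = sets borel" "AE x in \<mu>. norm x \<le> R"
    and Q: "prob_space Q" and \<kappa>: "\<kappa> \<in> Q \<rightarrow>\<^sub>M resample_space n" and d: "distr Q (resample_space n) \<kappa> = resample_space n"
  shows "root_n_estimator (M \<Otimes>\<^sub>M Q) n R \<mu> (\<lambda>w. empirical n (\<lambda>i. X (\<kappa> (snd w) i) (fst w)))"
  unfolding root_n_estimator_def
proof (intro conjI allI)
  interpret M: prob_space M by fact
  interpret Q: prob_space Q by fact
  interpret MQ: pair_sigma_finite M Q by standard
  interpret MQ: prob_space "M \<Otimes>\<^sub>M Q" by (rule prob_space_pair) fact+
  note est = root_n_estimator_empirical[OF M n ind X mu]
  have rv: "X i \<in> borel_measurable M" if "i < n" for i using ind that by (auto simp: M.indep_vars_def)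
  have meas: "(\<lambda>w. X (\<kappa> (snd w) i) (fst w)) \<in> borel_measurable (M \<Otimes>\<^sub>M Q)" if i: "i < n" for i
  proof (rule measurable_compose_countable'[where I = "{..<n}" and g = "\<lambda>w. \<kappa> (snd w) i" and f = "\<lambda>j w. X j (fst w)"])
    show "(\<lambda>w. X j (fst w)) \<in> borel_measurable (M \<Otimes>\<^sub>M Q)" if "j \<in> {..<n}" for j
      using rv that by (intro measurable_compose[OF measurable_fst]) auto
    show "(\<lambda>w. \<kappa> (snd w) i) \<in> M \<Otimes>\<^sub>M Q \<rightarrow>\<^sub>M count_space {..<n}"
      by (rule measurable_compose[OF measurable_compose[OF measurable_snd \<kappa>] measurable_resample_index[OF i]])
  qed simp
  show rl: "random_law (M \<Otimes>\<^sub>M Q) (\<lambda>w. empirical n (\<lambda>i. X (\<kappa> (snd w) i) (fst w)))"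
    by (rule random_law_empirical[OF n meas])
  have ae: "AE w in M \<Otimes>\<^sub>M Q. \<forall>i<n. norm (X i (fst w)) \<le> R"
    by (rule AE_distrD[OF measurable_fst], subst Q.distr_pair_fst) (rule est(2))
  show "AE w in M \<Otimes>\<^sub>M Q. AE x in empirical n (\<lambda>i. X (\<kappa> (snd w) i) (fst w)). norm x \<le> R"
  proof (rule AE_mp[OF ae], rule AE_I2, rule impI)
    fix w assume "w \<in> space (M \<Otimes>\<^sub>M Q)" and *: "\<forall>i<n. norm (X i (fst w)) \<le> R"
    then have "\<kappa> (snd w) \<in> space (resample_space n)" using measurable_space[OF \<kappa>] by (auto simp: space_pair_measure)
    then show "AE x in empirical n (\<lambda>i. X (\<kappa> (snd w) i) (fst w)). norm x \<le> R"
      using * resample_index_less by (intro AE_empirical) auto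
  qed
  fix \<theta> s
  let ?F = "cdf (proj_law \<theta> \<mu>) s"
  let ?F1 = "\<lambda>w. cdf (proj_law \<theta> (empirical n (\<lambda>i. X i w))) s"
  let ?F2 = "\<lambda>w q. cdf (proj_law \<theta> (empirical n (\<lambda>i. X (\<kappa> q i) w))) s"
  have F1b: "0 \<le> ?F1 w" "?F1 w \<le> 1" for w by (rule cdf_proj_law_bounds[OF empirical_law[OF n]])+
  have F2b: "0 \<le> ?F2 w q" "?F2 w q \<le> 1" for w q by (rule cdf_proj_law_bounds[OF empirical_law[OF n]])+
  have Fb: "0 \<le> ?F" "?F \<le> 1" by (rule cdf_proj_law_bounds[OF mu(1,2)])+
  have [measurable]: "?F1 \<in> borel_measurable M"
    by (rule random_lawD(3)[OF random_law_empirical[OF n rv], where h = "\<lambda>w. w" and f = "\<lambda>_. \<theta>" and g = "\<lambda>_. s"]) auto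
  have [measurable]: "(\<lambda>w. ?F2 (fst w) (snd w)) \<in> borel_measurable (M \<Otimes>\<^sub>M Q)"
    by (rule random_lawD(3)[OF rl, where h = "\<lambda>w. w" and f = "\<lambda>_. \<theta>" and g = "\<lambda>_. s"]) auto
  have sq1: "(u - v)\<^sup>2 \<le> 1" if "0 \<le> u" "u \<le> 1" "0 \<le> v" "v \<le> 1" for u v :: real
    using that by (simp add: abs_square_le_1 abs_le_iff)
  have i1: "integrable M (\<lambda>w. (?F1 w - ?F)\<^sup>2)"
    using sq1[OF F1b Fb] by (intro M.integrable_const_bound[where B = 1]) auto
  have i0: "integrable M ?F1" using F1b by (intro M.integrable_const_bound[where B = 1]) auto
  have i2: "integrable (M \<Otimes>\<^sub>M Q) (\<lambda>w. (?F2 (fst w) (snd w) - ?F1 (fst w))\<^sup>2)"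
    using sq1[OF F2b F1b] by (intro MQ.integrable_const_bound[where B = 1]) auto
  have i3: "integrable (M \<Otimes>\<^sub>M Q) (\<lambda>w. (?F1 (fst w) - ?F)\<^sup>2)"
    using sq1[OF F1b Fb] by (intro MQ.integrable_const_bound[where B = 1]) auto
  have i4: "integrable (M \<Otimes>\<^sub>M Q) (\<lambda>w. (?F2 (fst w) (snd w) - ?F)\<^sup>2)"
    using sq1[OF F2b Fb] by (intro MQ.integrable_const_bound[where B = 1]) auto
  have inner: "(\<integral>q. (?F2 w q - ?F1 w)\<^sup>2 \<partial>Q) = ?F1 w * (1 - ?F1 w) / real n" for w
  proof -
    let ?x = "\<lambda>i. X i w"
    have "(\<integral>k. (cdf (proj_law \<theta> (empirical n (\<lambda>i. ?x (k i)))) s - ?F1 w)\<^sup>2 \<partial>resample_space n) = ?F1 w * (1 - ?F1 w) / real n"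
      using sample_mean_second_moment[OF prob_space_resample_space[OF n] n indep_resample(1)[OF n, of ?x] indep_resample(2)[OF n, of _ ?x],
          of "\<lambda>x. step (\<theta> \<bullet> x) s" 1]
      by (simp add: variance_step[OF empirical_law[OF n]] cdf_proj_law(1)[OF empirical_law[OF n]] abs_step_le)
    moreover have "(\<lambda>k. (cdf (proj_law \<theta> (empirical n (\<lambda>i. ?x (k i)))) s - ?F1 w)\<^sup>2) \<in> borel_measurable (resample_space n)"
    proof -
      have "(\<lambda>k. ?x (k i)) \<in> borel_measurable (resample_space n)" if "i < n" for i
        by (rule measurable_compose[OF measurable_resample_index[OF that]]) simp
      from random_lawD(3)[OF random_law_empirical[OF n this], where h = "\<lambda>w. w" and f = "\<lambda>_. \<theta>" and g = "\<lambda>_. s"]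
      have [measurable]: "(\<lambda>k. cdf (proj_law \<theta> (empirical n (\<lambda>i. ?x (k i)))) s) \<in> borel_measurable (resample_space n)" by auto
      show ?thesis by measurable
    qed
    ultimately show ?thesis using \<kappa> by (subst (asm) d[symmetric]) (simp add: integral_distr)
  qed
  have mean: "M.expectation ?F1 = ?F"
  proof -
    have "?F1 w = (\<Sum>i<n. step (\<theta> \<bullet> X i w) s) / real n" for w
      unfolding cdf_proj_law(1)[OF empirical_law[OF n]] by (rule integral_empirical) measurable
    then have "M.expectation ?F1 = (\<Sum>i<n. M.expectation (\<lambda>w. step (\<theta> \<bullet> X i w) s)) / real n"
      using rv by (simp, subst Bochner_Integration.integral_sum)
        (auto intro!: M.integrable_const_bound[where B = 1] simp: step_def)
    also have "\<dots> = (\<Sum>i<n. ?F) / real n"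
    proof (intro arg_cong2[where f = "(/)"] sum.cong refl)
      fix i assume i: "i \<in> {..<n}"
      then show "M.expectation (\<lambda>w. step (\<theta> \<bullet> X i w) s) = ?F"
        unfolding cdf_proj_law(1)[OF mu(1,2)] using rv[of i] by (simp add: X[of i, symmetric] integral_distr)
    qed
    finally show ?thesis using n by simp
  qed
  have "(\<integral>w. (?F2 (fst w) (snd w) - ?F1 (fst w))\<^sup>2 \<partial>(M \<Otimes>\<^sub>M Q)) = (\<integral>w. ?F1 w * (1 - ?F1 w) / real n \<partial>M)"
    using MQ.integral_fst'[OF i2] by (simp add: inner)
  also have "\<dots> \<le> ?F * (1 - ?F) / real n"
  proof -
    \<comment> \<open>expand F1 around its mean F; the loss is exactly the variance of F1\<close>
    have "(\<integral>w. ?F1 w * (1 - ?F1 w) \<partial>M) = (\<integral>w. ?F1 w * (1 - 2 * ?F) + ?F\<^sup>2 - (?F1 w - ?F)\<^sup>2 \<partial>M)"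
      by (intro Bochner_Integration.integral_cong) (auto simp: power2_eq_square algebra_simps)
    also have "\<dots> = ?F * (1 - 2 * ?F) + ?F\<^sup>2 - M.expectation (\<lambda>w. (?F1 w - ?F)\<^sup>2)"
      using i0 i1 by (simp add: mean M.prob_space)
    also have "\<dots> = ?F * (1 - ?F) - M.expectation (\<lambda>w. (?F1 w - ?F)\<^sup>2)"
      by (simp add: power2_eq_square right_diff_distrib)
    also have "\<dots> \<le> ?F * (1 - ?F)" by simp
    finally show ?thesis using n by (simp add: divide_right_mono)
  qed
  finally have b2: "(\<integral>w. (?F2 (fst w) (snd w) - ?F1 (fst w))\<^sup>2 \<partial>(M \<Otimes>\<^sub>M Q)) \<le> ?F * (1 - ?F) / real n" .
  have b1: "(\<integral>w. (?F1 (fst w) - ?F)\<^sup>2 \<partial>(M \<Otimes>\<^sub>M Q)) = ?F * (1 - ?F) / real n"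
    using MQ.integral_fst'[OF i3] by (simp add: est(3) Q.prob_space)
  have "(\<integral>w. (?F2 (fst w) (snd w) - ?F)\<^sup>2 \<partial>(M \<Otimes>\<^sub>M Q))
      \<le> (\<integral>w. 2 * (?F2 (fst w) (snd w) - ?F1 (fst w))\<^sup>2 + 2 * (?F1 (fst w) - ?F)\<^sup>2 \<partial>(M \<Otimes>\<^sub>M Q))"
  proof (rule integral_mono[OF i4])
    show "integrable (M \<Otimes>\<^sub>M Q) (\<lambda>w. 2 * (?F2 (fst w) (snd w) - ?F1 (fst w))\<^sup>2 + 2 * (?F1 (fst w) - ?F)\<^sup>2)"
      using i2 i3 by auto
    have "(u - v)\<^sup>2 \<le> 2 * (u - m)\<^sup>2 + 2 * (m - v)\<^sup>2" for u v m :: real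
      using zero_le_power2[of "(u - m) - (m - v)"] by (simp add: power2_eq_square algebra_simps)
    then show "(?F2 (fst w) (snd w) - ?F)\<^sup>2 \<le> 2 * (?F2 (fst w) (snd w) - ?F1 (fst w))\<^sup>2 + 2 * (?F1 (fst w) - ?F)\<^sup>2" for w .
  qed
  also have "\<dots> \<le> 4 * (?F * (1 - ?F)) / real n"
    using i2 i3 b1 b2 by simp
  finally show "(\<integral>w. (cdf (proj_law \<theta> (empirical n (\<lambda>i. X (\<kappa> (snd w) i) (fst w)))) s - ?F)\<^sup>2 \<partial>(M \<Otimes>\<^sub>M Q))
      \<le> 4 * (?F * (1 - ?F)) / real n" .
qed

section \<open>The linearization error is negligible\<close>

lemma sum_abs_square_le: "(\<bar>u\<bar> + \<bar>v\<bar>)\<^sup>2 \<le> 2 * u\<^sup>2 + 2 * v\<^sup>2" for u v :: real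
  using zero_le_power2[of "\<bar>u\<bar> - \<bar>v\<bar>"] unfolding power2_sum power2_diff power2_abs by linarith

text \<open>
A first moment is bounded by a second moment, with a parameter l that can be chosen freely.
\<close>
lemma le_scaled_square: "0 < l \<Longrightarrow> q \<le> (l + q\<^sup>2 / l) / 2" for q l :: real
  using zero_le_power2[of "q - l"] by (simp add: field_simps power2_eq_square)

text \<open>
The error of the linearization is integrated first over the randomness, for fixed z. Where D z \<noteq> 0, the second bound of
pos_part_linearization_error makes the scaled mean error of order 1 / sqrt n. Where D z = 0, the constant C z in the mean
squared errors is 0, so the estimates are exact. The first bound of that lemma provides a uniform majorant, and dominated
convergence applies.
\<close>
lemma linearization_error_vanishes:
  fixes N :: "'z measure" and P :: "nat \<Rightarrow> 'w measure" and D :: "'z \<Rightarrow> real" and D1 D2 :: "nat \<Rightarrow> 'w \<Rightarrow> 'z \<Rightarrow> real"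
  assumes N: "finite_measure N" and P: "\<And>n. 0 < n \<Longrightarrow> prob_space (P n)"
    and Dm: "D \<in> borel_measurable N" and Db: "\<And>z. \<bar>D z\<bar> \<le> 1"
    and D1m: "\<And>n. 0 < n \<Longrightarrow> (\<lambda>(w, z). D1 n w z) \<in> borel_measurable (P n \<Otimes>\<^sub>M N)" and D1b: "\<And>n w z. 0 < n \<Longrightarrow> \<bar>D1 n w z\<bar> \<le> 1"
    and D2m: "\<And>n. 0 < n \<Longrightarrow> (\<lambda>(w, z). D2 n w z) \<in> borel_measurable (P n \<Otimes>\<^sub>M N)" and D2b: "\<And>n w z. 0 < n \<Longrightarrow> \<bar>D2 n w z\<bar> \<le> 1"
    and b1: "\<And>n z. 0 < n \<Longrightarrow> z \<in> space N \<Longrightarrow> (\<integral>w. (D1 n w z - D z)\<^sup>2 \<partial>P n) \<le> C z / real n"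
    and b2: "\<And>n z. 0 < n \<Longrightarrow> z \<in> space N \<Longrightarrow> (\<integral>w. (D2 n w z - D z)\<^sup>2 \<partial>P n) \<le> C z / real n"
    and C: "\<And>z. 0 \<le> C z" "\<And>z. C z \<le> c" and tie: "AE z in N. D z = 0 \<longrightarrow> C z = 0"
  shows "(\<lambda>n. sqrt (real n) * (\<integral>w. \<bar>\<integral>z. max 0 (D2 n w z) - max 0 (D1 n w z) - of_bool (0 < D z) * (D2 n w z - D1 n w z) \<partial>N\<bar> \<partial>P n))
    \<longlonglongrightarrow> 0"
proof (rule LIMSEQ_imp_Suc)
  let ?e = "\<lambda>n w z. max 0 (D2 n w z) - max 0 (D1 n w z) - of_bool (0 < D z) * (D2 n w z - D1 n w z)"
  interpret N: finite_measure N by fact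
  define S where "S n w z = \<bar>D1 n w z - D z\<bar> + \<bar>D2 n w z - D z\<bar>" for n w z
  define e where "e n z = sqrt (real n) * (\<integral>w. \<bar>?e n w z\<bar> \<partial>P n)" for n z
  have key: "sqrt (real n) * (\<integral>w. \<bar>\<integral>z. ?e n w z \<partial>N\<bar> \<partial>P n) \<le> (\<integral>z. e n z \<partial>N)"
    and em: "e n \<in> borel_measurable N"
    and eb: "z \<in> space N \<Longrightarrow> 0 < l \<Longrightarrow> e n z \<le> (l + 4 * C z / l) / 2"
    and ed: "z \<in> space N \<Longrightarrow> \<bar>D z\<bar> * e n z \<le> 4 * C z / sqrt (real n)"
    and e0: "0 \<le> e n z" if n: "0 < n" for n z and l :: real
  proof -
    interpret P: prob_space "P n" by (rule P[OF n])
    interpret PN: pair_sigma_finite "P n" N by standard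
    interpret PN: finite_measure "P n \<Otimes>\<^sub>M N" by (intro finite_measure_pair_measure P.finite_measure_axioms N)
    have [measurable]: "(\<lambda>x. D1 n (fst x) (snd x)) \<in> borel_measurable (P n \<Otimes>\<^sub>M N)"
      "(\<lambda>x. D2 n (fst x) (snd x)) \<in> borel_measurable (P n \<Otimes>\<^sub>M N)" "D \<in> borel_measurable N"
      using D1m[OF n] D2m[OF n] Dm by (simp_all add: case_prod_beta')
    have m1: "(\<lambda>w. D1 n w z) \<in> borel_measurable (P n)" "(\<lambda>w. D2 n w z) \<in> borel_measurable (P n)" if "z \<in> space N" for z
      using measurable_compose[OF measurable_Pair2'[OF that] D1m[OF n]] measurable_compose[OF measurable_Pair2'[OF that] D2m[OF n]]
      by simp_all
    have eS: "\<bar>?e n w z\<bar> \<le> S n w z" "\<bar>D z\<bar> * \<bar>?e n w z\<bar> \<le> (S n w z)\<^sup>2" for w z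
    proof -
      have s: "\<bar>D2 n w z - D1 n w z\<bar> \<le> S n w z" by (simp add: S_def)
      show "\<bar>?e n w z\<bar> \<le> S n w z" using pos_part_linearization_error(1)[of "D2 n w z" "D1 n w z" "D z"] s by linarith
      have "\<bar>D z\<bar> * \<bar>?e n w z\<bar> \<le> \<bar>D2 n w z - D1 n w z\<bar> * S n w z"
        unfolding S_def by (rule pos_part_linearization_error(2))
      also have "\<dots> \<le> S n w z * S n w z" using s by (intro mult_right_mono) (auto simp: S_def)
      finally show "\<bar>D z\<bar> * \<bar>?e n w z\<bar> \<le> (S n w z)\<^sup>2" by (simp add: power2_eq_square)
    qed
    have Sb: "0 \<le> S n w z" "S n w z \<le> 4" for w z
      using D1b[OF n, of w z] D2b[OF n, of w z] Db[of z] by (auto simp: S_def)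
    have eb4: "\<bar>?e n w z\<bar> \<le> 4" for w z using eS(1) Sb(2) by (rule order_trans)
    have ie: "integrable (P n \<Otimes>\<^sub>M N) (\<lambda>(w, z). ?e n w z)"
      unfolding case_prod_beta' using eb4 by (intro PN.integrable_const_bound[where B = 4] AE_I2) auto
    have iae: "integrable (P n \<Otimes>\<^sub>M N) (\<lambda>(w, z). \<bar>?e n w z\<bar>)"
      using integrable_abs[OF ie] by (simp add: case_prod_beta')
    have "(\<integral>w. \<bar>\<integral>z. ?e n w z \<partial>N\<bar> \<partial>P n) \<le> (\<integral>w. (\<integral>z. \<bar>?e n w z\<bar> \<partial>N) \<partial>P n)"
      using PN.integrable_fst[OF ie] PN.integrable_fst[OF iae] integral_norm_bound[of N "\<lambda>z. ?e n w z" for w]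
      by (intro integral_mono) auto
    also have "\<dots> = (\<integral>z. (\<integral>w. \<bar>?e n w z\<bar> \<partial>P n) \<partial>N)" by (rule PN.Fubini_integral[OF iae, symmetric])
    finally show "sqrt (real n) * (\<integral>w. \<bar>\<integral>z. ?e n w z \<partial>N\<bar> \<partial>P n) \<le> (\<integral>z. e n z \<partial>N)"
      unfolding e_def by (simp add: mult_left_mono)
    show "e n \<in> borel_measurable N"
      unfolding e_def using PN.integrable_snd[OF iae] by auto
    show "0 \<le> e n z" by (simp add: e_def)
    {
      assume z: "z \<in> space N"
      note [measurable] = m1[OF z]
      have Sm [measurable]: "(\<lambda>w. S n w z) \<in> borel_measurable (P n)" unfolding S_def by measurable
      have iS: "integrable (P n) (\<lambda>w. S n w z)" using Sb by (intro P.integrable_const_bound[where B = 4]) auto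
      have iS2: "integrable (P n) (\<lambda>w. (S n w z)\<^sup>2)"
        using power_mono[OF Sb(2,1), of _ _ 2] by (intro P.integrable_const_bound[where B = 16]) auto
      have i1: "integrable (P n) (\<lambda>w. \<bar>?e n w z\<bar>)" using eb4 by (intro P.integrable_const_bound[where B = 4]) auto
      have sq: "(u - v)\<^sup>2 \<le> 4" if "\<bar>u\<bar> \<le> 1" "\<bar>v\<bar> \<le> 1" for u v :: real
        using abs_le_square_iff[of "u - v" 2] that by auto
      have iD: "integrable (P n) (\<lambda>w. (D1 n w z - D z)\<^sup>2)" "integrable (P n) (\<lambda>w. (D2 n w z - D z)\<^sup>2)"
        using sq[OF D1b[OF n] Db] sq[OF D2b[OF n] Db] by (intro P.integrable_const_bound[where B = 4]; auto)+
      have "(\<integral>w. (S n w z)\<^sup>2 \<partial>P n) \<le> (\<integral>w. 2 * (D1 n w z - D z)\<^sup>2 + 2 * (D2 n w z - D z)\<^sup>2 \<partial>P n)"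
      proof (rule integral_mono[OF iS2])
        show "(S n w z)\<^sup>2 \<le> 2 * (D1 n w z - D z)\<^sup>2 + 2 * (D2 n w z - D z)\<^sup>2" for w
          unfolding S_def by (rule sum_abs_square_le)
      qed (use iD in auto)
      also have "\<dots> \<le> 4 * C z / real n" using iD b1[OF n z] b2[OF n z] by simp
      finally have ES: "(\<integral>w. (S n w z)\<^sup>2 \<partial>P n) \<le> 4 * C z / real n" .
      show "e n z \<le> (l + 4 * C z / l) / 2" if l: "0 < l"
      proof -
        have sn: "0 < sqrt (real n)" using n by simp
        have "sqrt (real n) * \<bar>?e n w z\<bar> \<le> (l + real n * (S n w z)\<^sup>2 / l) / 2" for w
        proof -
          have "sqrt (real n) * S n w z \<le> (l + real n * (S n w z)\<^sup>2 / l) / 2"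
            using le_scaled_square[OF l, of "sqrt (real n) * S n w z"] by (simp add: power_mult_distrib)
          moreover have "sqrt (real n) * \<bar>?e n w z\<bar> \<le> sqrt (real n) * S n w z" using eS(1) sn by (intro mult_left_mono) auto
          ultimately show ?thesis by linarith
        qed
        then have "(\<integral>w. sqrt (real n) * \<bar>?e n w z\<bar> \<partial>P n) \<le> (\<integral>w. (l + real n * (S n w z)\<^sup>2 / l) / 2 \<partial>P n)"
          using i1 iS2 by (intro integral_mono) auto
        also have "\<dots> = (l + real n * (\<integral>w. (S n w z)\<^sup>2 \<partial>P n) / l) / 2" using iS2 by (simp add: P.prob_space)
        also have "\<dots> \<le> (l + 4 * C z / l) / 2"
        proof -
          have "real n * (\<integral>w. (S n w z)\<^sup>2 \<partial>P n) \<le> 4 * C z" using ES n by (simp add: field_simps)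
          then have le: "real n * (\<integral>w. (S n w z)\<^sup>2 \<partial>P n) / l \<le> 4 * C z / l" using l by (intro divide_right_mono) auto
          show ?thesis by (rule divide_right_mono[OF add_left_mono[OF le]]) simp
        qed
        finally show ?thesis by (simp add: e_def)
      qed
      show "\<bar>D z\<bar> * e n z \<le> 4 * C z / sqrt (real n)"
      proof -
        have "(\<integral>w. \<bar>D z\<bar> * \<bar>?e n w z\<bar> \<partial>P n) \<le> (\<integral>w. (S n w z)\<^sup>2 \<partial>P n)"
          using i1 iS2 eS(2) by (intro integral_mono) auto
        then have "\<bar>D z\<bar> * (\<integral>w. \<bar>?e n w z\<bar> \<partial>P n) \<le> 4 * C z / real n" using ES by simp
        then have "sqrt (real n) * (\<bar>D z\<bar> * (\<integral>w. \<bar>?e n w z\<bar> \<partial>P n)) \<le> sqrt (real n) * (4 * C z / real n)"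
          by (intro mult_left_mono) auto
        also have "\<dots> = 4 * C z / sqrt (real n)"
          using n by (simp add: field_simps)
        finally show ?thesis by (simp add: e_def mult.left_commute)
      qed
    }
  qed
  have "(\<lambda>n. \<integral>z. e (Suc n) z \<partial>N) \<longlonglongrightarrow> (\<integral>z. 0 \<partial>N)"
  proof (rule integral_dominated_convergence[where w = "\<lambda>_. (1 + 4 * c) / 2"])
    show "AE z in N. norm (e (Suc n) z) \<le> (1 + 4 * c) / 2" for n
    proof (rule AE_I2)
      fix z assume z: "z \<in> space N"
      show "norm (e (Suc n) z) \<le> (1 + 4 * c) / 2"
        \<comment> \<open>the majorant is the bound by the second moment with l = 1\<close>
        using eb[of "Suc n" z 1] e0[of "Suc n" z] C(2)[of z] z by simp
    qed
    have sq0: "(\<lambda>n. 4 * C z / sqrt (real (Suc n))) \<longlonglongrightarrow> 0" for z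
    proof -
      have "filterlim (\<lambda>n. sqrt (real (Suc n))) at_top sequentially"
        using filterlim_compose[OF sqrt_at_top filterlim_compose[OF filterlim_real_sequentially filterlim_Suc]] by simp
      then show ?thesis by (intro tendsto_divide_0[OF tendsto_const] filterlim_at_top_imp_at_infinity)
    qed
    show "AE z in N. (\<lambda>n. e (Suc n) z) \<longlonglongrightarrow> 0"
      using tie AE_space
    proof eventually_elim
      case (elim z)
      show ?case
      proof (cases "D z = 0")
        case True
        then have "C z = 0" using elim by simp
        \<comment> \<open>with C z = 0 the bound by the second moment is l / 2 for every l\<close>
        then have "e (Suc n) z \<le> l" if "0 < l" for n l
          using eb[of "Suc n" z l] elim that by simp
        then have "e (Suc n) z = 0" for n
          using e0[of "Suc n" z] field_le_epsilon[of "e (Suc n) z" 0] by (auto intro: antisym)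
        then show ?thesis by simp
      next
        case False
        show ?thesis
        proof (rule Lim_null_comparison)
          show "\<forall>\<^sub>F n in sequentially. norm (e (Suc n) z) \<le> (4 * C z / sqrt (real (Suc n))) / \<bar>D z\<bar>"
          proof (rule always_eventually, rule allI)
            fix n
            have "e (Suc n) z \<le> (4 * C z / sqrt (real (Suc n))) / \<bar>D z\<bar>"
              using ed[of "Suc n" z] elim False by (subst pos_le_divide_eq) (auto simp: mult.commute)
            then show "norm (e (Suc n) z) \<le> (4 * C z / sqrt (real (Suc n))) / \<bar>D z\<bar>"
              using e0[of "Suc n" z] by simp
          qed
          show "(\<lambda>n. (4 * C z / sqrt (real (Suc n))) / \<bar>D z\<bar>) \<longlonglongrightarrow> 0"
            using tendsto_divide[OF sq0 tendsto_const, of "\<bar>D z\<bar>" z] False by simp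
        qed
      qed
    qed
  qed (use em in auto)
  then have lim: "(\<lambda>n. \<integral>z. e (Suc n) z \<partial>N) \<longlonglongrightarrow> 0" by simp
  show "(\<lambda>n. sqrt (real (Suc n)) * (\<integral>w. \<bar>\<integral>z. ?e (Suc n) w z \<partial>N\<bar> \<partial>P (Suc n))) \<longlonglongrightarrow> 0"
    by (rule tendsto_sandwich[OF always_eventually always_eventually tendsto_const lim]; rule allI)
       (simp, rule key, simp)
qed

text \<open>
The linearization at (\<mu>, \<nu>) of the sliced functional, as a function of the two laws.
\<close>
definition linear_part :: "real \<Rightarrow> real \<Rightarrow> 'a::euclidean_space measure \<Rightarrow> 'a measure \<Rightarrow> 'a measure \<Rightarrow> 'a measure \<Rightarrow> real" where
  "linear_part p R \<mu> \<nu> \<alpha> \<beta> = (\<integral>x. influence1 p R \<mu> \<nu> x \<partial>\<alpha>) + (\<integral>y. influence2 p R \<mu> \<nu> y \<partial>\<beta>)"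

lemma measurable_slice_gap_random:
  fixes \<alpha> \<beta> :: "'w \<Rightarrow> 'a::euclidean_space measure"
  assumes a: "random_law L \<alpha>" and b: "random_law L \<beta>"
  shows "(\<lambda>(w, z). slice_gap (\<alpha> w) (\<beta> w) z) \<in> borel_measurable (L \<Otimes>\<^sub>M slice_measure p R)"
proof -
  let ?L = "L \<Otimes>\<^sub>M (slice_measure p R :: ('a \<times> real \<times> real) measure)"
  have m: "(\<lambda>x. fst (snd x)) \<in> borel_measurable ?L"
    by (rule measurable_compose[OF measurable_snd measurable_slice_direction])
  have s: "snd \<in> (slice_measure p R :: ('a \<times> real \<times> real) measure) \<rightarrow>\<^sub>M borel \<Otimes>\<^sub>M borel"
    by (simp add: measurable_cong_sets[OF sets_slice_measure refl])
  note ss = measurable_compose[OF measurable_snd s]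
  have [measurable]: "(\<lambda>x. snd (snd x)) \<in> ?L \<rightarrow>\<^sub>M borel \<Otimes>\<^sub>M borel" by (rule ss)
  have [measurable]: "(\<lambda>x. cdf (proj_law (fst (snd x)) (\<alpha> (fst x))) (fst (snd (snd x)))) \<in> borel_measurable ?L"
    by (rule random_lawD(3)[OF a, where h = fst and f = "\<lambda>x. fst (snd x)" and g = "\<lambda>x. fst (snd (snd x))", OF measurable_fst m])
       (rule measurable_compose[OF ss measurable_fst])
  have [measurable]: "(\<lambda>x. cdf (proj_law (fst (snd x)) (\<beta> (fst x))) (snd (snd (snd x)))) \<in> borel_measurable ?L"
    by (rule random_lawD(3)[OF b, where h = fst and f = "\<lambda>x. fst (snd x)" and g = "\<lambda>x. snd (snd (snd x))", OF measurable_fst m])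
       (rule measurable_compose[OF ss measurable_snd])
  show ?thesis unfolding slice_gap_def case_prod_beta' by measurable
qed

text \<open>
Written through the gap, the linear part depends on the laws only through the distribution functions of projections, which are
measurable by assumption.
\<close>
lemma measurable_linear_part:
  fixes \<alpha> \<beta> :: "'w \<Rightarrow> 'a::euclidean_space measure"
  assumes p: "1 < p" and mu: "prob_space \<mu>" "sets \<mu> = sets borel" and nu: "prob_space \<nu>" "sets \<nu> = sets borel"
    and a: "random_law L \<alpha>" and b: "random_law L \<beta>"
  shows "(\<lambda>w. linear_part p R \<mu> \<nu> (\<alpha> w) (\<beta> w)) \<in> borel_measurable L"
proof -
  interpret finite_measure "slice_measure p R :: ('a \<times> real \<times> real) measure" by (rule finite_measure_slice_measure[OF p])
  have [measurable]: "(\<lambda>x. slice_gap (\<alpha> (fst x)) (\<beta> (fst x)) (snd x)) \<in> borel_measurable (L \<Otimes>\<^sub>M slice_measure p R)"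
    using measurable_slice_gap_random[OF a b, of p R] by (simp add: case_prod_beta')
  have [measurable]: "(\<lambda>x. slice_gap \<mu> \<nu> (snd x)) \<in> borel_measurable (L \<Otimes>\<^sub>M slice_measure p R)"
    by (rule measurable_compose[OF measurable_snd measurable_slice_gap[OF mu nu]])
  have "linear_part p R \<mu> \<nu> (\<alpha> w) (\<beta> w)
      = (\<integral>z. of_bool (0 < slice_gap \<mu> \<nu> z) * slice_gap (\<alpha> w) (\<beta> w) z \<partial>slice_measure p R)" for w
    unfolding linear_part_def using random_lawD(1,2)[OF a] random_lawD(1,2)[OF b]
    by (intro integral_positive_slice_gap_eq_influence(2)[OF p mu nu, symmetric])
  then show ?thesis
    by (simp only:) (rule borel_measurable_lebesgue_integral, simp add: case_prod_beta')
qed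

lemma abs_linear_part_le:
  assumes p: "1 < p" and mu: "prob_space \<mu>" "sets \<mu> = sets borel" and nu: "prob_space \<nu>" "sets \<nu> = sets borel"
    and a: "prob_space \<alpha>" and b: "prob_space \<beta>"
  shows "\<bar>linear_part p R \<mu> \<nu> \<alpha> \<beta>\<bar> \<le> 2 * box_mass p R"
proof -
  have "\<bar>\<integral>x. influence1 p R \<mu> \<nu> x \<partial>\<alpha>\<bar> \<le> box_mass p R" "\<bar>\<integral>x. influence2 p R \<mu> \<nu> x \<partial>\<beta>\<bar> \<le> box_mass p R"
    by (intro abs_expectation_le influence_bounded p a b)+
  then show ?thesis unfolding linear_part_def by linarith
qed

text \<open>
The increment between two pairs of estimates is compared with the linearization at the true laws. The first pair is
constant in the central limit theorem, and the empirical pair in the bootstrap.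
\<close>
lemma sliced_linearization:
  fixes \<mu> \<nu> :: "'a::euclidean_space measure" and P :: "nat \<Rightarrow> 'w measure"
  assumes p: "1 < p" and mu: "prob_space \<mu>" "sets \<mu> = sets borel" "convex (spt \<mu>)"
    and nu: "prob_space \<nu>" "sets \<nu> = sets borel"
    and P: "\<And>n. 0 < n \<Longrightarrow> prob_space (P n)"
    and a1: "\<And>n. 0 < n \<Longrightarrow> root_n_estimator (P n) n R \<mu> (\<gamma> n)" and a2: "\<And>n. 0 < n \<Longrightarrow> root_n_estimator (P n) n R \<mu> (\<gamma>' n)"
    and b1: "\<And>n. 0 < n \<Longrightarrow> root_n_estimator (P n) n R \<nu> (\<delta> n)" and b2: "\<And>n. 0 < n \<Longrightarrow> root_n_estimator (P n) n R \<nu> (\<delta>' n)"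
  defines "rem \<equiv> \<lambda>n w. (sliced_wasserstein_pow p (\<gamma>' n w) (\<delta>' n w) - sliced_wasserstein_pow p (\<gamma> n w) (\<delta> n w))
      - (linear_part p R \<mu> \<nu> (\<gamma>' n w) (\<delta>' n w) - linear_part p R \<mu> \<nu> (\<gamma> n w) (\<delta> n w))"
  shows "(\<lambda>n. sqrt (real n) * (\<integral>w. \<bar>rem n w\<bar> \<partial>P n)) \<longlonglongrightarrow> 0"
    and "0 < n \<Longrightarrow> integrable (P n) (rem n)"
proof -
  let ?N = "slice_measure p R :: ('a \<times> real \<times> real) measure"
  let ?D = "slice_gap \<mu> \<nu>"
  let ?D1 = "\<lambda>n w. slice_gap (\<gamma> n w) (\<delta> n w)" and ?D2 = "\<lambda>n w. slice_gap (\<gamma>' n w) (\<delta>' n w)"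
  let ?F = "\<lambda>z. cdf (proj_law (fst z) \<mu>) (fst (snd z))" and ?G = "\<lambda>z. cdf (proj_law (fst z) \<nu>) (snd (snd z))"
  interpret N: finite_measure ?N by (rule finite_measure_slice_measure[OF p])
  define C where "C z = 8 * (?F z * (1 - ?F z) + ?G z * (1 - ?G z))" for z :: "'a \<times> real \<times> real"
  note [measurable] = measurable_slice_gap[OF mu(1,2) nu]
  have rl: "random_law (P n) (\<gamma> n)" "random_law (P n) (\<gamma>' n)" "random_law (P n) (\<delta> n)" "random_law (P n) (\<delta>' n)" if "0 < n" for n
    using a1[OF that] a2[OF that] b1[OF that] b2[OF that] by (auto simp: root_n_estimator_def)
  note a1' = random_lawD(1,2)[OF rl(1)] and a2' = random_lawD(1,2)[OF rl(2)]
    and b1' = random_lawD(1,2)[OF rl(3)] and b2' = random_lawD(1,2)[OF rl(4)]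
  have FG: "0 \<le> ?F z" "?F z \<le> 1" "0 \<le> ?G z" "?G z \<le> 1" for z
    by (rule cdf_proj_law_bounds[OF mu(1,2)] cdf_proj_law_bounds[OF nu])+
  have C: "0 \<le> C z" "C z \<le> 16" for z
  proof -
    have "?F z * (1 - ?F z) \<le> 1 * 1" "?G z * (1 - ?G z) \<le> 1 * 1" using FG[of z] by (intro mult_mono; simp)+
    then show "C z \<le> 16" by (simp add: C_def)
    show "0 \<le> C z" using FG[of z] by (simp add: C_def)
  qed
  have gap_sq: "(\<integral>w. (slice_gap (\<alpha> w) (\<beta> w) z - ?D z)\<^sup>2 \<partial>P n) \<le> C z / real n"
    if n: "0 < n" and a: "root_n_estimator (P n) n R \<mu> \<alpha>" and b: "root_n_estimator (P n) n R \<nu> \<beta>" for n \<alpha> \<beta> z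
  proof -
    interpret prob_space "P n" by (rule P[OF n])
    have ra: "random_law (P n) \<alpha>" "random_law (P n) \<beta>" using a b by (auto simp: root_n_estimator_def)
    let ?f = "\<lambda>w. cdf (proj_law (fst z) (\<alpha> w)) (fst (snd z)) - ?F z"
    let ?g = "\<lambda>w. cdf (proj_law (fst z) (\<beta> w)) (snd (snd z)) - ?G z"
    have [measurable]: "?f \<in> borel_measurable (P n)" "?g \<in> borel_measurable (P n)"
      by (intro borel_measurable_diff borel_measurable_const
            random_lawD(3)[OF ra(1), where h = "\<lambda>w. w" and f = "\<lambda>_. fst z" and g = "\<lambda>_. fst (snd z)"]; simp)
         (intro borel_measurable_diff borel_measurable_const
            random_lawD(3)[OF ra(2), where h = "\<lambda>w. w" and f = "\<lambda>_. fst z" and g = "\<lambda>_. snd (snd z)"]; simp)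
    have fb: "\<bar>?f w\<bar> \<le> 1" "\<bar>?g w\<bar> \<le> 1" for w
      using FG[of z] cdf_proj_law_bounds[OF random_lawD(1,2)[OF ra(1)], of "fst z" w "fst (snd z)"]
        cdf_proj_law_bounds[OF random_lawD(1,2)[OF ra(2)], of "fst z" w "snd (snd z)"] by (simp_all add: abs_le_iff)
    have i: "integrable (P n) (\<lambda>w. (?f w)\<^sup>2)" "integrable (P n) (\<lambda>w. (?g w)\<^sup>2)"
      using fb by (intro integrable_const_bound[where B = 1]; simp add: abs_square_le_1)+
    have "(\<integral>w. (slice_gap (\<alpha> w) (\<beta> w) z - ?D z)\<^sup>2 \<partial>P n) \<le> (\<integral>w. 2 * (?g w)\<^sup>2 + 2 * (?f w)\<^sup>2 \<partial>P n)"
    proof (rule integral_mono_AE')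
      show "integrable (P n) (\<lambda>w. 2 * (?g w)\<^sup>2 + 2 * (?f w)\<^sup>2)" using i by auto
      have "(slice_gap (\<alpha> w) (\<beta> w) z - ?D z)\<^sup>2 \<le> 2 * (?g w)\<^sup>2 + 2 * (?f w)\<^sup>2" for w
      proof -
        have "\<bar>slice_gap (\<alpha> w) (\<beta> w) z - ?D z\<bar> \<le> \<bar>?g w\<bar> + \<bar>?f w\<bar>"
          unfolding slice_gap_def by (rule abs_gap_diff_le)
        then have "(slice_gap (\<alpha> w) (\<beta> w) z - ?D z)\<^sup>2 \<le> (\<bar>?g w\<bar> + \<bar>?f w\<bar>)\<^sup>2" by (simp add: abs_le_square_iff[symmetric])
        also have "\<dots> \<le> 2 * (?g w)\<^sup>2 + 2 * (?f w)\<^sup>2"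
          by (rule sum_abs_square_le)
        finally show ?thesis .
      qed
      then show "AE w in P n. (slice_gap (\<alpha> w) (\<beta> w) z - ?D z)\<^sup>2 \<le> 2 * (?g w)\<^sup>2 + 2 * (?f w)\<^sup>2" by simp
    qed simp
    also have "\<dots> = 2 * (\<integral>w. (?g w)\<^sup>2 \<partial>P n) + 2 * (\<integral>w. (?f w)\<^sup>2 \<partial>P n)" using i by simp
    also have "\<dots> \<le> 2 * (4 * (?G z * (1 - ?G z)) / real n) + 2 * (4 * (?F z * (1 - ?F z)) / real n)"
      using a b by (intro add_mono mult_left_mono) (auto simp: root_n_estimator_def)
    also have "\<dots> = C z / real n"
    proof -
      have "2 * (4 * v / m) + 2 * (4 * u / m) = 8 * (u + v) / m" for u v m :: real
        by (simp add: add_divide_distrib)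
      then show ?thesis unfolding C_def .
    qed
    finally show ?thesis .
  qed
  have tie: "AE z in ?N. ?D z = 0 \<longrightarrow> C z = 0"
    using AE_slice_gap_tie[OF p mu nu, of R] by eventually_elim (auto simp: C_def)
  have lim: "(\<lambda>n. sqrt (real n) * (\<integral>w. \<bar>\<integral>z. max 0 (?D2 n w z) - max 0 (?D1 n w z) - of_bool (0 < ?D z) * (?D2 n w z - ?D1 n w z) \<partial>?N\<bar> \<partial>P n))
    \<longlonglongrightarrow> 0"
  proof (rule linearization_error_vanishes[OF N.finite_measure_axioms P, where C = C and c = 16])
    show "\<bar>?D z\<bar> \<le> 1" for z by (rule slice_gap_bounded[OF mu(1,2) nu])
    show "\<bar>?D1 n w z\<bar> \<le> 1" if "0 < n" for n w z by (rule slice_gap_bounded[OF a1'[OF that] b1'[OF that]])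
    show "\<bar>?D2 n w z\<bar> \<le> 1" if "0 < n" for n w z by (rule slice_gap_bounded[OF a2'[OF that] b2'[OF that]])
    show "(\<lambda>(w, z). ?D1 n w z) \<in> borel_measurable (P n \<Otimes>\<^sub>M ?N)" if "0 < n" for n
      by (rule measurable_slice_gap_random[OF rl(1)[OF that] rl(3)[OF that]])
    show "(\<lambda>(w, z). ?D2 n w z) \<in> borel_measurable (P n \<Otimes>\<^sub>M ?N)" if "0 < n" for n
      by (rule measurable_slice_gap_random[OF rl(2)[OF that] rl(4)[OF that]])
    show "(\<integral>w. (?D1 n w z - ?D z)\<^sup>2 \<partial>P n) \<le> C z / real n" if "0 < n" for n z
      by (rule gap_sq[OF that a1[OF that] b1[OF that]])
    show "(\<integral>w. (?D2 n w z - ?D z)\<^sup>2 \<partial>P n) \<le> C z / real n" if "0 < n" for n z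
      by (rule gap_sq[OF that a2[OF that] b2[OF that]])
  qed (use C tie in auto)
  have ae: "AE w in P n. rem n w = (\<integral>z. max 0 (?D2 n w z) - max 0 (?D1 n w z) - of_bool (0 < ?D z) * (?D2 n w z - ?D1 n w z) \<partial>?N)
      \<and> \<bar>sliced_wasserstein_pow p (\<gamma> n w) (\<delta> n w)\<bar> \<le> measure ?N (space ?N) \<and> \<bar>sliced_wasserstein_pow p (\<gamma>' n w) (\<delta>' n w)\<bar> \<le> measure ?N (space ?N)"
    if n: "0 < n" for n
  proof -
    have "AE w in P n. AE x in \<gamma> n w. norm x \<le> R" "AE w in P n. AE x in \<gamma>' n w. norm x \<le> R"
      "AE w in P n. AE x in \<delta> n w. norm x \<le> R" "AE w in P n. AE x in \<delta>' n w. norm x \<le> R"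
      using a1[OF n] a2[OF n] b1[OF n] b2[OF n] by (auto simp: root_n_estimator_def)
    then show ?thesis
    proof eventually_elim
      case (elim w)
      have S1: "sliced_wasserstein_pow p (\<gamma> n w) (\<delta> n w) = (\<integral>z. max 0 (?D1 n w z) \<partial>?N)"
        by (rule sliced_wasserstein_pow_eq_integral[OF p a1'[OF n] elim(1) b1'[OF n] elim(3)])
      have S2: "sliced_wasserstein_pow p (\<gamma>' n w) (\<delta>' n w) = (\<integral>z. max 0 (?D2 n w z) \<partial>?N)"
        by (rule sliced_wasserstein_pow_eq_integral[OF p a2'[OF n] elim(2) b2'[OF n] elim(4)])
      note i1 = integrable_slice_pos_part[OF p a1'[OF n] b1'[OF n], of R w w]
        and i2 = integrable_slice_pos_part[OF p a2'[OF n] b2'[OF n], of R w w]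
        and l1 = integral_positive_slice_gap_eq_influence[OF p mu(1,2) nu a1'[OF n] b1'[OF n], of R w w]
        and l2 = integral_positive_slice_gap_eq_influence[OF p mu(1,2) nu a2'[OF n] b2'[OF n], of R w w]
      have bd: "\<bar>\<integral>z. max 0 (f z) \<partial>?N\<bar> \<le> measure ?N (space ?N)" if "integrable ?N (\<lambda>z. max 0 (f z))" "\<And>z. \<bar>f z\<bar> \<le> 1" for f
      proof -
        have "(\<integral>z. max 0 (f z) \<partial>?N) \<le> (\<integral>z. 1 \<partial>?N)"
          using that(2) by (intro integral_mono that(1)) (auto simp: abs_le_iff)
        moreover have "0 \<le> (\<integral>z. max 0 (f z) \<partial>?N)" by (intro integral_nonneg_AE) auto
        ultimately show ?thesis by simp
      qed
      show ?case
        unfolding S1 S2 rem_def linear_part_def l1(2)[symmetric] l2(2)[symmetric] right_diff_distrib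
        using i1 i2 l1(1) l2(1) bd[OF i1 slice_gap_bounded[OF a1'[OF n] b1'[OF n]]] bd[OF i2 slice_gap_bounded[OF a2'[OF n] b2'[OF n]]]
        by simp
    qed
  qed
  show "(\<lambda>n. sqrt (real n) * (\<integral>w. \<bar>rem n w\<bar> \<partial>P n)) \<longlonglongrightarrow> 0"
  proof (rule Lim_transform_eventually[OF lim eventually_sequentiallyI[of 1]])
    fix n :: nat assume "1 \<le> n"
    then have n: "0 < n" by simp
    have rm: "rem n \<in> borel_measurable (P n)"
      unfolding rem_def
      by (intro borel_measurable_diff measurable_sliced_wasserstein_pow measurable_linear_part p mu nu rl[OF n])
    have "(\<lambda>w. \<integral>z. max 0 (?D2 n w z) - max 0 (?D1 n w z) - of_bool (0 < ?D z) * (?D2 n w z - ?D1 n w z) \<partial>?N) \<in> borel_measurable (P n)"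
    proof -
      have [measurable]: "(\<lambda>x. ?D1 n (fst x) (snd x)) \<in> borel_measurable (P n \<Otimes>\<^sub>M ?N)"
        "(\<lambda>x. ?D2 n (fst x) (snd x)) \<in> borel_measurable (P n \<Otimes>\<^sub>M ?N)"
        using measurable_slice_gap_random[OF rl(1)[OF n] rl(3)[OF n], of p R] measurable_slice_gap_random[OF rl(2)[OF n] rl(4)[OF n], of p R]
        by (simp_all add: case_prod_beta')
      have [measurable]: "(\<lambda>x. ?D (snd x)) \<in> borel_measurable (P n \<Otimes>\<^sub>M ?N)"
        by (rule measurable_compose[OF measurable_snd measurable_slice_gap[OF mu(1,2) nu]])
      show ?thesis by (rule N.borel_measurable_lebesgue_integral) (simp add: case_prod_beta')
    qed
    then have "(\<integral>w. \<bar>rem n w\<bar> \<partial>P n) = (\<integral>w. \<bar>\<integral>z. max 0 (?D2 n w z) - max 0 (?D1 n w z) - of_bool (0 < ?D z) * (?D2 n w z - ?D1 n w z) \<partial>?N\<bar> \<partial>P n)"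
      using rm ae[OF n] by (intro integral_cong_AE) (auto elim!: eventually_mono)
    then show "sqrt (real n) * (\<integral>w. \<bar>\<integral>z. max 0 (?D2 n w z) - max 0 (?D1 n w z) - of_bool (0 < ?D z) * (?D2 n w z - ?D1 n w z) \<partial>?N\<bar> \<partial>P n)
      = sqrt (real n) * (\<integral>w. \<bar>rem n w\<bar> \<partial>P n)" by simp
  qed
  show "integrable (P n) (rem n)" if n: "0 < n"
  proof -
    interpret P: prob_space "P n" by (rule P[OF n])
    have rm: "rem n \<in> borel_measurable (P n)"
      unfolding rem_def
      by (intro borel_measurable_diff measurable_sliced_wasserstein_pow measurable_linear_part p mu nu rl[OF n])
    have "AE w in P n. norm (rem n w) \<le> 2 * measure ?N (space ?N) + 4 * box_mass p R"
      using ae[OF n]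
    proof eventually_elim
      case (elim w)
      have "\<bar>linear_part p R \<mu> \<nu> (\<gamma> n w) (\<delta> n w)\<bar> \<le> 2 * box_mass p R" "\<bar>linear_part p R \<mu> \<nu> (\<gamma>' n w) (\<delta>' n w)\<bar> \<le> 2 * box_mass p R"
        by (intro abs_linear_part_le p mu nu a1'[OF n] b1'[OF n] a2'[OF n] b2'[OF n])+
      with elim show ?case unfolding rem_def real_norm_def by linarith
    qed
    then show ?thesis using rm by (rule P.integrable_const_bound)
  qed
qed

section \<open>The central limit theorem\<close>

text \<open>
The error per unit of variance in char_sum_normal_bound, for centred variables that are bounded by B before centring and
divided by sqrt n.
\<close>
definition clt_error :: "real \<Rightarrow> real \<Rightarrow> nat \<Rightarrow> real" where
  "clt_error t B n = \<bar>t\<bar>^3 * (2 * B / sqrt (real n)) + t^4 * (2 * B / sqrt (real n))\<^sup>2"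

lemma clt_error_tendsto_0: "(\<lambda>n. clt_error t B n) \<longlonglongrightarrow> 0"
proof -
  have "(\<lambda>n. 2 * B / sqrt (real n)) \<longlonglongrightarrow> 0"
    by (intro tendsto_divide_0[OF tendsto_const] filterlim_at_top_imp_at_infinity
        filterlim_compose[OF sqrt_at_top filterlim_real_sequentially])
  then have "(\<lambda>n. \<bar>t\<bar>^3 * (2 * B / sqrt (real n)) + t^4 * (2 * B / sqrt (real n))\<^sup>2) \<longlonglongrightarrow> \<bar>t\<bar>^3 * 0 + t^4 * 0\<^sup>2"
    by (intro tendsto_intros)
  then show ?thesis by (simp add: clt_error_def)
qed

lemma clt_error_mono: "\<bar>t\<bar> \<le> T \<Longrightarrow> 0 \<le> B \<Longrightarrow> clt_error t B n \<le> clt_error T B n"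
  unfolding clt_error_def
proof (intro add_mono mult_right_mono)
  assume "\<bar>t\<bar> \<le> T" "0 \<le> B"
  then show "\<bar>t\<bar>^3 \<le> \<bar>T\<bar>^3" by (intro power_mono) auto
  have "\<bar>t\<bar>^4 \<le> \<bar>T\<bar>^4" using \<open>\<bar>t\<bar> \<le> T\<close> by (intro power_mono) auto
  then show "t^4 \<le> T^4" by simp
qed auto

lemma clt_error_nonneg: "0 \<le> B \<Longrightarrow> 0 \<le> clt_error t B n"
  by (simp add: clt_error_def)

lemma (in prob_space) char_centered_sum:
  fixes W :: "'i \<Rightarrow> 'a \<Rightarrow> real"
  assumes J: "finite J" and ind: "indep_vars (\<lambda>_. borel) W J" and B: "\<And>j w. \<bar>W j w\<bar> \<le> B" and n: "0 < n"
  defines "V \<equiv> (\<Sum>j\<in>J. expectation (\<lambda>w. (W j w - expectation (W j))\<^sup>2)) / real n"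
  shows "cmod (char (distr M borel (\<lambda>w. (\<Sum>j\<in>J. W j w - expectation (W j)) / sqrt (real n))) t - of_real (exp (- (t\<^sup>2 * V / 2))))
     \<le> clt_error t B n * V"
proof -
  define Z where "Z j w = (W j w - expectation (W j)) / sqrt (real n)" for j w
  have rv: "W j \<in> borel_measurable M" if "j \<in> J" for j using ind that by (auto simp: indep_vars_def)
  have iW: "integrable M (W j)" if "j \<in> J" for j
    using B by (intro integrable_const_bound[where B = B] rv[OF that]) auto
  have Eb: "\<bar>expectation (W j)\<bar> \<le> B" for j by (rule abs_expectation_le[OF prob_space_axioms B])
  have Zb: "\<bar>Z j w\<bar> \<le> 2 * B / sqrt (real n)" for j w
  proof -
    have "\<bar>W j w - expectation (W j)\<bar> \<le> 2 * B" using B[of j w] Eb[of j] by linarith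
    then show ?thesis unfolding Z_def abs_divide by (simp add: divide_right_mono)
  qed
  have ind': "indep_vars (\<lambda>_. borel) Z J"
    unfolding Z_def by (rule indep_vars_compose2[OF ind]) measurable
  have mean: "expectation (Z j) = 0" if "j \<in> J" for j
    unfolding Z_def using iW[OF that] by (simp add: prob_space)
  have "(\<Sum>j\<in>J. expectation (\<lambda>w. (Z j w)\<^sup>2)) = V"
    unfolding Z_def V_def power_divide using n by (simp add: sum_divide_distrib)
  moreover have "(\<Sum>j\<in>J. Z j w) = (\<Sum>j\<in>J. W j w - expectation (W j)) / sqrt (real n)" for w
    unfolding Z_def by (simp add: sum_divide_distrib)
  ultimately show ?thesis
    using char_sum_normal_bound[OF J ind' Zb mean, of t] by (simp add: clt_error_def)
qed

lemma (in prob_space) indep_vars_inj_reindex: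
  assumes ind: "indep_vars (\<lambda>_. N) Z UNIV" and f: "inj f"
  shows "indep_vars (\<lambda>_. N) (\<lambda>i. Z (f i)) UNIV"
  unfolding indep_vars_def2
proof (intro conjI ballI indep_setsI)
  have rv: "Z j \<in> M \<rightarrow>\<^sub>M N" for j using ind by (auto simp: indep_vars_def)
  show "random_variable N (Z (f i))" for i by (rule rv)
  show "{Z (f i) -` A \<inter> space M |A. A \<in> sets N} \<subseteq> events" for i using rv by (auto intro: measurable_sets)
  fix A J assume J: "J \<noteq> {}" "finite J" and A: "\<forall>j\<in>J. A j \<in> {Z (f j) -` A \<inter> space M |A. A \<in> sets N}"
  have inv: "inv f (f j) = j" for j using f by simp
  have "prob (\<Inter>k\<in>f ` J. A (inv f k)) = (\<Prod>k\<in>f ` J. prob (A (inv f k)))"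
  proof (rule indep_setsD)
    show "indep_sets (\<lambda>i. {Z i -` A \<inter> space M |A. A \<in> sets N}) UNIV" using ind by (simp add: indep_vars_def2)
  qed (use J A inv in auto)
  also have "(\<Prod>k\<in>f ` J. prob (A (inv f k))) = (\<Prod>j\<in>J. prob (A j))"
    using f by (subst prod.reindex) (auto simp: inv intro: inj_on_subset)
  finally show "prob (\<Inter>j\<in>J. A j) = (\<Prod>j\<in>J. prob (A j))" by (simp add: inv)
qed

definition var_of :: "'a measure \<Rightarrow> ('a \<Rightarrow> real) \<Rightarrow> real" where
  "var_of \<rho> g = (\<integral>z. (g z - (\<integral>u. g u \<partial>\<rho>))\<^sup>2 \<partial>\<rho>)"

lemma var_of_props:
  assumes "prob_space \<rho>" and [measurable]: "g \<in> borel_measurable \<rho>" and B: "\<And>x. \<bar>g x\<bar> \<le> B"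
  shows "var_of \<rho> g = (\<integral>z. (g z)\<^sup>2 \<partial>\<rho>) - (\<integral>z. g z \<partial>\<rho>)\<^sup>2" "0 \<le> var_of \<rho> g" "var_of \<rho> g \<le> B\<^sup>2"
    "\<bar>\<integral>z. g z \<partial>\<rho>\<bar> \<le> B"
proof -
  interpret prob_space \<rho> by fact
  have sq: "(g x)\<^sup>2 \<le> B\<^sup>2" for x using B[of x] by (simp add: abs_le_square_iff[symmetric])
  have i: "integrable \<rho> g" using B by (intro integrable_const_bound[where B = B]) auto
  have i2: "integrable \<rho> (\<lambda>z. (g z)\<^sup>2)" using sq by (intro integrable_const_bound[where B = "B\<^sup>2"]) auto
  show e: "var_of \<rho> g = (\<integral>z. (g z)\<^sup>2 \<partial>\<rho>) - (\<integral>z. g z \<partial>\<rho>)\<^sup>2"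
    unfolding var_of_def by (rule variance_eq[OF i i2])
  show "0 \<le> var_of \<rho> g" by (simp add: var_of_def)
  have "(\<integral>z. (g z)\<^sup>2 \<partial>\<rho>) \<le> (\<integral>z. B\<^sup>2 \<partial>\<rho>)" using i2 sq by (intro integral_mono) auto
  then show "var_of \<rho> g \<le> B\<^sup>2" unfolding e by (simp add: prob_space) (smt (verit) zero_le_power2)
  show "\<bar>\<integral>z. g z \<partial>\<rho>\<bar> \<le> B" by (rule abs_expectation_le[OF assms(1) B])
qed

lemma char_sample_mean:
  fixes X :: "nat \<Rightarrow> 'w \<Rightarrow> 'a::euclidean_space"
  assumes M: "prob_space M" and n: "0 < n" and ind: "prob_space.indep_vars M (\<lambda>_. borel) X {..<n}"
    and X: "\<And>i. i < n \<Longrightarrow> distr M borel (X i) = \<rho>"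
    and [measurable]: "g \<in> borel_measurable borel" and B: "\<And>x. \<bar>g x\<bar> \<le> B"
  shows "cmod (char (distr M borel (\<lambda>w. sqrt (real n) * ((\<integral>z. g z \<partial>empirical n (\<lambda>i. X i w)) - (\<integral>z. g z \<partial>\<rho>)))) t
      - of_real (exp (- (t\<^sup>2 * var_of \<rho> g / 2)))) \<le> clt_error t B n * var_of \<rho> g"
proof -
  interpret prob_space M by fact
  have rv: "X i \<in> borel_measurable M" if "i < n" for i using ind that by (auto simp: indep_vars_def)
  have E: "expectation (\<lambda>w. h (X i w)) = (\<integral>z. h z \<partial>\<rho>)" if "i < n" "h \<in> borel_measurable borel" for h :: "'a \<Rightarrow> real" and i
    using rv[OF that(1)] that(2) by (simp add: X[OF that(1), symmetric] integral_distr)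
  have ind': "indep_vars (\<lambda>_. borel) (\<lambda>i w. g (X i w)) {..<n}"
    by (rule indep_vars_compose2[OF ind]) measurable
  have s: "(\<Sum>i<n. g (X i w) - expectation (\<lambda>w. g (X i w))) / sqrt (real n)
      = sqrt (real n) * ((\<integral>z. g z \<partial>empirical n (\<lambda>i. X i w)) - (\<integral>z. g z \<partial>\<rho>))" for w
  proof -
    have "(\<Sum>i<n. g (X i w) - expectation (\<lambda>w. g (X i w))) = (\<Sum>i<n. g (X i w)) - real n * (\<integral>z. g z \<partial>\<rho>)"
      by (simp add: sum_subtractf E)
    also have "\<dots> = real n * ((\<integral>z. g z \<partial>empirical n (\<lambda>i. X i w)) - (\<integral>z. g z \<partial>\<rho>))"
      using n by (simp add: integral_empirical right_diff_distrib)
    finally show ?thesis using n by (simp add: field_simps)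
  qed
  have v: "(\<Sum>i<n. expectation (\<lambda>w. (g (X i w) - expectation (\<lambda>w. g (X i w)))\<^sup>2)) / real n = var_of \<rho> g"
  proof -
    have "(\<Sum>i<n. expectation (\<lambda>w. (g (X i w) - expectation (\<lambda>w. g (X i w)))\<^sup>2)) = (\<Sum>i<n. var_of \<rho> g)"
    proof (rule sum.cong)
      fix i assume i: "i \<in> {..<n}"
      then show "expectation (\<lambda>w. (g (X i w) - expectation (\<lambda>w. g (X i w)))\<^sup>2) = var_of \<rho> g"
        using E[of i "\<lambda>x. (g x - (\<integral>z. g z \<partial>\<rho>))\<^sup>2"] E[of i g] by (simp add: var_of_def)
    qed simp
    then show ?thesis using n by simp
  qed
  show ?thesis
    using char_centered_sum[OF _ ind' _ n, of B t] B unfolding s v by simp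
qed

text \<open>
Both samples together form one independent family, indexed by the disjoint sum of their index sets.
\<close>
lemma char_two_sample_mean:
  fixes X Y :: "nat \<Rightarrow> 'w \<Rightarrow> 'a::euclidean_space"
  assumes M: "prob_space M" and n: "0 < n"
    and ind: "prob_space.indep_vars M (\<lambda>_. borel) (case_sum X Y) UNIV"
    and X: "\<And>i. distr M borel (X i) = \<mu>" and Y: "\<And>i. distr M borel (Y i) = \<nu>"
    and g [measurable]: "g \<in> borel_measurable borel" and gB: "\<And>x. \<bar>g x\<bar> \<le> B"
    and h [measurable]: "h \<in> borel_measurable borel" and hB: "\<And>x. \<bar>h x\<bar> \<le> B"
  shows "cmod (char (distr M borel (\<lambda>w. sqrt (real n) * ((\<integral>z. g z \<partial>empirical n (\<lambda>i. X i w)) - (\<integral>z. g z \<partial>\<mu>))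
        + sqrt (real n) * ((\<integral>z. h z \<partial>empirical n (\<lambda>i. Y i w)) - (\<integral>z. h z \<partial>\<nu>)))) t
      - of_real (exp (- (t\<^sup>2 * (var_of \<mu> g + var_of \<nu> h) / 2)))) \<le> clt_error t B n * (var_of \<mu> g + var_of \<nu> h)"
proof -
  interpret prob_space M by fact
  have rv: "X i \<in> borel_measurable M" "Y i \<in> borel_measurable M" for i
  proof -
    have "case_sum X Y (Inl i) \<in> borel_measurable M" "case_sum X Y (Inr i) \<in> borel_measurable M"
      using ind by (auto simp: indep_vars_def simp del: sum.case)
    then show "X i \<in> borel_measurable M" "Y i \<in> borel_measurable M" by simp_all
  qed
  have EX: "expectation (\<lambda>w. f (X i w)) = (\<integral>z. f z \<partial>\<mu>)" if "f \<in> borel_measurable borel" for f :: "'a \<Rightarrow> real" and i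
    using rv(1)[of i] that by (simp add: X[of i, symmetric] integral_distr)
  have EY: "expectation (\<lambda>w. f (Y i w)) = (\<integral>z. f z \<partial>\<nu>)" if "f \<in> borel_measurable borel" for f :: "'a \<Rightarrow> real" and i
    using rv(2)[of i] that by (simp add: Y[of i, symmetric] integral_distr)
  define W where "W j w = (case j of Inl i \<Rightarrow> g (X i w) | Inr i \<Rightarrow> h (Y i w))" for j :: "nat + nat" and w
  have WX: "W (Inl i) = (\<lambda>w. g (X i w))" "W (Inr i) = (\<lambda>w. h (Y i w))" for i
    by (simp_all add: W_def fun_eq_iff)
  let ?J = "{..<n} <+> {..<n}"
  have "indep_vars (\<lambda>_. borel) (\<lambda>j w. (case j of Inl i \<Rightarrow> g | Inr i \<Rightarrow> h) (case_sum X Y j w)) UNIV"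
    by (rule indep_vars_compose2[OF ind]) (auto split: sum.split)
  also have "(\<lambda>j w. (case j of Inl i \<Rightarrow> g | Inr i \<Rightarrow> h) (case_sum X Y j w)) = W"
    by (auto simp: W_def fun_eq_iff split: sum.split)
  finally have ind': "indep_vars (\<lambda>_. borel) W ?J" by (rule indep_vars_subset) simp
  have WB: "\<bar>W j w\<bar> \<le> B" for j w using gB hB by (auto simp: W_def split: sum.split)
  have s: "(\<Sum>j\<in>?J. W j w - expectation (W j)) / sqrt (real n)
      = sqrt (real n) * ((\<integral>z. g z \<partial>empirical n (\<lambda>i. X i w)) - (\<integral>z. g z \<partial>\<mu>))
        + sqrt (real n) * ((\<integral>z. h z \<partial>empirical n (\<lambda>i. Y i w)) - (\<integral>z. h z \<partial>\<nu>))" for w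
  proof -
    have "(\<Sum>j\<in>?J. W j w - expectation (W j))
        = (\<Sum>i<n. g (X i w) - (\<integral>z. g z \<partial>\<mu>)) + (\<Sum>i<n. h (Y i w) - (\<integral>z. h z \<partial>\<nu>))"
      by (subst sum.Plus) (simp_all add: WX EX EY)
    also have "\<dots> = real n * ((\<integral>z. g z \<partial>empirical n (\<lambda>i. X i w)) - (\<integral>z. g z \<partial>\<mu>))
        + real n * ((\<integral>z. h z \<partial>empirical n (\<lambda>i. Y i w)) - (\<integral>z. h z \<partial>\<nu>))"
      using n by (simp add: integral_empirical right_diff_distrib sum_subtractf)
    also have "\<dots> / sqrt (real n) = sqrt (real n) * ((\<integral>z. g z \<partial>empirical n (\<lambda>i. X i w)) - (\<integral>z. g z \<partial>\<mu>))
        + sqrt (real n) * ((\<integral>z. h z \<partial>empirical n (\<lambda>i. Y i w)) - (\<integral>z. h z \<partial>\<nu>))"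
      by (simp add: add_divide_distrib real_div_sqrt flip: times_divide_eq_left)
    finally show ?thesis .
  qed
  have v: "(\<Sum>j\<in>?J. expectation (\<lambda>w. (W j w - expectation (W j))\<^sup>2)) / real n = var_of \<mu> g + var_of \<nu> h"
    using n EX[of "\<lambda>x. (g x - (\<integral>z. g z \<partial>\<mu>))\<^sup>2"] EY[of "\<lambda>x. (h x - (\<integral>z. h z \<partial>\<nu>))\<^sup>2"]
    by (subst sum.Plus) (simp_all add: WX EX EY var_of_def add_divide_distrib)
  show ?thesis
    using char_centered_sum[OF _ ind' WB n, of t] unfolding s v by simp
qed

lemma sample_mean_L1_tendsto:
  fixes X :: "nat \<Rightarrow> 'w \<Rightarrow> 'a::euclidean_space" and g :: "'a \<Rightarrow> real"
  assumes M: "prob_space M" and ind: "prob_space.indep_vars M (\<lambda>_. borel) X UNIV"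
    and X: "\<And>i. distr M borel (X i) = \<rho>"
    and [measurable]: "g \<in> borel_measurable borel" and B: "\<And>x. \<bar>g x\<bar> \<le> B"
  shows "(\<lambda>n. \<integral>w. \<bar>(\<integral>z. g z \<partial>empirical n (\<lambda>i. X i w)) - (\<integral>z. g z \<partial>\<rho>)\<bar> \<partial>M) \<longlonglongrightarrow> 0"
    and "0 < n \<Longrightarrow> integrable M (\<lambda>w. (\<integral>z. g z \<partial>empirical n (\<lambda>i. X i w)) - (\<integral>z. g z \<partial>\<rho>))"
proof -
  interpret prob_space M by fact
  have rv [measurable]: "X i \<in> borel_measurable M" for i using ind by (auto simp: indep_vars_def)
  interpret \<rho>: prob_space \<rho> using prob_space_distr[OF rv[of 0]] X[of 0] by simp
  have s\<rho> [measurable_cong]: "sets \<rho> = sets borel" using X[of 0, symmetric] by simp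
  note vp = var_of_props[where \<rho> = \<rho> and g = g and B = B]
  define u where "u n w = (\<integral>z. g z \<partial>empirical n (\<lambda>i. X i w)) - (\<integral>z. g z \<partial>\<rho>)" for n w
  have um [measurable]: "u n \<in> borel_measurable M" for n
    unfolding u_def by (subst integral_empirical) measurable
  have ub: "\<bar>u n w\<bar> \<le> 2 * B" if n: "0 < n" for n w
  proof -
    have "\<bar>\<integral>z. g z \<partial>empirical n (\<lambda>i. X i w)\<bar> \<le> B"
      by (rule var_of_props(4)[OF empirical_law(1)[OF n]])
         (simp_all add: B measurable_cong_sets[OF empirical_law(2)[OF n] refl])
    moreover have "\<bar>\<integral>z. g z \<partial>\<rho>\<bar> \<le> B" by (rule vp(4)) (auto simp: B \<rho>.prob_space_axioms)
    ultimately show ?thesis unfolding u_def by linarith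
  qed
  have iu: "integrable M (u n)" if "0 < n" for n using ub[OF that] by (intro integrable_const_bound[where B = "2 * B"]) auto
  have iu2: "integrable M (\<lambda>w. (u n w)\<^sup>2)" if "0 < n" for n
  proof (rule integrable_const_bound[where B = "(2 * B)\<^sup>2"], rule AE_I2)
    fix w
    have "\<bar>u n w\<bar> \<le> \<bar>2 * B\<bar>" using ub[OF that, of w] by linarith
    then show "norm ((u n w)\<^sup>2) \<le> (2 * B)\<^sup>2" by (simp only: abs_le_square_iff real_norm_def abs_power2)
  qed measurable
  show "integrable M (\<lambda>w. (\<integral>z. g z \<partial>empirical n (\<lambda>i. X i w)) - (\<integral>z. g z \<partial>\<rho>))" if "0 < n" using iu[OF that] unfolding u_def .
  have le: "(\<integral>w. \<bar>u n w\<bar> \<partial>M) \<le> (1 + var_of \<rho> g) / 2 * (1 / sqrt (real n))" if n: "0 < n" for n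
  proof -
    \<comment> \<open>balances the two terms of the bound, as the second moment is of order 1 / n\<close>
    define l where "l = 1 / sqrt (real n)"
    have l: "0 < l" using n by (simp add: l_def)
    have "(\<integral>w. \<bar>u n w\<bar> \<partial>M) \<le> (\<integral>w. (l + (u n w)\<^sup>2 / l) / 2 \<partial>M)"
      using iu[OF n] iu2[OF n] le_scaled_square[OF l, of "\<bar>u n w\<bar>" for w] by (intro integral_mono) auto
    also have "\<dots> = (l + (\<integral>w. (u n w)\<^sup>2 \<partial>M) / l) / 2" using iu2[OF n] by (simp add: prob_space)
    also have "(\<integral>w. (u n w)\<^sup>2 \<partial>M) = var_of \<rho> g / real n"
      unfolding u_def var_of_def using indep_vars_subset[OF ind] X by (intro sample_mean_second_moment M n) (auto intro: B)
    also have "var_of \<rho> g / real n / l = var_of \<rho> g * l" using n by (simp add: l_def field_simps)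
    also have "(l + var_of \<rho> g * l) / 2 = (1 + var_of \<rho> g) / 2 * l" by (simp add: distrib_right)
    finally show ?thesis unfolding l_def .
  qed
  have lim: "(\<lambda>n. (1 + var_of \<rho> g) / 2 * (1 / sqrt (real n))) \<longlonglongrightarrow> (1 + var_of \<rho> g) / 2 * 0"
    by (intro tendsto_mult tendsto_const tendsto_divide_0[OF tendsto_const] filterlim_at_top_imp_at_infinity
        filterlim_compose[OF sqrt_at_top filterlim_real_sequentially])
  have "(\<lambda>n. \<integral>w. \<bar>u n w\<bar> \<partial>M) \<longlonglongrightarrow> 0"
  proof (rule tendsto_sandwich[OF _ _ tendsto_const])
    show "(\<lambda>n. (1 + var_of \<rho> g) / 2 * (1 / sqrt (real n))) \<longlonglongrightarrow> 0" using lim by simp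
    show "\<forall>\<^sub>F n in sequentially. (\<integral>w. \<bar>u n w\<bar> \<partial>M) \<le> (1 + var_of \<rho> g) / 2 * (1 / sqrt (real n))"
      by (rule eventually_sequentiallyI[of 1], rule le) simp
  qed simp
  then show "(\<lambda>n. \<integral>w. \<bar>(\<integral>z. g z \<partial>empirical n (\<lambda>i. X i w)) - (\<integral>z. g z \<partial>\<rho>)\<bar> \<partial>M) \<longlonglongrightarrow> 0"
    by (simp add: u_def)
qed

text \<open>
The truth value b in the definitions below tells whether the second law is estimated from a sample (True) or known (False),
so that the statements for one and for two samples are proved together.
\<close>
locale two_samples =
  fixes p R :: real and \<mu> \<nu> :: "'a::euclidean_space measure" and M :: "'w measure" and X Y :: "nat \<Rightarrow> 'w \<Rightarrow> 'a"
  assumes p: "1 < p"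
    and mu: "prob_space \<mu>" "sets \<mu> = sets borel" "AE x in \<mu>. norm x \<le> R" and conv: "convex (spt \<mu>)"
    and nu: "prob_space \<nu>" "sets \<nu> = sets borel" "AE x in \<nu>. norm x \<le> R"
    and M: "prob_space M"
    and indep: "prob_space.indep_vars M (\<lambda>_. borel) (case_sum X Y) UNIV"
    and X: "\<And>i. distr M borel (X i) = \<mu>" and Y: "\<And>i. distr M borel (Y i) = \<nu>"
begin

sublocale prob_space M by (rule M)

abbreviation "\<Psi> \<equiv> influence1 p R \<mu> \<nu>"
abbreviation "\<psi> \<equiv> influence2 p R \<mu> \<nu>"
abbreviation "S \<equiv> sliced_wasserstein_pow p"

definition limit_variance :: "bool \<Rightarrow> real" where
  "limit_variance b = var_of \<mu> \<Psi> + (if b then var_of \<nu> \<psi> else 0)"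

definition nuhat :: "bool \<Rightarrow> nat \<Rightarrow> (nat \<Rightarrow> 'a) \<Rightarrow> 'a measure" where
  "nuhat b n y = (if b then empirical n y else \<nu>)"

lemma inf_meas [measurable]: "\<Psi> \<in> borel_measurable borel" "\<psi> \<in> borel_measurable borel"
  by (rule measurable_influence[OF p mu(1,2) nu(1,2)])+

lemma inf_bound: "\<bar>\<Psi> x\<bar> \<le> box_mass p R" "\<bar>\<psi> x\<bar> \<le> box_mass p R"
  by (rule influence_bounded[OF p])+

lemma box_mass_nonneg: "0 \<le> box_mass p R" by (simp add: box_mass_def)

lemma indep_X: "indep_vars (\<lambda>_. borel) X UNIV"
  using indep_vars_inj_reindex[OF indep, of Inl] by (simp add: inj_def)

lemma indep_Y: "indep_vars (\<lambda>_. borel) Y UNIV"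
  using indep_vars_inj_reindex[OF indep, of Inr] by (simp add: inj_def)

lemma rv_X [measurable]: "X i \<in> borel_measurable M" and rv_Y [measurable]: "Y i \<in> borel_measurable M"
  using indep_X indep_Y by (auto simp: indep_vars_def)

lemma limit_variance_nonneg: "0 \<le> limit_variance b"
  by (simp add: limit_variance_def var_of_def)

lemma root_n_muhat:
  assumes n: "0 < n" shows "root_n_estimator M n R \<mu> (\<lambda>w. empirical n (\<lambda>i. X i w))"
  using indep_vars_subset[OF indep_X] X by (intro root_n_estimator_empirical(1) M n mu) auto

lemma root_n_nuhat:
  assumes n: "0 < n" shows "root_n_estimator M n R \<nu> (\<lambda>w. nuhat b n (\<lambda>i. Y i w))"
proof (cases b)
  case True
  then show ?thesis
    using indep_vars_subset[OF indep_Y] Y by (simp add: nuhat_def, intro root_n_estimator_empirical(1) M n nu) auto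
next
  case False
  then show ?thesis by (simp add: nuhat_def root_n_estimator_const nu)
qed

lemma linear_part_diff_eq:
  "sqrt (real n) * (linear_part p R \<mu> \<nu> \<alpha>2 \<beta>2 - linear_part p R \<mu> \<nu> \<alpha>1 \<beta>1)
    = sqrt (real n) * ((\<integral>x. \<Psi> x \<partial>\<alpha>2) - (\<integral>x. \<Psi> x \<partial>\<alpha>1)) + sqrt (real n) * ((\<integral>x. \<psi> x \<partial>\<beta>2) - (\<integral>x. \<psi> x \<partial>\<beta>1))"
  by (simp add: linear_part_def algebra_simps)

text \<open>
The characteristic function of the statistic is close to that of its linear part because the remainder tends to 0 in mean, and
the latter is close to the normal one by the explicit error bound. The theorem of Levy concludes.
\<close>
lemma central_limit_sliced:
  "weak_conv_m (\<lambda>n. distr M borel (\<lambda>w. sqrt (real n) * (S (empirical n (\<lambda>i. X i w)) (nuhat b n (\<lambda>i. Y i w)) - S \<mu> \<nu>)))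
     (normal_law 0 (limit_variance b))"
proof -
  let ?T = "\<lambda>n w. sqrt (real n) * (S (empirical n (\<lambda>i. X i w)) (nuhat b n (\<lambda>i. Y i w)) - S \<mu> \<nu>)"
  let ?L = "\<lambda>n w. linear_part p R \<mu> \<nu> (empirical n (\<lambda>i. X i w)) (nuhat b n (\<lambda>i. Y i w))"
  let ?A = "\<lambda>n w. sqrt (real n) * (?L n w - linear_part p R \<mu> \<nu> \<mu> \<nu>)"
  have rl: "random_law M (\<lambda>w. empirical n (\<lambda>i. X i w))" "random_law M (\<lambda>w. nuhat b n (\<lambda>i. Y i w))" if "0 < n" for n
    using root_n_muhat[OF that] root_n_nuhat[OF that] by (auto simp: root_n_estimator_def)
  have Tm: "?T n \<in> borel_measurable M" for n
  proof (cases "n = 0")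
    case False
    then have n: "0 < n" by simp
    note [measurable] = measurable_sliced_wasserstein_pow[OF p rl[OF n]]
    show ?thesis by measurable
  qed simp
  have Am: "?A n \<in> borel_measurable M" if "0 < n" for n
  proof -
    note [measurable] = measurable_linear_part[OF p mu(1,2) nu(1,2) rl[OF that], of R]
    show ?thesis by measurable
  qed
  have rd: "real_distribution (distr M borel (?T n))" for n by (rule real_distribution_distr[OF Tm])
  note lin = sliced_linearization[where P = "\<lambda>_. M" and \<gamma> = "\<lambda>_ _. \<mu>" and \<gamma>' = "\<lambda>n w. empirical n (\<lambda>i. X i w)"
      and \<delta> = "\<lambda>_ _. \<nu>" and \<delta>' = "\<lambda>n w. nuhat b n (\<lambda>i. Y i w)" and R = R, OF p mu(1,2) conv nu(1,2)]
  have r0: "(\<lambda>n. sqrt (real n) * (\<integral>w. \<bar>(S (empirical n (\<lambda>i. X i w)) (nuhat b n (\<lambda>i. Y i w)) - S \<mu> \<nu>)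
      - (?L n w - linear_part p R \<mu> \<nu> \<mu> \<nu>)\<bar> \<partial>M)) \<longlonglongrightarrow> 0"
    by (rule lin(1)) (rule M root_n_estimator_const[OF mu] root_n_estimator_const[OF nu] root_n_muhat root_n_nuhat | assumption)+
  have ri: "integrable M (\<lambda>w. (S (empirical n (\<lambda>i. X i w)) (nuhat b n (\<lambda>i. Y i w)) - S \<mu> \<nu>)
      - (?L n w - linear_part p R \<mu> \<nu> \<mu> \<nu>))" if "0 < n" for n
    by (rule lin(2)) (rule M root_n_estimator_const[OF mu] root_n_estimator_const[OF nu] root_n_muhat root_n_nuhat that | assumption)+
  have "(\<lambda>n. char (distr M borel (?T n)) t) \<longlonglongrightarrow> char (normal_law 0 (limit_variance b)) t" for t
  proof (rule LIM_zero_cancel, rule Lim_null_comparison)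
    define e where "e n = \<bar>t\<bar> * (sqrt (real n) * (\<integral>w. \<bar>(S (empirical n (\<lambda>i. X i w)) (nuhat b n (\<lambda>i. Y i w)) - S \<mu> \<nu>)
      - (?L n w - linear_part p R \<mu> \<nu> \<mu> \<nu>)\<bar> \<partial>M)) + clt_error t (box_mass p R) n * limit_variance b" for n
    have "e \<longlonglongrightarrow> \<bar>t\<bar> * 0 + 0 * limit_variance b"
      unfolding e_def[abs_def] by (intro tendsto_intros r0 clt_error_tendsto_0)
    then show "e \<longlonglongrightarrow> 0" by simp
    show "\<forall>\<^sub>F n in sequentially. cmod (char (distr M borel (?T n)) t - char (normal_law 0 (limit_variance b)) t) \<le> e n"
    proof (rule eventually_sequentiallyI[of 1])
      fix n :: nat assume "1 \<le> n"
      then have n: "0 < n" by simp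
      have TA: "?T n w - ?A n w = sqrt (real n) * ((S (empirical n (\<lambda>i. X i w)) (nuhat b n (\<lambda>i. Y i w)) - S \<mu> \<nu>)
          - (?L n w - linear_part p R \<mu> \<nu> \<mu> \<nu>))" for w by (simp add: right_diff_distrib)
      have i: "integrable M (\<lambda>w. ?T n w - ?A n w)"
        unfolding TA by (intro integrable_mult_right ri n)
      have a: "cmod (char (distr M borel (?T n)) t - char (distr M borel (?A n)) t)
         \<le> \<bar>t\<bar> * (sqrt (real n) * (\<integral>w. \<bar>(S (empirical n (\<lambda>i. X i w)) (nuhat b n (\<lambda>i. Y i w)) - S \<mu> \<nu>)
      - (?L n w - linear_part p R \<mu> \<nu> \<mu> \<nu>)\<bar> \<partial>M))"
        using char_perturbation[OF Am[OF n] Tm i, of t] unfolding TA by (simp add: abs_mult)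
      have c: "cmod (char (distr M borel (?A n)) t - char (normal_law 0 (limit_variance b)) t) \<le> clt_error t (box_mass p R) n * limit_variance b"
      proof (cases b)
        case True
        show ?thesis
          using char_two_sample_mean[OF M n indep X Y inf_meas(1) inf_bound(1) inf_meas(2) inf_bound(2), of t] True
          unfolding char_normal_law[OF limit_variance_nonneg] linear_part_diff_eq by (simp add: limit_variance_def nuhat_def)
      next
        case False
        show ?thesis
          using char_sample_mean[OF M n indep_vars_subset[OF indep_X] X inf_meas(1) inf_bound(1), of t] False
          unfolding char_normal_law[OF limit_variance_nonneg] linear_part_diff_eq by (simp add: limit_variance_def nuhat_def)
      qed
      show "cmod (char (distr M borel (?T n)) t - char (normal_law 0 (limit_variance b)) t) \<le> e n"
        unfolding e_def using norm_triangle_le_diff[OF order_refl] a c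
          norm_triangle_ineq[of "char (distr M borel (?T n)) t - char (distr M borel (?A n)) t" "char (distr M borel (?A n)) t - char (normal_law 0 (limit_variance b)) t"]
        by simp
    qed
  qed
  then show ?thesis by (intro levy_continuity rd real_distribution_normal_law)
qed

end

section \<open>The bootstrap\<close>

text \<open>
Independent index draws for the two samples; the bootstrap with known second law uses only the first.
\<close>
definition resample_pair :: "nat \<Rightarrow> ((nat \<Rightarrow> nat) \<times> (nat \<Rightarrow> nat)) measure" where
  "resample_pair n = resample_space n \<Otimes>\<^sub>M resample_space n"

lemma prob_space_resample_pair: "0 < n \<Longrightarrow> prob_space (resample_pair n)"
  unfolding resample_pair_def by (intro prob_space_pair prob_space_resample_space)

lemma resample_pair_projections:
  assumes n: "0 < n"
  shows "fst \<in> resample_pair n \<rightarrow>\<^sub>M resample_space n" "snd \<in> resample_pair n \<rightarrow>\<^sub>M resample_space n"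
    and "distr (resample_pair n) (resample_space n) fst = resample_space n"
    and "distr (resample_pair n) (resample_space n) snd = resample_space n"
proof -
  interpret K: prob_space "resample_space n" by (rule prob_space_resample_space[OF n])
  interpret P: pair_sigma_finite "resample_space n" "resample_space n" by standard
  show "fst \<in> resample_pair n \<rightarrow>\<^sub>M resample_space n" "snd \<in> resample_pair n \<rightarrow>\<^sub>M resample_space n"
    unfolding resample_pair_def by measurable
  show d: "distr (resample_pair n) (resample_space n) fst = resample_space n"
    unfolding resample_pair_def by (rule K.distr_pair_fst)
  have "distr (resample_pair n) (resample_space n) snd
      = distr (distr (resample_pair n) (resample_pair n) (\<lambda>(x, y). (y, x))) (resample_space n) snd"
    unfolding resample_pair_def using P.distr_pair_swap by simp
  also have "\<dots> = distr (resample_pair n) (resample_space n) fst"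
    unfolding resample_pair_def by (subst distr_distr) (auto simp: comp_def case_prod_beta')
  finally show "distr (resample_pair n) (resample_space n) snd = resample_space n" using d by simp
qed

lemma random_law_resampled:
  fixes x :: "nat \<Rightarrow> 'a::euclidean_space"
  assumes n: "0 < n" and \<kappa>: "\<kappa> \<in> Q \<rightarrow>\<^sub>M resample_space n"
  shows "random_law Q (\<lambda>k. empirical n (\<lambda>i. x (\<kappa> k i)))"
proof (rule random_law_empirical[OF n])
  fix i assume "i < n"
  then show "(\<lambda>k. x (\<kappa> k i)) \<in> borel_measurable Q"
    by (intro measurable_compose[OF measurable_compose[OF \<kappa> measurable_resample_index]]) auto
qed

lemma random_law_coordinates:
  assumes n: "0 < n"
  shows "random_law (\<Pi>\<^sub>M i\<in>{..<n}. borel) (\<lambda>x. empirical n x :: 'a::euclidean_space measure)"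
  by (rule random_law_empirical[OF n]) simp

lemma measurable_resampled_sample:
  fixes x :: "nat \<Rightarrow> 'a::euclidean_space"
  shows "(\<lambda>k. \<lambda>i\<in>{..<n}. x (k i)) \<in> resample_space n \<rightarrow>\<^sub>M (\<Pi>\<^sub>M i\<in>{..<n}. borel)"
proof (rule measurable_restrict)
  fix i assume "i \<in> {..<n}"
  then show "(\<lambda>k. x (k i)) \<in> borel_measurable (resample_space n)"
    by (intro measurable_compose[OF measurable_resample_index]) auto
qed

text \<open>
The bootstrap distribution function is moved from the space of resampled points to the space of resampled indices.
\<close>
lemma bootstrap_cdf_eq:
  fixes x :: "nat \<Rightarrow> 'a::euclidean_space"
  assumes p: "1 < p" and n: "0 < n" and nu: "prob_space \<nu>" "sets \<nu> = sets borel"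
  shows "bootstrap_cdf p \<nu> n x t = cdf (distr (resample_pair n) borel
     (\<lambda>k. sqrt (real n) * (sliced_wasserstein_pow p (empirical n (\<lambda>i. x (fst k i))) \<nu> - sliced_wasserstein_pow p (empirical n x) \<nu>))) t"
proof -
  let ?P = "\<Pi>\<^sub>M i\<in>{..<n}. (borel :: 'a measure)" and ?K = "resample_space n"
  let ?f = "\<lambda>k. \<lambda>i\<in>{..<n}. x (k i)"
  let ?T = "\<lambda>x'. sqrt (real n) * (sliced_wasserstein_pow p (empirical n x') \<nu> - sliced_wasserstein_pow p (empirical n x) \<nu>)"
  note [measurable] = measurable_sliced_wasserstein_pow[OF p random_law_coordinates[OF n] random_law_const[OF nu]]
  note f = measurable_resampled_sample[where n = n and x = x]
  have c: "empirical n (?f k) = empirical n (\<lambda>i. x (k i))" for k by (rule empirical_cong) simp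
  have m: "(\<lambda>k. ?T (\<lambda>i. x (k i))) \<in> borel_measurable ?K"
  proof -
    have "?T \<in> borel_measurable ?P" by measurable
    from measurable_compose[OF f this] show ?thesis by (simp add: c)
  qed
  have "bootstrap_cdf p \<nu> n x t = measure (distr ?K ?P ?f) {x' \<in> space ?P. ?T x' \<le> t}"
    unfolding bootstrap_cdf_def bootstrap_law_eq_distr[OF n] space_distr ..
  also have "\<dots> = measure ?K {k \<in> space ?K. ?T (\<lambda>i. x (k i)) \<le> t}"
    using measurable_space[OF f] by (subst measure_distr[OF f]) (auto intro!: arg_cong[where f = "measure ?K"] simp: c)
  also have "\<dots> = measure (distr (resample_pair n) ?K fst) {k \<in> space ?K. ?T (\<lambda>i. x (k i)) \<le> t}"
    by (simp only: resample_pair_projections(3)[OF n])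
  also have "\<dots> = measure (resample_pair n) {k \<in> space (resample_pair n). ?T (\<lambda>i. x (fst k i)) \<le> t}"
    using m measurable_space[OF resample_pair_projections(1)[OF n]]
    by (subst measure_distr[OF resample_pair_projections(1)[OF n]]) (auto intro!: arg_cong[where f = "measure (resample_pair n)"])
  also have "\<dots> = cdf (distr (resample_pair n) borel (\<lambda>k. ?T (\<lambda>i. x (fst k i)))) t"
    unfolding cdf_def using measurable_compose[OF resample_pair_projections(1)[OF n] m]
    by (subst measure_distr) (auto intro!: arg_cong[where f = "measure (resample_pair n)"])
  finally show ?thesis .
qed

lemma bootstrap_cdf2_eq:
  fixes x y :: "nat \<Rightarrow> 'a::euclidean_space"
  assumes p: "1 < p" and n: "0 < n"
  shows "bootstrap_cdf2 p n x y t = cdf (distr (resample_pair n) borel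
     (\<lambda>k. sqrt (real n) * (sliced_wasserstein_pow p (empirical n (\<lambda>i. x (fst k i))) (empirical n (\<lambda>i. y (snd k i)))
        - sliced_wasserstein_pow p (empirical n x) (empirical n y)))) t"
proof -
  let ?P = "\<Pi>\<^sub>M i\<in>{..<n}. (borel :: 'a measure)" and ?K = "resample_space n"
  let ?f = "\<lambda>x k. \<lambda>i\<in>{..<n}. x (k i)"
  let ?T = "\<lambda>x' y'. sqrt (real n) * (sliced_wasserstein_pow p (empirical n x') (empirical n y') - sliced_wasserstein_pow p (empirical n x) (empirical n y))"
  interpret K: prob_space ?K by (rule prob_space_resample_space[OF n])
  note f = measurable_resampled_sample[where n = n and 'a = 'a]
  have c: "empirical n (?f x k) = empirical n (\<lambda>i. x (k i))" for x :: "nat \<Rightarrow> 'a" and k by (rule empirical_cong) simp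
  have T: "(\<lambda>z. ?T (fst z) (snd z)) \<in> borel_measurable (?P \<Otimes>\<^sub>M ?P)"
  proof -
    note [measurable] = measurable_sliced_wasserstein_pow[OF p random_law_compose[OF random_law_coordinates[OF n] measurable_fst]
       random_law_compose[OF random_law_coordinates[OF n] measurable_snd]]
    show ?thesis by measurable
  qed
  define F where "F = (\<lambda>(k, l). (?f x k, ?f y l))"
  have F: "F \<in> ?K \<Otimes>\<^sub>M ?K \<rightarrow>\<^sub>M ?P \<Otimes>\<^sub>M ?P"
    unfolding F_def case_prod_beta'
    by (intro measurable_Pair measurable_compose[OF measurable_fst f] measurable_compose[OF measurable_snd f])
  have m: "(\<lambda>k. ?T (\<lambda>i. x (fst k i)) (\<lambda>i. y (snd k i))) \<in> borel_measurable (resample_pair n)"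
    using measurable_compose[OF F T] by (simp add: F_def case_prod_beta' c resample_pair_def)
  have "prob_space (distr ?K ?P (?f y))" by (rule K.prob_space_distr[OF f])
  then have "sigma_finite_measure (distr ?K ?P (?f y))"
    by (intro finite_measure.sigma_finite_measure prob_space.finite_measure)
  then have law: "bootstrap_law n x \<Otimes>\<^sub>M bootstrap_law n y = distr (?K \<Otimes>\<^sub>M ?K) (?P \<Otimes>\<^sub>M ?P) F"
    unfolding bootstrap_law_eq_distr[OF n] F_def by (intro pair_measure_distr f)
  have "bootstrap_cdf2 p n x y t = measure (distr (?K \<Otimes>\<^sub>M ?K) (?P \<Otimes>\<^sub>M ?P) F) {z \<in> space (?P \<Otimes>\<^sub>M ?P). ?T (fst z) (snd z) \<le> t}"
    unfolding bootstrap_cdf2_def law space_distr by (intro arg_cong2[where f = measure]) auto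
  also have "\<dots> = measure (resample_pair n) {k \<in> space (resample_pair n). ?T (\<lambda>i. x (fst k i)) (\<lambda>i. y (snd k i)) \<le> t}"
    unfolding resample_pair_def using T measurable_space[OF F]
    by (subst measure_distr[OF F]) (auto intro!: arg_cong[where f = "measure (?K \<Otimes>\<^sub>M ?K)"] simp: c F_def)
  also have "\<dots> = cdf (distr (resample_pair n) borel (\<lambda>k. ?T (\<lambda>i. x (fst k i)) (\<lambda>i. y (snd k i)))) t"
    unfolding cdf_def using m by (subst measure_distr) (auto intro!: arg_cong[where f = "measure (resample_pair n)"])
  finally show ?thesis .
qed

text \<open>
A supremum over countably many points is measurable in a parameter.
\<close>
lemma cSUP_right_continuous:
  fixes f :: "real \<Rightarrow> real"
  assumes cont: "\<And>t. continuous (at_right t) f" and B: "\<And>t. f t \<le> B"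
  shows "(SUP t. f t) = (SUP t\<in>\<rat>. f t)"
proof (rule antisym)
  have bdd: "bdd_above (f ` A)" for A by (rule bdd_aboveI2[where M = B]) (rule B)
  show "(SUP t\<in>\<rat>. f t) \<le> (SUP t. f t)" by (rule cSUP_subset_mono) (auto intro: bdd Rats_0)
  show "(SUP t. f t) \<le> (SUP t\<in>\<rat>. f t)"
  proof (rule cSUP_least)
    fix t :: real
    show "f t \<le> (SUP t\<in>\<rat>. f t)"
    proof (rule field_le_epsilon)
      fix e :: real assume e: "0 < e"
      have "(f \<longlongrightarrow> f t) (at_right t)" using cont[of t] by (simp add: continuous_within)
      then have "\<forall>\<^sub>F s in at_right t. f t - e < f s" using e by (intro order_tendstoD(1)) auto
      then obtain b where b: "t < b" "\<And>s. t < s \<Longrightarrow> s < b \<Longrightarrow> f t - e < f s"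
        unfolding eventually_at_right_field by blast
      obtain q where q: "q \<in> \<rat>" "t < q" "q < b" using Rats_dense_in_real[OF b(1)] by blast
      have "f q \<le> (SUP t\<in>\<rat>. f t)" using q bdd by (intro cSUP_upper) auto
      with b(2)[of q] q show "f t \<le> (SUP t\<in>\<rat>. f t) + e" by simp
    qed
  qed simp
qed

lemma norm_diff_product_le:
  fixes a b c d :: complex
  assumes "norm a \<le> 1" "norm d \<le> 1"
  shows "norm (a * b - c * d) \<le> norm (a - c) + norm (b - d)"
proof -
  have "a * b - c * d = a * (b - d) + (a - c) * d" by (simp add: algebra_simps)
  then have "norm (a * b - c * d) \<le> norm (a * (b - d)) + norm ((a - c) * d)" by (metis norm_triangle_ineq)
  also have "\<dots> \<le> 1 * norm (b - d) + norm (a - c) * 1"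
    unfolding norm_mult using assms by (intro add_mono mult_mono) auto
  finally show ?thesis by simp
qed

lemma abs_exp_minus_diff_le:
  fixes u v :: real
  assumes "0 \<le> u" "0 \<le> v"
  shows "\<bar>exp (- u) - exp (- v)\<bar> \<le> \<bar>u - v\<bar>"
proof -
  have *: "exp (- a) - exp (- b) \<le> b - a" if "0 \<le> a" "a \<le> b" for a b :: real
  proof -
    have "exp (- a) - exp (- b) = exp (- a) * (1 - exp (- (b - a)))" by (simp add: exp_diff exp_minus field_simps)
    also have "\<dots> \<le> 1 * (b - a)"
    proof (rule mult_mono)
      show "1 - exp (- (b - a)) \<le> b - a" using exp_ge_add_one_self[of "- (b - a)"] by linarith
    qed (use that in auto)
    finally show ?thesis by simp
  qed
  show ?thesis using *[of u v] *[of v u] assms by (cases "u \<le> v") (auto simp: abs_if)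
qed

context two_samples
begin

definition boot_stat :: "bool \<Rightarrow> nat \<Rightarrow> (nat \<Rightarrow> 'a) \<Rightarrow> (nat \<Rightarrow> 'a) \<Rightarrow> (nat \<Rightarrow> nat) \<times> (nat \<Rightarrow> nat) \<Rightarrow> real" where
  "boot_stat b n x y k = sqrt (real n) * (S (empirical n (\<lambda>i. x (fst k i))) (nuhat b n (\<lambda>i. y (snd k i)))
      - S (empirical n x) (nuhat b n y))"

definition boot_lin :: "bool \<Rightarrow> nat \<Rightarrow> (nat \<Rightarrow> 'a) \<Rightarrow> (nat \<Rightarrow> 'a) \<Rightarrow> (nat \<Rightarrow> nat) \<times> (nat \<Rightarrow> nat) \<Rightarrow> real" where
  "boot_lin b n x y k = sqrt (real n) * (linear_part p R \<mu> \<nu> (empirical n (\<lambda>i. x (fst k i))) (nuhat b n (\<lambda>i. y (snd k i)))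
      - linear_part p R \<mu> \<nu> (empirical n x) (nuhat b n y))"

definition sample_variance :: "bool \<Rightarrow> nat \<Rightarrow> (nat \<Rightarrow> 'a) \<Rightarrow> (nat \<Rightarrow> 'a) \<Rightarrow> real" where
  "sample_variance b n x y = var_of (empirical n x) \<Psi> + (if b then var_of (empirical n y) \<psi> else 0)"

lemma random_law_nuhat_resampled:
  assumes n: "0 < n"
  shows "random_law (resample_pair n) (\<lambda>k. nuhat b n (\<lambda>i. y (snd k i)))"
  using random_law_resampled[OF n resample_pair_projections(2)[OF n]] random_law_const[OF nu(1,2)]
  by (cases b) (simp_all add: nuhat_def)

lemma measurable_boot:
  assumes n: "0 < n"
  shows "boot_stat b n x y \<in> borel_measurable (resample_pair n)" "boot_lin b n x y \<in> borel_measurable (resample_pair n)"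
proof -
  note rl = random_law_resampled[OF n resample_pair_projections(1)[OF n], of x] random_law_nuhat_resampled[OF n, of b y]
  note [measurable] = measurable_sliced_wasserstein_pow[OF p rl] measurable_linear_part[OF p mu(1,2) nu(1,2) rl, of R]
  show "boot_stat b n x y \<in> borel_measurable (resample_pair n)" "boot_lin b n x y \<in> borel_measurable (resample_pair n)"
    unfolding boot_stat_def[abs_def] boot_lin_def[abs_def] by measurable
qed

lemma var_of_empirical:
  assumes n: "0 < n"
  shows "0 \<le> var_of (empirical n x) \<Psi>" "var_of (empirical n x) \<Psi> \<le> (box_mass p R)\<^sup>2"
    "0 \<le> var_of (empirical n x) \<psi>" "var_of (empirical n x) \<psi> \<le> (box_mass p R)\<^sup>2"
proof -
  have m: "\<Psi> \<in> borel_measurable (empirical n x)" "\<psi> \<in> borel_measurable (empirical n x)"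
    using inf_meas by (simp_all add: measurable_cong_sets[OF empirical_law(2)[OF n] refl])
  show "0 \<le> var_of (empirical n x) \<Psi>" "var_of (empirical n x) \<Psi> \<le> (box_mass p R)\<^sup>2"
    by (rule var_of_props[OF empirical_law(1)[OF n] m(1)], rule inf_bound)+
  show "0 \<le> var_of (empirical n x) \<psi>" "var_of (empirical n x) \<psi> \<le> (box_mass p R)\<^sup>2"
    by (rule var_of_props[OF empirical_law(1)[OF n] m(2)], rule inf_bound)+
qed

lemma sample_variance_bounds:
  assumes n: "0 < n"
  shows "0 \<le> sample_variance b n x y" "sample_variance b n x y \<le> 2 * (box_mass p R)\<^sup>2"
  using var_of_empirical(1,2)[OF n, of x] var_of_empirical(3,4)[OF n, of y] by (auto simp: sample_variance_def)

text \<open>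
Given the data, the linear part of the bootstrap statistic is a centred sum of independent bounded variables whose variance is
the sample variance. The error bound is the same for all data.
\<close>
lemma char_boot_lin:
  assumes n: "0 < n"
  shows "cmod (char (distr (resample_pair n) borel (boot_lin b n x y)) t - of_real (exp (- (t\<^sup>2 * sample_variance b n x y / 2))))
     \<le> clt_error t (box_mass p R) n * (2 * (box_mass p R)\<^sup>2)"
proof -
  let ?K = "resample_space n" and ?B = "box_mass p R"
  interpret K: prob_space ?K by (rule prob_space_resample_space[OF n])
  define f where "f k = sqrt (real n) * ((\<integral>z. \<Psi> z \<partial>empirical n (\<lambda>i. x (k i))) - (\<integral>z. \<Psi> z \<partial>empirical n x))" for k
  define g where "g k = (if b then sqrt (real n) * ((\<integral>z. \<psi> z \<partial>empirical n (\<lambda>i. y (k i))) - (\<integral>z. \<psi> z \<partial>empirical n y)) else 0)" for k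
  define V where "V = var_of (empirical n x) \<Psi>"
  define W where "W = (if b then var_of (empirical n y) \<psi> else 0)"
  have V: "0 \<le> V" "V \<le> ?B\<^sup>2" and W: "0 \<le> W" "W \<le> ?B\<^sup>2"
    using var_of_empirical[OF n] by (auto simp: V_def W_def)
  have xm: "(\<lambda>k. x (k i)) \<in> borel_measurable ?K" if "i < n" for i and x :: "nat \<Rightarrow> 'a"
    using that by (intro measurable_compose[OF measurable_resample_index]) auto
  have fm: "f \<in> borel_measurable ?K"
    unfolding f_def integral_empirical[OF inf_meas(1)] using xm by (auto intro!: borel_measurable_sum measurable_compose[OF _ inf_meas(1)])
  have gm: "g \<in> borel_measurable ?K"
    unfolding g_def integral_empirical[OF inf_meas(2)] using xm
    by (cases b) (auto intro!: borel_measurable_sum measurable_compose[OF _ inf_meas(2)])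
  have cf: "cmod (char (distr ?K borel f) t - of_real (exp (- (t\<^sup>2 * V / 2)))) \<le> clt_error t ?B n * V"
    unfolding f_def V_def
    by (rule char_sample_mean[OF K.prob_space_axioms n indep_resample(1)[OF n] indep_resample(2)[OF n] inf_meas(1) inf_bound(1)])
  have cg: "cmod (char (distr ?K borel g) t - of_real (exp (- (t\<^sup>2 * W / 2)))) \<le> clt_error t ?B n * W"
  proof (cases b)
    case True
    show ?thesis
      using char_sample_mean[OF K.prob_space_axioms n indep_resample(1)[OF n, of y] indep_resample(2)[OF n, of _ y] inf_meas(2) inf_bound(2), of t] True
      unfolding g_def W_def by simp
  next
    case False
    have "char (distr ?K borel g) t = 1"
      unfolding char_def using gm False by (subst integral_distr) (auto simp: g_def K.prob_space)
    then show ?thesis using False by (simp add: W_def)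
  qed
  have lin: "boot_lin b n x y = (\<lambda>(k, l). f k + g l)"
    unfolding boot_lin_def linear_part_diff_eq by (auto simp: fun_eq_iff f_def g_def nuhat_def)
  have "char (distr (resample_pair n) borel (boot_lin b n x y)) t = char (distr ?K borel f) t * char (distr ?K borel g) t"
    unfolding lin resample_pair_def by (rule char_pair_sum[OF K.prob_space_axioms K.prob_space_axioms fm gm])
  moreover have "of_real (exp (- (t\<^sup>2 * sample_variance b n x y / 2))) = (of_real (exp (- (t\<^sup>2 * V / 2))) * of_real (exp (- (t\<^sup>2 * W / 2))) :: complex)"
  proof -
    have "- (t\<^sup>2 * sample_variance b n x y / 2) = - (t\<^sup>2 * V / 2) + - (t\<^sup>2 * W / 2)"
      by (simp add: sample_variance_def V_def W_def distrib_left add_divide_distrib)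
    then show ?thesis by (simp only: exp_add of_real_mult)
  qed
  moreover have "cmod (char (distr ?K borel f) t) \<le> 1"
    by (rule real_distribution.cmod_char_le_1[OF K.real_distribution_distr[OF fm]])
  moreover have "cmod (of_real (exp (- (t\<^sup>2 * W / 2)))) \<le> 1" using W by (simp del: of_real_exp)
  ultimately have "cmod (char (distr (resample_pair n) borel (boot_lin b n x y)) t - of_real (exp (- (t\<^sup>2 * sample_variance b n x y / 2))))
     \<le> clt_error t ?B n * V + clt_error t ?B n * W"
    using norm_diff_product_le[of "char (distr ?K borel f) t" "of_real (exp (- (t\<^sup>2 * W / 2)))" "char (distr ?K borel g) t" "of_real (exp (- (t\<^sup>2 * V / 2)))"] cf cg
    by simp
  also have "\<dots> = clt_error t ?B n * (V + W)" by (simp add: distrib_left)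
  also have "\<dots> \<le> clt_error t ?B n * (2 * ?B\<^sup>2)"
    using V W clt_error_nonneg[OF box_mass_nonneg] by (intro mult_left_mono) auto
  finally show ?thesis .
qed

definition boot_remainder :: "bool \<Rightarrow> nat \<Rightarrow> 'w \<Rightarrow> real" where
  "boot_remainder b n w = (\<integral>k. \<bar>boot_stat b n (\<lambda>i. X i w) (\<lambda>i. Y i w) k - boot_lin b n (\<lambda>i. X i w) (\<lambda>i. Y i w) k\<bar> \<partial>resample_pair n)"

lemma boot_random_laws:
  assumes n: "0 < n"
  shows "root_n_estimator (M \<Otimes>\<^sub>M resample_pair n) n R \<mu> (\<lambda>w. empirical n (\<lambda>i. X i (fst w)))"
    and "root_n_estimator (M \<Otimes>\<^sub>M resample_pair n) n R \<mu> (\<lambda>w. empirical n (\<lambda>i. X (fst (snd w) i) (fst w)))"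
    and "root_n_estimator (M \<Otimes>\<^sub>M resample_pair n) n R \<nu> (\<lambda>w. nuhat b n (\<lambda>i. Y i (fst w)))"
    and "root_n_estimator (M \<Otimes>\<^sub>M resample_pair n) n R \<nu> (\<lambda>w. nuhat b n (\<lambda>i. Y (snd (snd w) i) (fst w)))"
proof -
  interpret Q: prob_space "resample_pair n" by (rule prob_space_resample_pair[OF n])
  show "root_n_estimator (M \<Otimes>\<^sub>M resample_pair n) n R \<mu> (\<lambda>w. empirical n (\<lambda>i. X i (fst w)))"
    by (rule root_n_estimator_compose[OF root_n_muhat[OF n] measurable_fst Q.distr_pair_fst])
  show "root_n_estimator (M \<Otimes>\<^sub>M resample_pair n) n R \<nu> (\<lambda>w. nuhat b n (\<lambda>i. Y i (fst w)))"
    by (rule root_n_estimator_compose[OF root_n_nuhat[OF n] measurable_fst Q.distr_pair_fst])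
  show "root_n_estimator (M \<Otimes>\<^sub>M resample_pair n) n R \<mu> (\<lambda>w. empirical n (\<lambda>i. X (fst (snd w) i) (fst w)))"
    by (rule root_n_estimator_bootstrap[OF M n indep_vars_subset[OF indep_X] X mu Q.prob_space_axioms
          resample_pair_projections(1,3)[OF n]]) simp
  show "root_n_estimator (M \<Otimes>\<^sub>M resample_pair n) n R \<nu> (\<lambda>w. nuhat b n (\<lambda>i. Y (snd (snd w) i) (fst w)))"
  proof (cases b)
    case True
    have "root_n_estimator (M \<Otimes>\<^sub>M resample_pair n) n R \<nu> (\<lambda>w. empirical n (\<lambda>i. Y (snd (snd w) i) (fst w)))"
      by (rule root_n_estimator_bootstrap[OF M n indep_vars_subset[OF indep_Y] Y nu Q.prob_space_axioms
          resample_pair_projections(2,4)[OF n]]) simp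
    then show ?thesis using True by (simp add: nuhat_def)
  next
    case False
    then show ?thesis by (simp add: nuhat_def root_n_estimator_const nu)
  qed
qed

text \<open>
On the product of the data space with the index space, the original and the resampled empirical measures are both root-n
estimators of the true laws. So the linearization at the true laws applies, and by Fubini the conditional mean of the
remainder given the data tends to 0 in mean.
\<close>
lemma boot_remainder_tendsto:
  shows "(\<lambda>n. expectation (boot_remainder b n)) \<longlonglongrightarrow> 0"
    and "0 < n \<Longrightarrow> integrable M (boot_remainder b n)"
    and "0 < n \<Longrightarrow> AE w in M. integrable (resample_pair n) (\<lambda>k. boot_stat b n (\<lambda>i. X i w) (\<lambda>i. Y i w) k - boot_lin b n (\<lambda>i. X i w) (\<lambda>i. Y i w) k)"
proof -
  let ?d = "\<lambda>n w k. boot_stat b n (\<lambda>i. X i w) (\<lambda>i. Y i w) k - boot_lin b n (\<lambda>i. X i w) (\<lambda>i. Y i w) k"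
  define rem where "rem n w = (S (empirical n (\<lambda>i. X (fst (snd w) i) (fst w))) (nuhat b n (\<lambda>i. Y (snd (snd w) i) (fst w)))
      - S (empirical n (\<lambda>i. X i (fst w))) (nuhat b n (\<lambda>i. Y i (fst w))))
    - (linear_part p R \<mu> \<nu> (empirical n (\<lambda>i. X (fst (snd w) i) (fst w))) (nuhat b n (\<lambda>i. Y (snd (snd w) i) (fst w)))
      - linear_part p R \<mu> \<nu> (empirical n (\<lambda>i. X i (fst w))) (nuhat b n (\<lambda>i. Y i (fst w))))" for n and w :: "'w \<times> ((nat \<Rightarrow> nat) \<times> (nat \<Rightarrow> nat))"
  have PS: "prob_space (M \<Otimes>\<^sub>M resample_pair n)" if "0 < n" for n by (intro prob_space_pair M prob_space_resample_pair that)
  note lin = sliced_linearization[where P = "\<lambda>n. M \<Otimes>\<^sub>M resample_pair n" and \<gamma> = "\<lambda>n w. empirical n (\<lambda>i. X i (fst w))"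
      and \<gamma>' = "\<lambda>n w. empirical n (\<lambda>i. X (fst (snd w) i) (fst w))"
      and \<delta> = "\<lambda>n w. nuhat b n (\<lambda>i. Y i (fst w))" and \<delta>' = "\<lambda>n w. nuhat b n (\<lambda>i. Y (snd (snd w) i) (fst w))" and R = R,
      OF p mu(1,2) conv nu(1,2), folded rem_def]
  have lim: "(\<lambda>n. sqrt (real n) * (\<integral>w. \<bar>rem n w\<bar> \<partial>(M \<Otimes>\<^sub>M resample_pair n))) \<longlonglongrightarrow> 0"
    by (rule lin(1)) (rule PS boot_random_laws | assumption)+
  have ir: "integrable (M \<Otimes>\<^sub>M resample_pair n) (rem n)" if "0 < n" for n
    by (rule lin(2)) (rule PS boot_random_laws that | assumption)+
  have d: "?d n w k = sqrt (real n) * rem n (w, k)" for n w k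
    by (simp add: boot_stat_def boot_lin_def rem_def right_diff_distrib)
  have fub: "integrable M (boot_remainder b n)" "AE w in M. integrable (resample_pair n) (?d n w)"
      "expectation (boot_remainder b n) = sqrt (real n) * (\<integral>w. \<bar>rem n w\<bar> \<partial>(M \<Otimes>\<^sub>M resample_pair n))" if n: "0 < n" for n
  proof -
    interpret Q: prob_space "resample_pair n" by (rule prob_space_resample_pair[OF n])
    interpret P: pair_sigma_finite M "resample_pair n" by standard
    have i: "integrable (M \<Otimes>\<^sub>M resample_pair n) (\<lambda>w. sqrt (real n) * rem n w)" using ir[OF n] by simp
    have ia: "integrable (M \<Otimes>\<^sub>M resample_pair n) (\<lambda>w. \<bar>sqrt (real n) * rem n w\<bar>)" using i by (rule integrable_abs)
    show "AE w in M. integrable (resample_pair n) (?d n w)"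
      using P.AE_integrable_fst'[OF i] by (simp only: d)
    show "integrable M (boot_remainder b n)"
      using P.integrable_fst'[OF ia] unfolding boot_remainder_def[abs_def] d .
    have "expectation (boot_remainder b n) = (\<integral>w. \<bar>sqrt (real n) * rem n w\<bar> \<partial>(M \<Otimes>\<^sub>M resample_pair n))"
      using P.integral_fst'[OF ia] unfolding boot_remainder_def[abs_def] d .
    then show "expectation (boot_remainder b n) = sqrt (real n) * (\<integral>w. \<bar>rem n w\<bar> \<partial>(M \<Otimes>\<^sub>M resample_pair n))"
      by (simp add: abs_mult)
  qed
  show "(\<lambda>n. expectation (boot_remainder b n)) \<longlonglongrightarrow> 0"
    by (rule Lim_transform_eventually[OF lim eventually_sequentiallyI[of 1]]) (simp add: fub(3))
  show "integrable M (boot_remainder b n)" "AE w in M. integrable (resample_pair n) (?d n w)" if "0 < n"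
    using fub that by auto
qed

text \<open>
A variance is a second moment minus the square of a mean, and both converge in mean by the law of large numbers for bounded
functions.
\<close>
lemma sample_variance_tendsto:
  shows "(\<lambda>n. expectation (\<lambda>w. \<bar>sample_variance b n (\<lambda>i. X i w) (\<lambda>i. Y i w) - limit_variance b\<bar>)) \<longlonglongrightarrow> 0"
    and "0 < n \<Longrightarrow> integrable M (\<lambda>w. \<bar>sample_variance b n (\<lambda>i. X i w) (\<lambda>i. Y i w) - limit_variance b\<bar>)"
proof -
  let ?B = "box_mass p R"
  have one: "(\<lambda>n. expectation (\<lambda>w. \<bar>var_of (empirical n (\<lambda>i. Z i w)) g - var_of \<rho> g\<bar>)) \<longlonglongrightarrow> 0 \<and>
      (\<forall>n>0. integrable M (\<lambda>w. var_of (empirical n (\<lambda>i. Z i w)) g - var_of \<rho> g))"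
    if ind: "indep_vars (\<lambda>_. borel) Z UNIV" and Z: "\<And>i. distr M borel (Z i) = \<rho>"
      and g [measurable]: "g \<in> borel_measurable borel" and B: "\<And>x. \<bar>g x\<bar> \<le> ?B" and \<rho>: "prob_space \<rho>" "sets \<rho> = sets borel"
    for Z :: "nat \<Rightarrow> 'w \<Rightarrow> 'a" and g \<rho>
  proof -
    have B2: "\<bar>(g x)\<^sup>2\<bar> \<le> ?B\<^sup>2" for x using B[of x] by (simp add: abs_le_square_iff[symmetric])
    note L1 = sample_mean_L1_tendsto[OF M ind Z g B] and L2 = sample_mean_L1_tendsto[OF M ind Z _ B2]
    let ?m = "\<lambda>n w. \<integral>z. g z \<partial>empirical n (\<lambda>i. Z i w)" and ?q = "\<lambda>n w. \<integral>z. (g z)\<^sup>2 \<partial>empirical n (\<lambda>i. Z i w)"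
    let ?d = "\<lambda>n w. var_of (empirical n (\<lambda>i. Z i w)) g - var_of \<rho> g"
    have gm: "g \<in> borel_measurable \<rho>" by (simp add: measurable_cong_sets[OF \<rho>(2) refl])
    note vr = var_of_props[OF \<rho>(1) gm B]
    have key: "?d n w = (?q n w - (\<integral>z. (g z)\<^sup>2 \<partial>\<rho>)) - (?m n w - (\<integral>z. g z \<partial>\<rho>)) * (?m n w + (\<integral>z. g z \<partial>\<rho>))"
      "\<bar>?m n w + (\<integral>z. g z \<partial>\<rho>)\<bar> \<le> 2 * ?B" if n: "0 < n" for n w
    proof -
      have "g \<in> borel_measurable (empirical n (\<lambda>i. Z i w))" by (simp add: measurable_cong_sets[OF empirical_law(2)[OF n] refl])
      note ve = var_of_props[OF empirical_law(1)[OF n] this B]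
      show "?d n w = (?q n w - (\<integral>z. (g z)\<^sup>2 \<partial>\<rho>)) - (?m n w - (\<integral>z. g z \<partial>\<rho>)) * (?m n w + (\<integral>z. g z \<partial>\<rho>))"
        unfolding ve(1) vr(1) by (simp add: power2_eq_square algebra_simps)
      show "\<bar>?m n w + (\<integral>z. g z \<partial>\<rho>)\<bar> \<le> 2 * ?B" using ve(4) vr(4) by linarith
    qed
    have bd: "\<bar>?d n w\<bar> \<le> \<bar>?q n w - (\<integral>z. (g z)\<^sup>2 \<partial>\<rho>)\<bar> + 2 * ?B * \<bar>?m n w - (\<integral>z. g z \<partial>\<rho>)\<bar>" if n: "0 < n" for n w
    proof -
      have "\<bar>(?m n w - (\<integral>z. g z \<partial>\<rho>)) * (?m n w + (\<integral>z. g z \<partial>\<rho>))\<bar> \<le> \<bar>?m n w - (\<integral>z. g z \<partial>\<rho>)\<bar> * (2 * ?B)"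
        unfolding abs_mult using key(2)[OF n] by (intro mult_left_mono) auto
      then show ?thesis unfolding key(1)[OF n] by (simp add: mult.commute)
    qed
    have Zm [measurable]: "Z i \<in> borel_measurable M" for i using ind by (auto simp: indep_vars_def)
    have dm: "?d n \<in> borel_measurable M" if n: "0 < n" for n
      unfolding key(1)[OF n] by (simp add: integral_empirical)
    have i: "integrable M (\<lambda>w. \<bar>?q n w - (\<integral>z. (g z)\<^sup>2 \<partial>\<rho>)\<bar> + 2 * ?B * \<bar>?m n w - (\<integral>z. g z \<partial>\<rho>)\<bar>)" if n: "0 < n" for n
      using L1(2)[OF n] L2(2)[OF _ n] by auto
    have id: "integrable M (?d n)" if n: "0 < n" for n
      by (rule Bochner_Integration.integrable_bound[OF i[OF n] dm[OF n]])
         (use bd[OF n] in \<open>auto intro!: AE_I2 order_trans[OF _ abs_ge_self]\<close>)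
    have up: "expectation (\<lambda>w. \<bar>?d n w\<bar>) \<le> expectation (\<lambda>w. \<bar>?q n w - (\<integral>z. (g z)\<^sup>2 \<partial>\<rho>)\<bar>) + 2 * ?B * expectation (\<lambda>w. \<bar>?m n w - (\<integral>z. g z \<partial>\<rho>)\<bar>)"
      if n: "0 < n" for n
    proof -
      have "expectation (\<lambda>w. \<bar>?d n w\<bar>) \<le> expectation (\<lambda>w. \<bar>?q n w - (\<integral>z. (g z)\<^sup>2 \<partial>\<rho>)\<bar> + 2 * ?B * \<bar>?m n w - (\<integral>z. g z \<partial>\<rho>)\<bar>)"
        using id[OF n] i[OF n] bd[OF n] by (intro integral_mono) auto
      also have "\<dots> = expectation (\<lambda>w. \<bar>?q n w - (\<integral>z. (g z)\<^sup>2 \<partial>\<rho>)\<bar>) + 2 * ?B * expectation (\<lambda>w. \<bar>?m n w - (\<integral>z. g z \<partial>\<rho>)\<bar>)"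
        using integrable_abs[OF L1(2)[OF n]] integrable_abs[OF L2(2)[OF _ n]] by simp
      finally show ?thesis .
    qed
    have "(\<lambda>n. expectation (\<lambda>w. \<bar>?q n w - (\<integral>z. (g z)\<^sup>2 \<partial>\<rho>)\<bar>) + 2 * ?B * expectation (\<lambda>w. \<bar>?m n w - (\<integral>z. g z \<partial>\<rho>)\<bar>)) \<longlonglongrightarrow> 0 + 2 * ?B * 0"
      by (intro tendsto_add tendsto_mult tendsto_const L1(1) L2(1)) measurable
    then have lim: "(\<lambda>n. expectation (\<lambda>w. \<bar>?q n w - (\<integral>z. (g z)\<^sup>2 \<partial>\<rho>)\<bar>) + 2 * ?B * expectation (\<lambda>w. \<bar>?m n w - (\<integral>z. g z \<partial>\<rho>)\<bar>)) \<longlonglongrightarrow> 0" by simp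
    have "(\<lambda>n. expectation (\<lambda>w. \<bar>?d n w\<bar>)) \<longlonglongrightarrow> 0"
    proof (rule tendsto_sandwich[OF _ _ tendsto_const lim])
      show "\<forall>\<^sub>F n in sequentially. expectation (\<lambda>w. \<bar>?d n w\<bar>) \<le> expectation (\<lambda>w. \<bar>?q n w - (\<integral>z. (g z)\<^sup>2 \<partial>\<rho>)\<bar>) + 2 * ?B * expectation (\<lambda>w. \<bar>?m n w - (\<integral>z. g z \<partial>\<rho>)\<bar>)"
        by (rule eventually_sequentiallyI[of 1], rule up) simp
    qed simp
    with id show ?thesis by blast
  qed
  note 1 = one[OF indep_X X inf_meas(1) inf_bound(1) mu(1,2)] and 2 = one[OF indep_Y Y inf_meas(2) inf_bound(2) nu(1,2)]
  let ?u = "\<lambda>n w. var_of (empirical n (\<lambda>i. X i w)) \<Psi> - var_of \<mu> \<Psi>"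
  let ?v = "\<lambda>n w. if b then var_of (empirical n (\<lambda>i. Y i w)) \<psi> - var_of \<nu> \<psi> else 0"
  have v: "(\<lambda>n. expectation (\<lambda>w. \<bar>?v n w\<bar>)) \<longlonglongrightarrow> 0" "\<And>n. 0 < n \<Longrightarrow> integrable M (?v n)" using 2 by (cases b; simp)+
  have d: "sample_variance b n (\<lambda>i. X i w) (\<lambda>i. Y i w) - limit_variance b = ?u n w + ?v n w" for n w
    by (simp add: sample_variance_def limit_variance_def)
  show "integrable M (\<lambda>w. \<bar>sample_variance b n (\<lambda>i. X i w) (\<lambda>i. Y i w) - limit_variance b\<bar>)" if "0 < n"
    unfolding d using 1 v(2) that by (intro integrable_abs Bochner_Integration.integrable_add) auto
  have "(\<lambda>n. expectation (\<lambda>w. \<bar>?u n w\<bar>) + expectation (\<lambda>w. \<bar>?v n w\<bar>)) \<longlonglongrightarrow> 0 + 0"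
    using 1 v by (intro tendsto_add) auto
  then have lim: "(\<lambda>n. expectation (\<lambda>w. \<bar>?u n w\<bar>) + expectation (\<lambda>w. \<bar>?v n w\<bar>)) \<longlonglongrightarrow> 0" by simp
  show "(\<lambda>n. expectation (\<lambda>w. \<bar>sample_variance b n (\<lambda>i. X i w) (\<lambda>i. Y i w) - limit_variance b\<bar>)) \<longlonglongrightarrow> 0"
  proof (rule tendsto_sandwich[OF _ _ tendsto_const lim])
    show "\<forall>\<^sub>F n in sequentially. expectation (\<lambda>w. \<bar>sample_variance b n (\<lambda>i. X i w) (\<lambda>i. Y i w) - limit_variance b\<bar>)
        \<le> expectation (\<lambda>w. \<bar>?u n w\<bar>) + expectation (\<lambda>w. \<bar>?v n w\<bar>)"
    proof (rule eventually_sequentiallyI[of 1])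
      fix n :: nat assume "1 \<le> n"
      then have i: "integrable M (?u n)" "integrable M (?v n)" using 1 v(2) by auto
      show "expectation (\<lambda>w. \<bar>sample_variance b n (\<lambda>i. X i w) (\<lambda>i. Y i w) - limit_variance b\<bar>)
        \<le> expectation (\<lambda>w. \<bar>?u n w\<bar>) + expectation (\<lambda>w. \<bar>?v n w\<bar>)"
        unfolding d Bochner_Integration.integral_add[OF integrable_abs[OF i(1)] integrable_abs[OF i(2)], symmetric]
        by (intro integral_mono integrable_abs Bochner_Integration.integrable_add i abs_triangle_ineq)
    qed
  qed simp
qed

definition boot_distance :: "bool \<Rightarrow> nat \<Rightarrow> 'w \<Rightarrow> real" where
  "boot_distance b n w = (SUP t. \<bar>cdf (distr (resample_pair n) borel (boot_stat b n (\<lambda>i. X i w) (\<lambda>i. Y i w))) t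
      - cdf (normal_law 0 (limit_variance b)) t\<bar>)"

lemma real_distribution_boot:
  assumes n: "0 < n"
  shows "real_distribution (distr (resample_pair n) borel (boot_stat b n x y))"
  by (rule prob_space.real_distribution_distr[OF prob_space_resample_pair[OF n] measurable_boot(1)[OF n]])

lemma measurable_boot_distance:
  assumes n: "0 < n"
  shows "boot_distance b n \<in> borel_measurable M"
proof -
  let ?Q = "resample_pair n"
  let ?F = "\<lambda>w. cdf (distr ?Q borel (boot_stat b n (\<lambda>i. X i w) (\<lambda>i. Y i w)))"
  let ?N = "cdf (normal_law 0 (limit_variance b))"
  interpret Q: prob_space ?Q by (rule prob_space_resample_pair[OF n])
  interpret N: real_distribution "normal_law 0 (limit_variance b)" by (rule real_distribution_normal_law)
  have F: "real_distribution (distr ?Q borel (boot_stat b n (\<lambda>i. X i w) (\<lambda>i. Y i w)))" for w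
    by (rule real_distribution_boot[OF n])
  have rl: "random_law (M \<Otimes>\<^sub>M ?Q) (\<lambda>w. empirical n (\<lambda>i. X i (fst w)))" "random_law (M \<Otimes>\<^sub>M ?Q) (\<lambda>w. empirical n (\<lambda>i. X (fst (snd w) i) (fst w)))"
     "random_law (M \<Otimes>\<^sub>M ?Q) (\<lambda>w. nuhat b n (\<lambda>i. Y i (fst w)))" "random_law (M \<Otimes>\<^sub>M ?Q) (\<lambda>w. nuhat b n (\<lambda>i. Y (snd (snd w) i) (fst w)))"
    using boot_random_laws[OF n] by (auto simp: root_n_estimator_def)
  note [measurable] = measurable_sliced_wasserstein_pow[OF p rl(2) rl(4)] measurable_sliced_wasserstein_pow[OF p rl(1) rl(3)]
  have st [measurable]: "(\<lambda>w. boot_stat b n (\<lambda>i. X i (fst w)) (\<lambda>i. Y i (fst w)) (snd w)) \<in> borel_measurable (M \<Otimes>\<^sub>M ?Q)"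
    unfolding boot_stat_def by measurable
  have Fm: "(\<lambda>w. ?F w t) \<in> borel_measurable M" for t
  proof -
    have "?F w t = (\<integral>k. step (boot_stat b n (\<lambda>i. X i w) (\<lambda>i. Y i w) k) t \<partial>?Q)" for w
      unfolding cdf_eq_expectation_step[OF F] using measurable_boot(1)[OF n] by (subst integral_distr) auto
    then show ?thesis
      by (simp only:) (rule Q.borel_measurable_lebesgue_integral, simp add: case_prod_beta')
  qed
  have bd: "\<bar>?F w t - ?N t\<bar> \<le> 1" for w t
  proof -
    interpret L: real_distribution "distr ?Q borel (boot_stat b n (\<lambda>i. X i w) (\<lambda>i. Y i w))" by (rule F)
    show ?thesis using L.cdf_nonneg[of t] L.cdf_bounded_prob[of t] N.cdf_nonneg[of t] N.cdf_bounded_prob[of t] by (simp add: abs_le_iff)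
  qed
  have "boot_distance b n w = (SUP t\<in>\<rat>. \<bar>?F w t - ?N t\<bar>)" for w
    unfolding boot_distance_def
  proof (rule cSUP_right_continuous[OF _ bd])
    interpret L: real_distribution "distr ?Q borel (boot_stat b n (\<lambda>i. X i w) (\<lambda>i. Y i w))" by (rule F)
    show "continuous (at_right t) (\<lambda>t. \<bar>?F w t - ?N t\<bar>)" for t
      by (intro continuous_intros L.cdf_is_right_cont N.cdf_is_right_cont)
  qed
  then have "boot_distance b n = (\<lambda>w. SUP t\<in>\<rat>. \<bar>?F w t - ?N t\<bar>)" by blast
  also have "\<dots> \<in> borel_measurable M"
  proof (rule borel_measurable_cSUP)
    show "(\<lambda>w. \<bar>?F w t - ?N t\<bar>) \<in> borel_measurable M" for t using Fm[of t] by measurable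
    show "bdd_above ((\<lambda>t. \<bar>?F w t - ?N t\<bar>) ` \<rat>)" for w by (rule bdd_aboveI2[where M = 1]) (rule bd)
  qed (rule countable_rat)
  finally show ?thesis .
qed

text \<open>
Outside an event whose probability is controlled by the inequality of Markov, the conditional mean of the remainder and the
error of the sample variance are small. Then the conditional characteristic function of the bootstrap statistic is close to
the normal one on [-T, T], and cdf_close_if_char_close applies with the data held fixed.
\<close>
lemma boot_distance_tendsto:
  assumes v: "0 < limit_variance b" and \<epsilon>: "0 < \<epsilon>"
  shows "(\<lambda>n. measure M {w \<in> space M. \<epsilon> < boot_distance b n w}) \<longlonglongrightarrow> 0"
proof -
  let ?B = "box_mass p R" and ?V = "limit_variance b"
  obtain \<delta> T where \<delta>: "0 < \<delta>" "0 < T" and close: "\<And>Q x. real_distribution Q \<Longrightarrow>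
      (\<And>t. \<bar>t\<bar> \<le> T \<Longrightarrow> cmod (char Q t - of_real (exp (- (t\<^sup>2 * ?V / 2)))) \<le> \<delta>) \<Longrightarrow> \<bar>cdf Q x - cdf (normal_law 0 ?V) x\<bar> \<le> \<epsilon>"
    using cdf_close_if_char_close[OF v \<epsilon>] by metis
  \<comment> \<open>the remainder enters with factor T and the variance with factor T^2; together they may use half of \<delta>\<close>
  define \<eta> where "\<eta> = \<delta> / (2 * (T + T\<^sup>2))"
  have T2: "0 < T + T\<^sup>2" using \<delta> by (simp add: add_pos_pos)
  have "c * (\<delta> / (2 * c)) = \<delta> / 2" if "0 < c" for c using that by simp
  from this[OF T2] have \<eta>: "0 < \<eta>" "(T + T\<^sup>2) * \<eta> = \<delta> / 2" using \<delta> T2 unfolding \<eta>_def by simp_all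
  define G where "G n w = boot_remainder b n w + \<bar>sample_variance b n (\<lambda>i. X i w) (\<lambda>i. Y i w) - ?V\<bar>" for n w
  have iG: "integrable M (G n)" if "0 < n" for n
    unfolding G_def using boot_remainder_tendsto(2)[OF that] sample_variance_tendsto(2)[OF that]
    by (intro Bochner_Integration.integrable_add)
  have rem0: "0 \<le> boot_remainder b n w" for n w unfolding boot_remainder_def by (intro integral_nonneg_AE) auto
  have "(\<lambda>n. expectation (boot_remainder b n) + expectation (\<lambda>w. \<bar>sample_variance b n (\<lambda>i. X i w) (\<lambda>i. Y i w) - ?V\<bar>)) \<longlonglongrightarrow> 0 + 0"
    by (intro tendsto_add boot_remainder_tendsto(1) sample_variance_tendsto(1))
  then have limG: "(\<lambda>n. (expectation (boot_remainder b n) + expectation (\<lambda>w. \<bar>sample_variance b n (\<lambda>i. X i w) (\<lambda>i. Y i w) - ?V\<bar>)) / \<eta>) \<longlonglongrightarrow> 0"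
    using tendsto_divide[OF _ tendsto_const, of _ "0 :: real" sequentially \<eta>] \<eta> by fastforce
  have "(\<lambda>n. clt_error T ?B n * (2 * ?B\<^sup>2)) \<longlonglongrightarrow> 0 * (2 * ?B\<^sup>2)" by (intro tendsto_mult clt_error_tendsto_0 tendsto_const)
  then have small: "\<forall>\<^sub>F n in sequentially. clt_error T ?B n * (2 * ?B\<^sup>2) < \<delta> / 2" using \<delta> by (intro order_tendstoD(2)) auto
  have "\<forall>\<^sub>F n in sequentially. measure M {w \<in> space M. \<epsilon> < boot_distance b n w}
      \<le> (expectation (boot_remainder b n) + expectation (\<lambda>w. \<bar>sample_variance b n (\<lambda>i. X i w) (\<lambda>i. Y i w) - ?V\<bar>)) / \<eta>"
    using small eventually_gt_at_top[of 0]
  proof eventually_elim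
    case (elim n)
    then have n: "0 < n" and clt: "clt_error T ?B n * (2 * ?B\<^sup>2) < \<delta> / 2" by auto
    interpret Q: prob_space "resample_pair n" by (rule prob_space_resample_pair[OF n])
    have dist: "boot_distance b n w \<le> \<epsilon>"
      if int: "integrable (resample_pair n) (\<lambda>k. boot_stat b n (\<lambda>i. X i w) (\<lambda>i. Y i w) k - boot_lin b n (\<lambda>i. X i w) (\<lambda>i. Y i w) k)"
        and G: "G n w < \<eta>" for w
      unfolding boot_distance_def
    proof (rule cSUP_least, simp, rule close[OF real_distribution_boot[OF n]])
      fix t :: real assume t: "\<bar>t\<bar> \<le> T"
      let ?x = "\<lambda>i. X i w" and ?y = "\<lambda>i. Y i w"
      let ?r = "boot_remainder b n w" and ?s = "sample_variance b n ?x ?y"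
      have r: "0 \<le> ?r" "?r + \<bar>?s - ?V\<bar> < \<eta>" using rem0[of n w] G by (auto simp: G_def)
      have a: "cmod (char (distr (resample_pair n) borel (boot_stat b n ?x ?y)) t - char (distr (resample_pair n) borel (boot_lin b n ?x ?y)) t) \<le> T * ?r"
      proof -
        have "cmod (char (distr (resample_pair n) borel (boot_stat b n ?x ?y)) t - char (distr (resample_pair n) borel (boot_lin b n ?x ?y)) t) \<le> \<bar>t\<bar> * ?r"
          unfolding boot_remainder_def
          by (rule Q.char_perturbation[OF measurable_boot(2)[OF n] measurable_boot(1)[OF n] int])
        also have "\<dots> \<le> T * ?r" using t r by (intro mult_right_mono) auto
        finally show ?thesis .
      qed
      have c: "cmod (char (distr (resample_pair n) borel (boot_lin b n ?x ?y)) t - of_real (exp (- (t\<^sup>2 * ?s / 2)))) \<le> clt_error T ?B n * (2 * ?B\<^sup>2)"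
        using char_boot_lin[OF n, of b ?x ?y t] mult_right_mono[OF clt_error_mono[OF t box_mass_nonneg], of "2 * ?B\<^sup>2" n]
        by simp
      have d: "cmod (of_real (exp (- (t\<^sup>2 * ?s / 2))) - of_real (exp (- (t\<^sup>2 * ?V / 2)))) \<le> T\<^sup>2 * \<bar>?s - ?V\<bar>"
      proof -
        have "\<bar>exp (- (t\<^sup>2 * ?s / 2)) - exp (- (t\<^sup>2 * ?V / 2))\<bar> \<le> \<bar>t\<^sup>2 * ?s / 2 - t\<^sup>2 * ?V / 2\<bar>"
          using sample_variance_bounds(1)[OF n] limit_variance_nonneg by (intro abs_exp_minus_diff_le) auto
        also have "\<dots> = t\<^sup>2 / 2 * \<bar>?s - ?V\<bar>"
        proof -
          have "t\<^sup>2 * ?s / 2 - t\<^sup>2 * ?V / 2 = t\<^sup>2 / 2 * (?s - ?V)" by (simp add: right_diff_distrib)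
          then show ?thesis unfolding abs_mult by (simp only: abs_mult) simp
        qed
        also have "\<dots> \<le> T\<^sup>2 * \<bar>?s - ?V\<bar>"
        proof (intro mult_right_mono)
          have "t\<^sup>2 \<le> T\<^sup>2" using t \<delta>(2) by (simp add: abs_le_square_iff[symmetric])
          then show "t\<^sup>2 / 2 \<le> T\<^sup>2" using zero_le_power2[of t] by linarith
        qed auto
        finally show ?thesis by (simp only: of_real_diff[symmetric] norm_of_real)
      qed
      have "T * ?r + T\<^sup>2 * \<bar>?s - ?V\<bar> \<le> (T + T\<^sup>2) * (?r + \<bar>?s - ?V\<bar>)"
        using \<delta> r by (simp add: algebra_simps)
      also have "\<dots> \<le> (T + T\<^sup>2) * \<eta>" using r T2 by (intro mult_left_mono) auto
      finally have "T * ?r + T\<^sup>2 * \<bar>?s - ?V\<bar> \<le> \<delta> / 2" using \<eta> by simp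
      moreover have tri: "cmod (u - z) \<le> cmod (u - v) + cmod (v - w) + cmod (w - z)" for u v w z :: complex
        using norm_triangle_ineq[of "u - v" "v - w"] norm_triangle_ineq[of "u - w" "w - z"] by simp
      ultimately show "cmod (char (distr (resample_pair n) borel (boot_stat b n ?x ?y)) t - of_real (exp (- (t\<^sup>2 * ?V / 2)))) \<le> \<delta>"
        using tri[of "char (distr (resample_pair n) borel (boot_stat b n ?x ?y)) t" "of_real (exp (- (t\<^sup>2 * ?V / 2)))"
            "char (distr (resample_pair n) borel (boot_lin b n ?x ?y)) t" "of_real (exp (- (t\<^sup>2 * ?s / 2)))"] a c d clt
        by linarith
    qed
    have "measure M {w \<in> space M. \<epsilon> < boot_distance b n w} \<le> measure M {w \<in> space M. \<eta> \<le> G n w}"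
    proof (rule finite_measure_mono_AE)
      show "{w \<in> space M. \<eta> \<le> G n w} \<in> events" using iG[OF n] by measurable
      show "AE w in M. w \<in> {w \<in> space M. \<epsilon> < boot_distance b n w} \<longrightarrow> w \<in> {w \<in> space M. \<eta> \<le> G n w}"
        using boot_remainder_tendsto(3)[OF n, of b]
      proof eventually_elim
        case (elim w)
        then show ?case using dist[of w] by (auto simp: not_less[symmetric])
      qed
    qed
    also have "\<dots> \<le> expectation (G n) / \<eta>"
      by (rule integral_Markov_inequality_measure[OF iG[OF n] sets.empty_sets]) (use \<eta> rem0 in \<open>auto simp: G_def\<close>)
    also have "expectation (G n) = expectation (boot_remainder b n) + expectation (\<lambda>w. \<bar>sample_variance b n (\<lambda>i. X i w) (\<lambda>i. Y i w) - ?V\<bar>)"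
      unfolding G_def by (intro Bochner_Integration.integral_add boot_remainder_tendsto(2) sample_variance_tendsto(2) n)
    finally show ?case .
  qed
  then show ?thesis
    by (rule tendsto_sandwich[OF _ _ tendsto_const limG, rotated]) auto
qed

text \<open>
The distance for n = 0 does not affect the limit, but convergence in probability asks for measurability for every n; hence the
separate assumption on Z 0.
\<close>
lemma boot_distance_tendsto_zero_in_prob:
  assumes v: "0 < limit_variance b" and Z: "\<And>n w. 0 < n \<Longrightarrow> Z n w = boot_distance b n w" and Z0: "Z 0 \<in> borel_measurable M"
  shows "tendsto_zero_in_prob M Z"
  unfolding tendsto_zero_in_prob_def
proof (intro conjI allI impI)
  have Zeq: "Z n = boot_distance b n" if "0 < n" for n using Z[OF that] by blast
  show "Z n \<in> borel_measurable M" for n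
    using Z0 measurable_boot_distance[of n b] Zeq[of n] by (cases "n = 0") auto
  fix \<epsilon> :: real assume \<epsilon>: "0 < \<epsilon>"
  have nn: "0 \<le> boot_distance b n w" if n: "0 < n" for n w
  proof -
    let ?F = "cdf (distr (resample_pair n) borel (boot_stat b n (\<lambda>i. X i w) (\<lambda>i. Y i w)))" and ?N = "cdf (normal_law 0 (limit_variance b))"
    interpret L: real_distribution "distr (resample_pair n) borel (boot_stat b n (\<lambda>i. X i w) (\<lambda>i. Y i w))" by (rule real_distribution_boot[OF n])
    interpret N: real_distribution "normal_law 0 (limit_variance b)" by (rule real_distribution_normal_law)
    have "\<bar>?F t - ?N t\<bar> \<le> 1" for t
      using L.cdf_nonneg[of t] L.cdf_bounded_prob[of t] N.cdf_nonneg[of t] N.cdf_bounded_prob[of t] by (simp add: abs_le_iff)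
    then have "\<bar>?F 0 - ?N 0\<bar> \<le> boot_distance b n w"
      unfolding boot_distance_def by (intro cSUP_upper bdd_aboveI2[where M = 1]) auto
    then show ?thesis by (meson abs_ge_zero order_trans)
  qed
  show "(\<lambda>n. measure M {w \<in> space M. \<epsilon> < \<bar>Z n w\<bar>}) \<longlonglongrightarrow> 0"
    by (rule Lim_transform_eventually[OF boot_distance_tendsto[OF v \<epsilon>] eventually_sequentiallyI[of 1]])
       (simp add: Zeq nn)
qed

end

section \<open>Semiparametric efficiency\<close>

lemma cdf_proj_law_perturb:
  fixes \<mu> :: "'a::euclidean_space measure"
  assumes mu: "prob_space \<mu>" "sets \<mu> = sets borel" and h: "h \<in> tangents \<mu>" and C: "\<And>x. \<bar>h x\<bar> \<le> C"
    and t: "0 \<le> t" "t * C \<le> 1"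
  shows "cdf (proj_law \<theta> (perturb \<mu> t h)) s = cdf (proj_law \<theta> \<mu>) s + t * score_cdf \<mu> h (\<lambda>x. \<theta> \<bullet> x) s"
proof -
  interpret prob_space \<mu> by fact
  have [measurable_cong]: "sets \<mu> = sets borel" by fact
  note P = perturb_prob[OF mu h C t]
  have i: "integrable \<mu> (\<lambda>x. step (\<theta> \<bullet> x) s)"
    by (intro integrable_const_bound[where B = 1]) (auto simp: step_def)
  show ?thesis unfolding cdf_proj_law(1)[OF P(1,2)] cdf_proj_law(1)[OF mu] score_cdf_def by (rule P(4)[OF i])
qed

context two_samples
begin

text \<open>
The argument for laws on the line, carried out on the product of directions and thresholds.
\<close>
lemma sliced_right_derivative:
  assumes h: "h1 \<in> tangents \<mu>" "h2 \<in> tangents \<nu>"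
  shows "((\<lambda>t. (S (perturb \<mu> t h1) (perturb \<nu> t h2) - S \<mu> \<nu>) / t)
     \<longlongrightarrow> (\<integral>x. \<Psi> x * h1 x \<partial>\<mu>) + (\<integral>y. \<psi> y * h2 y \<partial>\<nu>)) (at_right 0)"
proof -
  let ?N = "slice_measure p R :: ('a \<times> real \<times> real) measure"
  interpret mu: prob_space \<mu> by (rule mu)
  interpret nu: prob_space \<nu> by (rule nu)
  have sm [measurable_cong]: "sets \<mu> = sets borel" "sets \<nu> = sets borel" by (rule mu nu)+
  interpret N: finite_measure ?N by (rule finite_measure_slice_measure[OF p])
  obtain C1 where C1: "0 < C1" "\<And>x. \<bar>h1 x\<bar> \<le> C1" using tangentsD[OF h(1)] by blast
  obtain C2 where C2: "0 < C2" "\<And>x. \<bar>h2 x\<bar> \<le> C2" using tangentsD[OF h(2)] by blast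
  have hm: "h1 \<in> borel_measurable borel" "h2 \<in> borel_measurable borel" using h by (auto simp: tangents_def)
  define H1 where "H1 w = score_cdf \<mu> h1 (\<lambda>x. fst w \<bullet> x)" for w :: "'a \<times> real \<times> real"
  define H2 where "H2 w = score_cdf \<nu> h2 (\<lambda>x. fst w \<bullet> x)" for w :: "'a \<times> real \<times> real"
  define E where "E w = gap (H1 w) (H2 w) (snd w)" for w
  have [measurable]: "(\<lambda>x. fst (fst x)) \<in> borel_measurable (?N \<Otimes>\<^sub>M borel)"
    by (rule measurable_compose[OF measurable_fst measurable_slice_direction])
  have proj: "(\<lambda>(w, x). fst w \<bullet> x) \<in> borel_measurable (?N \<Otimes>\<^sub>M borel)"
    unfolding case_prod_beta' by measurable
  have s: "snd \<in> ?N \<rightarrow>\<^sub>M borel \<Otimes>\<^sub>M borel"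
    by (simp add: measurable_cong_sets[OF sets_slice_measure refl])
  note [measurable] = s measurable_slice_gap[OF mu(1,2) nu(1,2)]
  have [measurable]: "(\<lambda>w. H1 w (fst (snd w))) \<in> borel_measurable ?N"
    unfolding H1_def by (rule borel_measurable_score_cdf[OF mu(1,2) hm(1) proj measurable_compose[OF s measurable_fst]])
  have [measurable]: "(\<lambda>w. H2 w (snd (snd w))) \<in> borel_measurable ?N"
    unfolding H2_def by (rule borel_measurable_score_cdf[OF nu(1,2) hm(2) proj measurable_compose[OF s measurable_snd]])
  have Em [measurable]: "E \<in> borel_measurable ?N" unfolding E_def[abs_def] by measurable
  have Eb: "\<bar>E w\<bar> \<le> C1 + C2" for w
    using abs_gap_diff_le[of "H1 w" "H2 w" "snd w" "\<lambda>_. 0" "\<lambda>_. 0"]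
      score_cdf_bounded[where h = h1, OF mu(1) C1(2), where g = "\<lambda>x. fst w \<bullet> x" and s = "fst (snd w)"]
      score_cdf_bounded[where h = h2, OF nu(1) C2(2), where g = "\<lambda>x. fst w \<bullet> x" and s = "snd (snd w)"]
    by (simp add: E_def H1_def H2_def) (simp add: gap_def)
  have nd: "AE w in ?N. slice_gap \<mu> \<nu> w \<noteq> 0 \<or> E w = 0"
    using AE_slice_gap_tie[OF p mu(1,2) conv nu(1,2), of R]
  proof eventually_elim
    case (elim w)
    show ?case
    proof (cases "slice_gap \<mu> \<nu> w = 0")
      case True
      with elim have "H1 w (fst (snd w)) = 0" "H2 w (snd (snd w)) = 0"
        unfolding H1_def H2_def cdf_proj_law(1)[OF mu(1,2)] cdf_proj_law(1)[OF nu(1,2)]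
        by (auto intro!: score_cdf_eq_0 mu(1,2) nu(1,2) h)
      then show ?thesis by (simp add: E_def gap_def)
    qed simp
  qed
  \<comment> \<open>for t \<le> T both perturbed measures are nonnegative\<close>
  define T where "T = 1 / (C1 + C2)"
  have T: "0 < T" using C1 C2 by (simp add: T_def)
  have tC: "t * C1 \<le> 1" "t * C2 \<le> 1" if "0 \<le> t" "t \<le> T" for t
  proof -
    have "t * C1 \<le> t * (C1 + C2)" "t * C2 \<le> t * (C1 + C2)" using that C1 C2 by (auto intro: mult_left_mono)
    moreover have "t * (C1 + C2) \<le> 1" using that C1 C2 by (simp add: T_def field_simps)
    ultimately show "t * C1 \<le> 1" "t * C2 \<le> 1" by linarith+
  qed
  note P1 = perturb_prob[OF mu(1,2) h(1) C1(2) _ tC(1)] and P2 = perturb_prob[OF nu(1,2) h(2) C2(2) _ tC(2)]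
  have G: "slice_gap (perturb \<mu> t h1) (perturb \<nu> t h2) w = slice_gap \<mu> \<nu> w + t * E w" if "0 \<le> t" "t \<le> T" for t w
    unfolding slice_gap_def E_def H1_def H2_def gap_def
      cdf_proj_law_perturb[OF mu(1,2) h(1) C1(2) that(1) tC(1)[OF that]] cdf_proj_law_perturb[OF nu(1,2) h(2) C2(2) that(1) tC(2)[OF that]]
    by (simp add: algebra_simps)
  have ip: "integrable \<mu> \<Psi>" "integrable \<nu> \<psi>"
    using inf_bound by (auto intro!: mu.integrable_const_bound[where B = "box_mass p R"] nu.integrable_const_bound[where B = "box_mass p R"])
  have lin: "(\<integral>w. of_bool (0 < slice_gap \<mu> \<nu> w) * slice_gap (perturb \<mu> t h1) (perturb \<nu> t h2) w \<partial>?N)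
      = ((\<integral>x. \<Psi> x \<partial>\<mu>) + (\<integral>y. \<psi> y \<partial>\<nu>)) + t * ((\<integral>x. \<Psi> x * h1 x \<partial>\<mu>) + (\<integral>y. \<psi> y * h2 y \<partial>\<nu>))" if t: "0 \<le> t" "t \<le> T" for t
    unfolding integral_positive_slice_gap_eq_influence(2)[OF p mu(1,2) nu(1,2) P1(1)[OF t(1) t] P1(2)[OF t(1) t] P2(1)[OF t(1) t] P2(2)[OF t(1) t]]
      P1(4)[OF t(1) t ip(1)] P2(4)[OF t(1) t ip(2)] by (simp add: algebra_simps)
  have "((\<lambda>t. ((\<integral>w. max 0 (slice_gap (perturb \<mu> t h1) (perturb \<nu> t h2) w) \<partial>?N) - (\<integral>w. max 0 (slice_gap \<mu> \<nu> w) \<partial>?N)) / t)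
     \<longlongrightarrow> (\<integral>x. \<Psi> x * h1 x \<partial>\<mu>) + (\<integral>y. \<psi> y * h2 y \<partial>\<nu>)) (at_right 0)"
    by (rule pos_part_path_derivative[OF N.finite_measure_axioms _ Em _ Eb nd T G lin])
       (auto intro: slice_gap_bounded[OF mu(1,2) nu(1,2)])
  moreover have "\<forall>\<^sub>F t in at_right 0. t \<in> {0<..<T}"
    using T by (intro eventually_at_right_real)
  then have "\<forall>\<^sub>F t in at_right 0. (S (perturb \<mu> t h1) (perturb \<nu> t h2) - S \<mu> \<nu>) / t
     = ((\<integral>w. max 0 (slice_gap (perturb \<mu> t h1) (perturb \<nu> t h2) w) \<partial>?N) - (\<integral>w. max 0 (slice_gap \<mu> \<nu> w) \<partial>?N)) / t"
  proof (rule eventually_mono)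
    fix t assume "t \<in> {0<..<T}"
    then have t: "0 \<le> t" "t \<le> T" by auto
    show "(S (perturb \<mu> t h1) (perturb \<nu> t h2) - S \<mu> \<nu>) / t
     = ((\<integral>w. max 0 (slice_gap (perturb \<mu> t h1) (perturb \<nu> t h2) w) \<partial>?N) - (\<integral>w. max 0 (slice_gap \<mu> \<nu> w) \<partial>?N)) / t"
      unfolding sliced_wasserstein_pow_eq_integral[OF p mu nu]
        sliced_wasserstein_pow_eq_integral[OF p P1(1)[OF t(1) t] P1(2)[OF t(1) t] P1(5)[OF t(1) t mu(3)]
          P2(1)[OF t(1) t] P2(2)[OF t(1) t] P2(5)[OF t(1) t nu(3)]] ..
  qed
  ultimately show ?thesis by (subst tendsto_cong)
qed

end

lemma square_integrable_imp_integrable: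
  assumes "prob_space N" "square_integrable N f"
  shows "integrable N f" "\<bar>\<integral>x. f x \<partial>N\<bar> \<le> sqrt (\<integral>x. (f x)\<^sup>2 \<partial>N)"
proof -
  interpret prob_space N by fact
  have [measurable]: "f \<in> borel_measurable N" and i2: "integrable N (\<lambda>x. (f x)\<^sup>2)" using assms(2) by (auto simp: square_integrable_def)
  show i: "integrable N f" by (rule square_integrable_imp_integrable) (use i2 in auto)
  have "0 \<le> variance f" by simp
  then have "(\<integral>x. f x \<partial>N)\<^sup>2 \<le> (\<integral>x. (f x)\<^sup>2 \<partial>N)" using variance_eq[OF i i2] by simp
  then show "\<bar>\<integral>x. f x \<partial>N\<bar> \<le> sqrt (\<integral>x. (f x)\<^sup>2 \<partial>N)" by (metis real_sqrt_abs real_sqrt_le_iff)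
qed

lemma square_integrable_mult_bounded:
  assumes f: "square_integrable N f" and [measurable]: "g \<in> borel_measurable N" and B: "\<And>x. \<bar>g x\<bar> \<le> B"
  shows "square_integrable N (\<lambda>x. f x * g x)" "(\<integral>x. (f x * g x)\<^sup>2 \<partial>N) \<le> B\<^sup>2 * (\<integral>x. (f x)\<^sup>2 \<partial>N)"
proof -
  have [measurable]: "f \<in> borel_measurable N" and i2: "integrable N (\<lambda>x. (f x)\<^sup>2)" using f by (auto simp: square_integrable_def)
  have le: "(f x * g x)\<^sup>2 \<le> B\<^sup>2 * (f x)\<^sup>2" for x
  proof -
    have "(g x)\<^sup>2 \<le> B\<^sup>2" using B[of x] by (simp add: abs_le_square_iff[symmetric])
    then show ?thesis by (simp add: power_mult_distrib mult.commute[of "(f x)\<^sup>2"] mult_right_mono)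
  qed
  have i: "integrable N (\<lambda>x. (f x * g x)\<^sup>2)"
    by (rule Bochner_Integration.integrable_bound[OF integrable_mult_right[OF i2, of "B\<^sup>2"]]) (use le in auto)
  then show "square_integrable N (\<lambda>x. f x * g x)" by (simp add: square_integrable_def)
  have "(\<integral>x. (f x * g x)\<^sup>2 \<partial>N) \<le> (\<integral>x. B\<^sup>2 * (f x)\<^sup>2 \<partial>N)" using i i2 le by (intro integral_mono) auto
  then show "(\<integral>x. (f x * g x)\<^sup>2 \<partial>N) \<le> B\<^sup>2 * (\<integral>x. (f x)\<^sup>2 \<partial>N)" by simp
qed

lemma L2_functional_inner_product:
  assumes N: "prob_space N" and g: "g \<in> borel_measurable N" and B: "\<And>x. \<bar>g x\<bar> \<le> B"
  shows "L2_functional N (\<lambda>f. \<integral>x. f x * g x \<partial>N)"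
  unfolding L2_functional_def
proof (intro conjI allI impI exI[of _ B])
  fix f f' :: "'a \<Rightarrow> real" and a :: real
  assume f: "square_integrable N f"
  note fg = square_integrable_mult_bounded[OF f g B]
  note i = square_integrable_imp_integrable[OF N fg(1)]
  have B0: "0 \<le> B" using B[of undefined] by linarith
  show "(\<integral>x. a * f x * g x \<partial>N) = a * (\<integral>x. f x * g x \<partial>N)" by (simp add: mult.assoc)
  have "sqrt (\<integral>x. (f x * g x)\<^sup>2 \<partial>N) \<le> sqrt (B\<^sup>2 * (\<integral>x. (f x)\<^sup>2 \<partial>N))" using fg(2) by simp
  also have "\<dots> = B * sqrt (\<integral>x. (f x)\<^sup>2 \<partial>N)" using B0 by (simp add: real_sqrt_mult)
  finally show "\<bar>\<integral>x. f x * g x \<partial>N\<bar> \<le> B * sqrt (\<integral>x. (f x)\<^sup>2 \<partial>N)" using i(2) by linarith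
  assume f': "square_integrable N f'"
  note fg' = square_integrable_mult_bounded[OF f' g B]
  show "(\<integral>x. (f x + f' x) * g x \<partial>N) = (\<integral>x. f x * g x \<partial>N) + (\<integral>x. f' x * g x \<partial>N)"
    using i(1) square_integrable_imp_integrable(1)[OF N fg'(1)] by (simp add: distrib_right)
qed

text \<open>
The inequality of Cauchy and Schwarz, with equality for h = g. If g vanishes almost everywhere, the supremum is 0 only because
it is taken over a nonempty set, and h0 ensures this.
\<close>
lemma efficiency_sup_inner_product:
  assumes N: "prob_space N" and g: "g \<in> borel_measurable N" and B: "\<And>x. \<bar>g x\<bar> \<le> B" and gH: "g \<in> H"
    and H: "\<And>h. h \<in> H \<Longrightarrow> h \<in> borel_measurable N \<and> (\<exists>C. \<forall>x. \<bar>h x\<bar> \<le> C)"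
    and ne: "h0 \<in> H" "\<not> (AE x in N. h0 x = 0)"
  shows "ereal (\<integral>x. (g x)\<^sup>2 \<partial>N) = efficiency_sup N H (\<lambda>f. \<integral>x. f x * g x \<partial>N)"
  unfolding efficiency_sup_def
proof (rule antisym)
  interpret prob_space N by fact
  have int: "integrable N (\<lambda>x. h x * h' x)" if "h \<in> borel_measurable N" "h' \<in> borel_measurable N" "\<And>x. \<bar>h x\<bar> \<le> C" "\<And>x. \<bar>h' x\<bar> \<le> C'"
    for h h' :: "'a \<Rightarrow> real" and C C'
  proof (intro integrable_const_bound[where B = "C * C'"] AE_I2)
    show "norm (h x * h' x) \<le> C * C'" for x
      using that(3)[of x] that(4)[of x] unfolding real_norm_def abs_mult by (intro mult_mono) auto
  qed (use that in auto)
  have sq0: "AE x in N. h x = 0" if "integrable N (\<lambda>x. (h x)\<^sup>2)" "(\<integral>x. (h x)\<^sup>2 \<partial>N) = 0" for h :: "'a \<Rightarrow> real"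
    using that by (subst (asm) integral_nonneg_eq_0_iff_AE) auto
  have ig: "integrable N (\<lambda>x. (g x)\<^sup>2)" using int[OF g g B B] by (simp add: power2_eq_square)
  let ?b = "\<integral>x. (g x)\<^sup>2 \<partial>N"
  show "(SUP h\<in>{h \<in> H. \<not> (AE x in N. h x = 0)}. ereal ((\<integral>x. h x * g x \<partial>N)\<^sup>2 / (\<integral>x. (h x)\<^sup>2 \<partial>N))) \<le> ereal ?b"
  proof (rule SUP_least)
    fix h assume h: "h \<in> {h \<in> H. \<not> (AE x in N. h x = 0)}"
    then obtain C where hm: "h \<in> borel_measurable N" and C: "\<And>x. \<bar>h x\<bar> \<le> C" using H by blast
    let ?a = "\<integral>x. (h x)\<^sup>2 \<partial>N" and ?c = "\<integral>x. h x * g x \<partial>N"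
    have ih: "integrable N (\<lambda>x. (h x)\<^sup>2)" using int[OF hm hm C C] by (simp add: power2_eq_square)
    have ihg: "integrable N (\<lambda>x. h x * g x)" by (rule int[OF hm g C B])
    have "0 \<le> ?a" by simp
    then have a: "0 < ?a" using h sq0[OF ih] by (auto simp: less_le)
    \<comment> \<open>the squared distance of g from its projection on the line spanned by h\<close>
    have "0 \<le> (\<integral>x. (g x - ?c / ?a * h x)\<^sup>2 \<partial>N)" by simp
    also have "\<dots> = (\<integral>x. (g x)\<^sup>2 - 2 * (?c / ?a) * (h x * g x) + (?c / ?a)\<^sup>2 * (h x)\<^sup>2 \<partial>N)"
      by (intro Bochner_Integration.integral_cong) (auto simp: power2_diff power_mult_distrib power2_eq_square algebra_simps)
    also have "\<dots> = ?b - 2 * (?c / ?a) * ?c + (?c / ?a)\<^sup>2 * ?a" using ig ih ihg by simp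
    also have "\<dots> = ?b - ?c\<^sup>2 / ?a" using a by (simp add: power2_eq_square field_simps)
    finally show "ereal (?c\<^sup>2 / ?a) \<le> ereal ?b" by simp
  qed
  show "ereal ?b \<le> (SUP h\<in>{h \<in> H. \<not> (AE x in N. h x = 0)}. ereal ((\<integral>x. h x * g x \<partial>N)\<^sup>2 / (\<integral>x. (h x)\<^sup>2 \<partial>N)))"
  proof (cases "AE x in N. g x = 0")
    case True
    then have "?b = (\<integral>x. 0 \<partial>N)" using g by (intro integral_cong_AE) (auto elim: eventually_mono)
    then have "ereal ?b \<le> ereal ((\<integral>x. h0 x * g x \<partial>N)\<^sup>2 / (\<integral>x. (h0 x)\<^sup>2 \<partial>N))" by simp
    then show ?thesis using ne by (intro SUP_upper2[of h0]) auto
  next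
    case False
    have "?b \<noteq> 0" using False sq0[OF ig] by auto
    then have "?b = (\<integral>x. g x * g x \<partial>N)\<^sup>2 / ?b" by (simp add: power2_eq_square)
    then show ?thesis using False gH by (intro SUP_upper2[of g]) auto
  qed
qed

text \<open>
A law without atoms has two distinct support points. The centred indicator of a neighbourhood of one of them does not vanish
near the other.
\<close>
lemma absolutely_continuous_nonzero_tangent:
  fixes \<mu> :: "'a::euclidean_space measure"
  assumes mu: "prob_space \<mu>" "sets \<mu> = sets borel" and ac: "absolutely_continuous lborel \<mu>"
  obtains h where "h \<in> tangents \<mu>" "\<not> (AE x in \<mu>. h x = 0)"
proof -
  interpret prob_space \<mu> by fact
  have [measurable_cong]: "sets \<mu> = sets borel" by fact
  have sp: "space \<mu> = UNIV" using sets_eq_imp_space_eq[OF mu(2)] by simp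
  have atom: "emeasure \<mu> {x} = 0" for x
  proof -
    have "{x} \<in> null_sets lborel" by (auto simp: null_sets_def)
    then show ?thesis using ac unfolding absolutely_continuous_def by blast
  qed
  have "\<exists>x\<in>spt \<mu>. \<exists>y\<in>spt \<mu>. x \<noteq> y"
  proof (rule ccontr)
    assume "\<not> ?thesis"
    then obtain z where "spt \<mu> \<subseteq> {z}" by blast
    then have "AE x in \<mu>. x = z" using AE_in_spt[OF mu(2)] by (auto elim!: eventually_mono)
    then have "prob {z} = 1" by (subst prob_eq_1) (auto simp: mu(2))
    then show False using atom[of z] by (simp add: measure_def)
  qed
  then obtain x y where xy: "x \<in> spt \<mu>" "y \<in> spt \<mu>" "x \<noteq> y" by blast
  obtain U V where UV: "open U" "open V" "x \<in> U" "y \<in> V" "U \<inter> V = {}" using hausdorff[OF xy(3)] by blast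
  have pos: "0 < prob U" "0 < prob V"
    using xy UV by (auto simp: spt_def emeasure_eq_measure)
  have meas [measurable]: "U \<in> sets borel" "V \<in> sets borel" using UV by auto
  define h where "h z = indicator U z - prob U" for z
  have "integrable \<mu> (indicator U :: 'a \<Rightarrow> real)"
    by (intro integrable_real_indicator) (auto simp: emeasure_eq_measure mu(2))
  then have "(\<integral>z. indicator U z - prob U \<partial>\<mu>) = 0" by (simp add: prob_space)
  then have "h \<in> tangents \<mu>"
    unfolding tangents_def h_def using meas by (auto simp: bounded_iff intro!: exI[of _ "1 + prob U"] split: split_indicator)
  moreover have "\<not> (AE z in \<mu>. h z = 0)"
  proof
    assume "AE z in \<mu>. h z = 0"
    then have "AE z in \<mu>. z \<notin> V" using pos UV(5) by (auto elim!: eventually_mono simp: h_def split: split_indicator_asm)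
    then have "prob V = 0" by (subst prob_eq_0) (auto simp: mu(2))
    with pos show False by simp
  qed
  ultimately show ?thesis by (rule that)
qed

lemma perturb_zero: "perturb \<nu> t (\<lambda>_. 0) = \<nu>"
  by (simp add: perturb_def density_1)

lemma centred_tangent:
  assumes "prob_space \<rho>" "sets \<rho> = sets borel" and [measurable]: "g \<in> borel_measurable borel" and B: "\<And>x. \<bar>g x\<bar> \<le> B"
  shows "(\<lambda>x. g x - (\<integral>x. g x \<partial>\<rho>)) \<in> tangents \<rho>" "\<bar>g x - (\<integral>x. g x \<partial>\<rho>)\<bar> \<le> 2 * B"
proof -
  interpret \<rho>: prob_space \<rho> by fact
  have [measurable_cong]: "sets \<rho> = sets borel" by fact
  have i: "integrable \<rho> g" using B by (intro \<rho>.integrable_const_bound[where B = B]) auto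
  have b: "\<bar>g x - (\<integral>x. g x \<partial>\<rho>)\<bar> \<le> 2 * B" for x
    using B[of x] var_of_props(4)[where g = g and \<rho> = \<rho> and B = B, OF assms(1) _ B] by simp
  show "\<bar>g x - (\<integral>x. g x \<partial>\<rho>)\<bar> \<le> 2 * B" by (rule b)
  show "(\<lambda>x. g x - (\<integral>x. g x \<partial>\<rho>)) \<in> tangents \<rho>"
    using i b by (auto simp: tangents_def \<rho>.prob_space bounded_iff)
qed

text \<open>
Tangents have mean zero, so adding a constant to g does not change the pairing.
\<close>
lemma tangent_orthogonal_const:
  assumes "prob_space \<rho>" "sets \<rho> = sets borel" and [measurable]: "g \<in> borel_measurable borel" and B: "\<And>x. \<bar>g x\<bar> \<le> B" and h: "h \<in> tangents \<rho>"
  shows "(\<integral>x. h x * (g x - c) \<partial>\<rho>) = (\<integral>x. g x * h x \<partial>\<rho>)" "integrable \<rho> h" "integrable \<rho> (\<lambda>x. h x * (g x - c))"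
proof -
  interpret \<rho>: prob_space \<rho> by fact
  have [measurable_cong]: "sets \<rho> = sets borel" by fact
  obtain C where C: "\<And>x. \<bar>h x\<bar> \<le> C" using tangentsD[OF h] by blast
  have [measurable]: "h \<in> borel_measurable borel" using h by (simp add: tangents_def)
  show ih: "integrable \<rho> h" using C by (intro \<rho>.integrable_const_bound[where B = C]) auto
  have ig: "integrable \<rho> (\<lambda>x. g x * h x)"
  proof (intro \<rho>.integrable_const_bound[where B = "B * C"] AE_I2)
    show "norm (g x * h x) \<le> B * C" for x using B[of x] C[of x] unfolding real_norm_def abs_mult by (intro mult_mono) auto
  qed auto
  have eq: "h x * (g x - c) = g x * h x - c * h x" for x by (simp add: algebra_simps)
  show "integrable \<rho> (\<lambda>x. h x * (g x - c))" unfolding eq using ig ih by auto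
  show "(\<integral>x. h x * (g x - c) \<partial>\<rho>) = (\<integral>x. g x * h x \<partial>\<rho>)"
    unfolding eq using ig ih h by (simp add: tangents_def)
qed

context two_samples
begin

text \<open>
The derivative is represented by the centred influence function, which is a tangent; its squared norm is its variance.
\<close>
lemma efficiency_one_sample:
  assumes ac: "absolutely_continuous lborel \<mu>"
  shows "efficiency_bound \<mu> (\<lambda>\<rho>. S \<rho> \<nu>) (limit_variance False)"
proof -
  let ?g = "\<lambda>x. \<Psi> x - (\<integral>x. \<Psi> x \<partial>\<mu>)"
  note ct = centred_tangent[OF mu(1,2) inf_meas(1) inf_bound(1)]
  have gm: "?g \<in> borel_measurable \<mu>" using ct(1) by (simp add: tangents_def measurable_cong_sets[OF mu(2) refl])
  obtain h0 where h0: "h0 \<in> tangents \<mu>" "\<not> (AE x in \<mu>. h0 x = 0)"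
    using absolutely_continuous_nonzero_tangent[OF mu(1,2) ac] by blast
  show ?thesis
    unfolding efficiency_bound_def
  proof (intro exI[of _ "\<lambda>f. \<integral>x. f x * ?g x \<partial>\<mu>"] conjI ballI)
    show "L2_functional \<mu> (\<lambda>f. \<integral>x. f x * ?g x \<partial>\<mu>)" by (rule L2_functional_inner_product[OF mu(1) gm ct(2)])
    show "((\<lambda>t. (S (perturb \<mu> t h) \<nu> - S \<mu> \<nu>) / t) \<longlongrightarrow> (\<integral>x. h x * ?g x \<partial>\<mu>)) (at_right 0)" if h: "h \<in> tangents \<mu>" for h
      using sliced_right_derivative[OF h tangents_zero]
      by (simp add: perturb_zero tangent_orthogonal_const(1)[OF mu(1,2) inf_meas(1) inf_bound(1) h])
    have H: "h \<in> borel_measurable \<mu> \<and> (\<exists>C. \<forall>x. \<bar>h x\<bar> \<le> C)" if "h \<in> tangents \<mu>" for h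
      using that tangentsD[OF that] by (auto simp: tangents_def measurable_cong_sets[OF mu(2) refl])
    show "ereal (limit_variance False) = efficiency_sup \<mu> (tangents \<mu>) (\<lambda>f. \<integral>x. f x * ?g x \<partial>\<mu>)"
      using efficiency_sup_inner_product[OF mu(1) gm ct(2) ct(1) H h0]
      by (simp add: limit_variance_def var_of_def)
  qed
qed

text \<open>
The derivative is represented by the direct sum of the two centred influence functions. The summands are orthogonal in the
product space, so the squared norm is the sum of the two variances.
\<close>
lemma efficiency_two_sample:
  assumes ac: "absolutely_continuous lborel \<mu>"
  shows "efficiency_bound2 \<mu> \<nu> S (limit_variance True)"
proof -
  let ?a = "\<lambda>x. \<Psi> x - (\<integral>x. \<Psi> x \<partial>\<mu>)" and ?b = "\<lambda>y. \<psi> y - (\<integral>y. \<psi> y \<partial>\<nu>)"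
  let ?N = "\<mu> \<Otimes>\<^sub>M \<nu>" and ?g = "direct_sum (\<lambda>x. \<Psi> x - (\<integral>x. \<Psi> x \<partial>\<mu>)) (\<lambda>y. \<psi> y - (\<integral>y. \<psi> y \<partial>\<nu>))"
  let ?H = "{direct_sum h\<^sub>1 h\<^sub>2 |h\<^sub>1 h\<^sub>2. h\<^sub>1 \<in> tangents \<mu> \<and> h\<^sub>2 \<in> tangents \<nu>}"
  interpret mu: prob_space \<mu> by (rule mu)
  interpret nu: prob_space \<nu> by (rule nu)
  interpret P: pair_sigma_finite \<mu> \<nu> by standard
  have N: "prob_space ?N" by (intro prob_space_pair mu nu)
  interpret N: prob_space ?N by (rule N)
  have [measurable_cong]: "sets \<mu> = sets borel" "sets \<nu> = sets borel" by (rule mu nu)+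
  note ct1 = centred_tangent[OF mu(1,2) inf_meas(1) inf_bound(1)] and ct2 = centred_tangent[OF nu(1,2) inf_meas(2) inf_bound(2)]
  have dm: "direct_sum h1 h2 \<in> borel_measurable ?N" if "h1 \<in> tangents \<mu>" "h2 \<in> tangents \<nu>" for h1 h2
  proof -
    have [measurable]: "h1 \<in> borel_measurable borel" "h2 \<in> borel_measurable borel" using that by (auto simp: tangents_def)
    show ?thesis unfolding direct_sum_def case_prod_beta' by measurable
  qed
  have db: "\<bar>direct_sum u v z\<bar> \<le> C + C'" if "\<And>x. \<bar>u x\<bar> \<le> C" "\<And>x. \<bar>v x\<bar> \<le> C'" for u v :: "'a \<Rightarrow> real" and C C' z
    using that(1)[of "fst z"] that(2)[of "snd z"] by (simp add: direct_sum_def case_prod_beta)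
  have gm: "?g \<in> borel_measurable ?N" by (rule dm[OF ct1(1) ct2(1)])
  have gb: "\<bar>?g z\<bar> \<le> 2 * box_mass p R + 2 * box_mass p R" for z
    using ct1(2)[of "fst z"] ct2(2)[of "snd z"] by (simp add: direct_sum_def case_prod_beta)
  have L: "(\<integral>z. direct_sum h1 h2 z * ?g z \<partial>?N) = (\<integral>x. h1 x * ?a x \<partial>\<mu>) + (\<integral>y. h2 y * ?b y \<partial>\<nu>)"
    if h: "h1 \<in> tangents \<mu>" "h2 \<in> tangents \<nu>" for h1 h2
  proof -
    obtain C1 where C1: "\<And>x. \<bar>h1 x\<bar> \<le> C1" using tangentsD[OF h(1)] by blast
    obtain C2 where C2: "\<And>x. \<bar>h2 x\<bar> \<le> C2" using tangentsD[OF h(2)] by blast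
    note t1 = tangent_orthogonal_const[OF mu(1,2) inf_meas(1) inf_bound(1) h(1)]
      and t2 = tangent_orthogonal_const[OF nu(1,2) inf_meas(2) inf_bound(2) h(2)]
    have i: "integrable ?N (\<lambda>z. direct_sum h1 h2 z * ?g z)"
    proof (intro N.integrable_const_bound[where B = "(C1 + C2) * (2 * box_mass p R + 2 * box_mass p R)"] AE_I2)
      show "norm (direct_sum h1 h2 z * ?g z) \<le> (C1 + C2) * (2 * box_mass p R + 2 * box_mass p R)" for z
      proof -
        have "\<bar>direct_sum h1 h2 z\<bar> \<le> C1 + C2" by (rule db[OF C1 C2])
        then show ?thesis unfolding real_norm_def abs_mult using gb[of z] by (intro mult_mono) auto
      qed
    qed (use dm[OF h] gm in auto)
    have ib: "integrable \<nu> ?b" using tangent_orthogonal_const(2)[OF nu(1,2) inf_meas(2) inf_bound(2) ct2(1)] .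
    have "(\<integral>z. direct_sum h1 h2 z * ?g z \<partial>?N) = (\<integral>x. (\<integral>y. (h1 x + h2 y) * (?a x + ?b y) \<partial>\<nu>) \<partial>\<mu>)"
      using P.integral_fst'[OF i] by (simp add: direct_sum_def)
    also have "\<dots> = (\<integral>x. h1 x * ?a x + (\<integral>y. h2 y * ?b y \<partial>\<nu>) \<partial>\<mu>)"
    proof (rule Bochner_Integration.integral_cong)
      fix x
      \<comment> \<open>the mixed products integrate to 0, as all four functions are centred\<close>
      have "(\<integral>y. (h1 x + h2 y) * (?a x + ?b y) \<partial>\<nu>) = (\<integral>y. h1 x * ?a x + h1 x * ?b y + ?a x * h2 y + h2 y * ?b y \<partial>\<nu>)"
        by (intro Bochner_Integration.integral_cong) (auto simp: algebra_simps)
      also have "\<dots> = h1 x * ?a x + h1 x * (\<integral>y. ?b y \<partial>\<nu>) + ?a x * (\<integral>y. h2 y \<partial>\<nu>) + (\<integral>y. h2 y * ?b y \<partial>\<nu>)"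
        using ib t2(2,3) by (subst Bochner_Integration.integral_add Bochner_Integration.integral_add; simp add: nu.prob_space)+
      also have "\<dots> = h1 x * ?a x + (\<integral>y. h2 y * ?b y \<partial>\<nu>)"
        using h(2) ct2(1) by (simp add: tangents_def)
      finally show "(\<integral>y. (h1 x + h2 y) * (?a x + ?b y) \<partial>\<nu>) = h1 x * ?a x + (\<integral>y. h2 y * ?b y \<partial>\<nu>)" .
    qed simp
    also have "\<dots> = (\<integral>x. h1 x * ?a x \<partial>\<mu>) + (\<integral>y. h2 y * ?b y \<partial>\<nu>)" using t1(3) by (simp add: mu.prob_space)
    finally show ?thesis .
  qed
  obtain h0 where h0: "h0 \<in> tangents \<mu>" "\<not> (AE x in \<mu>. h0 x = 0)"
    using absolutely_continuous_nonzero_tangent[OF mu(1,2) ac] by blast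
  have z0: "direct_sum h0 (\<lambda>_. 0) \<in> ?H" using h0(1) tangents_zero by blast
  have nz: "\<not> (AE z in ?N. direct_sum h0 (\<lambda>_. 0) z = 0)"
  proof
    assume "AE z in ?N. direct_sum h0 (\<lambda>_. 0) z = 0"
    then have "AE z in ?N. h0 (fst z) = 0" by (simp add: direct_sum_def case_prod_beta)
    moreover have [measurable]: "h0 \<in> borel_measurable borel" using h0 by (simp add: tangents_def)
    ultimately have "AE x in distr ?N \<mu> fst. h0 x = 0" by (subst AE_distr_iff) auto
    then show False using h0(2) unfolding nu.distr_pair_fst by simp
  qed
  show ?thesis
    unfolding efficiency_bound2_def
  proof (intro exI[of _ "\<lambda>f. \<integral>z. f z * ?g z \<partial>?N"] conjI ballI)
    show "L2_functional ?N (\<lambda>f. \<integral>z. f z * ?g z \<partial>?N)" by (rule L2_functional_inner_product[OF N gm gb])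
    show "((\<lambda>t. (S (perturb \<mu> t h1) (perturb \<nu> t h2) - S \<mu> \<nu>) / t) \<longlongrightarrow> (\<integral>z. direct_sum h1 h2 z * ?g z \<partial>?N)) (at_right 0)"
      if h: "h1 \<in> tangents \<mu>" "h2 \<in> tangents \<nu>" for h1 h2
      using sliced_right_derivative[OF h] unfolding L[OF h]
      by (simp add: tangent_orthogonal_const(1)[OF mu(1,2) inf_meas(1) inf_bound(1) h(1)] tangent_orthogonal_const(1)[OF nu(1,2) inf_meas(2) inf_bound(2) h(2)])
    have H: "h \<in> borel_measurable ?N \<and> (\<exists>C. \<forall>x. \<bar>h x\<bar> \<le> C)" if "h \<in> ?H" for h
    proof -
      from that obtain h1 h2 where h: "h = direct_sum h1 h2" "h1 \<in> tangents \<mu>" "h2 \<in> tangents \<nu>" by blast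
      obtain C1 where C1: "\<And>x. \<bar>h1 x\<bar> \<le> C1" using tangentsD[OF h(2)] by blast
      obtain C2 where C2: "\<And>x. \<bar>h2 x\<bar> \<le> C2" using tangentsD[OF h(3)] by blast
      have "\<bar>direct_sum h1 h2 z\<bar> \<le> C1 + C2" for z by (rule db[OF C1 C2])
      then show ?thesis using dm[OF h(2,3)] unfolding h(1) by blast
    qed
    have gH: "?g \<in> ?H" using ct1(1) ct2(1) by blast
    have "(\<integral>z. (?g z)\<^sup>2 \<partial>?N) = limit_variance True"
      using L[OF ct1(1) ct2(1)] by (simp add: limit_variance_def var_of_def power2_eq_square)
    then show "ereal (limit_variance True) = efficiency_sup ?N ?H (\<lambda>f. \<integral>z. f z * ?g z \<partial>?N)"
      using efficiency_sup_inner_product[OF N gm gb gH H z0 nz] by simp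
  qed
qed

end

section \<open>The asymptotic variance\<close>

lemma cov_bounded:
  assumes \<rho>: "prob_space \<rho>" and [measurable]: "f \<in> borel_measurable \<rho>" "g \<in> borel_measurable \<rho>"
    and f: "\<And>x. \<bar>f x\<bar> \<le> B" and g: "\<And>x. \<bar>g x\<bar> \<le> C"
  shows "cov \<rho> f g = (\<integral>x. f x * (g x - (\<integral>u. g u \<partial>\<rho>)) \<partial>\<rho>)" "cov \<rho> f g = (\<integral>x. g x * (f x - (\<integral>u. f u \<partial>\<rho>)) \<partial>\<rho>)"
proof -
  interpret prob_space \<rho> by fact
  have i: "integrable \<rho> f" "integrable \<rho> g"
    by (rule integrable_const_bound[where B = B], use f in simp, measurable)
      (rule integrable_const_bound[where B = C], use g in simp, measurable)
  have ifg: "integrable \<rho> (\<lambda>x. f x * g x)"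
  proof (intro integrable_const_bound[where B = "B * C"] AE_I2)
    show "norm (f x * g x) \<le> B * C" for x using f[of x] g[of x] unfolding real_norm_def abs_mult by (intro mult_mono) auto
  qed auto
  have igf: "integrable \<rho> (\<lambda>x. g x * f x)" using ifg by (simp add: mult.commute)
  show "cov \<rho> f g = (\<integral>x. f x * (g x - (\<integral>u. g u \<partial>\<rho>)) \<partial>\<rho>)" "cov \<rho> f g = (\<integral>x. g x * (f x - (\<integral>u. f u \<partial>\<rho>)) \<partial>\<rho>)"
    unfolding cov_def using i ifg igf by (simp_all add: right_diff_distrib left_diff_distrib prob_space mult.commute[of "g _"])
qed

lemma cov_AE_shift:
  assumes \<rho>: "prob_space \<rho>" and [measurable]: "f \<in> borel_measurable \<rho>" "g \<in> borel_measurable \<rho>" "f' \<in> borel_measurable \<rho>" "g' \<in> borel_measurable \<rho>"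
    and i: "integrable \<rho> f'" "integrable \<rho> g'" and f: "AE x in \<rho>. f x = f' x + a" and g: "AE x in \<rho>. g x = g' x + b"
  shows "cov \<rho> f g = cov \<rho> f' g'"
proof -
  interpret prob_space \<rho> by fact
  have "(\<integral>x. f x \<partial>\<rho>) = (\<integral>x. f' x + a \<partial>\<rho>)" "(\<integral>x. g x \<partial>\<rho>) = (\<integral>x. g' x + b \<partial>\<rho>)"
    using f g by (auto intro!: integral_cong_AE)
  then have m: "(\<integral>x. f x \<partial>\<rho>) = (\<integral>x. f' x \<partial>\<rho>) + a" "(\<integral>x. g x \<partial>\<rho>) = (\<integral>x. g' x \<partial>\<rho>) + b"
    using i by (simp_all add: prob_space)
  show ?thesis
    unfolding cov_def m
  proof (rule integral_cong_AE)
    show "AE x in \<rho>. (f x - (expectation f' + a)) * (g x - (expectation g' + b)) = (f' x - expectation f') * (g' x - expectation g')"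
      using f g by eventually_elim simp
  qed measurable
qed

text \<open>
Averaging over directions turns the pairing of s \<theta> with a fixed function into the pairing with I. Applied to both
arguments of the covariance, this gives the variance of I. The potentials enter only up to additive constants and null
sets.
\<close>
lemma sliced_variance_eq_var_of:
  fixes \<rho> :: "'a::euclidean_space measure" and \<xi> :: "'a \<Rightarrow> real \<Rightarrow> ereal" and s :: "'a \<Rightarrow> 'a \<Rightarrow> real"
  assumes \<rho>: "prob_space \<rho>" "sets \<rho> = sets borel"
    and \<xi>m: "\<And>\<theta>. \<theta> \<in> sphere 0 1 \<Longrightarrow> \<xi> \<theta> \<in> borel_measurable borel"
    and \<xi>: "\<And>\<theta>. \<theta> \<in> sphere 0 1 \<Longrightarrow> \<exists>a. AE x in \<rho>. \<xi> \<theta> (\<theta> \<bullet> x) = ereal (s \<theta> x + a)"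
    and sm: "(\<lambda>w. s (fst w) (snd w)) \<in> borel_measurable (borel \<Otimes>\<^sub>M borel)" and sb: "\<And>\<theta> x. \<bar>s \<theta> x\<bar> \<le> B"
    and I: "I \<in> borel_measurable borel" "\<And>x. \<bar>I x\<bar> \<le> B"
    and exchange: "\<forall>h C. h \<in> borel_measurable borel \<longrightarrow> (\<forall>x. \<bar>h x\<bar> \<le> C) \<longrightarrow>
       (\<integral>\<theta>. (\<integral>x. s \<theta> x * h x \<partial>\<rho>) \<partial>sphere_unif) = (\<integral>x. I x * h x \<partial>\<rho>)"
  shows "sliced_variance_exists \<rho> \<xi>" "sliced_variance \<rho> \<xi> = var_of \<rho> I"
proof -
  interpret prob_space \<rho> by fact
  have fub: "(\<integral>\<theta>. (\<integral>x. s \<theta> x * h x \<partial>\<rho>) \<partial>sphere_unif) = (\<integral>x. I x * h x \<partial>\<rho>)"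
    if "h \<in> borel_measurable borel" "\<And>x. \<bar>h x\<bar> \<le> C" for h C
    using exchange that by blast
  have sr [measurable_cong]: "sets \<rho> = sets borel" by fact
  have sm1 [measurable]: "s \<theta> \<in> borel_measurable borel" for \<theta>
    using measurable_compose[OF measurable_Pair1'[of \<theta> borel borel] sm] by simp
  have smr: "s \<theta> \<in> borel_measurable \<rho>" for \<theta> using sm1 by (simp add: measurable_cong_sets[OF sr refl])
  have ints: "integrable \<rho> (s \<theta>)" for \<theta> using sb by (intro integrable_const_bound[where B = B]) auto
  have B0: "0 \<le> B" using sb[of undefined undefined] by linarith
  have mb: "\<bar>expectation (s \<theta>)\<bar> \<le> B" for \<theta> by (rule var_of_props(4)[OF \<rho>(1) smr sb])
  have mI: "\<bar>expectation I\<bar> \<le> B" using I by (intro var_of_props(4)[OF \<rho>(1)]) (simp_all add: measurable_cong_sets[OF sr refl])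
  have pm: "sliced_potential \<xi> \<theta> \<in> borel_measurable \<rho>" if "\<theta> \<in> sphere 0 1" for \<theta>
  proof -
    have "(\<lambda>x. \<theta> \<bullet> x) \<in> borel_measurable \<rho>" by measurable
    from measurable_compose[OF this \<xi>m[OF that]] show ?thesis unfolding sliced_potential_def[abs_def] by measurable
  qed
  have ps: "\<exists>a. AE x in \<rho>. sliced_potential \<xi> \<theta> x = s \<theta> x + a" if th: "\<theta> \<in> sphere 0 1" for \<theta>
  proof -
    obtain a where "AE x in \<rho>. \<xi> \<theta> (\<theta> \<bullet> x) = ereal (s \<theta> x + a)" using \<xi>[OF th] by blast
    then have "AE x in \<rho>. sliced_potential \<xi> \<theta> x = s \<theta> x + a" by eventually_elim (simp add: sliced_potential_def)
    then show ?thesis by blast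
  qed
  have cov: "cov \<rho> (sliced_potential \<xi> \<theta>) (sliced_potential \<xi> \<eta>) = cov \<rho> (s \<theta>) (s \<eta>)" if "\<theta> \<in> sphere 0 1" "\<eta> \<in> sphere 0 1" for \<theta> \<eta>
    using ps[OF that(1)] ps[OF that(2)] by (elim exE) (rule cov_AE_shift[OF \<rho>(1) pm pm smr smr ints ints], use that in auto)
  note cs = cov_bounded[OF \<rho>(1) smr smr sb sb]
  have cI: "I \<in> borel_measurable \<rho>" using I(1) by (simp add: measurable_cong_sets[OF sr refl])
  have inner: "(\<integral>\<theta>. cov \<rho> (s \<theta>) (s \<eta>) \<partial>sphere_unif) = (\<integral>x. s \<eta> x * (I x - expectation I) \<partial>\<rho>)" for \<eta>
  proof -
    have b: "\<bar>s \<eta> x - expectation (s \<eta>)\<bar> \<le> 2 * B" for x using sb[of \<eta> x] mb[of \<eta>] by linarith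
    have "(\<integral>\<theta>. cov \<rho> (s \<theta>) (s \<eta>) \<partial>sphere_unif) = (\<integral>x. I x * (s \<eta> x - expectation (s \<eta>)) \<partial>\<rho>)"
      unfolding cs(1) using b by (intro fub) auto
    also have "\<dots> = cov \<rho> I (s \<eta>)" by (rule cov_bounded(1)[OF \<rho>(1) cI smr I(2) sb, symmetric])
    also have "\<dots> = (\<integral>x. s \<eta> x * (I x - expectation I) \<partial>\<rho>)" by (rule cov_bounded(2)[OF \<rho>(1) cI smr I(2) sb])
    finally show ?thesis .
  qed
  have "sliced_variance \<rho> \<xi> = (\<integral>\<eta>. (\<integral>\<theta>. cov \<rho> (s \<theta>) (s \<eta>) \<partial>sphere_unif) \<partial>sphere_unif)"
    unfolding sliced_variance_def by (intro Bochner_Integration.integral_cong refl) (simp add: space_sphere_unif cov)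
  also have "\<dots> = (\<integral>x. I x * (I x - expectation I) \<partial>\<rho>)"
  proof -
    have "\<bar>I x - expectation I\<bar> \<le> 2 * B" for x using I(2)[of x] mI by linarith
    then show ?thesis unfolding inner using I(1) by (intro fub) auto
  qed
  also have "\<dots> = cov \<rho> I I" by (rule cov_bounded(1)[OF \<rho>(1) cI cI I(2) I(2), symmetric])
  finally show "sliced_variance \<rho> \<xi> = var_of \<rho> I" by (simp add: cov_def var_of_def power2_eq_square)
  show "sliced_variance_exists \<rho> \<xi>"
    unfolding sliced_variance_exists_def
  proof (intro conjI ballI)
    fix \<theta> :: 'a assume th: "\<theta> \<in> sphere 0 1"
    obtain a where a: "AE x in \<rho>. \<xi> \<theta> (\<theta> \<bullet> x) = ereal (s \<theta> x + a)" using \<xi>[OF th] by blast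
    then show "AE x in \<rho>. \<bar>\<xi> \<theta> (\<theta> \<bullet> x)\<bar> \<noteq> \<infinity>" by eventually_elim simp
    have "AE x in \<rho>. norm ((sliced_potential \<xi> \<theta> x)\<^sup>2) \<le> (B + \<bar>a\<bar>)\<^sup>2"
      using a
    proof eventually_elim
      case (elim x)
      have "\<bar>s \<theta> x + a\<bar> \<le> \<bar>B + \<bar>a\<bar>\<bar>" using sb[of \<theta> x] B0 by linarith
      then show ?case using elim by (simp add: sliced_potential_def abs_le_square_iff)
    qed
    then have "integrable \<rho> (\<lambda>x. (sliced_potential \<xi> \<theta> x)\<^sup>2)"
      using pm[OF th] by (intro integrable_const_bound) auto
    then show "square_integrable \<rho> (sliced_potential \<xi> \<theta>)" using pm[OF th] by (simp add: square_integrable_def)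
  next
    let ?S = "(sphere_unif :: 'a measure) \<Otimes>\<^sub>M (sphere_unif :: 'a measure)"
    interpret S: prob_space ?S by (intro prob_space_pair sphere.prob_space_axioms)
    have f1: "fst \<in> borel_measurable ?S" by (rule measurable_compose[OF measurable_fst measurable_sphere_unif])
    have f2: "snd \<in> borel_measurable ?S" by (rule measurable_compose[OF measurable_snd measurable_sphere_unif])
    have m1 [measurable]: "(\<lambda>w. s (fst (fst w)) (snd w)) \<in> borel_measurable (?S \<Otimes>\<^sub>M \<rho>)"
      using measurable_compose[OF measurable_Pair[OF measurable_compose[OF measurable_fst f1] measurable_snd[of ?S \<rho>, unfolded measurable_cong_sets[OF refl sr]]] sm]
      by simp
    have m2 [measurable]: "(\<lambda>w. s (snd (fst w)) (snd w)) \<in> borel_measurable (?S \<Otimes>\<^sub>M \<rho>)"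
      using measurable_compose[OF measurable_Pair[OF measurable_compose[OF measurable_fst f2] measurable_snd[of ?S \<rho>, unfolded measurable_cong_sets[OF refl sr]]] sm]
      by simp
    have m3 [measurable]: "(\<lambda>w. expectation (s (snd w))) \<in> borel_measurable ?S"
      by (rule borel_measurable_lebesgue_integral) (simp add: case_prod_beta')
    have "(\<lambda>w. \<integral>x. s (fst w) x * (s (snd w) x - expectation (s (snd w))) \<partial>\<rho>) \<in> borel_measurable ?S"
      by (rule borel_measurable_lebesgue_integral) (simp add: case_prod_beta')
    then have cm: "(\<lambda>w. cov \<rho> (s (fst w)) (s (snd w))) \<in> borel_measurable ?S" by (simp only: cs(1))
    have cb: "\<bar>cov \<rho> (s \<theta>) (s \<eta>)\<bar> \<le> B * (2 * B)" for \<theta> \<eta>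
      unfolding cs(1)
    proof (rule var_of_props(4)[OF \<rho>(1)])
      show "\<bar>s \<theta> x * (s \<eta> x - expectation (s \<eta>))\<bar> \<le> B * (2 * B)" for x
        unfolding abs_mult using sb[of \<theta> x] sb[of \<eta> x] mb[of \<eta>] by (intro mult_mono) auto
    qed measurable
    have "integrable ?S (\<lambda>w. cov \<rho> (s (fst w)) (s (snd w)))"
      using cb cm by (intro S.integrable_const_bound[where B = "B * (2 * B)"]) auto
    then show "integrable ?S (\<lambda>(\<theta>, \<eta>). cov \<rho> (sliced_potential \<xi> \<theta>) (sliced_potential \<xi> \<eta>))"
      by (subst Bochner_Integration.integrable_cong[OF refl, where g = "\<lambda>w. cov \<rho> (s (fst w)) (s (snd w))"])
         (auto simp: space_pair_measure space_sphere_unif cov)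
  qed
qed

context two_samples
begin

lemma proj_laws:
  assumes "\<theta> \<in> sphere 0 1"
  shows "real_distribution (proj_law \<theta> \<mu>)" "AE x in proj_law \<theta> \<mu>. \<bar>x\<bar> \<le> R"
    "real_distribution (proj_law \<theta> \<nu>)" "AE x in proj_law \<theta> \<nu>. \<bar>x\<bar> \<le> R"
    "tie_free (cdf (proj_law \<theta> \<mu>)) (cdf (proj_law \<theta> \<nu>))"
  using assms mu nu conv
  by (auto intro!: real_distribution_proj_law AE_proj_law_bounded tie_free_proj_law)

lemma potentials_along_slices:
  assumes th: "\<theta> \<in> sphere 0 1" and pot: "ot_potential p (proj_law \<theta> \<mu>) (proj_law \<theta> \<nu>) f"
  shows "\<exists>a. AE x in \<mu>. f (\<theta> \<bullet> x) = ereal (slice_pot1 p R \<mu> \<nu> \<theta> x + a)"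
    and "\<exists>b. AE y in \<nu>. c_transform p f (\<theta> \<bullet> y) = ereal (slice_pot2 p R \<mu> \<nu> \<theta> y + b)"
    and "f \<in> borel_measurable borel" "c_transform p f \<in> borel_measurable borel"
proof -
  have sm [measurable_cong]: "sets \<mu> = sets borel" "sets \<nu> = sets borel" by (rule mu nu)+
  note eq = ot_potential_AE_eq[OF p proj_laws[OF th] pot]
  have m: "(\<lambda>x. \<theta> \<bullet> x) \<in> borel_measurable \<mu>" "(\<lambda>x. \<theta> \<bullet> x) \<in> borel_measurable \<nu>" by measurable
  show "\<exists>a. AE x in \<mu>. f (\<theta> \<bullet> x) = ereal (slice_pot1 p R \<mu> \<nu> \<theta> x + a)"
    using eq(1) AE_distrD[OF m(1)] unfolding slice_pot1_def proj_law_def[of \<theta> \<mu>] by blast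
  show "\<exists>b. AE y in \<nu>. c_transform p f (\<theta> \<bullet> y) = ereal (slice_pot2 p R \<mu> \<nu> \<theta> y + b)"
    using eq(2) AE_distrD[OF m(2)] unfolding slice_pot2_def proj_law_def[of \<theta> \<nu>] by blast
  show "f \<in> borel_measurable borel"
    using pot by (auto simp: ot_potential_def ereal_L1_def proj_law_def)
  show "c_transform p f \<in> borel_measurable borel" by (rule borel_measurable_c_transform[OF p])
qed

text \<open>
In every direction an arbitrary potential agrees with the explicit one up to a constant, almost everywhere.
\<close>
lemma sliced_variance_potentials:
  assumes pot: "\<And>\<theta>. \<theta> \<in> sphere 0 1 \<Longrightarrow> ot_potential p (proj_law \<theta> \<mu>) (proj_law \<theta> \<nu>) (\<phi> \<theta>)"
  shows "sliced_variance_exists \<mu> \<phi>" "sliced_variance \<mu> \<phi> = var_of \<mu> \<Psi>"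
    and "sliced_variance_exists \<nu> (\<lambda>\<theta>. c_transform p (\<phi> \<theta>))" "sliced_variance \<nu> (\<lambda>\<theta>. c_transform p (\<phi> \<theta>)) = var_of \<nu> \<psi>"
proof -
  note sm = measurable_slice_pot[OF p mu(1,2) nu(1,2) measurable_fst measurable_snd, of R]
  have pots: "\<And>\<theta>. \<theta> \<in> sphere 0 1 \<Longrightarrow> \<phi> \<theta> \<in> borel_measurable borel"
      "\<And>\<theta>. \<theta> \<in> sphere 0 1 \<Longrightarrow> \<exists>a. AE x in \<mu>. \<phi> \<theta> (\<theta> \<bullet> x) = ereal (slice_pot1 p R \<mu> \<nu> \<theta> x + a)"
      "\<And>\<theta>. \<theta> \<in> sphere 0 1 \<Longrightarrow> c_transform p (\<phi> \<theta>) \<in> borel_measurable borel"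
      "\<And>\<theta>. \<theta> \<in> sphere 0 1 \<Longrightarrow> \<exists>a. AE y in \<nu>. c_transform p (\<phi> \<theta>) (\<theta> \<bullet> y) = ereal (slice_pot2 p R \<mu> \<nu> \<theta> y + a)"
    using potentials_along_slices pot by blast+
  have fub1: "\<forall>h C. h \<in> borel_measurable borel \<longrightarrow> (\<forall>x. \<bar>h x\<bar> \<le> C) \<longrightarrow>
      (\<integral>\<theta>. (\<integral>x. slice_pot1 p R \<mu> \<nu> \<theta> x * h x \<partial>\<mu>) \<partial>sphere_unif) = (\<integral>x. \<Psi> x * h x \<partial>\<mu>)"
    using integral_slice_pot(1)[OF p mu(1,2) nu(1,2) mu(1,2)] by blast
  have fub2: "\<forall>h C. h \<in> borel_measurable borel \<longrightarrow> (\<forall>x. \<bar>h x\<bar> \<le> C) \<longrightarrow>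
      (\<integral>\<theta>. (\<integral>x. slice_pot2 p R \<mu> \<nu> \<theta> x * h x \<partial>\<nu>) \<partial>sphere_unif) = (\<integral>x. \<psi> x * h x \<partial>\<nu>)"
    using integral_slice_pot(2)[OF p mu(1,2) nu(1,2) nu(1,2)] by blast
  show "sliced_variance_exists \<mu> \<phi>" "sliced_variance \<mu> \<phi> = var_of \<mu> \<Psi>"
    using sliced_variance_eq_var_of[OF mu(1,2) pots(1,2) sm(1) slice_pot_bounded(1)[OF p] inf_meas(1) inf_bound(1) fub1]
    by (simp_all add: borel_prod)
  show "sliced_variance_exists \<nu> (\<lambda>\<theta>. c_transform p (\<phi> \<theta>))" "sliced_variance \<nu> (\<lambda>\<theta>. c_transform p (\<phi> \<theta>)) = var_of \<nu> \<psi>"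
    using sliced_variance_eq_var_of[OF nu(1,2) pots(3,4) sm(2) slice_pot_bounded(2)[OF p] inf_meas(2) inf_bound(2) fub2]
    by (simp_all add: borel_prod)
qed

lemma bootstrap_one_sample:
  assumes v: "0 < limit_variance False"
  shows "tendsto_zero_in_prob M (\<lambda>n w. SUP t. \<bar>bootstrap_cdf p \<nu> n (\<lambda>i. X i w) t - cdf (normal_law 0 (limit_variance False)) t\<bar>)"
proof (rule boot_distance_tendsto_zero_in_prob[OF v])
  show "(SUP t. \<bar>bootstrap_cdf p \<nu> n (\<lambda>i. X i w) t - cdf (normal_law 0 (limit_variance False)) t\<bar>) = boot_distance False n w"
    if "0 < n" for n w
    unfolding boot_distance_def bootstrap_cdf_eq[OF p that nu(1,2)] boot_stat_def[abs_def] nuhat_def by simp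
  \<comment> \<open>the empty sample carries no information, so the function of the data is constant\<close>
  have c: "bootstrap_cdf p \<nu> 0 x = bootstrap_cdf p \<nu> 0 (\<lambda>_. 0)" for x
    by (simp add: bootstrap_cdf_def bootstrap_law_def PiM_empty fun_eq_iff)
  show "(\<lambda>w. SUP t. \<bar>bootstrap_cdf p \<nu> 0 (\<lambda>i. X i w) t - cdf (normal_law 0 (limit_variance False)) t\<bar>) \<in> borel_measurable M"
    by (subst c) (rule borel_measurable_const)
qed

lemma bootstrap_two_sample:
  assumes v: "0 < limit_variance True"
  shows "tendsto_zero_in_prob M (\<lambda>n w. SUP t. \<bar>bootstrap_cdf2 p n (\<lambda>i. X i w) (\<lambda>i. Y i w) t - cdf (normal_law 0 (limit_variance True)) t\<bar>)"
proof (rule boot_distance_tendsto_zero_in_prob[OF v])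
  show "(SUP t. \<bar>bootstrap_cdf2 p n (\<lambda>i. X i w) (\<lambda>i. Y i w) t - cdf (normal_law 0 (limit_variance True)) t\<bar>) = boot_distance True n w"
    if "0 < n" for n w
    unfolding boot_distance_def bootstrap_cdf2_eq[OF p that] boot_stat_def[abs_def] nuhat_def by simp
  \<comment> \<open>the empty samples carry no information, so the function of the data is constant\<close>
  have b: "bootstrap_law 0 x = bootstrap_law 0 (\<lambda>_. 0 :: 'a)" for x :: "nat \<Rightarrow> 'a"
    by (simp add: bootstrap_law_def PiM_empty)
  have c: "bootstrap_cdf2 p 0 x y = bootstrap_cdf2 p 0 (\<lambda>_. 0 :: 'a) (\<lambda>_. 0 :: 'a)" for x y :: "nat \<Rightarrow> 'a"
    by (rule ext) (simp only: bootstrap_cdf2_def b[of x] b[of y] of_nat_0 real_sqrt_zero mult_zero_left)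
  show "(\<lambda>w. SUP t. \<bar>bootstrap_cdf2 p 0 (\<lambda>i. X i w) (\<lambda>i. Y i w) t - cdf (normal_law 0 (limit_variance True)) t\<bar>) \<in> borel_measurable M"
    by (subst c) (rule borel_measurable_const)
qed

end

theorem theorem1:
  fixes p :: real
    and \<mu> \<nu> :: "'a::euclidean_space measure"
    and \<phi> :: "'a \<Rightarrow> real \<Rightarrow> ereal"
    and M :: "'w measure"
    and X Y :: "nat \<Rightarrow> 'w \<Rightarrow> 'a"
  assumes p: "1 < p"
    and mu: "prob_space \<mu>" "sets \<mu> = sets borel" "compact (spt \<mu>)"
    and nu: "prob_space \<nu>" "sets \<nu> = sets borel" "compact (spt \<nu>)"
    and mu_ac: "absolutely_continuous lborel \<mu>"
    and mu_convex: "convex (spt \<mu>)"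
    and potential: "\<And>\<theta>. \<theta> \<in> sphere 0 1 \<Longrightarrow> ot_potential p (proj_law \<theta> \<mu>) (proj_law \<theta> \<nu>) (\<phi> \<theta>)"
    and M: "prob_space M"
    and indep: "prob_space.indep_vars M (\<lambda>_. borel) (case_sum X Y) UNIV"
    and X: "\<And>i. distr M borel (X i) = \<mu>"
    and Y: "\<And>i. distr M borel (Y i) = \<nu>"
  shows
    "(\<forall>\<theta>\<in>sphere 0 1. \<forall>f g.
        ot_potential p (proj_law \<theta> \<mu>) (proj_law \<theta> \<nu>) f \<longrightarrow>
        ot_potential p (proj_law \<theta> \<mu>) (proj_law \<theta> \<nu>) g \<longrightarrow>
        (\<exists>a::real. \<forall>s\<in>interior (spt (proj_law \<theta> \<mu>)). f s = g s + ereal a))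
     \<and>
     (let v2 = sliced_variance \<mu> \<phi> in
        sliced_variance_exists \<mu> \<phi> \<and>
        (\<forall>\<phi>'. (\<forall>\<theta>\<in>sphere 0 1. ot_potential p (proj_law \<theta> \<mu>) (proj_law \<theta> \<nu>) (\<phi>' \<theta>)) \<longrightarrow>
           sliced_variance \<mu> \<phi>' = v2) \<and>
        weak_conv_m
          (\<lambda>n. distr M borel (\<lambda>\<omega>. sqrt (real n) *
             (sliced_wasserstein_pow p (empirical n (\<lambda>i. X i \<omega>)) \<nu> - sliced_wasserstein_pow p \<mu> \<nu>)))
          (normal_law 0 v2) \<and>
        efficiency_bound \<mu> (\<lambda>\<rho>. sliced_wasserstein_pow p \<rho> \<nu>) v2 \<and>
        (v2 > 0 \<longrightarrow>
           tendsto_zero_in_prob M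
             (\<lambda>n \<omega>. SUP t. \<bar>bootstrap_cdf p \<nu> n (\<lambda>i. X i \<omega>) t - cdf (normal_law 0 v2) t\<bar>)))
     \<and>
     (absolutely_continuous lborel \<nu> \<and> convex (spt \<nu>) \<longrightarrow>
      (let v2 = sliced_variance \<mu> \<phi>; \<psi> = (\<lambda>\<theta>. c_transform p (\<phi> \<theta>)); w2 = sliced_variance \<nu> \<psi> in
        sliced_variance_exists \<nu> \<psi> \<and>
        weak_conv_m
          (\<lambda>n. distr M borel (\<lambda>\<omega>. sqrt (real n) *
             (sliced_wasserstein_pow p (empirical n (\<lambda>i. X i \<omega>)) (empirical n (\<lambda>i. Y i \<omega>))
               - sliced_wasserstein_pow p \<mu> \<nu>)))
          (normal_law 0 (v2 + w2)) \<and>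
        efficiency_bound2 \<mu> \<nu> (sliced_wasserstein_pow p) (v2 + w2) \<and>
        (v2 + w2 > 0 \<longrightarrow>
           tendsto_zero_in_prob M
             (\<lambda>n \<omega>. SUP t. \<bar>bootstrap_cdf2 p n (\<lambda>i. X i \<omega>) (\<lambda>i. Y i \<omega>) t
                - cdf (normal_law 0 (v2 + w2)) t\<bar>))))"
proof -
  obtain R1 where R1: "0 < R1" "AE x in \<mu>. norm x \<le> R1" using compact_spt_bounded[OF mu(2,3)] by blast
  obtain R2 where R2: "0 < R2" "AE x in \<nu>. norm x \<le> R2" using compact_spt_bounded[OF nu(2,3)] by blast
  define R where "R = max R1 R2"
  have R: "AE x in \<mu>. norm x \<le> R" "AE x in \<nu>. norm x \<le> R"
    using R1(2) R2(2) by (auto simp: R_def elim: eventually_mono)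
  interpret two_samples p R \<mu> \<nu> M X Y
    by (intro two_samples.intro p mu(1,2) nu(1,2) R mu_convex M indep X Y)
  have var: "sliced_variance_exists \<mu> \<phi>" "sliced_variance \<mu> \<phi> = var_of \<mu> \<Psi>"
      "sliced_variance_exists \<nu> (\<lambda>\<theta>. c_transform p (\<phi> \<theta>))" "sliced_variance \<nu> (\<lambda>\<theta>. c_transform p (\<phi> \<theta>)) = var_of \<nu> \<psi>"
    by (rule sliced_variance_potentials, rule potential, assumption)+
  have v: "sliced_variance \<mu> \<phi> = limit_variance False" unfolding var limit_variance_def by simp
  have vw: "sliced_variance \<mu> \<phi> + sliced_variance \<nu> (\<lambda>\<theta>. c_transform p (\<phi> \<theta>)) = limit_variance True"
    unfolding var limit_variance_def by simp
  have unique: "\<forall>\<theta>\<in>sphere 0 1. \<forall>f g. ot_potential p (proj_law \<theta> \<mu>) (proj_law \<theta> \<nu>) f \<longrightarrow>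
        ot_potential p (proj_law \<theta> \<mu>) (proj_law \<theta> \<nu>) g \<longrightarrow>
        (\<exists>a::real. \<forall>s\<in>interior (spt (proj_law \<theta> \<mu>)). f s = g s + ereal a)"
    using ot_potential_unique[OF p proj_laws] by blast
  have same: "\<forall>\<phi>'. (\<forall>\<theta>\<in>sphere 0 1. ot_potential p (proj_law \<theta> \<mu>) (proj_law \<theta> \<nu>) (\<phi>' \<theta>)) \<longrightarrow>
           sliced_variance \<mu> \<phi>' = limit_variance False"
    unfolding v[symmetric] var(2) by (blast intro: sliced_variance_potentials(2))
  have clt1: "weak_conv_m (\<lambda>n. distr M borel (\<lambda>\<omega>. sqrt (real n) *
             (sliced_wasserstein_pow p (empirical n (\<lambda>i. X i \<omega>)) \<nu> - sliced_wasserstein_pow p \<mu> \<nu>)))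
          (normal_law 0 (limit_variance False))"
    using central_limit_sliced[of False] by (simp add: nuhat_def)
  have clt2: "weak_conv_m (\<lambda>n. distr M borel (\<lambda>\<omega>. sqrt (real n) *
             (sliced_wasserstein_pow p (empirical n (\<lambda>i. X i \<omega>)) (empirical n (\<lambda>i. Y i \<omega>)) - sliced_wasserstein_pow p \<mu> \<nu>)))
          (normal_law 0 (limit_variance True))"
    using central_limit_sliced[of True] by (simp add: nuhat_def)
  show ?thesis
    unfolding Let_def vw unfolding v
    by (intro conjI impI unique same var(1,3) clt1 clt2 efficiency_one_sample efficiency_two_sample mu_ac
        bootstrap_one_sample bootstrap_two_sample)
qed

end
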